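(* Let $E\to M$ and $F\to N$ be two smooth real vector bundles of respective ranks $n,n'>1$. Suppose $H^1(M,\mathbb Z/2)=0$. Then the Poisson algebras $\mathcal S(\mathcal P(E,M))$ and $\mathcal S(\mathcal P(F,N))$ are isomorphic if and only if the vector bundles $E$ and $F$ are isomorphic.
   Context: $\Gamma(E)$ is the space of smooth sections of $E\to M$ and $\mathrm{End}(\Gamma(E))$ the space of its $\mathbb R$-linear endomorphisms. For $u\in C^\infty(M)$, $\gamma_u:\Gamma(E)\to\Gamma(E)$, $s\mapsto us$. Define $\mathcal P^i(E,M)=\{0\}$ for $i\le -1$, $\mathcal P^0(E,M)=\mathcal A(E,M)=\{\gamma_u:u\in C^\infty(M)\}$, and for $i\ge 0$, $\mathcal P^{i+1}(E,M)=\{T\in \mathrm{End}(\Gamma(E)) : [T,\gamma_u]\in\mathcal P^i(E,M)\ \forall u\in C^\infty(M)\}$. Put $\mathcal P(E,M)=\bigcup_{i\ge0}\mathcal P^i(E,M)$. $\mathcal S(\mathcal P(E,M))=\bigoplus_{i\in\mathbb Z}\mathcal S^i(\mathcal P(E,M))$ with $\mathcal S^i(\mathcal P(E,M))=\mathcal P^i(E,M)/\mathcal P^{i-1}(E,M)$. Let $\sigma_i(T)$ be the class of $T\in\mathcal P^i(E,M)$ in $\mathcal S^i(\mathcal P(E,M))$. For $P=\sigma_i(T)$ and $Q=\sigma_j(D)$, the (commutative, associative) product and the Lie bracket are $P\cdot Q=\sigma_{i+j}(T\circ D)$ and $\{P,Q\}=\sigma_{i+j-1}([T,D])$, extended bilinearly.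 The same definitions apply to $F\to N$. An isomorphism of Poisson algebras is an $\mathbb R$-linear bijection that is both a homomorphism of associative algebras and a homomorphism of Lie algebras; it is not required to be graded, nor to be $C^\infty$-linear in any sense. An isomorphism of vector bundles $E\to M$, $F\to N$ is a fiberwise linear diffeomorphism $E\to F$ covering a diffeomorphism $M\to N$. *)

theory Defs
  imports
    "HOL-Analysis.Analysis"
    "HOL-Algebra.Algebra"
    "HOL-Homology.Homology"
    "HOL-Library.Z2"
begin

section \<open>Smooth manifolds\<close>

primrec Ck_on :: "nat \<Rightarrow> 'a::real_normed_vector set \<Rightarrow> ('a \<Rightarrow> 'b::real_normed_vector) \<Rightarrow> bool" where
  "Ck_on 0 S f \<longleftrightarrow> continuous_on S f"
| "Ck_on (Suc k) S f \<longleftrightarrow>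
     (\<forall>x\<in>S. f differentiable (at x)) \<and> (\<forall>v. Ck_on k S (\<lambda>x. frechet_derivative f (at x) v))"

text \<open>Used only for open \<open>S\<close> in finite-dimensional spaces, where it is ordinary smoothness.\<close>

definition smooth_on :: "'a::real_normed_vector set \<Rightarrow> ('a \<Rightarrow> 'b::real_normed_vector) \<Rightarrow> bool" where
  "smooth_on S f \<longleftrightarrow> (\<forall>k. Ck_on k S f)"

text \<open>A chart is a pair \<open>(U, \<phi>)\<close>; the values of \<open>\<phi>\<close> outside \<open>U\<close> are irrelevant. The atlas need not be
  maximal.\<close>

record ('a, 'm) manifold =
  mtop :: "'a topology"
  charts :: "('a set \<times> ('a \<Rightarrow> 'm)) set"

abbreviation points :: "('a, 'm, 'z) manifold_scheme \<Rightarrow> 'a set" where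
  "points M \<equiv> topspace (mtop M)"

text \<open>The model space \<open>'m\<close> is an arbitrary finite-dimensional real normed space rather than a
  \<^class>\<open>euclidean_space\<close>, because the latter would exclude manifolds of dimension 0. Manifolds are
  Hausdorff and second countable, not necessarily connected.\<close>

definition smooth_manifold :: "('a, 'm::real_normed_vector) manifold \<Rightarrow> bool" where
  "smooth_manifold M \<longleftrightarrow>
     (\<exists>B. finite B \<and> span B = (UNIV :: 'm set)) \<and>
     Hausdorff_space (mtop M) \<and> second_countable (mtop M) \<and>
     (\<forall>(U, \<phi>) \<in> charts M. openin (mtop M) U \<and> open (\<phi> ` U) \<and>
        homeomorphic_map (subtopology (mtop M) U) (top_of_set (\<phi> ` U)) \<phi>) \<and>
     (\<Union>(U, \<phi>) \<in> charts M. U) = points M \<and>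
     (\<forall>(U, \<phi>) \<in> charts M. \<forall>(V, \<psi>) \<in> charts M.
        smooth_on (\<phi> ` (U \<inter> V)) (\<psi> \<circ> inv_into U \<phi>))"

definition smooth_map ::
  "('a, 'm::real_normed_vector) manifold \<Rightarrow> ('b, 'k::real_normed_vector) manifold \<Rightarrow> ('a \<Rightarrow> 'b) \<Rightarrow> bool"
where
  "smooth_map M N f \<longleftrightarrow>
     continuous_map (mtop M) (mtop N) f \<and>
     (\<forall>(U, \<phi>) \<in> charts M. \<forall>(V, \<psi>) \<in> charts N.
        smooth_on (\<phi> ` {x \<in> U. f x \<in> V}) (\<psi> \<circ> f \<circ> inv_into U \<phi>))"

definition diffeomorphism ::
  "('a, 'm::real_normed_vector) manifold \<Rightarrow> ('b, 'k::real_normed_vector) manifold \<Rightarrow> ('a \<Rightarrow> 'b) \<Rightarrow> bool"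
where
  "diffeomorphism M N f \<longleftrightarrow>
     bij_betw f (points M) (points N) \<and> smooth_map M N f \<and>
     smooth_map N M (inv_into (points M) f)"

definition open_submanifold :: "('a, 'm) manifold \<Rightarrow> 'a set \<Rightarrow> ('a, 'm) manifold" where
  "open_submanifold M U =
     \<lparr>mtop = subtopology (mtop M) U, charts = (\<lambda>(V, \<phi>). (V \<inter> U, \<phi>)) ` charts M\<rparr>"

definition prod_manifold ::
  "('a, 'm) manifold \<Rightarrow> ('b, 'k) manifold \<Rightarrow> ('a \<times> 'b, 'm \<times> 'k) manifold"
where
  "prod_manifold M N =
     \<lparr>mtop = prod_topology (mtop M) (mtop N),
      charts = {(U \<times> V, map_prod \<phi> \<psi>) | U \<phi> V \<psi>. (U, \<phi>) \<in> charts M \<and> (V, \<psi>) \<in> charts N}\<rparr>"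

definition model_manifold :: "('m::real_normed_vector, 'm) manifold" where
  "model_manifold = \<lparr>mtop = euclidean, charts = {(UNIV, id)}\<rparr>"

definition smooth_functions :: "('a, 'm::real_normed_vector) manifold \<Rightarrow> ('a \<Rightarrow> real) set" where
  "smooth_functions M = {u. smooth_map M model_manifold u}"


section \<open>Vector bundles\<close>

text \<open>The rank is \<open>CARD('n)\<close>. The operations \<open>fadd\<close> and \<open>fscale\<close> are meaningful only within fibres.\<close>

record ('a, 'm, 'e, 'n::finite) vector_bundle =
  total :: "('e, 'm \<times> (real ^ 'n)) manifold"
  proj :: "'e \<Rightarrow> 'a"
  fadd :: "'e \<Rightarrow> 'e \<Rightarrow> 'e"
  fscale :: "real \<Rightarrow> 'e \<Rightarrow> 'e"

definition fibre :: "('a, 'm, 'e, 'n::finite) vector_bundle \<Rightarrow> 'a \<Rightarrow> 'e set" where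
  "fibre E x = {e \<in> points (total E). proj E e = x}"

definition local_trivialization ::
  "('a, 'm::real_normed_vector, 'e, 'n::finite) vector_bundle \<Rightarrow> ('a, 'm) manifold \<Rightarrow>
   'a set \<Rightarrow> ('e \<Rightarrow> real ^ 'n) \<Rightarrow> bool"
where
  "local_trivialization E M U \<tau> \<longleftrightarrow>
     openin (mtop M) U \<and>
     diffeomorphism (open_submanifold (total E) {e \<in> points (total E). proj E e \<in> U})
       (prod_manifold (open_submanifold M U) model_manifold) (\<lambda>e. (proj E e, \<tau> e)) \<and>
     (\<forall>x\<in>U. \<forall>e\<in>fibre E x. \<forall>e'\<in>fibre E x. \<forall>c.
        \<tau> (fadd E e e') = \<tau> e + \<tau> e' \<and> \<tau> (fscale E c e) = c *\<^sub>R \<tau> e)"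

text \<open>The vector space axioms in the fibres need not be listed: a local trivialization restricts to
  a bijection of each fibre onto \<open>\<real>\<^sup>n\<close> that preserves both operations.\<close>

definition smooth_vector_bundle ::
  "('a, 'm::real_normed_vector, 'e, 'n::finite) vector_bundle \<Rightarrow> ('a, 'm) manifold \<Rightarrow> bool"
where
  "smooth_vector_bundle E M \<longleftrightarrow>
     smooth_manifold M \<and> smooth_manifold (total E) \<and> smooth_map (total E) M (proj E) \<and>
     (\<forall>x\<in>points M. \<forall>e\<in>fibre E x. \<forall>e'\<in>fibre E x. \<forall>c.
        fadd E e e' \<in> fibre E x \<and> fscale E c e \<in> fibre E x) \<and>
     (\<forall>x\<in>points M. \<exists>U \<tau>. x \<in> U \<and> local_trivialization E M U \<tau>)"

definition vector_bundle_iso ::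
  "('a, 'm::real_normed_vector, 'e, 'n::finite) vector_bundle \<Rightarrow> ('a, 'm) manifold \<Rightarrow>
   ('b, 'k::real_normed_vector, 'f, 'p::finite) vector_bundle \<Rightarrow> ('b, 'k) manifold \<Rightarrow>
   ('e \<Rightarrow> 'f) \<Rightarrow> ('a \<Rightarrow> 'b) \<Rightarrow> bool"
where
  "vector_bundle_iso E M F N \<Phi> \<phi> \<longleftrightarrow>
     diffeomorphism (total E) (total F) \<Phi> \<and> diffeomorphism M N \<phi> \<and>
     (\<forall>e\<in>points (total E). proj F (\<Phi> e) = \<phi> (proj E e)) \<and>
     (\<forall>x\<in>points M. \<forall>e\<in>fibre E x. \<forall>e'\<in>fibre E x. \<forall>c.
        \<Phi> (fadd E e e') = fadd F (\<Phi> e) (\<Phi> e') \<and> \<Phi> (fscale E c e) = fscale F c (\<Phi> e))"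

definition vector_bundles_isomorphic ::
  "('a, 'm::real_normed_vector, 'e, 'n::finite) vector_bundle \<Rightarrow> ('a, 'm) manifold \<Rightarrow>
   ('b, 'k::real_normed_vector, 'f, 'p::finite) vector_bundle \<Rightarrow> ('b, 'k) manifold \<Rightarrow> bool"
where
  "vector_bundles_isomorphic E M F N \<longleftrightarrow> (\<exists>\<Phi> \<phi>. vector_bundle_iso E M F N \<Phi> \<phi>)"


section \<open>Singular cohomology with coefficients in \<open>\<int>/2\<close>\<close>

text \<open>Cochains are functions on singular simplices, normalised to be 0 elsewhere.\<close>

definition cochain_group :: "nat \<Rightarrow> 'a topology \<Rightarrow> (((nat \<Rightarrow> real) \<Rightarrow> 'a) \<Rightarrow> bit) monoid" where
  "cochain_group p Z =
     \<lparr>carrier = {c. \<forall>f. \<not> singular_simplex p Z f \<longrightarrow> c f = 0},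
      monoid.mult = (\<lambda>c d f. c f + d f), one = (\<lambda>f. 0)\<rparr>"

definition coboundary ::
  "nat \<Rightarrow> 'a topology \<Rightarrow> (((nat \<Rightarrow> real) \<Rightarrow> 'a) \<Rightarrow> bit) \<Rightarrow> ((nat \<Rightarrow> real) \<Rightarrow> 'a) \<Rightarrow> bit"
where
  "coboundary p Z c = (\<lambda>f. if singular_simplex (Suc p) Z f
     then (\<Sum>k\<le>Suc p. (-1) ^ k * c (singular_face (Suc p) k f)) else 0)"

definition cocycle_group :: "nat \<Rightarrow> 'a topology \<Rightarrow> (((nat \<Rightarrow> real) \<Rightarrow> 'a) \<Rightarrow> bit) monoid" where
  "cocycle_group p Z = (cochain_group p Z)
     \<lparr>carrier := {c \<in> carrier (cochain_group p Z). coboundary p Z c = (\<lambda>f. 0)}\<rparr>"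

definition coboundary_set :: "nat \<Rightarrow> 'a topology \<Rightarrow> (((nat \<Rightarrow> real) \<Rightarrow> 'a) \<Rightarrow> bit) set" where
  "coboundary_set p Z = (case p of 0 \<Rightarrow> {\<lambda>f. 0}
     | Suc q \<Rightarrow> coboundary q Z ` carrier (cochain_group q Z))"

definition cohomology_group :: "nat \<Rightarrow> 'a topology \<Rightarrow> (((nat \<Rightarrow> real) \<Rightarrow> 'a) \<Rightarrow> bit) set monoid" where
  "cohomology_group p Z = cocycle_group p Z Mod coboundary_set p Z"


section \<open>The Poisson algebra associated with a filtered real algebra\<close>

text \<open>Real associative algebras are records of type \<^typ>\<open>(real, 't) module\<close> of \<open>HOL-Algebra\<close>, with the
  ring multiplication as product.\<close>

definition commutator :: "(real, 't, 'z) module_scheme \<Rightarrow> 't \<Rightarrow> 't \<Rightarrow> 't" where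
  "commutator A T D = (T \<otimes>\<^bsub>A\<^esub> D) \<ominus>\<^bsub>A\<^esub> (D \<otimes>\<^bsub>A\<^esub> T)"

record 's poisson_algebra = "(real, 's) module" +
  bracket :: "'s \<Rightarrow> 's \<Rightarrow> 's"

definition poisson_algebra_iso ::
  "'s poisson_algebra \<Rightarrow> 't poisson_algebra \<Rightarrow> ('s \<Rightarrow> 't) \<Rightarrow> bool"
where
  "poisson_algebra_iso R S h \<longleftrightarrow>
     bij_betw h (carrier R) (carrier S) \<and>
     (\<forall>x\<in>carrier R. \<forall>y\<in>carrier R. h (x \<oplus>\<^bsub>R\<^esub> y) = h x \<oplus>\<^bsub>S\<^esub> h y) \<and>
     (\<forall>c. \<forall>x\<in>carrier R. h (c \<odot>\<^bsub>R\<^esub> x) = c \<odot>\<^bsub>S\<^esub> h x) \<and>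
     (\<forall>x\<in>carrier R. \<forall>y\<in>carrier R. h (x \<otimes>\<^bsub>R\<^esub> y) = h x \<otimes>\<^bsub>S\<^esub> h y) \<and>
     (\<forall>x\<in>carrier R. \<forall>y\<in>carrier R. h (bracket R x y) = bracket S (h x) (h y))"

definition poisson_algebras_isomorphic :: "'s poisson_algebra \<Rightarrow> 't poisson_algebra \<Rightarrow> bool" where
  "poisson_algebras_isomorphic R S \<longleftrightarrow> (\<exists>h. poisson_algebra_iso R S h)"

text \<open>Below, \<open>P\<close> is an increasing filtration of \<open>A\<close> by subspaces with \<open>P i \<cdot> P j \<subseteq> P (i + j)\<close> and
  \<open>[P i, P j] \<subseteq> P (i + j - 1)\<close>. The quotient \<open>P i / P (i - 1)\<close> is an additive group whose elements are
  cosets; following \<^const>\<open>FactGroup\<close> its addition is called \<^const>\<open>monoid.mult\<close>, its zero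
  \<^const>\<open>one\<close>, and finite sums in it are written \<^const>\<open>finprod\<close>.\<close>

definition gr_part :: "(real, 't) module \<Rightarrow> (int \<Rightarrow> 't set) \<Rightarrow> int \<Rightarrow> 't set monoid" where
  "gr_part A P i = A\<lparr>carrier := P i\<rparr> A_Mod P (i - 1)"

definition symbol :: "(real, 't) module \<Rightarrow> (int \<Rightarrow> 't set) \<Rightarrow> int \<Rightarrow> 't \<Rightarrow> 't set" where
  "symbol A P i T = P (i - 1) +>\<^bsub>A\<^esub> T"

text \<open>As in \<^const>\<open>rcoset_mult\<close>, the unions over all representatives are unions of equal cosets.\<close>

definition symbol_smult :: "(real, 't) module \<Rightarrow> (int \<Rightarrow> 't set) \<Rightarrow> int \<Rightarrow> real \<Rightarrow> 't set \<Rightarrow> 't set" where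
  "symbol_smult A P i c Z = (\<Union>T\<in>Z. symbol A P i (c \<odot>\<^bsub>A\<^esub> T))"

definition symbol_mult ::
  "(real, 't) module \<Rightarrow> (int \<Rightarrow> 't set) \<Rightarrow> int \<Rightarrow> int \<Rightarrow> 't set \<Rightarrow> 't set \<Rightarrow> 't set"
where
  "symbol_mult A P i j Z W = (\<Union>T\<in>Z. \<Union>D\<in>W. symbol A P (i + j) (T \<otimes>\<^bsub>A\<^esub> D))"

definition symbol_bracket ::
  "(real, 't) module \<Rightarrow> (int \<Rightarrow> 't set) \<Rightarrow> int \<Rightarrow> int \<Rightarrow> 't set \<Rightarrow> 't set \<Rightarrow> 't set"
where
  "symbol_bracket A P i j Z W = (\<Union>T\<in>Z. \<Union>D\<in>W. symbol A P (i + j - 1) (commutator A T D))"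

text \<open>The degree \<open>k\<close> component of a product (bracket) collects the pairs of degrees \<open>(i, j)\<close> with
  \<open>i + j = k\<close> (with \<open>i + j - 1 = k\<close>).\<close>

definition gr_poisson ::
  "(real, 't) module \<Rightarrow> (int \<Rightarrow> 't set) \<Rightarrow> (int \<Rightarrow> 't set) poisson_algebra"
where
  "gr_poisson A P =
     \<lparr>carrier = carrier (sum_group UNIV (gr_part A P)),
      monoid.mult = (\<lambda>x y k. finprod (gr_part A P k)
         (\<lambda>i. symbol_mult A P i (k - i) (x i) (y (k - i)))
         {i. x i \<noteq> \<one>\<^bsub>gr_part A P i\<^esub> \<and> y (k - i) \<noteq> \<one>\<^bsub>gr_part A P (k - i)\<^esub>}),
      one = (\<lambda>i. if i = 0 then symbol A P 0 \<one>\<^bsub>A\<^esub> else \<one>\<^bsub>gr_part A P i\<^esub>),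
      ring.zero = \<one>\<^bsub>sum_group UNIV (gr_part A P)\<^esub>,
      ring.add = (\<lambda>x y. x \<otimes>\<^bsub>sum_group UNIV (gr_part A P)\<^esub> y),
      module.smult = (\<lambda>c x i. symbol_smult A P i c (x i)),
      bracket = (\<lambda>x y k. finprod (gr_part A P k)
         (\<lambda>i. symbol_bracket A P i (k + 1 - i) (x i) (y (k + 1 - i)))
         {i. x i \<noteq> \<one>\<^bsub>gr_part A P i\<^esub> \<and> y (k + 1 - i) \<noteq> \<one>\<^bsub>gr_part A P (k + 1 - i)\<^esub>})\<rparr>"


section \<open>The algebra \<open>\<P>(E, M)\<close> and its symbols\<close>

definition smooth_sections ::
  "('a, 'm::real_normed_vector, 'e, 'n::finite) vector_bundle \<Rightarrow> ('a, 'm) manifold \<Rightarrow> ('a \<Rightarrow> 'e) set"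
where
  "smooth_sections E M =
     {s \<in> extensional (points M). smooth_map M (total E) s \<and> (\<forall>x\<in>points M. proj E (s x) = x)}"

definition section_add ::
  "('a, 'm, 'e, 'n::finite) vector_bundle \<Rightarrow> ('a, 'm) manifold \<Rightarrow> ('a \<Rightarrow> 'e) \<Rightarrow> ('a \<Rightarrow> 'e) \<Rightarrow> 'a \<Rightarrow> 'e"
where
  "section_add E M s t = (\<lambda>x\<in>points M. fadd E (s x) (t x))"

definition section_mult ::
  "('a, 'm, 'e, 'n::finite) vector_bundle \<Rightarrow> ('a, 'm) manifold \<Rightarrow> ('a \<Rightarrow> real) \<Rightarrow> ('a \<Rightarrow> 'e) \<Rightarrow> 'a \<Rightarrow> 'e"
where
  "section_mult E M u s = (\<lambda>x\<in>points M. fscale E (u x) (s x))"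

definition section_scale ::
  "('a, 'm, 'e, 'n::finite) vector_bundle \<Rightarrow> ('a, 'm) manifold \<Rightarrow> real \<Rightarrow> ('a \<Rightarrow> 'e) \<Rightarrow> 'a \<Rightarrow> 'e"
where
  "section_scale E M c s = section_mult E M (\<lambda>x. c) s"

type_synonym ('a, 'e) section_operator = "('a \<Rightarrow> 'e) \<Rightarrow> 'a \<Rightarrow> 'e"

definition End_sections ::
  "('a, 'm::real_normed_vector, 'e, 'n::finite) vector_bundle \<Rightarrow> ('a, 'm) manifold \<Rightarrow>
   (real, ('a, 'e) section_operator) module"
where
  "End_sections E M =
     \<lparr>carrier = {T \<in> smooth_sections E M \<rightarrow>\<^sub>E smooth_sections E M.
        (\<forall>s\<in>smooth_sections E M. \<forall>t\<in>smooth_sections E M.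
           T (section_add E M s t) = section_add E M (T s) (T t)) \<and>
        (\<forall>c. \<forall>s\<in>smooth_sections E M. T (section_scale E M c s) = section_scale E M c (T s))},
      monoid.mult = compose (smooth_sections E M),
      one = (\<lambda>s\<in>smooth_sections E M. s),
      ring.zero = (\<lambda>s\<in>smooth_sections E M. section_scale E M 0 s),
      ring.add = (\<lambda>T D. \<lambda>s\<in>smooth_sections E M. section_add E M (T s) (D s)),
      module.smult = (\<lambda>c T. \<lambda>s\<in>smooth_sections E M. section_scale E M c (T s))\<rparr>"

definition multiplication_op ::
  "('a, 'm::real_normed_vector, 'e, 'n::finite) vector_bundle \<Rightarrow> ('a, 'm) manifold \<Rightarrow>
   ('a \<Rightarrow> real) \<Rightarrow> ('a, 'e) section_operator"
where
  "multiplication_op E M u = (\<lambda>s\<in>smooth_sections E M. section_mult E M u s)"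

primrec P_nat ::
  "('a, 'm::real_normed_vector, 'e, 'n::finite) vector_bundle \<Rightarrow> ('a, 'm) manifold \<Rightarrow>
   nat \<Rightarrow> ('a, 'e) section_operator set"
where
  "P_nat E M 0 = multiplication_op E M ` smooth_functions M"
| "P_nat E M (Suc i) = {T \<in> carrier (End_sections E M).
     \<forall>u\<in>smooth_functions M. commutator (End_sections E M) T (multiplication_op E M u) \<in> P_nat E M i}"

definition P_filtration ::
  "('a, 'm::real_normed_vector, 'e, 'n::finite) vector_bundle \<Rightarrow> ('a, 'm) manifold \<Rightarrow>
   int \<Rightarrow> ('a, 'e) section_operator set"
where
  "P_filtration E M i = (if i < 0 then {\<zero>\<^bsub>End_sections E M\<^esub>} else P_nat E M (nat i))"

definition symbol_poisson_algebra ::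
  "('a, 'm::real_normed_vector, 'e, 'n::finite) vector_bundle \<Rightarrow> ('a, 'm) manifold \<Rightarrow>
   (int \<Rightarrow> ('a, 'e) section_operator set) poisson_algebra"
where
  "symbol_poisson_algebra E M = gr_poisson (End_sections E M) (P_filtration E M)"

end

theory Submission
  imports Defs
begin

text \<open>Every function is a sum of nowhere vanishing ones and the symbol of a unit has order 0, so an isomorphism of the
  Poisson algebras induces an isomorphism \<open>psi\<close> of the function algebras; as characters of smooth functions are
  evaluations, it comes from a diffeomorphism. The square-zero elements single out, in degree 1, the endomorphism fields
  modulo functions, on which one obtains a map \<open>theta\<close> that is \<open>psi\<close>-semilinear, a Lie homomorphism and compatible with
  Casimir sums, all modulo functions. At each point \<open>theta\<close> is therefore, up to scalars, a conjugation by a linear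
  isomorphism of the fibres or, after choosing a metric, the conjugation of minus the adjoint. This isomorphism is smooth
  in a neighbourhood of each point and unique up to a factor; the signs of the factors on overlaps form a cocycle, which
  is trivial since \<open>H\<^sup>1(M, Z/2) = 0\<close>, and a partition of unity glues the local isomorphisms. Conversely, a bundle
  isomorphism transports operators, preserving the filtration.\<close>

text \<open>The isomorphism is not assumed graded: an element of one degree may go to a sum over
  several degrees, only one component of which is kept. No inverse of \<open>theta\<close> is
  therefore at hand, and \<open>theta\<close> might vanish. The Casimir identity sum [E_ij,
  [E_ji, A]] = 2n A - 2 tr(A) excludes this. It extends from endomorphism fields to square-zero
  elements of all orders, so it can be carried through the isomorphism and read off in degree 1 for
  every endomorphism field of the target. Injectivity modulo scalars, in both directions, then makes
  the ranks equal. Whether \<open>theta\<close> is a conjugation or of adjoint type is locally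
  constant but may differ between components of the base; the metric identifies a bundle with its
  dual, so that both types give isomorphisms between the same two bundles. In rank 2 every map is a
  conjugation. Fibres get arbitrary linear coordinates, with no continuity in the base point, and
  smoothness is expressed through transition matrices; bundle maps thus become plain matrix-valued
  functions on the base.\<close>

abbreviation (input) "opn M == openin (mtop M)"
abbreviation (input) "Cinf == smooth_functions"
abbreviation (input) "minv == matrix_inv"

lemmas mv_assoc = matrix_vector_mul_assoc

notation scaleR (infixr "*R" 75)

section \<open>Calculus on finite-dimensional normed spaces\<close>

definition fin_dim :: "'a::real_normed_vector itself => bool" where
 "fin_dim _ \<longleftrightarrow> (\<exists>B::'a set. finite B \<and> span B = UNIV)"

text \<open>Replaces an orthonormal basis, since the model space is only normed. Boundedness of
  \<open>c b\<close> is demanded for every \<open>b\<close>, also outside \<open>B\<close>, which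
  spares membership conditions later.\<close>

definition coordinate_system :: "'a::real_normed_vector set => ('a => 'a => real) => bool" where
 "coordinate_system B c \<longleftrightarrow> finite B \<and> (\<forall>b. bounded_linear (c b)) \<and> (\<forall>x. (\<Sum>b\<in>B. c b x *R b) = x)"

text \<open>Tychonoff on the full function space; pinning the coordinates outside \<open>B\<close>
  to 0 makes this a copy of a box in R^B.\<close>

lemma compact_coefficient_box:
 fixes B :: "'b set" and R :: real
 shows "compact {f :: 'b => real. \<forall>b. \<bar>f b\<bar>\<le>(if b\<in>B then R else 0)}"
proof -
 have "compactin (product_topology (%b::'b. euclideanreal) UNIV)
   (PiE UNIV (%b. {-(if b\<in>B then R else 0)..(if b\<in>B then R else 0)}))"
  unfolding compactin_PiE by (auto simp: compactin_euclidean_iff)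
 moreover have "PiE UNIV (%b. {-(if b\<in>B then R else 0)..(if b\<in>B then R else 0)})
   = {f :: 'b => real. \<forall>b. \<bar>f b\<bar>\<le>(if b\<in>B then R else 0)}"
  by (auto simp: PiE_def Pi_def abs_le_iff; meson)
 ultimately show ?thesis
  by (simp add: euclidean_product_topology compactin_euclidean_iff)
qed

text \<open>Equivalence of norms in finite dimension: the norm attains a positive minimum on the
  compact l1 unit sphere of coefficients, so each coordinate functional is bounded by its
  reciprocal.\<close>

lemma coordinate_system_exists:
 assumes "fin_dim TYPE('a::real_normed_vector)"
 obtains B :: "'a::real_normed_vector set" and c where "coordinate_system B c"
proof -
 obtain B0 :: "'a set" where B0: "finite B0" "span B0 = UNIV"
  using assms by (auto simp: fin_dim_def)
 obtain B where B: "B\<subseteq>B0" "independent B" "B0\<subseteq>span B"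
  using maximal_independent_subset[of B0] by blast
 have fB: "finite B" using B(1) B0(1) finite_subset by blast
 have sB: "span B = UNIV" using B(3) B0(2) by (metis span_mono span_span top.extremum_uniqueI)
 define c where "c = (%b x. representation B x b)"
 have lin: "linear (c b)" for b
  unfolding c_def by (rule linearI)
   (auto simp: representation_add[OF B(2)] representation_scale[OF B(2)] sB)
 have rep: "(\<Sum>b\<in>B. c b x *R b) = x" for x
  unfolding c_def using sum_representation_eq[OF B(2), of x B] fB sB by auto
 define S where "S = {f :: 'a => real. \<forall>b. \<bar>f b\<bar>\<le>(if b\<in>B then 1 else 0)}\<inter>{f. (\<Sum>b\<in>B. \<bar>f b\<bar>) = 1}"
 have "closed {f :: 'a => real. (\<Sum>b\<in>B. \<bar>f b\<bar>) = 1}"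
  by (rule closed_Collect_eq) (intro continuous_intros continuous_on_product_coordinates)+
 hence cS: "compact S" unfolding S_def
  by (intro compact_Int_closed compact_coefficient_box)
 define g where "g = (%f::'a => real. norm (\<Sum>b\<in>B. f b *R b))"
 have cc: "continuous_on S (%f. f b)" for b
  by (rule continuous_on_subset[OF continuous_on_product_coordinates]) simp
 have cg: "continuous_on S g" unfolding g_def by (intro continuous_intros cc)
 have gpos: "g f > 0" if "f\<in>S" for f
 proof (rule ccontr)
  assume "\<not> 0 < g f"
  hence "(\<Sum>b\<in>B. f b *R b) = 0" by (simp add: g_def)
  hence "\<forall>b\<in>B. f b = 0" using independentD[OF B(2) fB subset_refl] by blast
  thus False using that by (simp add: S_def)
 qed
 have "\<exists>m>0. \<forall>f\<in>S. m\<le>g f"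
 proof (cases "S = {}")
  case True thus ?thesis by (auto intro: exI[of _ 1])
 next
  case False
  then obtain f where "f\<in>S" "\<forall>h\<in>S. g f\<le>g h"
   using continuous_attains_inf[OF cS False cg] by auto
  thus ?thesis using gpos by auto
 qed
 then obtain m where m: "m > 0" "!!f. f\<in>S ==> m\<le>g f" by auto
 have bd: "(\<Sum>b\<in>B. \<bar>c b x\<bar>) * m\<le>norm x" for x
 proof (cases "(\<Sum>b\<in>B. \<bar>c b x\<bar>) = 0")
  case True thus ?thesis by simp
 next
  case False
  define s where "s = (\<Sum>b\<in>B. \<bar>c b x\<bar>)"
  have s: "s > 0" using False unfolding s_def by (simp add: less_le sum_nonneg)
  define f where "f = (%b. if b\<in>B then c b x / s else 0)"
  have "\<bar>c b x\<bar>\<le>s" if "b\<in>B" for b unfolding s_def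
   by (rule member_le_sum[OF that]) (use fB in auto)
  hence "f\<in>S" using s unfolding S_def f_def
   by (auto simp: sum_divide_distrib[symmetric] s_def[symmetric])
  hence "m\<le>g f" by (rule m)
  also have "g f = norm (\<Sum>b\<in>B. (1/s) *R (c b x *R b))"
   unfolding g_def f_def by (intro arg_cong[where f=norm] sum.cong) auto
  also have "\<dots> = norm x / s" using s by (simp add: scaleR_sum_right[symmetric] rep del: scaleR_scaleR)
  finally show ?thesis using s by (simp add: s_def[symmetric] field_simps)
 qed
 have "bounded_linear (c b)" for b
 proof (cases "b\<in>B")
  case True
  show ?thesis
  proof (rule bounded_linear_intro[where K = "1/m"])
   fix x
   have "\<bar>c b x\<bar>\<le>(\<Sum>b\<in>B. \<bar>c b x\<bar>)" by (rule member_le_sum[OF True]) (use fB in auto)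
   thus "norm (c b x)\<le>norm x * (1/m)" using bd[of x] m(1)
    by (simp add: field_simps) (metis mult_left_mono order_trans less_imp_le)
  qed (use lin[of b] in "auto simp: linear_iff")
 next
  case False
  hence "c b = (%x. 0)" unfolding c_def
   by (auto simp: fun_eq_iff) (meson representation_ne_zero)
  thus ?thesis by simp
 qed
 hence "coordinate_system B c" using fB rep by (auto simp: coordinate_system_def)
 thus ?thesis using that by blast
qed

lemma fin_dim_euclidean: "fin_dim TYPE('a::euclidean_space)"
 unfolding fin_dim_def by (intro exI[of _ Basis]) simp

abbreviation fderiv :: "('a::real_normed_vector => 'b::real_normed_vector) => 'a => 'a => 'b" where
 "fderiv f x \<equiv> frechet_derivative f (at x)"

lemma fderiv_cong:
 assumes "open S" "x\<in>S" "!!y. y\<in>S ==> f y = g y"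
 shows "f differentiable (at x) \<longleftrightarrow> g differentiable (at x)" "fderiv f x = fderiv g x"
proof -
 have 1: "(f has_derivative D) (at x) \<longleftrightarrow> (g has_derivative D) (at x)" for D
  using assms by (metis has_derivative_transform_within_open)
 show "f differentiable (at x) \<longleftrightarrow> g differentiable (at x)"
  by (simp add: differentiable_def 1)
 show "fderiv f x = fderiv g x" by (simp add: frechet_derivative_def 1)
qed

lemma Ck_on_cong:
 assumes "open S" "!!y. y\<in>S ==> f y = g y" "Ck_on k S f"
 shows "Ck_on k S g"
 using assms
proof (induction k arbitrary: f g)
 case 0 thus ?case by (simp cong: continuous_on_cong)
next
 case (Suc k)
 note cong = fderiv_cong[OF Suc.prems(1) _ Suc.prems(2)]
 show ?case unfolding Ck_on.simps
 proof (intro conjI ballI allI)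
  show "g differentiable at x" if "x\<in>S" for x using Suc.prems cong(1)[OF that] that by auto
  show "Ck_on k S (%x. fderiv g x v)" for v
   by (rule Suc.IH[of "%x. fderiv f x v"]) (use Suc.prems cong in auto)
 qed
qed

lemma Ck_on_mono: "Ck_on k S f ==> T\<subseteq>S ==> Ck_on k T f"
 by (induction k arbitrary: f) (auto intro: continuous_on_subset)

lemma Ck_on_imp_continuous_on: "Ck_on k S f ==> continuous_on S f"
proof (cases k)
 case (Suc j)
 assume "Ck_on k S f"
 hence "f differentiable_on S"
  unfolding differentiable_on_def using Suc by (simp add: differentiable_at_withinI)
 thus ?thesis by (rule differentiable_imp_continuous_on)
qed simp

lemma Ck_on_Suc_imp: "Ck_on (Suc k) S f ==> Ck_on k S f"
proof (induction k arbitrary: f)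
 case 0 thus ?case using Ck_on_imp_continuous_on[OF 0] by simp
next
 case (Suc k) thus ?case by (metis Ck_on.simps(2))
qed

lemma Ck_on_SucI:
 assumes "open S" "!!x. x\<in>S ==> (f has_derivative D x) (at x)" "!!v. Ck_on k S (%x. D x v)"
 shows "Ck_on (Suc k) S f"
proof -
 have *: "D x = fderiv f x" if "x\<in>S" for x using frechet_derivative_at assms(2)[OF that] by blast
 show ?thesis unfolding Ck_on.simps
 proof (intro conjI ballI allI)
  show "f differentiable at x" if "x\<in>S" for x using assms(2)[OF that] by (auto simp: differentiable_def)
  show "Ck_on k S (%x. fderiv f x v)" for v
   by (rule Ck_on_cong[OF assms(1) _ assms(3)]) (simp add: *)
 qed
qed

lemma Ck_on_SucD:
 assumes "Ck_on (Suc k) S f"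
 shows "x\<in>S ==> (f has_derivative fderiv f x) (at x)" "Ck_on k S (%x. fderiv f x v)"
 using assms by (auto simp: frechet_derivative_works)

lemma Ck_on_const: "Ck_on k S (%x. c)"
 by (induction k arbitrary: c) auto

lemma Ck_on_bounded_linear_id: "open S ==> bounded_linear L ==> Ck_on k S L"
proof (cases k)
 case 0 thus "bounded_linear L ==> ?thesis" by (simp add: linear_continuous_on)
next
 case (Suc j)
 assume "open S" "bounded_linear L"
 thus ?thesis unfolding Suc
  by (intro Ck_on_SucI[where D = "%x. L"])
   (auto intro: bounded_linear_imp_has_derivative Ck_on_const)
qed

lemma Ck_on_bounded_linear:
 assumes "open S" "bounded_linear L" "Ck_on k S f"
 shows "Ck_on k S (%x. L (f x))"
 using assms(3)
proof (induction k arbitrary: f)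
 case 0 thus ?case using assms(2) by (simp add: bounded_linear.continuous_on)
next
 case (Suc k)
 show ?case
  by (rule Ck_on_SucI[OF assms(1), where D = "%x v. L (fderiv f x v)"])
   (use Suc Ck_on_SucD[OF Suc.prems] in "auto intro: bounded_linear.has_derivative[OF assms(2)]")
qed

lemma Ck_on_add:
 assumes "open S" "Ck_on k S f" "Ck_on k S g"
 shows "Ck_on k S (%x. f x + g x)"
 using assms(2,3)
proof (induction k arbitrary: f g)
 case 0 thus ?case by (auto intro: continuous_intros)
next
 case (Suc k)
 show ?case
  by (rule Ck_on_SucI[OF assms(1), where D = "%x v. fderiv f x v + fderiv g x v"])
   (use Suc.IH Ck_on_SucD[OF Suc.prems(1)] Ck_on_SucD[OF Suc.prems(2)] in "auto intro: has_derivative_add")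
qed

lemma Ck_on_sum:
 assumes "open S" "!!i. i\<in>I ==> Ck_on k S (f i)"
 shows "Ck_on k S (%x. \<Sum>i\<in>I. f i x)"
 using assms(2)
 by (induction I rule: infinite_finite_induct) (auto intro: Ck_on_const Ck_on_add[OF assms(1)])

lemma Ck_on_bilinear:
 assumes "open S" "bounded_bilinear B" "Ck_on k S f" "Ck_on k S g"
 shows "Ck_on k S (%x. B (f x) (g x))"
 using assms(3,4)
proof (induction k arbitrary: f g)
 case 0 thus ?case using bounded_bilinear.continuous_on[OF assms(2)] by auto
next
 case (Suc k)
 show ?case
  by (rule Ck_on_SucI[OF assms(1), where D = "%x v. B (f x) (fderiv g x v) + B (fderiv f x v) (g x)"])
   (use Suc.IH Ck_on_SucD[OF Suc.prems(1)] Ck_on_SucD[OF Suc.prems(2)]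
    Suc.prems[THEN Ck_on_Suc_imp] in
    \<open>auto intro!: bounded_bilinear.FDERIV[OF assms(2)] Ck_on_add[OF assms(1)]\<close>)
qed

text \<open>\<open>Ck_on\<close> only controls derivatives in fixed directions, while the chain rule
  feeds \<open>fderiv g\<close> with a moving vector. Expanding that vector in a coordinate system
  of the middle space turns the derivative into a finite sum of products to which the induction
  hypothesis applies.\<close>

lemma Ck_on_compose:
 assumes "open S" "open T" "fin_dim TYPE('b::real_normed_vector)"
  "Ck_on k S (f :: 'a::real_normed_vector => 'b::real_normed_vector)" "Ck_on k T g" "f ` S\<subseteq>T"
 shows "Ck_on k S (%x. g (f x))"
 using assms(4,5,6)
proof (induction k arbitrary: f g)
 case 0 thus ?case using continuous_on_compose2[of T g S f] by auto
next
 case (Suc k)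
 obtain B :: "'b set" and c where Bc: "coordinate_system B c" using coordinate_system_exists[OF assms(3)] .
 have bl: "bounded_linear (c b)" for b using Bc by (auto simp: coordinate_system_def)
 note fD = Ck_on_SucD[OF Suc.prems(1)] and gD = Ck_on_SucD[OF Suc.prems(2)]
 show ?case
 proof (rule Ck_on_SucI[OF assms(1), where D = "%x v. \<Sum>b\<in>B. c b (fderiv f x v) *R fderiv g (f x) b"])
  fix x assume x: "x\<in>S"
  have g: "(g has_derivative fderiv g (f x)) (at (f x))" using gD(1) Suc.prems(3) x by auto
  have D: "((%x. g (f x)) has_derivative (%v. fderiv g (f x) (fderiv f x v))) (at x)"
   by (rule has_derivative_compose[OF fD(1)[OF x] g])
  have eq: "fderiv g (f x) w = (\<Sum>b\<in>B. c b w *R fderiv g (f x) b)" for w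
  proof -
   have "linear (fderiv g (f x))" using g has_derivative_linear by blast
   hence "fderiv g (f x) (\<Sum>b\<in>B. c b w *R b) = (\<Sum>b\<in>B. c b w *R fderiv g (f x) b)"
    by (simp add: linear_sum linear_scale)
   thus ?thesis using Bc by (simp add: coordinate_system_def)
  qed
  show "((%x. g (f x)) has_derivative
    (%v. \<Sum>b\<in>B. c b (fderiv f x v) *R fderiv g (f x) b)) (at x)"
   by (rule has_derivative_eq_rhs[OF D]) (rule ext, rule eq)
 next
  fix v
  have "Ck_on k S (%x. fderiv g (f x) b)" for b
   using Suc.IH[OF Ck_on_Suc_imp[OF Suc.prems(1)] gD(2) Suc.prems(3)] .
  thus "Ck_on k S (%x. \<Sum>b\<in>B. c b (fderiv f x v) *R fderiv g (f x) b)"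
   by (intro Ck_on_sum Ck_on_bilinear[OF assms(1) bounded_bilinear_scaleR]
     Ck_on_bounded_linear[OF assms(1) bl] fD(2) assms(1)) auto
 qed
qed

lemma Ck_on_union:
 assumes "!!x. x\<in>S ==> \<exists>T. open T \<and> x\<in>T \<and> Ck_on k T f"
 shows "Ck_on k S f"
 using assms
proof (induction k arbitrary: f)
 case 0
 have "continuous (at x) f" if "x\<in>S" for x
  using 0[OF that] by (auto simp: continuous_on_eq_continuous_at)
 thus ?case by (auto intro: continuous_at_imp_continuous_on)
next
 case (Suc k)
 show ?case unfolding Ck_on.simps
 proof (intro conjI ballI allI)
  show "f differentiable at x" if "x\<in>S" for x using Suc.prems[OF that] by auto
  show "Ck_on k S (%x. fderiv f x v)" for v by (rule Suc.IH) (use Suc.prems in fastforce)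
 qed
qed

lemma smooth_on_cong: "open S ==> (!!y. y\<in>S ==> f y = g y) ==> smooth_on S f ==> smooth_on S g"
 unfolding smooth_on_def using Ck_on_cong by blast

lemma smooth_on_mono: "smooth_on S f ==> T\<subseteq>S ==> smooth_on T f"
 unfolding smooth_on_def using Ck_on_mono by blast

lemma smooth_on_imp_continuous_on: "smooth_on S f ==> continuous_on S f"
 unfolding smooth_on_def using Ck_on_imp_continuous_on by blast

lemma smooth_on_const: "smooth_on S (%x. c)"
 unfolding smooth_on_def using Ck_on_const by blast

lemma smooth_on_bounded_linear: "open S ==> bounded_linear L ==> smooth_on S L"
 unfolding smooth_on_def using Ck_on_bounded_linear_id by blast

lemma smooth_on_id: "open S ==> smooth_on S (%x. x)"
 using smooth_on_bounded_linear[OF _ bounded_linear_ident] .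

lemma smooth_on_linear_compose:
 "open S ==> bounded_linear L ==> smooth_on S f ==> smooth_on S (%x. L (f x))"
 unfolding smooth_on_def by (simp add: Ck_on_bounded_linear)

lemma smooth_on_add: "open S ==> smooth_on S f ==> smooth_on S g ==> smooth_on S (%x. f x + g x)"
 unfolding smooth_on_def by (simp add: Ck_on_add)

lemma smooth_on_sum: "open S ==> (!!i. i\<in>I ==> smooth_on S (f i)) ==> smooth_on S (%x. \<Sum>i\<in>I. f i x)"
 unfolding smooth_on_def by (simp add: Ck_on_sum)

lemma smooth_on_bilinear:
 "open S ==> bounded_bilinear B ==> smooth_on S f ==> smooth_on S g ==> smooth_on S (%x. B (f x) (g x))"
 unfolding smooth_on_def by (simp add: Ck_on_bilinear)

lemma smooth_on_compose:
 assumes "open S" "open T" "fin_dim TYPE('b::real_normed_vector)"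
  "smooth_on S (f :: 'a::real_normed_vector => 'b::real_normed_vector)" "smooth_on T g" "f ` S\<subseteq>T"
 shows "smooth_on S (%x. g (f x))"
 unfolding smooth_on_def
proof
 fix k
 show "Ck_on k S (%x. g (f x))"
  by (rule Ck_on_compose[OF assms(1-3) _ _ assms(6)]) (use assms(4,5) in "auto simp: smooth_on_def")
qed

lemma smooth_on_union:
 assumes "!!x. x\<in>S ==> \<exists>T. open T \<and> x\<in>T \<and> smooth_on T f"
 shows "smooth_on S f"
 unfolding smooth_on_def
 by (intro allI Ck_on_union) (use assms in "auto simp: smooth_on_def")

text \<open>The derivative is a polynomial in \<open>inverse\<close> itself, so the induction
  hypothesis applies to it.\<close>

lemma smooth_on_inverse: "smooth_on (- {0::real}) inverse"
proof -
 have o: "open (- {0::real})" by auto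
 have "Ck_on k (- {0::real}) inverse" for k
 proof (induction k)
  case 0 show ?case by (auto intro: continuous_intros)
 next
  case (Suc k)
  show ?case
  proof (rule Ck_on_SucI[OF o])
   show "(inverse has_derivative (%v. (- v) * (inverse x * inverse x))) (at x)"
    if "x\<in>- {0::real}" for x
    using that by (auto intro!: derivative_eq_intros)
   show "Ck_on k (- {0::real}) (%x. (- v) * (inverse x * inverse x))" for v
    by (intro Ck_on_bilinear[OF o bounded_bilinear_mult] Ck_on_const Suc)
  qed
 qed
 thus ?thesis by (simp add: smooth_on_def)
qed

lemma smooth_on_prod:
 assumes S: "open S"
  and f: "smooth_on S (f :: 'a::real_normed_vector => 'b::real_normed_vector)"
  and g: "smooth_on S (g :: 'a::real_normed_vector => 'c::real_normed_vector)"
 shows "smooth_on S (%x. (f x, g x))"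
proof -
 have "bounded_linear (%x. (x, 0::'c))" "bounded_linear (%x. (0::'b, x))"
  by (auto intro: bounded_linear_Pair bounded_linear_ident bounded_linear_zero)
 from this[THEN smooth_on_linear_compose[OF S]]
 have "smooth_on S (%x. (f x, 0) + (0, g x))"
  using f g by (intro smooth_on_add[OF S]) blast+
 thus ?thesis by simp
qed

section \<open>Smoothness at a point\<close>

text \<open>The part of \<open>smooth_manifold\<close> that local arguments use, with charts
  described by open images and preimages instead of subspace homeomorphisms. Model spaces satisfy it
  too, so functions and maps are treated alike.\<close>

definition atlas :: "('a, 'm::real_normed_vector) manifold => bool" where
 "atlas M \<longleftrightarrow> fin_dim TYPE('m) \<and>
  (\<forall>(U, phi)\<in>charts M. opn M U \<and> inj_on phi U \<and>
    (\<forall>W. opn M W --> W\<subseteq>U --> open (phi ` W)) \<and>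
    (\<forall>W. open W --> opn M {x\<in>U. phi x\<in>W})) \<and>
  (\<forall>x\<in>points M. \<exists>(U, phi)\<in>charts M. x\<in>U) \<and>
  (\<forall>(U, phi)\<in>charts M. \<forall>(V, psi)\<in>charts M.
    smooth_on (phi ` (U\<inter>V)) (psi\<circ>inv_into U phi))"

lemma atlasD:
 assumes "atlas (M :: ('a, 'm::real_normed_vector) manifold)"
 shows "fin_dim TYPE('m)"
  "(U, phi)\<in>charts M ==> opn M U"
  "(U, phi)\<in>charts M ==> U\<subseteq>points M"
  "(U, phi)\<in>charts M ==> inj_on phi U"
  "(U, phi)\<in>charts M ==> opn M W ==> W\<subseteq>U ==> open (phi ` W)"
  "(U, phi)\<in>charts M ==> open W' ==> opn M {x\<in>U. phi x\<in>W'}"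
  "(U, phi)\<in>charts M ==> (V, psi)\<in>charts M ==>
   smooth_on (phi ` (U\<inter>V)) (psi\<circ>inv_into U phi)"
  "(U, phi)\<in>charts M ==> x\<in>U ==> inv_into U phi (phi x) = x"
proof -
 show "fin_dim TYPE('m)" using assms by (simp add: atlas_def)
 have *: "opn M U \<and> inj_on phi U \<and>
    (\<forall>W. opn M W --> W\<subseteq>U --> open (phi ` W)) \<and>
    (\<forall>W. open W --> opn M {x\<in>U. phi x\<in>W})" if "(U, phi)\<in>charts M"
  using assms that unfolding atlas_def by blast
 show "(U, phi)\<in>charts M ==> opn M U" using * by blast
 thus "(U, phi)\<in>charts M ==> U\<subseteq>points M" using openin_subset by blast
 show "(U, phi)\<in>charts M ==> inj_on phi U" using * by blast
 show "(U, phi)\<in>charts M ==> opn M W ==> W\<subseteq>U ==> open (phi ` W)"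
  using * by simp
 show "(U, phi)\<in>charts M ==> open W' ==> opn M {x\<in>U. phi x\<in>W'}" using * by simp
 show "(U, phi)\<in>charts M ==> (V, psi)\<in>charts M ==>
   smooth_on (phi ` (U\<inter>V)) (psi\<circ>inv_into U phi)"
  using assms unfolding atlas_def by blast
 show "(U, phi)\<in>charts M ==> x\<in>U ==> inv_into U phi (phi x) = x" using * by simp
qed

lemma chart_inverse_continuous:
 assumes "atlas M" "(U, phi)\<in>charts M"
 shows "continuous_map (top_of_set (phi ` U)) (mtop M) (inv_into U phi)"
 unfolding continuous_map_def
proof (intro conjI allI impI)
 note A = atlasD[OF assms(1)]
 show "inv_into U phi\<in>topspace (top_of_set (phi ` U)) \<rightarrow> points M" using A(3,8)[OF assms(2)] by auto
 fix W assume "opn M W"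
 hence "open (phi ` (U\<inter>W))" by (intro A(5)[OF assms(2)]) (use A(2)[OF assms(2)] in auto)
 moreover have "{y\<in>topspace (top_of_set (phi ` U)). inv_into U phi y\<in>W} = phi ` (U\<inter>W)"
  by (auto simp: A(8)[OF assms(2)])
 ultimately show "openin (top_of_set (phi ` U)) {y\<in>topspace (top_of_set (phi ` U)). inv_into U phi y\<in>W}"
  by (metis inf_le1 image_mono open_subset)
qed

lemma atlas_chart:
 assumes "atlas M" "x\<in>points M"
 obtains U phi where "(U, phi)\<in>charts M" "x\<in>U"
 using assms unfolding atlas_def by blast

lemma manifold_atlas:
 assumes "smooth_manifold (M :: ('a, 'm::real_normed_vector) manifold)"
 shows "atlas M"
 unfolding atlas_def
proof (intro conjI)
 show "fin_dim TYPE('m)"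
  using assms by (simp add: smooth_manifold_def fin_dim_def)
 show "\<forall>x\<in>points M. \<exists>(U, phi)\<in>charts M. x\<in>U"
  using assms unfolding smooth_manifold_def by (elim conjE) blast
 show "\<forall>(U, phi)\<in>charts M. \<forall>(V, psi)\<in>charts M. smooth_on (phi ` (U\<inter>V)) (psi\<circ>inv_into U phi)"
  using assms by (simp add: smooth_manifold_def)
 show "\<forall>(U, phi)\<in>charts M. opn M U \<and> inj_on phi U \<and>
   (\<forall>W. opn M W --> W\<subseteq>U --> open (phi ` W)) \<and>
   (\<forall>W. open W --> opn M {x\<in>U. phi x\<in>W})"
 proof (clarify)
  fix U phi assume c: "(U, phi)\<in>charts M"
  have h: "opn M U" "open (phi ` U)"
   "homeomorphic_map (subtopology (mtop M) U) (top_of_set (phi ` U)) phi"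
   using assms c by (fastforce simp: smooth_manifold_def)+
  have tU: "topspace (subtopology (mtop M) U) = U" using h(1) by (simp add: openin_subset topspace_subtopology inf_absorb2)
  have 1: "inj_on phi U" using homeomorphic_imp_injective_map[OF h(3)] tU by simp
  have 2: "open (phi ` W)" if "opn M W" "W\<subseteq>U" for W
  proof -
   have "openin (subtopology (mtop M) U) W"
    using that h(1) by (simp add: openin_open_subtopology)
   hence "openin (top_of_set (phi ` U)) (phi ` W)"
    using homeomorphic_imp_open_map[OF h(3)] by (simp add: open_map_def)
   thus ?thesis using h(2) openin_open_eq by blast
  qed
  have 3: "opn M {x\<in>U. phi x\<in>W}" if "open W" for W
  proof -
   have "openin (top_of_set (phi ` U)) (W\<inter>phi ` U)" using that by (metis Int_commute openin_open_Int)
   hence "openin (subtopology (mtop M) U) {x\<in>topspace (subtopology (mtop M) U). phi x\<in>W\<inter>phi ` U}"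
    using homeomorphic_imp_continuous_map[OF h(3)] openin_continuous_map_preimage by blast
   moreover have "{x\<in>topspace (subtopology (mtop M) U). phi x\<in>W\<inter>phi ` U} = {x\<in>U. phi x\<in>W}"
    using tU by auto
   ultimately show ?thesis using h(1) by (simp add: openin_open_subtopology)
  qed
  show "opn M U \<and> inj_on phi U \<and> (\<forall>W. opn M W --> W\<subseteq>U --> open (phi ` W)) \<and>
   (\<forall>W. open W --> opn M {x\<in>U. phi x\<in>W})"
   using h(1) 1 2 3 by blast
 qed
qed

definition smooth_in_charts ::
 "('a, 'm::real_normed_vector) manifold => ('a => 'b) =>
 'a set\<times>('a => 'm) => 'b set\<times>('b => 'k::real_normed_vector) => 'a set => bool"
where
 "smooth_in_charts M f = (%(U, phi) (V, psi) Q. opn M Q \<and> Q\<subseteq>U \<and> f ` Q\<subseteq>V \<and>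
  smooth_on (phi ` Q) (psi\<circ>f\<circ>inv_into U phi))"

text \<open>A germ version of \<open>smooth_map\<close>. A neighbourhood that is mapped into one
  chart is demanded, so continuity near the point is built in and changes away from the point are
  harmless.\<close>

definition smooth_at ::
 "('a, 'm::real_normed_vector) manifold => ('b, 'k::real_normed_vector) manifold => ('a => 'b) => 'a => bool"
where
 "smooth_at M N f x \<longleftrightarrow> (\<exists>c\<in>charts M. \<exists>d\<in>charts N. \<exists>Q. x\<in>Q \<and> smooth_in_charts M f c d Q)"

lemma smooth_atI:
 "(U, phi)\<in>charts M ==> (V, psi)\<in>charts N ==> x\<in>Q ==>
  smooth_in_charts M f (U, phi) (V, psi) Q ==> smooth_at M N f x"
 unfolding smooth_at_def by blast

lemma smooth_in_charts_preimage:
 assumes "atlas M" "atlas N" "(U, phi)\<in>charts M" "(V, psi)\<in>charts N"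
  "smooth_in_charts M f (U, phi) (V, psi) Q" "opn N W"
 shows "opn M {z\<in>Q. f z\<in>W}"
proof -
 have Q: "opn M Q" "Q\<subseteq>U" "f ` Q\<subseteq>V" "smooth_on (phi ` Q) (psi\<circ>f\<circ>inv_into U phi)"
  using assms(5) by (auto simp: smooth_in_charts_def)
 let ?g = "psi\<circ>f\<circ>inv_into U phi"
 have "opn N (W\<inter>V)" using assms(6) atlasD(2)[OF assms(2,4)] by blast
 hence 1: "open (psi ` (W\<inter>V))" using atlasD(5)[OF assms(2,4)] by blast
 have 2: "open (phi ` Q)" using atlasD(5)[OF assms(1,3) Q(1,2)] .
 have "open (?g -` (psi ` (W\<inter>V))\<inter>phi ` Q)"
  using continuous_open_preimage[OF smooth_on_imp_continuous_on[OF Q(4)] 2 1] by (simp add: Int_commute)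
 hence "opn M {z\<in>U. phi z\<in>?g -` (psi ` (W\<inter>V))\<inter>phi ` Q}"
  by (rule atlasD(6)[OF assms(1,3)])
 moreover have "{z\<in>U. phi z\<in>?g -` (psi ` (W\<inter>V))\<inter>phi ` Q} = {z\<in>Q. f z\<in>W}"
  (is "?L = ?R")
 proof (rule Set.set_eqI, rule iffI)
  fix z assume z: "z\<in>?L"
  hence zQ: "z\<in>Q" using atlasD(4)[OF assms(1,3)] Q(2) by (auto simp: inj_on_def)
  hence "psi (f z)\<in>psi ` (W\<inter>V)" using z Q(2) by (auto simp: atlasD(8)[OF assms(1,3)])
  moreover have "f z\<in>V" using zQ Q(3) by auto
  ultimately show "z\<in>?R" using atlasD(4)[OF assms(2,4)] zQ by (auto simp: inj_on_def)
 next
  fix z assume z: "z\<in>?R"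
  thus "z\<in>?L" using Q(2,3) by (auto simp: atlasD(8)[OF assms(1,3)] subset_iff)
 qed
 ultimately show ?thesis by simp
qed

lemma smooth_in_charts_subset:
 assumes "atlas M" "smooth_in_charts M f c d Q" "opn M Q'" "Q'\<subseteq>Q"
 shows "smooth_in_charts M f c d Q'"
 using assms by (auto simp: smooth_in_charts_def split: prod.splits intro: smooth_on_mono)

text \<open>The new coordinate expression is the old one between two transition maps.\<close>

lemma smooth_in_charts_change:
 assumes M: "atlas M" and N: "atlas N" and c: "(U, phi)\<in>charts M" and d: "(V, psi)\<in>charts N"
  and c': "(U', phi1)\<in>charts M" and d': "(V', psi')\<in>charts N"
  and f: "smooth_in_charts M f (U, phi) (V, psi) Q" and sub: "Q\<subseteq>U'" "f ` Q\<subseteq>V'"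
 shows "smooth_in_charts M f (U', phi1) (V', psi') Q"
proof -
 have Q: "opn M Q" "Q\<subseteq>U" "f ` Q\<subseteq>V" "smooth_on (phi ` Q) (psi\<circ>f\<circ>inv_into U phi)"
  using f by (auto simp: smooth_in_charts_def)
 note inv = atlasD(8)[OF M c] atlasD(8)[OF M c']  atlasD(8)[OF N d]
 have o1: "open (phi1 ` Q)" by (rule atlasD(5)[OF M c' Q(1) sub(1)])
 have o2: "open (phi ` Q)" by (rule atlasD(5)[OF M c Q(1,2)])
 have o3: "open (psi ` (V\<inter>V'))"
  by (rule atlasD(5)[OF N d]) (use atlasD(2)[OF N d] atlasD(2)[OF N d'] in auto)
 have s1: "smooth_on (phi1 ` Q) (phi\<circ>inv_into U' phi1)"
  by (rule smooth_on_mono[OF atlasD(7)[OF M c' c]]) (use Q(2) sub in auto)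
 have "smooth_on (phi1 ` Q) (%y. (psi\<circ>f\<circ>inv_into U phi) ((phi\<circ>inv_into U' phi1) y))"
  by (rule smooth_on_compose[OF o1 o2 atlasD(1)[OF M] s1 Q(4)]) (use sub in "auto simp: inv subset_iff")
 hence s2: "smooth_on (phi1 ` Q) (%y. (psi'\<circ>inv_into V psi) ((psi\<circ>f\<circ>inv_into U phi) ((phi\<circ>inv_into U' phi1) y)))"
  by (rule smooth_on_compose[OF o1 o3 atlasD(1)[OF N] _ atlasD(7)[OF N d d']])
   (use sub Q in "auto simp: inv subset_iff")
 have "smooth_on (phi1 ` Q) (psi'\<circ>f\<circ>inv_into U' phi1)"
  by (rule smooth_on_cong[OF o1 _ s2]) (use sub Q in "auto simp: inv subset_iff image_subset_iff")
 thus ?thesis using Q sub by (simp add: smooth_in_charts_def)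
qed

text \<open>Frees the notion from the charts hidden in its existential quantifiers: any charts
  around \<open>x\<close> and \<open>f x\<close> will do.\<close>

lemma smooth_atE:
 assumes "smooth_at M N f x" "atlas M" "atlas N"
  "(U, phi)\<in>charts M" "x\<in>U" "(V, psi)\<in>charts N" "f x\<in>V"
 obtains Q where "x\<in>Q" "smooth_in_charts M f (U, phi) (V, psi) Q"
proof -
 obtain U' phi1 V' psi' Q where *: "(U', phi1)\<in>charts M" "(V', psi')\<in>charts N" "x\<in>Q"
  "smooth_in_charts M f (U', phi1) (V', psi') Q"
  using assms(1) by (auto simp: smooth_at_def)
 let ?Q = "{z\<in>Q. f z\<in>V}\<inter>U"
 have o: "opn M ?Q"
  using smooth_in_charts_preimage[OF assms(2,3) *(1,2,4) atlasD(2)[OF assms(3,6)]]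
   atlasD(2)[OF assms(2,4)] by blast
 have "smooth_in_charts M f (U', phi1) (V', psi') ?Q"
  by (rule smooth_in_charts_subset[OF assms(2) *(4) o]) auto
 from smooth_in_charts_change[OF assms(2,3) *(1,2) assms(4,6) this]
 have "smooth_in_charts M f (U, phi) (V, psi) ?Q" by auto
 thus ?thesis by (rule that[rotated]) (use * assms in auto)
qed

lemma smooth_at_points:
 assumes "smooth_at M N f x" "atlas M" "atlas N"
 shows "x\<in>points M" "f x\<in>points N"
 using assms(1) atlasD(3)[OF assms(2)] atlasD(3)[OF assms(3)]
 unfolding smooth_at_def smooth_in_charts_def by fastforce+

lemma smooth_at_nhd:
 assumes "smooth_at M N f x" "atlas M" "atlas N" "opn N W" "f x\<in>W"
 obtains Q where "opn M Q" "x\<in>Q" "f ` Q\<subseteq>W" "!!z. z\<in>Q ==> smooth_at M N f z"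
proof -
 obtain U phi V psi Q where *: "(U, phi)\<in>charts M" "(V, psi)\<in>charts N" "x\<in>Q"
  "smooth_in_charts M f (U, phi) (V, psi) Q"
  using assms(1) by (auto simp: smooth_at_def)
 have 1: "opn M {z\<in>Q. f z\<in>W}"
  by (rule smooth_in_charts_preimage[OF assms(2,3) *(1,2,4) assms(4)])
 have 2: "smooth_at M N f z" if "z\<in>Q" for z using * that by (auto simp: smooth_at_def)
 show ?thesis by (rule that[OF 1]) (use * assms(5) 2 in auto)
qed

lemma smooth_at_cong:
 assumes "smooth_at M N f x" "atlas M" "opn M W" "x\<in>W" "!!z. z\<in>W ==> f z = g z"
 shows "smooth_at M N g x"
proof -
 obtain U phi V psi Q where *: "(U, phi)\<in>charts M" "(V, psi)\<in>charts N" "x\<in>Q"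
  "smooth_in_charts M f (U, phi) (V, psi) Q"
  using assms(1) by (auto simp: smooth_at_def)
 have oQ: "opn M (Q\<inter>W)" using *(4) assms(3) by (auto simp: smooth_in_charts_def)
 have s: "smooth_in_charts M f (U, phi) (V, psi) (Q\<inter>W)"
  by (rule smooth_in_charts_subset[OF assms(2) *(4) oQ]) auto
 have sub: "Q\<inter>W\<subseteq>U" using s by (simp add: smooth_in_charts_def)
 have o: "open (phi ` (Q\<inter>W))"
  by (rule atlasD(5)[OF assms(2) *(1) oQ sub])
 have "smooth_on (phi ` (Q\<inter>W)) (psi\<circ>g\<circ>inv_into U phi)"
  by (rule smooth_on_cong[OF o, of "psi\<circ>f\<circ>inv_into U phi"])
   (use s sub assms(5) in "auto simp: smooth_in_charts_def atlasD(8)[OF assms(2) *(1)] subset_iff")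
 moreover have "g ` (Q\<inter>W)\<subseteq>V" using s assms(5) by (force simp: smooth_in_charts_def)
 ultimately have "smooth_in_charts M g (U, phi) (V, psi) (Q\<inter>W)" using s by (simp add: smooth_in_charts_def)
 thus ?thesis by (rule smooth_atI[OF *(1,2), rotated]) (use * assms(4) in simp)
qed

lemma smooth_map_iff:
 assumes M: "atlas M" and N: "atlas N"
 shows "smooth_map M N f \<longleftrightarrow> (\<forall>x\<in>points M. f x\<in>points N \<and> smooth_at M N f x)"
proof
 assume f: "smooth_map M N f"
 show "\<forall>x\<in>points M. f x\<in>points N \<and> smooth_at M N f x"
 proof
  fix x assume x: "x\<in>points M"
  have cf: "continuous_map (mtop M) (mtop N) f" using f by (simp add: smooth_map_def)
  hence fx: "f x\<in>points N" using x continuous_map_image_subset_topspace by blast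
  obtain U phi where U: "(U, phi)\<in>charts M" "x\<in>U" using atlas_chart[OF M x] .
  obtain V psi where V: "(V, psi)\<in>charts N" "f x\<in>V" using atlas_chart[OF N fx] .
  have "{x\<in>U. f x\<in>V} = U\<inter>{x\<in>points M. f x\<in>V}" using atlasD(3)[OF M U(1)] by auto
  hence "opn M {x\<in>U. f x\<in>V}"
   using openin_continuous_map_preimage[OF cf atlasD(2)[OF N V(1)]] atlasD(2)[OF M U(1)] by auto
  moreover have "smooth_on (phi ` {x\<in>U. f x\<in>V}) (psi\<circ>f\<circ>inv_into U phi)"
   using f U(1) V(1) unfolding smooth_map_def by blast
  ultimately have "smooth_in_charts M f (U, phi) (V, psi) {x\<in>U. f x\<in>V}"
   by (auto simp: smooth_in_charts_def)
  hence "smooth_at M N f x" by (rule smooth_atI[OF U(1) V(1), rotated]) (use U V in simp)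
  thus "f x\<in>points N \<and> smooth_at M N f x" using fx by simp
 qed
next
 assume f: "\<forall>x\<in>points M. f x\<in>points N \<and> smooth_at M N f x"
 have "opn M {x\<in>points M. f x\<in>W}" if W: "opn N W" for W
 proof (subst openin_subopen, clarify)
  fix x assume x: "x\<in>points M" "f x\<in>W"
  obtain Q where Q: "opn M Q" "x\<in>Q" "f ` Q\<subseteq>W"
   using smooth_at_nhd[OF bspec[OF f x(1), THEN conjunct2] M N W x(2)] by metis
  thus "\<exists>T. opn M T \<and> x\<in>T \<and> T\<subseteq>{x\<in>points M. f x\<in>W}"
   using openin_subset[OF Q(1)] by (intro exI[of _ Q]) auto
 qed
 moreover have "smooth_on (phi ` {x\<in>U. f x\<in>V}) (psi\<circ>f\<circ>inv_into U phi)"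
  if U: "(U, phi)\<in>charts M" and V: "(V, psi)\<in>charts N" for U phi V psi
 proof (rule smooth_on_union, clarify)
  fix x assume x: "x\<in>U" "f x\<in>V"
  hence fx: "smooth_at M N f x" using f atlasD(3)[OF M U] by auto
  obtain Q where Q: "x\<in>Q" "smooth_in_charts M f (U, phi) (V, psi) Q"
   using smooth_atE[OF fx M N U x(1) V x(2)] by metis
  thus "\<exists>T. open T \<and> phi x\<in>T \<and> smooth_on T (psi\<circ>f\<circ>inv_into U phi)"
   using atlasD(5)[OF M U, of Q] by (intro exI[of _ "phi ` Q"]) (auto simp: smooth_in_charts_def)
 qed
 ultimately show "smooth_map M N f"
  using f unfolding smooth_map_def continuous_map_def by fast
qed

lemma smooth_at_compose:
 assumes M: "atlas M" and N: "atlas N" and P: "atlas P"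
  and f: "smooth_at M N f x" and g: "smooth_at N P g (f x)"
 shows "smooth_at M P (%z. g (f z)) x"
proof -
 obtain U phi V psi Q where *: "(U, phi)\<in>charts M" "(V, psi)\<in>charts N" "x\<in>Q"
  "smooth_in_charts M f (U, phi) (V, psi) Q"
  using f by (auto simp: smooth_at_def)
 have fx: "f x\<in>V" using * by (auto simp: smooth_in_charts_def)
 obtain W omega where W: "(W, omega)\<in>charts P" "g (f x)\<in>W"
  using atlas_chart[OF P smooth_at_points(2)[OF g N P]] by metis
 obtain Q' where Q': "f x\<in>Q'" "smooth_in_charts N g (V, psi) (W, omega) Q'"
  using smooth_atE[OF g N P *(2) fx W] .
 have Q'': "opn N Q'" "Q'\<subseteq>V" "g ` Q'\<subseteq>W" "smooth_on (psi ` Q') (omega\<circ>g\<circ>inv_into V psi)"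
  using Q'(2) by (auto simp: smooth_in_charts_def)
 let ?Q = "{z\<in>Q. f z\<in>Q'}"
 have o: "opn M ?Q" by (rule smooth_in_charts_preimage[OF M N *(1,2,4) Q''(1)])
 have s: "smooth_in_charts M f (U, phi) (V, psi) ?Q" by (rule smooth_in_charts_subset[OF M *(4) o]) auto
 hence Q: "?Q\<subseteq>U" "smooth_on (phi ` ?Q) (psi\<circ>f\<circ>inv_into U phi)" by (auto simp: smooth_in_charts_def)
 have o1: "open (phi ` ?Q)" by (rule atlasD(5)[OF M *(1) o Q(1)])
 have o2: "open (psi ` Q')" by (rule atlasD(5)[OF N *(2) Q''(1,2)])
 have c: "smooth_on (phi ` ?Q) (%y. (omega\<circ>g\<circ>inv_into V psi) ((psi\<circ>f\<circ>inv_into U phi) y))"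
  by (rule smooth_on_compose[OF o1 o2 atlasD(1)[OF N] Q(2) Q''(4)])
   (use Q(1) in "auto simp: atlasD(8)[OF M *(1)] subset_iff")
 have "smooth_on (phi ` ?Q) (omega\<circ>(%z. g (f z))\<circ>inv_into U phi)"
  by (rule smooth_on_cong[OF o1 _ c])
   (use Q(1) Q''(2) in "auto simp: atlasD(8)[OF M *(1)] atlasD(8)[OF N *(2)] subset_iff")
 hence "smooth_in_charts M (%z. g (f z)) (U, phi) (W, omega) ?Q"
  using o Q(1) Q''(3) by (auto simp: smooth_in_charts_def)
 thus ?thesis by (rule smooth_atI[OF *(1) W(1), rotated]) (use * Q'(1) in simp)
qed

section \<open>Smooth functions\<close>

lemma smooth_mapD:
 "smooth_map M N f ==> (U, phi)\<in>charts M ==> (V, psi)\<in>charts N ==>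
  smooth_on (phi ` {x\<in>U. f x\<in>V}) (psi\<circ>f\<circ>inv_into U phi)"
 unfolding smooth_map_def by fast

lemma smooth_at_id:
 assumes M: "atlas M" and x: "x\<in>points M" shows "smooth_at M M (%z. z) x"
proof -
 obtain V phi where c: "(V, phi)\<in>charts M" "x\<in>V" using atlas_chart[OF M x] .
 have o: "open (phi ` V)" by (rule atlasD(5)[OF M c(1) atlasD(2)[OF M c(1)]]) simp
 have "smooth_on (phi ` V) (phi\<circ>(%z. z)\<circ>inv_into V phi)"
  by (rule smooth_on_cong[OF o _ smooth_on_id[OF o]]) (auto simp: atlasD(8)[OF M c(1)])
 thus ?thesis by (intro smooth_atI[OF c(1) c(1) c(2)]) (use atlasD(2)[OF M c(1)] in "auto simp: smooth_in_charts_def")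
qed

lemma atlas_model_manifold:
 "fin_dim TYPE('v::real_normed_vector) ==> atlas (model_manifold :: ('v, 'v) manifold)"
 by (auto simp: atlas_def model_manifold_def intro: smooth_on_id[OF open_UNIV, unfolded id_def[symmetric]])

lemma atlas_model_euclidean [simp]: "atlas (model_manifold :: ('v::euclidean_space, 'v) manifold)"
 by (rule atlas_model_manifold[OF fin_dim_euclidean])

lemma points_model_manifold [simp]: "points model_manifold = UNIV"
 by (simp add: model_manifold_def)

abbreviation smooth_fun :: "('a, 'm::real_normed_vector) manifold => ('a => 'v::real_normed_vector) => 'a => bool" where
 "smooth_fun M u x \<equiv> smooth_at M model_manifold u x"

lemma smooth_fun_iff:
 assumes M: "atlas M" and v: "fin_dim TYPE('v::real_normed_vector)" and U: "(U, phi)\<in>charts M" "x\<in>U"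
 shows "smooth_fun M (u :: 'a => 'v::real_normed_vector) x \<longleftrightarrow>
  (\<exists>Q. opn M Q \<and> x\<in>Q \<and> Q\<subseteq>U \<and> smooth_on (phi ` Q) (u\<circ>inv_into U phi))"
proof
 have c: "(UNIV, id)\<in>charts (model_manifold :: ('v, 'v) manifold)" by (simp add: model_manifold_def)
 {
  assume "smooth_fun M u x"
  then obtain Q where "x\<in>Q" "smooth_in_charts M u (U, phi) (UNIV, id) Q"
   using smooth_atE[OF _ M atlas_model_manifold[OF v] U c] by blast
  thus "\<exists>Q. opn M Q \<and> x\<in>Q \<and> Q\<subseteq>U \<and> smooth_on (phi ` Q) (u\<circ>inv_into U phi)"
   by (auto simp: smooth_in_charts_def)
 }
 {
  assume "\<exists>Q. opn M Q \<and> x\<in>Q \<and> Q\<subseteq>U \<and> smooth_on (phi ` Q) (u\<circ>inv_into U phi)"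
  then obtain Q where "opn M Q" "x\<in>Q" "Q\<subseteq>U" "smooth_on (phi ` Q) (u\<circ>inv_into U phi)" by blast
  thus "smooth_fun M u x"
   by (intro smooth_atI[OF U(1) c, of x Q]) (auto simp: smooth_in_charts_def)
 }
qed

text \<open>One template for binary operations on germs: both arguments are read in the same chart
  of \<open>M\<close> and combined there.\<close>

lemma smooth_fun_lift2:
 assumes M: "atlas M" and v: "fin_dim TYPE('v::real_normed_vector)"
  and w: "fin_dim TYPE('w::real_normed_vector)" and r: "fin_dim TYPE('r::real_normed_vector)"
  and h: "!!S (f :: 'm => 'v) g. open S ==> smooth_on S f ==> smooth_on S g ==> smooth_on S (%y. h (f y) (g y))"
  and f: "smooth_fun (M :: ('a, 'm::real_normed_vector) manifold) (f :: 'a => 'v::real_normed_vector) x"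
  and g: "smooth_fun M (g :: 'a => 'w::real_normed_vector) x"
 shows "smooth_fun M (%z. h (f z) (g z) :: 'r::real_normed_vector) x"
proof -
 obtain U phi where U: "(U, phi)\<in>charts M" "x\<in>U"
  using atlas_chart[OF M smooth_at_points(1)[OF f M atlas_model_manifold[OF v]]] .
 obtain Q where Q: "opn M Q" "x\<in>Q" "Q\<subseteq>U" "smooth_on (phi ` Q) (f\<circ>inv_into U phi)"
  using smooth_fun_iff[OF M v U] f by blast
 obtain Q' where Q': "opn M Q'" "x\<in>Q'" "Q'\<subseteq>U" "smooth_on (phi ` Q') (g\<circ>inv_into U phi)"
  using smooth_fun_iff[OF M w U] g by blast
 have o: "open (phi ` (Q\<inter>Q'))" by (rule atlasD(5)[OF M U(1)]) (use Q Q' in auto)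
 have "smooth_on (phi ` (Q\<inter>Q')) (%y. h ((f\<circ>inv_into U phi) y) ((g\<circ>inv_into U phi) y))"
  using h[OF o smooth_on_mono[OF Q(4)] smooth_on_mono[OF Q'(4)]] by blast
 hence "smooth_on (phi ` (Q\<inter>Q')) ((%z. h (f z) (g z))\<circ>inv_into U phi)" by (simp add: o_def)
 thus ?thesis using smooth_fun_iff[OF M r U, of "%z. h (f z) (g z)"] Q Q' by blast
qed

lemma smooth_fun_const:
 assumes "atlas M" "x\<in>points M" shows "smooth_fun M (%z. c) x"
proof -
 obtain U phi where U: "(U, phi)\<in>charts M" "x\<in>U" using atlas_chart[OF assms] .
 have c: "(UNIV, id)\<in>charts (model_manifold :: ('v::real_normed_vector, 'v) manifold)" by (simp add: model_manifold_def)
 show ?thesis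
  by (rule smooth_atI[OF U(1) c U(2)])
   (use atlasD(2)[OF assms(1) U(1)] in "auto simp: smooth_in_charts_def o_def smooth_on_const")
qed

lemma smooth_fun_bilinear:
 assumes "atlas M" "fin_dim TYPE('v::real_normed_vector)" "fin_dim TYPE('w::real_normed_vector)"
  "fin_dim TYPE('r::real_normed_vector)"
  "bounded_bilinear (h :: 'v::real_normed_vector => 'w::real_normed_vector => 'r::real_normed_vector)"
  "smooth_fun M f x" "smooth_fun M g x"
 shows "smooth_fun M (%z. h (f z) (g z)) x"
 by (rule smooth_fun_lift2[OF assms(1-4) _ assms(6,7)]) (rule smooth_on_bilinear[OF _ assms(5)])

lemma smooth_fun_add:
 assumes "atlas M" "smooth_fun M (f :: 'a => 'v::euclidean_space) x" "smooth_fun M g x"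
 shows "smooth_fun M (%z. f z + g z) x"
 by (rule smooth_fun_lift2[OF assms(1) _ _ _ _ assms(2,3)])
  (auto intro: fin_dim_euclidean smooth_on_add)

lemma smooth_fun_scaleR:
 assumes "atlas M" "smooth_fun M f x" "smooth_fun M (g :: 'a => 'v::euclidean_space) x"
 shows "smooth_fun M (%z. f z *R g z) x"
 by (rule smooth_fun_bilinear[OF assms(1) _ _ _ bounded_bilinear_scaleR assms(2,3)])
  (auto intro: fin_dim_euclidean)

lemma smooth_fun_mult:
 assumes "atlas M" "smooth_fun M f x" "smooth_fun M (g :: 'a => real) x"
 shows "smooth_fun M (%z. f z * g z) x"
 using smooth_fun_scaleR[OF assms] by simp

lemma smooth_fun_compose:
 assumes M: "atlas M" and v: "fin_dim TYPE('v::real_normed_vector)"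
  and f: "smooth_fun M (f :: 'a => 'v::real_normed_vector) x" and W: "open W" "f x\<in>W" "smooth_on W (g :: 'v => 'r)"
  and r: "fin_dim TYPE('r::real_normed_vector)"
 shows "smooth_fun M (%z. g (f z)) x"
proof -
 have c: "(UNIV, id)\<in>charts (model_manifold :: ('v, 'v) manifold)"
   "(UNIV, id)\<in>charts (model_manifold :: ('r, 'r) manifold)" by (simp_all add: model_manifold_def)
 have "inv_into UNIV id = (id :: 'v => 'v)" by (simp add: inv_id)
 hence "smooth_fun model_manifold g (f x)"
  by (intro smooth_atI[OF c, of _ W]) (use W in "auto simp: smooth_in_charts_def model_manifold_def")
 thus ?thesis
  using smooth_at_compose[OF M atlas_model_manifold[OF v] atlas_model_manifold[OF r] f] by blast
qed

lemma smooth_fun_linear: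
 assumes "atlas M" "smooth_fun M (f :: 'a => 'v::euclidean_space) x" "bounded_linear (L :: 'v => 'w::euclidean_space)"
 shows "smooth_fun M (%z. L (f z)) x"
 by (rule smooth_fun_compose[OF assms(1) fin_dim_euclidean assms(2) open_UNIV UNIV_I
    smooth_on_bounded_linear[OF open_UNIV assms(3)] fin_dim_euclidean])

lemma smooth_fun_minus:
 assumes "atlas M" "smooth_fun M (f :: 'a => 'v::euclidean_space) x" "smooth_fun M g x"
 shows "smooth_fun M (%z. f z - g z) x"
proof -
 have "smooth_fun M (%z. - g z) x"
  using smooth_fun_linear[OF assms(1,3), of uminus] by (simp add: bounded_linear_minus bounded_linear_ident)
 thus ?thesis using smooth_fun_add[OF assms(1,2)] by fastforce
qed

lemma smooth_fun_inverse:
 assumes "atlas M" "smooth_fun M f x" "f x ~= 0"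
 shows "smooth_fun M (%z. inverse (f z :: real)) x"
 by (rule smooth_fun_compose[OF assms(1) fin_dim_euclidean assms(2) _ _ smooth_on_inverse fin_dim_euclidean])
  (use assms in auto)

lemma smooth_fun_sum:
 assumes "atlas M" "x\<in>points M" "!!i. i\<in>I ==> smooth_fun M (f i :: 'a => 'v::euclidean_space) x"
 shows "smooth_fun M (%z. \<Sum>i\<in>I. f i z) x"
 using assms(3)
 by (induction I rule: infinite_finite_induct)
  (auto intro: smooth_fun_const[OF assms(1,2)] smooth_fun_add[OF assms(1)])

lemma smooth_fun_prod:
 assumes "atlas M" "x\<in>points M" "!!i. i\<in>I ==> smooth_fun M (f i :: 'a => real) x"
 shows "smooth_fun M (%z. \<Prod>i\<in>I. f i z) x"
 using assms(3)
 by (induction I rule: infinite_finite_induct)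
  (auto intro: smooth_fun_const[OF assms(1,2)] smooth_fun_mult[OF assms(1)])

lemma smooth_fun_chart:
 assumes "atlas M" "(U, phi)\<in>charts M" "x\<in>U"
 shows "smooth_fun M phi x"
proof -
 have o: "open (phi ` U)" using atlasD(5)[OF assms(1,2) atlasD(2)[OF assms(1,2)]] by simp
 have s: "smooth_on (phi ` U) (phi\<circ>inv_into U phi)"
  by (rule smooth_on_cong[OF o _ smooth_on_id[OF o]]) (auto simp: f_inv_into_f)
 thus ?thesis
  unfolding smooth_fun_iff[OF assms(1) atlasD(1)[OF assms(1)] assms(2,3), of phi]
  using atlasD(2)[OF assms(1,2)] assms(3) by (intro exI[of _ U]) simp
qed

lemma smooth_functions_iff:
 assumes "atlas M" shows "u\<in>Cinf M \<longleftrightarrow> (\<forall>x\<in>points M. smooth_fun M u x)"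
 using smooth_map_iff[OF assms atlas_model_euclidean, of u] by (auto simp: smooth_functions_def)

lemma smooth_at_imp_openin:
 assumes M: "atlas M" and U: "opn M U" and v: "fin_dim TYPE('v::real_normed_vector)"
  and f: "!!x. x\<in>U ==> smooth_fun M (f :: 'a => 'v::real_normed_vector) x" and W: "open W"
 shows "opn M {x\<in>U. f x\<in>W}"
proof (subst openin_subopen, clarify)
 fix x assume x: "x\<in>U" "f x\<in>W"
 have oW: "opn model_manifold W" using W by (simp add: model_manifold_def)
 obtain Q where "opn M Q" "x\<in>Q" "f ` Q\<subseteq>W"
  using smooth_at_nhd[OF f[OF x(1)] M atlas_model_manifold[OF v] oW x(2)] by metis
 thus "\<exists>T. opn M T \<and> x\<in>T \<and> T\<subseteq>{x\<in>U. f x\<in>W}"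
  using U x(1) by (intro exI[of _ "Q\<inter>U"]) auto
qed

section \<open>Bump functions and partitions of unity\<close>

text \<open>The polynomial in \<open>1/t\<close> makes the family closed under differentiation, with
  \<open>p\<close> replaced by X^2 (p - p'). Smoothness of exp(-1/t), extended by 0, is then a
  single induction over all \<open>p\<close>.\<close>

definition flat_exp :: "real poly => real => real" where
 "flat_exp p t = (if t > 0 then poly p (1 / t) * exp (- (1 / t)) else 0)"

lemma poly_exp_tendsto_0: "((%x. poly p x * exp (- x)) \<longlongrightarrow> (0::real)) at_top"
proof -
 have "((%x. \<Sum>i\<le>Polynomial.degree p. poly.coeff p i * (x ^ i / exp x)) \<longlongrightarrow> (\<Sum>i\<le>Polynomial.degree p. poly.coeff p i * 0)) at_top"
  by (intro tendsto_sum tendsto_mult tendsto_const tendsto_power_div_exp_0)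
 moreover have "(%x. \<Sum>i\<le>Polynomial.degree p. poly.coeff p i * (x ^ i / exp x)) = (%x. poly p x * exp (- x))"
  by (auto simp: poly_altdef sum_distrib_right exp_minus divide_inverse mult.assoc)
 ultimately show ?thesis by simp
qed

lemma flat_exp_deriv:
 "(flat_exp p has_field_derivative flat_exp ([:0, 0, 1:] * (p - pderiv p)) t) (at t)"
proof -
 consider "t < 0" | "t = 0" | "t > 0" by linarith
 thus ?thesis
 proof cases
  case 1
  have "((%x. 0) has_field_derivative 0) (at t)" by simp
  hence "(flat_exp p has_field_derivative 0) (at t)"
   by (rule has_field_derivative_transform_within_open[where S = "{..<0}"])
    (use 1 in "auto simp: flat_exp_def")
  thus ?thesis using 1 by (simp add: flat_exp_def)
 next
  case 2
  \<comment> \<open>At 0 the difference quotient is treated from each side. On the right, x = 1/h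
    turns it into a polynomial times exp(-x) at infinity.\<close>
  have L: "((%h. flat_exp p h / h) \<longlongrightarrow> 0) (at_left 0)"
  proof (rule tendsto_eventually)
   show "\<forall>\<^sub>F h in at_left 0. flat_exp p h / h = 0"
    by (auto simp: eventually_at_left_field flat_exp_def intro: exI[of _ "-1"])
  qed
  have "((%h. poly ([:0, 1:] * p) (inverse h) * exp (- inverse h)) \<longlongrightarrow> 0) (at_right 0)"
   using filterlim_compose[OF poly_exp_tendsto_0 filterlim_inverse_at_top_right] .
  hence R: "((%h. flat_exp p h / h) \<longlongrightarrow> 0) (at_right 0)"
   by (rule Lim_transform_eventually)
    (auto simp: eventually_at_right_field flat_exp_def divide_inverse intro: exI[of _ 1])
  have "((%h. flat_exp p h / h) \<longlongrightarrow> 0) (at 0)" using L R by (simp add: filterlim_at_split)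
  hence "(flat_exp p has_field_derivative 0) (at 0)" by (simp add: DERIV_def flat_exp_def[of _ 0])
  thus ?thesis using 2 by (simp add: flat_exp_def[of _ 0])
 next
  case 3
  have "((%t. poly p (1 / t) * exp (- (1 / t))) has_field_derivative
    (poly (pderiv p) (1 / t) * (- 1 / t\<^sup>2) * exp (- (1 / t)) + poly p (1 / t) * (exp (- (1 / t)) * (1 / t\<^sup>2)))) (at t)"
   using 3 by (auto intro!: derivative_eq_intros DERIV_chain'[of "%t. 1 / t" _ _ _ "poly p"] poly_DERIV simp: power2_eq_square)
  hence "(flat_exp p has_field_derivative
    (poly (pderiv p) (1 / t) * (- 1 / t\<^sup>2) * exp (- (1 / t)) + poly p (1 / t) * (exp (- (1 / t)) * (1 / t\<^sup>2)))) (at t)"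
   by (rule has_field_derivative_transform_within_open[where S = "{0<..}"])
    (use 3 in "auto simp: flat_exp_def")
  moreover have "poly (pderiv p) (1 / t) * (- 1 / t\<^sup>2) * exp (- (1 / t)) + poly p (1 / t) * (exp (- (1 / t)) * (1 / t\<^sup>2))
    = flat_exp ([:0, 0, 1:] * (p - pderiv p)) t"
   using 3 by (simp add: flat_exp_def power2_eq_square field_simps)
  ultimately show ?thesis by simp
 qed
qed

lemma smooth_on_flat_exp: "smooth_on UNIV (flat_exp p)"
proof -
 have "Ck_on k UNIV (flat_exp p)" for k
 proof (induction k arbitrary: p)
  case 0
  show ?case using flat_exp_deriv DERIV_isCont
   by (simp add: continuous_on_eq_continuous_at) blast
 next
  case (Suc k)
  show ?case
  proof (rule Ck_on_SucI[OF open_UNIV])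
   show "(flat_exp p has_derivative (%v. flat_exp ([:0, 0, 1:] * (p - pderiv p)) t * v)) (at t)" for t
    using flat_exp_deriv[of p t] unfolding has_field_derivative_def .
   show "Ck_on k UNIV (%t. flat_exp ([:0, 0, 1:] * (p - pderiv p)) t * v)" for v
    by (intro Ck_on_bilinear[OF open_UNIV bounded_bilinear_mult] Ck_on_const Suc)
  qed
 qed
 thus ?thesis by (simp add: smooth_on_def)
qed

text \<open>The classical quotient h(2 - t) / (h(2 - t) + h(t - 1)) for h(t) = exp(-1/t) extended by
  0; the two summands never vanish together.\<close>

lemma smooth_step_exists:
 obtains H :: "real => real"
 where "smooth_on UNIV H" "!!t. 0\<le>H t" "!!t. H t\<le>1" "!!t. t\<le>1 ==> H t = 1" "!!t. 2\<le>t ==> H t = 0"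
proof -
 define h where "h = flat_exp 1"
 have h: "h t\<ge>0" "t > 0 ==> h t > 0" "t\<le>0 ==> h t = 0" for t
  by (auto simp: h_def flat_exp_def)
 have pos: "h (2 - t) + h (t - 1) > 0" for t
  using h(1)[of "2 - t"] h(1)[of "t - 1"] h(2)[of "2 - t"] h(2)[of "t - 1"] by (cases "t < 2") auto
 have aff: "smooth_on UNIV (%t. a + b * t)" for a b :: real
  by (intro smooth_on_add smooth_on_const smooth_on_bounded_linear bounded_linear_mult_right) auto
 have s: "smooth_on UNIV (%t. h (a + b * t))" for a b :: real
  by (rule smooth_on_compose[OF open_UNIV open_UNIV fin_dim_euclidean aff smooth_on_flat_exp[of 1, folded h_def]]) simp
 have s1: "smooth_on UNIV (%t. h (2 - t))" and s2: "smooth_on UNIV (%t. h (t - 1))"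
  using s[of 2 "-1"] s[of "-1" 1] by simp_all
 have s3: "smooth_on UNIV (%t. inverse (h (2 - t) + h (t - 1)))"
  by (rule smooth_on_compose[OF open_UNIV _ fin_dim_euclidean smooth_on_add[OF open_UNIV s1 s2] smooth_on_inverse])
   (use pos in "auto simp: less_le")
 have "smooth_on UNIV (%t. h (2 - t) * inverse (h (2 - t) + h (t - 1)))"
  by (rule smooth_on_bilinear[OF open_UNIV bounded_bilinear_mult s1 s3])
 moreover have "h (2 - t) * inverse (h (2 - t) + h (t - 1))\<le>1" for t
  using pos[of t] h(1)[of "t - 1"] by (simp add: field_simps)
 moreover have "0\<le>h (2 - t) * inverse (h (2 - t) + h (t - 1))" for t
  using pos[of t] h(1)[of "2 - t"] by simp
 ultimately show ?thesis using pos h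
  by (intro that[of "%t. h (2 - t) * inverse (h (2 - t) + h (t - 1))"]) (auto simp: less_le)
qed

definition bump :: "('a, 'm::real_normed_vector) manifold => 'a set => 'a => ('a => real) => 'a set => 'a set => bool" where
 "bump M W p b V K \<longleftrightarrow> b\<in>Cinf M \<and> (\<forall>x. 0\<le>b x \<and> b x\<le>1 \<and> (x\<notin>K --> b x = 0)) \<and>
  opn M V \<and> p\<in>V \<and> (\<forall>x\<in>V. b x = 1) \<and> compactin (mtop M) K \<and> K\<subseteq>W \<and> V\<subseteq>K"

text \<open>A norm need not be smooth off 0, so the bump is a step function of the sum of squares
  \<open>q\<close> of coordinates; a suitable scale fits the compact sublevel set into the given
  neighbourhood.\<close>

lemma bump_function:
 assumes M: "smooth_manifold (M :: ('a, 'm::real_normed_vector) manifold)" and W: "opn M W" "p\<in>W"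
 obtains b V K where "bump M W p b V K"
proof -
 have A: "atlas M" by (rule manifold_atlas[OF M])
 have "p\<in>points M" using W openin_subset by blast
 then obtain U phi where U: "(U, phi)\<in>charts M" "p\<in>U" by (rule atlas_chart[OF A])
 define G where "G = phi ` (U\<inter>W)"
 have oG: "open G" unfolding G_def by (rule atlasD(5)[OF A U(1)]) (use atlasD(2)[OF A U(1)] W in auto)
 have "phi p\<in>G" using U W by (auto simp: G_def)
 then obtain r where r: "r > 0" "ball (phi p) r\<subseteq>G" using oG open_contains_ball by blast
 obtain B :: "'m set" and c where Bc: "coordinate_system B c"
  using coordinate_system_exists[OF atlasD(1)[OF A]] .
 have fB: "finite B" and bl: "bounded_linear (c b)" and rep: "(\<Sum>b\<in>B. c b y *R b) = y" for b y
  using Bc by (auto simp: coordinate_system_def)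
 define N where "N = (\<Sum>b\<in>B. norm b)"
 have N: "N\<ge>0" by (auto simp: N_def sum_nonneg)
 \<comment> \<open>With this scale \<open>q y \<le> 2\<close> bounds every coordinate by
   \<open>2 * s\<close>, hence the distance to \<open>phi p\<close> by \<open>2 * s * N\<close>,
   which is below \<open>r\<close>.\<close>
 define s where "s = r / (2 * (1 + N))"
 have s: "s > 0" using r N by (simp add: s_def)
 define q where "q = (%y. \<Sum>b\<in>B. (c b (y - phi p) / s)\<^sup>2)"
 have coord: "\<bar>c b (y - phi p)\<bar>\<le>2 * s" if "q y\<le>2" "b\<in>B" for y b
 proof -
  have "(c b (y - phi p) / s)\<^sup>2\<le>q y" unfolding q_def by (rule member_le_sum) (use that fB in auto)
  hence "(c b (y - phi p) / s)\<^sup>2\<le>2\<^sup>2" using that by simp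
  hence "\<bar>c b (y - phi p) / s\<bar>\<le>2" by (metis abs_le_square_iff abs_numeral)
  thus ?thesis using s by (simp add: field_simps)
 qed
 define K' where "K' = {y. q y\<le>2}"
 have K'G: "K'\<subseteq>G"
 proof
  fix y assume y: "y\<in>K'"
  have "norm (y - phi p) = norm (\<Sum>b\<in>B. c b (y - phi p) *R b)" by (simp add: rep)
  also have "\<dots>\<le>(\<Sum>b\<in>B. \<bar>c b (y - phi p)\<bar> * norm b)" by (rule order_trans[OF norm_sum]) simp
  also have "\<dots>\<le>(\<Sum>b\<in>B. 2 * s * norm b)"
   by (intro sum_mono mult_right_mono coord) (use y in "auto simp: K'_def")
  also have "\<dots> = 2 * s * N" by (simp add: N_def sum_distrib_left)
  also have "\<dots> < r" using r N by (simp add: s_def field_simps)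
  finally show "y\<in>G" using r by (auto simp: dist_norm norm_minus_commute)
 qed
 have sq: "smooth_on UNIV q"
  unfolding q_def power2_eq_square divide_inverse
  by (intro smooth_on_sum smooth_on_bilinear[OF _ bounded_bilinear_mult] smooth_on_const
    smooth_on_linear_compose[OF _ bl] smooth_on_add[where g = "%x. - phi p", simplified] smooth_on_id open_UNIV)
 have cq: "continuous_on UNIV q" by (rule smooth_on_imp_continuous_on[OF sq])
 have clK: "closed K'" unfolding K'_def by (rule closed_Collect_le) (auto intro: cq)
 have cc: "continuous_on S (%f. f b)" for b :: 'm and S :: "('m => real) set"
  by (rule continuous_on_subset[OF continuous_on_product_coordinates]) simp
 \<comment> \<open>Compactness of \<open>K'\<close> comes from the coefficient box:
   \<open>K'\<close> is a closed subset of its continuous image.\<close>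
 let ?box = "{f :: 'm => real. \<forall>b. \<bar>f b\<bar>\<le>(if b\<in>B then 2 * s else 0)}"
 have cimg: "compact ((%f. phi p + (\<Sum>b\<in>B. f b *R b)) ` ?box)"
  by (intro compact_continuous_image compact_coefficient_box continuous_intros cc)
 have "K'\<subseteq>(%f. phi p + (\<Sum>b\<in>B. f b *R b)) ` ?box"
 proof
  fix y assume y: "y\<in>K'"
  let ?f = "%b. if b\<in>B then c b (y - phi p) else 0"
  have "(\<Sum>b\<in>B. ?f b *R b) = y - phi p" using rep[of "y - phi p"] by (simp cong: sum.cong)
  moreover have "?f\<in>?box" using coord y by (auto simp: K'_def)
  ultimately show "y\<in>(%f. phi p + (\<Sum>b\<in>B. f b *R b)) ` ?box" by (intro image_eqI[of _ _ ?f]) simp_all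
 qed
 hence cK': "compact K'" using compact_Int_closed[OF cimg clK] by (simp add: inf.absorb2)
 define K where "K = inv_into U phi ` K'"
 have "compactin (top_of_set (phi ` U)) K'"
  using cK' K'G by (auto simp: compactin_subtopology compactin_euclidean_iff G_def)
 hence cK: "compactin (mtop M) K" unfolding K_def by (rule image_compactin[OF _ chart_inverse_continuous[OF A U(1)]])
 have KW: "K\<subseteq>W" "K\<subseteq>U" using K'G by (auto simp: K_def G_def atlasD(8)[OF A U(1)])
 have inK: "x\<in>K \<longleftrightarrow> q (phi x)\<le>2" if "x\<in>U" for x
 proof -
  have "x\<in>K \<longleftrightarrow> phi x\<in>K'"
   using that K'G by (auto simp: K_def G_def atlasD(8)[OF A U(1)] intro!: image_eqI[of _ _ "phi x"])
  thus ?thesis by (simp add: K'_def)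
 qed
 obtain H :: "real => real" where H: "smooth_on UNIV H" "!!t. 0\<le>H t" "!!t. H t\<le>1"
  "!!t. t\<le>1 ==> H t = 1" "!!t. 2\<le>t ==> H t = 0" using smooth_step_exists by metis
 define b where "b = (%x. if x\<in>U then H (q (phi x)) else 0)"
 have b0: "b x = 0" if "x\<notin>K" for x using that inK[of x] H(5) by (auto simp: b_def)
 have sH: "smooth_on UNIV (%y. H (q y))"
  by (rule smooth_on_compose[OF open_UNIV open_UNIV fin_dim_euclidean sq H(1)]) simp
 have "closedin (mtop M) K"
  by (rule compactin_imp_closedin[OF _ cK]) (use M in "simp add: smooth_manifold_def")
 hence oK: "opn M (points M - K)" by (simp add: closedin_def)
 have "smooth_fun M b x" if x: "x\<in>points M" for x
 proof (cases "x\<in>U")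
  case True
  have "smooth_fun M (%x. H (q (phi x))) x"
   by (rule smooth_fun_compose[OF A atlasD(1)[OF A] smooth_fun_chart[OF A U(1) True] open_UNIV UNIV_I sH fin_dim_euclidean])
  thus ?thesis
   by (rule smooth_at_cong[OF _ A atlasD(2)[OF A U(1)] True]) (simp add: b_def)
 next
  case False
  thus ?thesis
   by (intro smooth_at_cong[OF smooth_fun_const[OF A x, of 0] A oK]) (use x KW b0 in auto)
 qed
 hence "b\<in>Cinf M" by (simp add: smooth_functions_iff[OF A])
 moreover have "0\<le>b x" "b x\<le>1" for x by (auto simp: b_def H)
 moreover have "opn M {x\<in>U. phi x\<in>{y. q y < 1}}"
  by (rule atlasD(6)[OF A U(1)]) (auto intro!: open_Collect_less cq)
 moreover have "p\<in>{x\<in>U. phi x\<in>{y. q y < 1}}"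
  using U(2) bl by (simp add: q_def linear_simps)
 moreover have "b x = 1" if "x\<in>{x\<in>U. phi x\<in>{y. q y < 1}}" for x
  using that by (auto simp: b_def H)
 moreover have "{x\<in>U. phi x\<in>{y. q y < 1}}\<subseteq>K" using inK by auto
 ultimately have "bump M W p b {x\<in>U. phi x\<in>{y. q y < 1}} K" unfolding bump_def using cK KW(1) b0 by blast
 thus ?thesis by (rule that)
qed

definition cutoff :: "('a, 'm::real_normed_vector) manifold => 'a set => ('a => real) => bool" where
 "cutoff M U b \<longleftrightarrow> b\<in>Cinf M \<and> (\<exists>K. compactin (mtop M) K \<and> K\<subseteq>U \<and> (\<forall>x. x\<notin>K --> b x = 0))"

lemma cutoff_zero_nhd:
 assumes M: "smooth_manifold M" and b: "cutoff M U b" and x: "x\<in>points M" "x\<notin>U"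
 obtains Q where "opn M Q" "x\<in>Q" "!!z. z\<in>Q ==> b z = 0"
proof -
 obtain K where K: "compactin (mtop M) K" "K\<subseteq>U" "!!x. x\<notin>K ==> b x = 0" using b by (auto simp: cutoff_def)
 have "closedin (mtop M) K" using M K(1) by (simp add: smooth_manifold_def compactin_imp_closedin)
 thus thesis by (intro that[of "points M - K"]) (use K x in "auto simp: closedin_def")
qed

text \<open>Extension by zero: near a point outside \<open>U\<close> the factor \<open>b\<close>
  vanishes, so the values of \<open>f\<close> there are irrelevant.\<close>

lemma cutoff_smooth:
 assumes M: "smooth_manifold M" and b: "cutoff M U b" and f: "x\<in>U ==> smooth_fun M (f :: 'a => 'v::euclidean_space) x"
  and x: "x\<in>points M"
 shows "smooth_fun M (%z. b z *R f z) x"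
proof (cases "x\<in>U")
 case True
 have "smooth_fun M b x" using b smooth_functions_iff[OF manifold_atlas[OF M]] x by (auto simp: cutoff_def)
 thus ?thesis using smooth_fun_scaleR[OF manifold_atlas[OF M]] f[OF True] by blast
next
 case False
 obtain Q where Q: "opn M Q" "x\<in>Q" "!!z. z\<in>Q ==> b z = 0" using cutoff_zero_nhd[OF M b x False] by metis
 show ?thesis
  by (rule smooth_at_cong[OF smooth_fun_const[OF manifold_atlas[OF M] x, of 0] manifold_atlas[OF M] Q(1,2)]) (simp add: Q(3))
qed

lemma cutoff_exists:
 assumes M: "smooth_manifold M" and W: "opn M W" "x\<in>W"
 obtains b V where "cutoff M W b" "opn M V" "x\<in>V" "V\<subseteq>W" "!!z. z\<in>V ==> b z = 1"
proof -
 obtain b V K where b: "bump M W x b V K" by (rule bump_function[OF M W])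
 show thesis by (rule that[of b V]) (use b in "auto simp: cutoff_def bump_def")
qed

text \<open>Local finiteness in an ordered form: on \<open>V k\<close> the functions of index above
  \<open>k\<close> vanish and the partial sums from \<open>k\<close> on equal 1. Every infinite sum
  is then locally a sum up to a known index.\<close>

definition pou_on ::
 "('a, 'm::real_normed_vector) manifold => ('a => 'a set) => (nat => 'a => real) => (nat => 'a) =>
 (nat => 'a set) => (nat => 'a set) => bool"
where
 "pou_on M U rho p K V \<longleftrightarrow>
  (\<forall>k. rho k\<in>Cinf M \<and> p k\<in>points M \<and> compactin (mtop M) (K k) \<and> K k\<subseteq>U (p k) \<and>
   opn M (V k) \<and> (\<forall>x. 0\<le>rho k x) \<and> (\<forall>x. x\<notin>K k --> rho k x = 0)) \<and>
  (\<forall>x\<in>points M. \<exists>k. x\<in>V k) \<and>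
  (\<forall>k. \<forall>x\<in>V k. (\<forall>j>k. rho j x = 0) \<and> (\<forall>j\<ge>k. (\<Sum>i\<le>j. rho i x) = 1))"

lemma pou_onD:
 assumes "pou_on M U rho p K V"
 shows "rho k\<in>Cinf M" "0\<le>rho k x" "p k\<in>points M"
  "compactin (mtop M) (K k)" "K k\<subseteq>U (p k)" "x\<notin>K k ==> rho k x = 0"
  "opn M (V k)" "x\<in>points M ==> \<exists>k. x\<in>V k"
  "x\<in>V k ==> j > k ==> rho j x = 0"
  "x\<in>V k ==> j\<ge>k ==> (\<Sum>i\<le>j. rho i x) = 1"
 using assms by (simp_all add: pou_on_def)

text \<open>The Lindeloef property leaves countably many bumps, and a telescoping product makes
  their sum finite near each point without refining the cover.\<close>

lemma partition_of_unity_exists: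
 assumes M: "smooth_manifold M" and ne: "points M ~= {}"
  and U: "!!x. x\<in>points M ==> opn M (U x) \<and> x\<in>U x"
 obtains rho p K V where "pou_on M U rho p K V"
proof -
 have A: "atlas M" by (rule manifold_atlas[OF M])
 have "\<exists>b V K. bump M (U x) x b V K" if x: "x\<in>points M" for x
  using bump_function[OF M U[OF x, THEN conjunct1] U[OF x, THEN conjunct2]] by metis
 then obtain bb VV KK where "!!x. x\<in>points M ==> bump M (U x) x (bb x) (VV x) (KK x)" by metis
 hence g: "bb x\<in>Cinf M" "0\<le>bb x z" "bb x z\<le>1" "opn M (VV x)" "x\<in>VV x"
  "z\<in>VV x ==> bb x z = 1" "compactin (mtop M) (KK x)" "KK x\<subseteq>U x" "z\<notin>KK x ==> bb x z = 0"
  if "x\<in>points M" for x z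
  using that unfolding bump_def by blast+
 have "Lindelof_space (mtop M)"
  by (rule second_countable_imp_Lindelof_space) (use M in "simp add: smooth_manifold_def")
 moreover have "\<Union> (VV ` points M) = points M" using g(4,5) openin_subset by fastforce
 ultimately obtain \<V> where V: "countable \<V>" "\<V>\<subseteq>VV ` points M" "\<Union>\<V> = points M"
  using g(4) unfolding Lindelof_space_def by (metis (no_types, lifting) imageE)
 then obtain C where C: "countable C" "C\<subseteq>points M" "\<V> = VV ` C"
  by (metis countable_subset_image)
 have Cne: "C ~= {}"
 proof
  assume "C = {}"
  hence "points M = {}" using V(3) unfolding C(3) by simp
  with ne show False by (rule notE)
 qed
 define p where "p = from_nat_into C"
 have pC: "p k\<in>points M" for k using from_nat_into[OF Cne, of k] C(2) by (auto simp: p_def)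
 have cov: "\<exists>k. x\<in>VV (p k)" if x: "x\<in>points M" for x
 proof -
  obtain y where "y\<in>C" "x\<in>VV y" using V(3) x unfolding C(3) by blast
  thus ?thesis using from_nat_into_surj[OF C(1)] by (metis p_def)
 qed
 \<comment> \<open>The partial sums telescope to 1 minus the product of all 1 - b_i, and this
   product vanishes as soon as one b_i equals 1. All later \<open>rho\<close> vanish there for the
   same reason.\<close>
 define rho where "rho = (%k x. bb (p k) x * (\<Prod>j<k. 1 - bb (p j) x))"
 have sm: "rho k\<in>Cinf M" for k
  unfolding smooth_functions_iff[OF A] rho_def
 proof
  fix x assume x: "x\<in>points M"
  have "smooth_fun M (bb (p j)) x" for j using g(1)[OF pC] x by (simp add: smooth_functions_iff[OF A])
  thus "smooth_fun M (%x. bb (p k) x * (\<Prod>j<k. 1 - bb (p j) x)) x"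
   by (intro smooth_fun_mult[OF A] smooth_fun_prod[OF A x] smooth_fun_minus[OF A] smooth_fun_const[OF A x])
 qed
 have tele: "(\<Sum>i\<le>j. rho i x) = 1 - (\<Prod>i\<le>j. 1 - bb (p i) x)" for j x
 proof (induction j)
  case 0 show ?case by (simp add: rho_def)
 next
  case (Suc j)
  thus ?case by (simp add: rho_def lessThan_Suc_atMost algebra_simps)
 qed
 have nonneg: "0\<le>rho k x" for k x unfolding rho_def
  by (intro mult_nonneg_nonneg prod_nonneg) (use g(2,3)[OF pC] in auto)
 have vanish: "rho j x = 0" if "x\<in>VV (p k)" "j > k" for k j x
 proof -
  have "1 - bb (p k) x = 0" using g(6)[OF pC that(1)] by simp
  hence "(\<Prod>j<j. 1 - bb (p j) x) = 0" using that(2) by (intro prod_zero) auto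
  thus ?thesis by (simp add: rho_def)
 qed
 have total: "(\<Sum>i\<le>j. rho i x) = 1" if "x\<in>VV (p k)" "j\<ge>k" for k j x
 proof -
  have "1 - bb (p k) x = 0" using g(6)[OF pC that(1)] by simp
  hence "(\<Prod>i\<le>j. 1 - bb (p i) x) = 0" using that(2) by (intro prod_zero) auto
  thus ?thesis by (simp add: tele)
 qed
 have supp: "rho k x = 0" if "x\<notin>KK (p k)" for k x using g(9)[OF pC that] by (simp add: rho_def)
 have "pou_on M U rho p (%k. KK (p k)) (%k. VV (p k))"
  unfolding pou_on_def
  using sm pC g(4,7,8)[OF pC] nonneg supp cov vanish total by blast
 thus ?thesis by (rule that)
qed

text \<open>The least bound merely makes this a total function; when later terms vanish on each
  \<open>V k\<close>, every admissible bound gives the same value.\<close>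

definition locally_finite_sum :: "(nat => 'a set) => (nat => 'a => 'v::comm_monoid_add) => 'a => 'v" where
 "locally_finite_sum V g x = (\<Sum>j\<le>(LEAST k. x\<in>V k). g j x)"

lemma locally_finite_sum_eq:
 assumes "x\<in>V k" "!!k j. x\<in>V k ==> j > k ==> g j x = 0"
 shows "locally_finite_sum V g x = (\<Sum>j\<le>k. g j x)"
 unfolding locally_finite_sum_def
proof (rule sum.mono_neutral_left)
 show "\<forall>i\<in>{..k} - {..LEAST k. x\<in>V k}. g i x = 0"
  using assms(2) LeastI[of "%k. x\<in>V k", OF assms(1)] by auto
qed (use Least_le[of "%k. x\<in>V k", OF assms(1)] in auto)

lemma smooth_fun_locally_finite_sum:
 assumes M: "atlas M" and k: "x\<in>V k" "opn M (V k)"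
  and z: "!!x k j. x\<in>V k ==> j > k ==> g j x = 0"
  and s: "!!j. j\<le>k ==> smooth_fun M (g j :: 'a => 'v::euclidean_space) x"
 shows "smooth_fun M (locally_finite_sum V g) x"
proof (rule smooth_at_cong[OF _ M k(2,1)])
 have "x\<in>points M" using k openin_subset by blast
 thus "smooth_fun M (%x. \<Sum>j\<le>k. g j x) x" by (intro smooth_fun_sum[OF M]) (use s in auto)
 show "(\<Sum>j\<le>k. g j y) = locally_finite_sum V g y" if "y\<in>V k" for y
  using locally_finite_sum_eq[of y V k g] that z by simp
qed

section \<open>Characters of the algebra of smooth functions\<close>

text \<open>Weighting the j-th function of a partition of unity by j gives a function that is at
  least \<open>n\<close> away from the first \<open>n\<close> supports.\<close>

lemma proper_smooth_function:
 assumes M: "smooth_manifold M"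
 obtains f C where "f\<in>Cinf M" "!!n::nat. compactin (mtop M) (C n)"
  "!!n x. x\<in>points M ==> x\<notin>C n ==> f x\<ge>real n"
proof (cases "points M = {}")
 case True
 thus ?thesis using that[of "%x. 0" "%n. {}"] smooth_functions_iff[OF manifold_atlas[OF M]] by auto
next
 case False
 have A: "atlas M" by (rule manifold_atlas[OF M])
 have U: "opn M (points M) \<and> x\<in>points M" if "x\<in>points M" for x using that by simp
 obtain rho p K V where "pou_on M (%_. points M) rho p K V"
  by (rule partition_of_unity_exists[OF M False U])
 note P = pou_onD[OF this]
 define g where "g = (%j x. real j * rho j x)"
 have gz: "g j x = 0" if "x\<in>V k" "j > k" for x k j using P(9)[OF that] by (simp add: g_def)
 have "smooth_fun M (locally_finite_sum V g) x" if x: "x\<in>points M" for x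
 proof -
  obtain k where k: "x\<in>V k" using P(8)[OF x] by blast
  show ?thesis
  proof (rule smooth_fun_locally_finite_sum[where V=V and k=k, OF A k P(7) gz])
   fix j
   have "smooth_fun M (rho j) x" using P(1) x by (simp add: smooth_functions_iff[OF A])
   thus "smooth_fun M (g j) x" unfolding g_def
    by (intro smooth_fun_mult[OF A] smooth_fun_const[OF A x])
  qed
 qed
 hence 1: "locally_finite_sum V g\<in>Cinf M" by (simp add: smooth_functions_iff[OF A])
 have 2: "compactin (mtop M) (\<Union>i<n. K i)" for n
  by (rule compactin_Union) (use P(4) in auto)
 have 3: "locally_finite_sum V g x\<ge>real n" if x: "x\<in>points M" "x\<notin>(\<Union>i<n. K i)" for n x
 proof -
  obtain k where k: "x\<in>V k" using P(8)[OF x(1)] by blast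
  have "real n * (\<Sum>j\<le>k. rho j x)\<le>(\<Sum>j\<le>k. g j x)"
   unfolding sum_distrib_left g_def
  proof (rule sum_mono)
   fix j
   show "real n * rho j x\<le>real j * rho j x"
    using x(2) P(2)[of j x] P(6)[of x j] by (cases "j < n") (auto intro: mult_right_mono)
  qed
  thus ?thesis using P(10)[OF k order_refl] locally_finite_sum_eq[where V=V and g=g, OF k gz] by simp
 qed
 show ?thesis by (rule that[OF 1 2 3])
qed

text \<open>If no point represents \<open>h\<close>, a function in the kernel of \<open>h\<close>
  without zeros can be built; it is invertible, which contradicts \<open>h\<close> being 1 on the
  constant 1. A proper function reduces the construction to a compact set. \<open>cong\<close> is
  there because functions are defined on the whole type and only their values on the points should
  count.\<close>

lemma character_is_evaluation:
 assumes M: "smooth_manifold M"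
  and add: "!!u v. u\<in>Cinf M ==> v\<in>Cinf M ==> h (%x. u x + v x) = h u + h v"
  and mult: "!!u v. u\<in>Cinf M ==> v\<in>Cinf M ==> h (%x. u x * v x) = h u * h v"
  and const: "!!c. h (%x. c) = (c::real)"
  and cong: "!!u v. u\<in>Cinf M ==> v\<in>Cinf M ==> (\<forall>x\<in>points M. u x = v x) ==> h u = h v"
 shows "\<exists>x\<in>points M. \<forall>u\<in>Cinf M. h u = u x"
proof (rule ccontr)
 assume neg: "\<not> ?thesis"
 have A: "atlas M" by (rule manifold_atlas[OF M])
 note sf = smooth_functions_iff[OF A]
 have cst: "(%x. c)\<in>Cinf M" for c by (simp add: sf smooth_fun_const[OF A])
 obtain f C where f: "f\<in>Cinf M" "!!n::nat. compactin (mtop M) (C n)"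
  "!!n x. x\<in>points M ==> x\<notin>C n ==> f x\<ge>real n" using proper_smooth_function[OF M] by metis
 have shift: "(%x. u x - h u)\<in>Cinf M" "h (%x. u x - h u) = 0" if "u\<in>Cinf M" for u
 proof -
  show "(%x. u x - h u)\<in>Cinf M"
   using that by (simp add: sf smooth_fun_minus[OF A] smooth_fun_const[OF A])
  show "h (%x. u x - h u) = 0" using add[OF that cst[of "- h u"]] const by simp
 qed
 obtain n where n: "real n > h f" using reals_Archimedean2 by blast
 have "\<exists>w. w\<in>Cinf M \<and> h w = 0 \<and> w x ~= 0" if x: "x\<in>points M" for x
 proof -
  obtain u where "u\<in>Cinf M" "h u ~= u x" using neg x by blast
  thus ?thesis using shift by (intro exI[of _ "%x. u x - h u"]) auto
 qed
 then obtain w where w: "!!x. x\<in>points M ==> w x\<in>Cinf M \<and> h (w x) = 0 \<and> w x x ~= 0" by metis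
 define O' where "O' = (%x. {z\<in>points M. w x z\<in>- {0}})"
 have oO: "opn M (O' x)" if "x\<in>points M" for x
  unfolding O'_def
  by (rule smooth_at_imp_openin[OF A _ fin_dim_euclidean]) (use w[OF that] sf in auto)
 have Cs: "C n\<subseteq>points M" using compactin_subset_topspace[OF f(2)] .
 hence "C n\<subseteq>\<Union> (O' ` C n)" using w by (auto simp: O'_def)
 then obtain \<F> where "finite \<F>" "\<F>\<subseteq>O' ` C n" "C n\<subseteq>\<Union>\<F>"
  using compactinD[OF f(2)[of n], of "O' ` C n"] oO Cs by blast
 then obtain F where F: "finite F" "F\<subseteq>C n" "C n\<subseteq>\<Union> (O' ` F)" by (metis finite_subset_image)
 \<comment> \<open>Off \<open>C n\<close> the first square is positive since \<open>f\<close> is at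
   least \<open>n > h f\<close>; on \<open>C n\<close> one of the finitely many \<open>w y\<close>
   is nonzero. Every summand lies in the kernel of \<open>h\<close>.\<close>
 define g where "g = (%x. (f x - h f) * (f x - h f) + (\<Sum>y\<in>F. w y x * w y x))"
 have sum: "(%x. \<Sum>y\<in>S. w y x * w y x)\<in>Cinf M \<and> h (%x. \<Sum>y\<in>S. w y x * w y x) = 0"
  if "finite S" "S\<subseteq>C n" for S
  using that
 proof (induction S rule: finite_induct)
  case empty thus ?case using cst const[of 0] by simp
 next
  case (insert y S)
  have wy: "w y\<in>Cinf M" "h (w y) = 0" using w insert.prems Cs by auto
  have w2: "(%x. w y x * w y x)\<in>Cinf M" using wy by (simp add: sf smooth_fun_mult[OF A])
  show ?case using insert add[OF w2, of "%x. \<Sum>y\<in>S. w y x * w y x"] mult[OF wy(1) wy(1)] wy w2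
   by (simp add: sf smooth_fun_add[OF A])
 qed
 have f2: "(%x. (f x - h f) * (f x - h f))\<in>Cinf M"
  using shift(1)[OF f(1)] by (simp add: sf smooth_fun_mult[OF A])
 have gs: "g\<in>Cinf M"
  unfolding g_def using f2 sum[OF F(1,2)] by (simp add: sf smooth_fun_add[OF A])
 have hg: "h g = 0"
  unfolding g_def using add[OF f2 sum[OF F(1,2), THEN conjunct1]] sum[OF F(1,2)] mult[OF shift(1) shift(1)] shift(2) f(1)
  by simp
 have gpos: "g x > 0" if x: "x\<in>points M" for x
 proof (cases "x\<in>C n")
  case True
  then obtain y where y: "y\<in>F" "w y x ~= 0" using F(3) by (auto simp: O'_def)
  have "0 < w y x * w y x" using y(2) by (metis mult_pos_pos mult_neg_neg linorder_neqE_linordered_idom)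
  also have "\<dots>\<le>(\<Sum>y\<in>F. w y x * w y x)" by (rule member_le_sum) (use y F(1) in auto)
  finally show ?thesis unfolding g_def by (rule add_nonneg_pos[OF zero_le_square])
 next
  case False
  hence "f x - h f > 0" using f(3)[OF x False] n by simp
  thus ?thesis unfolding g_def by (intro add_pos_nonneg sum_nonneg) auto
 qed
 have ig: "(%x. inverse (g x))\<in>Cinf M"
  unfolding sf using gs gpos by (metis A less_irrefl sf smooth_fun_inverse)
 have "(%x. g x * inverse (g x))\<in>Cinf M" using gs ig by (simp add: sf smooth_fun_mult[OF A])
 hence "h (%x. g x * inverse (g x)) = h (%x. 1)"
  by (rule cong[OF _ cst]) (use gpos in "auto simp: less_le")
 thus False using mult[OF gs ig] hg const[of 1] by simp
qed

lemma smooth_functions_local: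
 assumes M: "smooth_manifold M" and W: "opn M W" "p\<in>W"
  and f: "!!x. x\<in>W ==> smooth_fun M (f :: 'a => real) x"
 obtains g V where "g\<in>Cinf M" "opn M V" "p\<in>V" "V\<subseteq>W" "!!x. x\<in>V ==> g x = f x"
proof -
 obtain b V where b: "cutoff M W b" "opn M V" "p\<in>V" "V\<subseteq>W" "!!z. z\<in>V ==> b z = 1"
  using cutoff_exists[OF M W] by metis
 have "(%z. b z * f z)\<in>Cinf M"
  using cutoff_smooth[OF M b(1) f] by (simp add: smooth_functions_iff[OF manifold_atlas[OF M]])
 thus ?thesis using that[of "%z. b z * f z" V] b by simp
qed

text \<open>Coordinates near \<open>f x\<close> extend to global functions, whose composites with
  \<open>f\<close> are smooth. Continuity of \<open>f\<close> is not given and has to be extracted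
  from a cutoff function.\<close>

lemma smooth_at_from_functions:
 assumes M: "smooth_manifold (M :: ('a, 'm::real_normed_vector) manifold)"
  and N: "smooth_manifold (N :: ('b, 'k::real_normed_vector) manifold)" and x: "x\<in>points M"
  and into: "!!z. z\<in>points M ==> f z\<in>points N"
  and f: "!!u. u\<in>Cinf N ==> (%z. u (f z))\<in>Cinf M"
 shows "smooth_at M N f x"
proof -
 have A: "atlas M" "atlas N" using M N manifold_atlas by blast+
 obtain V psi where V: "(V, psi)\<in>charts N" "f x\<in>V" using atlas_chart[OF A(2) into[OF x]] .
 obtain U phi where U: "(U, phi)\<in>charts M" "x\<in>U" using atlas_chart[OF A(1) x] .
 note oV = atlasD(2)[OF A(2) V(1)]
 have fd: "fin_dim TYPE('k)" by (rule atlasD(1)[OF A(2)])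
 obtain B :: "'k set" and c where Bc: "coordinate_system B c" using coordinate_system_exists[OF fd] .
 have fB: "finite B" and bl: "!!b. bounded_linear (c b)" and rep: "!!y. (\<Sum>b\<in>B. c b y *R b) = y"
  using Bc by (auto simp: coordinate_system_def)
 have "\<exists>g W. g\<in>Cinf N \<and> opn N W \<and> f x\<in>W \<and> W\<subseteq>V \<and> (\<forall>z\<in>W. g z = c b (psi z))" for b
 proof -
  have "smooth_fun N (%z. c b (psi z)) z" if "z\<in>V" for z
   by (rule smooth_fun_compose[OF A(2) fd smooth_fun_chart[OF A(2) V(1) that] open_UNIV UNIV_I
      smooth_on_bounded_linear[OF open_UNIV bl] fin_dim_euclidean])
  from smooth_functions_local[OF N oV V(2) this] show ?thesis by metis
 qed
 then obtain g W where g: "!!b. g b\<in>Cinf N" "!!b. opn N (W b)" "!!b. f x\<in>W b"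
  "!!b z. z\<in>W b ==> g b z = c b (psi z)" by metis
 have "opn N (V\<inter>\<Inter>(W ` B))"
  using oV fB g(2) by (cases "B = {}") (auto intro!: openin_Int openin_Inter)
 then obtain d V' where d: "cutoff N (V\<inter>\<Inter>(W ` B)) d" "f x\<in>V'" "!!z. z\<in>V' ==> d z = 1"
  using cutoff_exists[OF N, of "V\<inter>\<Inter>(W ` B)" "f x"] V(2) g(3) by (metis IntI INT_I)
 \<comment> \<open>\<open>Q\<close> is open because the composite of \<open>d\<close> with
   \<open>f\<close> is smooth by hypothesis, and positivity of \<open>d\<close> forces
   \<open>f z\<close> into the region where the coordinates agree with the global functions.\<close>
 define Q where "Q = {z\<in>U. d (f z)\<in>{0<..}}"
 have oQ: "opn M Q" unfolding Q_def
  by (rule smooth_at_imp_openin[OF A(1) atlasD(2)[OF A(1) U(1)] fin_dim_euclidean])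
   (use d(1) f[of d] atlasD(3)[OF A(1) U(1)] in "auto simp: cutoff_def smooth_functions_iff[OF A(1)]")
 have QK: "f z\<in>V\<inter>\<Inter>(W ` B)" if "z\<in>Q" for z using that d(1) unfolding Q_def cutoff_def by (metis (mono_tags, lifting) greaterThan_iff less_irrefl mem_Collect_eq subsetD)
 have xQ: "x\<in>Q" using U(2) d(2,3) by (auto simp: Q_def)
 have QU: "Q\<subseteq>U" by (auto simp: Q_def)
 have oQ': "open (phi ` Q)" by (rule atlasD(5)[OF A(1) U(1) oQ QU])
 have s: "smooth_fun M (%z. g b (f z)) z" if "z\<in>Q" for b z
  using f[OF g(1)[of b]] that QU atlasD(3)[OF A(1) U(1)] by (auto simp: smooth_functions_iff[OF A(1)])
 have sm: "smooth_on (phi ` Q) ((%z. g b (f z))\<circ>inv_into U phi)" for b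
 proof (rule smooth_on_union, clarify)
  fix z assume z: "z\<in>Q"
  hence zU: "z\<in>U" using QU by auto
  obtain Q' where Q': "opn M Q'" "z\<in>Q'" "Q'\<subseteq>U" "smooth_on (phi ` Q') ((%z. g b (f z))\<circ>inv_into U phi)"
   using s[OF z, unfolded smooth_fun_iff[OF A(1) fin_dim_euclidean U(1) zU]] by metis
  show "\<exists>T. open T \<and> phi z\<in>T \<and> smooth_on T ((%z. g b (f z))\<circ>inv_into U phi)"
   by (rule exI[of _ "phi ` Q'"]) (use Q' atlasD(5)[OF A(1) U(1)] in auto)
 qed
 have s1: "smooth_on (phi ` Q) (%y. \<Sum>b\<in>B. ((%z. g b (f z))\<circ>inv_into U phi) y *R b)"
  by (intro smooth_on_sum smooth_on_bilinear[OF _ bounded_bilinear_scaleR] oQ' sm smooth_on_const)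
 have "smooth_on (phi ` Q) (psi\<circ>f\<circ>inv_into U phi)"
 proof (rule smooth_on_cong[OF oQ' _ s1])
  fix y assume "y\<in>phi ` Q"
  then obtain z where z: "z\<in>Q" "y = phi z" by auto
  have "g b (f z) = c b (psi (f z))" if "b\<in>B" for b
   by (rule g(4)) (use QK[OF z(1)] that in auto)
  thus "(\<Sum>b\<in>B. ((%z. g b (f z))\<circ>inv_into U phi) y *R b) = (psi\<circ>f\<circ>inv_into U phi) y"
   using z QU rep[of "psi (f z)"] by (auto simp: atlasD(8)[OF A(1) U(1)] subset_iff)
 qed
 hence "smooth_in_charts M f (U, phi) (V, psi) Q"
  using oQ QU QK by (auto simp: smooth_in_charts_def)
 thus ?thesis by (rule smooth_atI[OF U(1) V(1) xQ])
qed

section \<open>Differential operators over a commutative subalgebra\<close>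

text \<open>Abstracts the endomorphisms of a space of sections: \<open>U\<close> are the
  multiplications by functions, \<open>Omega\<close> the points, \<open>ev\<close> the value of the
  function at a point. The theory of symbols and of isomorphisms in low degree is derived from these
  axioms.\<close>

locale diff_algebra = ring R for R :: "(real, 't) module" (structure) +
 fixes U :: "'t set" and Omega :: "'x set" and ev :: "'x => 't => real"
 assumes smult_closed [simp, intro]: "T\<in>carrier R ==> c\<odot>T\<in>carrier R"
  and smult_l_distr: "T\<in>carrier R ==> (c + d)\<odot>T = c\<odot>T\<oplus>d\<odot>T"
  and smult_r_distr: "T\<in>carrier R ==> D\<in>carrier R ==> c\<odot>(T\<oplus>D) = c\<odot>T\<oplus>c\<odot>D"
  and smult_assoc1: "T\<in>carrier R ==> (c * d)\<odot>T = c\<odot>(d\<odot>T)"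
  and smult_one: "T\<in>carrier R ==> 1\<odot>T = T"
  and smult_mult_left: "T\<in>carrier R ==> D\<in>carrier R ==> (c\<odot>T)\<otimes>D = c\<odot>(T\<otimes>D)"
  and smult_mult_right: "T\<in>carrier R ==> D\<in>carrier R ==> T\<otimes>(c\<odot>D) = c\<odot>(T\<otimes>D)"
  and U_carrier: "U\<subseteq>carrier R" and U_one: "\<one>\<in>U"
  and U_add: "u\<in>U ==> v\<in>U ==> u\<oplus>v\<in>U"
  and U_mult: "u\<in>U ==> v\<in>U ==> u\<otimes>v\<in>U"
  and U_smult: "u\<in>U ==> c\<odot>u\<in>U"
  and U_comm: "u\<in>U ==> v\<in>U ==> u\<otimes>v = v\<otimes>u"
  and ev_add: "x\<in>Omega ==> u\<in>U ==> v\<in>U ==> ev x (u\<oplus>v) = ev x u + ev x v"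
  and ev_mult: "x\<in>Omega ==> u\<in>U ==> v\<in>U ==> ev x (u\<otimes>v) = ev x u * ev x v"
  and ev_smult: "x\<in>Omega ==> u\<in>U ==> ev x (c\<odot>u) = c * ev x u"
  and ev_one: "x\<in>Omega ==> ev x \<one> = 1"
  and ev_faithful: "u\<in>U ==> (!!x. x\<in>Omega ==> ev x u = 0) ==> u = \<zero>"
  and ev_unit: "u\<in>U ==> (!!x. x\<in>Omega ==> ev x u ~= 0) ==> \<exists>v\<in>U. u\<otimes>v = \<one>"
begin

lemma in_carrier [simp]: "u\<in>U ==> u\<in>carrier R" using U_carrier by blast

lemma smult_zero_left [simp]: "T\<in>carrier R ==> 0\<odot>T = \<zero>"
 using smult_l_distr[of T 0 0] by (metis add.l_cancel_one' add.r_cancel_one' smult_closed add_0)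

lemma smult_minus_one: "T\<in>carrier R ==> (-1)\<odot>T =\<ominus>T"
 using smult_l_distr[of T 1 "-1"] smult_one[of T] by (metis add.right_inverse minus_unique smult_closed minus_equality add.m_comm smult_zero_left)

lemma smult_zero_right [simp]: "c\<odot>\<zero> = \<zero>"
 using smult_assoc1[of \<zero> c 0] by simp

definition subspace :: "'t set => bool" where
 "subspace H \<longleftrightarrow> H\<subseteq>carrier R \<and> \<zero>\<in>H \<and> (\<forall>a\<in>H. \<forall>b\<in>H. a\<oplus>b\<in>H) \<and> (\<forall>c. \<forall>a\<in>H. c\<odot>a\<in>H)"

lemma subspaceD:
 assumes "subspace H"
 shows "a\<in>H ==> a\<in>carrier R" "\<zero>\<in>H" "a\<in>H ==> b\<in>H ==> a\<oplus>b\<in>H"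
  "a\<in>H ==> c\<odot>a\<in>H" "a\<in>H ==>\<ominus>a\<in>H" "a\<in>H ==> b\<in>H ==> a\<ominus>b\<in>H"
proof -
 show neg: "\<ominus> a\<in>H" if "a\<in>H" for a
  using assms that smult_minus_one[of a] unfolding subspace_def by (metis subset_iff)
 show "a\<in>H ==> b\<in>H ==> a\<ominus>b\<in>H"
  using assms neg unfolding subspace_def minus_eq by blast
qed (use assms in "auto simp: subspace_def")

lemma subspace_finsum:
 assumes "subspace H" "!!i. i\<in>I ==> g i\<in>H"
 shows "finsum R g I\<in>H"
 using assms(2)
proof (induction I rule: infinite_finite_induct)
 case (insert i I)
 have "finsum R g (insert i I) = g i\<oplus>finsum R g I"
  by (rule finsum_insert) (use insert subspaceD(1)[OF assms(1)] in auto)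
 thus ?case using insert subspaceD(3)[OF assms(1)] by simp
qed (auto simp: subspaceD(2)[OF assms(1)])

lemma subspace_U: "subspace U"
proof -
 have "\<zero>\<in>U" using U_smult[OF U_one, of 0] by simp
 thus ?thesis using U_carrier U_add U_smult by (auto simp: subspace_def)
qed

abbreviation cmt :: "'t => 't => 't" where "cmt T D \<equiv> commutator R T D"

lemma cmt_closed [simp, intro]: "T\<in>carrier R ==> D\<in>carrier R ==> cmt T D\<in>carrier R"
 by (simp add: commutator_def)

lemma cmt_add_left: "T\<in>carrier R ==> D\<in>carrier R ==> Z\<in>carrier R ==> cmt (T\<oplus>D) Z = cmt T Z\<oplus>cmt D Z"
 unfolding commutator_def by algebra

lemma cmt_add_right: "T\<in>carrier R ==> D\<in>carrier R ==> Z\<in>carrier R ==> cmt Z (T\<oplus>D) = cmt Z T\<oplus>cmt Z D"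
 unfolding commutator_def by algebra

lemma cmt_swap: "T\<in>carrier R ==> D\<in>carrier R ==> cmt T D =\<ominus>cmt D T"
 unfolding commutator_def by algebra

lemma cmt_mult_left: "T\<in>carrier R ==> D\<in>carrier R ==> Z\<in>carrier R ==> cmt (T\<otimes>D) Z = T\<otimes>cmt D Z\<oplus>cmt T Z\<otimes>D"
 unfolding commutator_def by algebra

lemma cmt_jacobi: "T\<in>carrier R ==> D\<in>carrier R ==> Z\<in>carrier R ==> cmt (cmt T D) Z = cmt T (cmt D Z)\<oplus>cmt (cmt T Z) D"
 unfolding commutator_def by algebra

lemma smult_minus: "T\<in>carrier R ==> c\<odot>(\<ominus> T) =\<ominus>(c\<odot>T)"
 by (metis mult.commute smult_assoc1 smult_closed smult_minus_one)

lemma cmt_smult_left: "T\<in>carrier R ==> D\<in>carrier R ==> cmt (c\<odot>T) D = c\<odot>cmt T D"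
 by (simp add: commutator_def smult_mult_left smult_mult_right minus_eq smult_r_distr smult_minus)

lemma cmt_smult_right: "T\<in>carrier R ==> D\<in>carrier R ==> cmt T (c\<odot>D) = c\<odot>cmt T D"
 by (simp add: commutator_def smult_mult_left smult_mult_right minus_eq smult_r_distr smult_minus)

lemma cmt_zero [simp]: "T\<in>carrier R ==> cmt T \<zero> = \<zero>" "T\<in>carrier R ==> cmt \<zero> T = \<zero>"
 by (simp_all add: commutator_def minus_eq)

lemma cmt_minus_left: "T\<in>carrier R ==> D\<in>carrier R ==> Z\<in>carrier R ==> cmt (T\<ominus>D) Z = cmt T Z\<ominus>cmt D Z"
 unfolding commutator_def by algebra

lemma cmt_minus_right: "T\<in>carrier R ==> D\<in>carrier R ==> Z\<in>carrier R ==> cmt Z (T\<ominus>D) = cmt Z T\<ominus>cmt Z D"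
 unfolding commutator_def by algebra

lemma cmt_U [simp]: "u\<in>U ==> v\<in>U ==> cmt u v = \<zero>"
 using U_comm[of u v] by (simp add: commutator_def)

lemma cmt_cmt_U:
 assumes "T\<in>carrier R" "u\<in>U" "v\<in>U"
 shows "cmt (cmt T u) v = cmt (cmt T v) u"
 using cmt_jacobi[of T u v] assms by simp

primrec Pn :: "nat => 't set" where
 "Pn 0 = U"
| "Pn (Suc i) = {T\<in>carrier R. \<forall>u\<in>U. cmt T u\<in>Pn i}"

text \<open>The differential operators in the usual sense: \<open>Dn 0\<close> is the whole
  centralizer of \<open>U\<close>, that is, the endomorphism fields. The filtrations interlace,
  \<open>Dn i\<close> lying between \<open>Pn i\<close> and \<open>Pn (Suc i)\<close>; operators in
  \<open>Pn i\<close> have order at most \<open>i\<close> and a scalar symbol in that order.\<close>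

primrec Dn :: "nat => 't set" where
 "Dn 0 = {T\<in>carrier R. \<forall>u\<in>U. cmt T u = \<zero>}"
| "Dn (Suc i) = {T\<in>carrier R. \<forall>u\<in>U. cmt T u\<in>Dn i}"

definition P :: "int => 't set" where "P i = (if i < 0 then {\<zero>} else Pn (nat i))"

lemma subspace_preimage:
 assumes "subspace H" shows "subspace {T\<in>carrier R. \<forall>u\<in>U. cmt T u\<in>H}"
 unfolding subspace_def
 using subspaceD[OF assms] by (auto simp: cmt_add_left cmt_smult_left)

lemma subspace_zero: "subspace {\<zero>}" by (simp add: subspace_def)

lemma subspace_Pn: "subspace (Pn i)"
 by (induction i) (auto intro: subspace_U subspace_preimage[simplified])

lemma subspace_Dn: "subspace (Dn i)"
 using subspace_preimage[OF subspace_zero]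
 by (induction i) (auto intro: subspace_preimage[simplified])

lemma subspace_P: "subspace (P i)"
 by (simp add: P_def subspace_Pn subspace_zero)

lemmas Pn_carrier = subspaceD(1)[OF subspace_Pn] and Dn_carrier = subspaceD(1)[OF subspace_Dn]
 and P_carrier = subspaceD(1)[OF subspace_P]

lemma Pn_Suc: "Pn i\<subseteq>Pn (Suc i)"
proof (induction i)
 case 0 show ?case using subspaceD(2)[OF subspace_U] by auto
next
 case (Suc i) thus ?case by (auto simp del: Pn.simps(1))
qed

lemma Dn_le_Pn: "Dn i\<subseteq>Pn (Suc i)"
proof (induction i)
 case 0 show ?case using subspaceD(2)[OF subspace_U] by auto
next
 case (Suc i) thus ?case by (auto simp del: Dn.simps(1) Pn.simps(1))
qed

lemma P_mono: "i\<le>j ==> P i\<subseteq>P j"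
proof -
 have "Pn m\<subseteq>Pn n" if "m\<le>n" for m n using lift_Suc_mono_le[of Pn, OF Pn_Suc that] .
 thus "i\<le>j ==> P i\<subseteq>P j" using subspaceD(2)[OF subspace_Pn] by (auto simp: P_def nat_mono)
qed

text \<open>Shared by both filtrations: the Leibniz rule lowers the order of one factor, by
  induction on the total order. In order 0 the commutator is zero, which covers the truncated
  \<open>j - 1\<close> at \<open>j = 0\<close>.\<close>

lemma filtration_mult:
 assumes F: "!!i. subspace (F i)" "!!i. F (Suc i) = {T\<in>carrier R. \<forall>u\<in>U. cmt T u\<in>F i}"
  and F0: "!!T D. T\<in>F 0 ==> D\<in>F 0 ==> T\<otimes>D\<in>F 0" "!!T u. T\<in>F 0 ==> u\<in>U ==> cmt T u = \<zero>"
 shows "i + j = n ==> T\<in>F i ==> D\<in>F j ==> T\<otimes>D\<in>F n"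
proof (induction n arbitrary: i j T D)
 case 0 thus ?case by (auto intro: F0)
next
 case (Suc n)
 have c: "T\<in>carrier R" "D\<in>carrier R" using Suc.prems subspaceD(1)[OF F(1)] by blast+
 have "cmt (T\<otimes>D) u\<in>F n" if u: "u\<in>U" for u
 proof -
  have 1: "T\<otimes>cmt D u\<in>F n"
   using Suc.IH[of i "j - 1" T "cmt D u"] Suc.prems u c subspaceD(2)[OF F(1)] F0(2)
   by (cases j) (auto simp: F(2))
  have 2: "cmt T u\<otimes>D\<in>F n"
   using Suc.IH[of "i - 1" j "cmt T u" D] Suc.prems u c subspaceD(2)[OF F(1)] F0(2)
   by (cases i) (auto simp: F(2))
  show ?thesis using cmt_mult_left[of T D u] c u 1 2 subspaceD(3)[OF F(1)] by simp
 qed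
 thus ?case using c by (simp add: F(2))
qed

lemma Pn_mult: "i + j = n ==> T\<in>Pn i ==> D\<in>Pn j ==> T\<otimes>D\<in>Pn n"
 by (rule filtration_mult[of Pn, OF subspace_Pn Pn.simps(2)]) (auto intro: U_mult)

lemma Dn_mult: "i + j = n ==> T\<in>Dn i ==> D\<in>Dn j ==> T\<otimes>D\<in>Dn n"
 by (rule filtration_mult[of Dn, OF subspace_Dn Dn.simps(2)]) (auto simp: cmt_mult_left)

text \<open>Jacobi lowers the order of one argument at a time; in total order 1 the claim is the
  definition of \<open>Pn\<close>, up to a sign.\<close>

lemma Pn_cmt:
 "i + j = n ==> T\<in>Pn i ==> D\<in>Pn j ==> cmt T D\<in>P (int n - 1)"
proof (induction n arbitrary: i j T D)
 case 0 thus ?case by (simp add: P_def)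
next
 case (Suc n)
 have c: "T\<in>carrier R" "D\<in>carrier R" using Suc.prems Pn_carrier by blast+
 show ?case
 proof (cases n)
  case 0
  then consider "i = 1" "j = 0" | "i = 0" "j = 1" using Suc.prems(1) by linarith
  thus ?thesis
  proof cases
   case 1 thus ?thesis using Suc.prems 0 by (simp add: P_def)
  next
   case 2 thus ?thesis using Suc.prems 0 cmt_swap[OF c] subspaceD(5)[OF subspace_U] by (simp add: P_def)
  qed
 next
  case (Suc m)
  have "cmt (cmt T D) u\<in>Pn m" if u: "u\<in>U" for u
  proof -
   have 1: "cmt T (cmt D u)\<in>Pn m"
    using Suc.IH[of i "j - 1" T "cmt D u"] Suc.prems u c subspaceD(2)[OF subspace_Pn] Suc
    by (cases j) (auto simp: P_def)
   have 2: "cmt (cmt T u) D\<in>Pn m"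
    using Suc.IH[of "i - 1" j "cmt T u" D] Suc.prems u c subspaceD(2)[OF subspace_Pn] Suc
    by (cases i) (auto simp: P_def)
   show ?thesis using cmt_jacobi[of T D u] c u 1 2 subspaceD(3)[OF subspace_Pn] by simp
  qed
  thus ?thesis using c Suc by (simp add: P_def nat_add_distrib)
 qed
qed

lemma P_neg: "T\<in>P i ==> D\<in>P j ==> i < 0 \<or> j < 0 ==> T = \<zero> \<and> D\<in>carrier R \<or> D = \<zero> \<and> T\<in>carrier R"
 using P_carrier[of T i] P_carrier[of D j] by (auto simp: P_def)

lemma P_mult: "T\<in>P i ==> D\<in>P j ==> T\<otimes>D\<in>P (i + j)"
 using P_neg[of T i D j] Pn_mult[of "nat i" "nat j" _ T D] subspaceD(2)[OF subspace_Pn]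
 by (cases "i < 0 \<or> j < 0") (auto simp: P_def nat_add_distrib)

lemma P_cmt: "T\<in>P i ==> D\<in>P j ==> cmt T D\<in>P (i + j - 1)"
 using P_neg[of T i D j] Pn_cmt[of "nat i" "nat j" "nat (i + j)" T D] subspaceD(2)[OF subspace_P]
 by (cases "i < 0 \<or> j < 0") (auto simp: P_def[of i] P_def[of j] nat_add_distrib)

text \<open>The value at \<open>x\<close> of the symbol of order \<open>i\<close> on the covector \<open>du\<close>, i.e. of
  \<open>(ad u)\<^sup>i T / i!\<close>.\<close>

primrec sym :: "nat => 't => 'x => 't => real" where
 "sym 0 u x T = ev x T"
| "sym (Suc i) u x T = sym i u x (cmt T u) / real (Suc i)"

lemma ev_zero: "x\<in>Omega ==> ev x \<zero> = 0"
 using ev_smult[OF _ U_one, of x 0] by simp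

lemma sym_add:
 "x\<in>Omega ==> u\<in>U ==> T\<in>Pn i ==> D\<in>Pn i ==> sym i u x (T\<oplus>D) = sym i u x T + sym i u x D"
 by (induction i arbitrary: T D) (auto simp: ev_add cmt_add_left add_divide_distrib)

lemma sym_smult:
 "x\<in>Omega ==> u\<in>U ==> T\<in>Pn i ==> sym i u x (c\<odot>T) = c * sym i u x T"
 by (induction i arbitrary: T) (auto simp: ev_smult cmt_smult_left)

lemma sym_zero: "x\<in>Omega ==> u\<in>U ==> sym i u x \<zero> = 0"
 by (induction i) (auto simp: ev_zero)

lemma sym_lower: "x\<in>Omega ==> u\<in>U ==> T\<in>Pn i ==> sym (Suc i) u x T = 0"
proof (induction i arbitrary: T)
 case 0 thus ?case by (simp add: ev_zero)
next
 case (Suc i)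
 have e: "sym (Suc i) u x (cmt T u) = 0" by (rule Suc.IH) (use Suc.prems in auto)
 show ?case by (subst sym.simps(2)) (simp only: e div_0)
qed

lemma sym_P_lower: "x\<in>Omega ==> u\<in>U ==> T\<in>P (int i - 1) ==> sym i u x T = 0"
 using sym_lower[of x u T "i - 1"] sym_zero[of x u i] by (cases i) (auto simp: P_def split: if_splits)

lemma sym_cong:
 assumes "x\<in>Omega" "u\<in>U" "T\<in>Pn i" "D\<in>Pn i" "T\<ominus>D\<in>P (int i - 1)"
 shows "sym i u x T = sym i u x D"
proof -
 have c: "T\<in>carrier R" "D\<in>carrier R" using assms Pn_carrier by blast+
 have "sym i u x (D\<oplus>(T\<ominus>D)) = sym i u x D + sym i u x (T\<ominus>D)"
  by (rule sym_add) (use assms subspaceD(6)[OF subspace_Pn] in auto)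
 moreover have "D\<oplus>(T\<ominus>D) = T" using c by algebra
 ultimately show ?thesis using sym_P_lower[OF assms(1,2,5)] by simp
qed

text \<open>Leibniz rule again. The division by the order in \<open>sym\<close> produces the weights
  i and j, which add up to the total order and cancel.\<close>

lemma sym_mult:
 "i + j = n ==> x\<in>Omega ==> u\<in>U ==> T\<in>Pn i ==> D\<in>Pn j ==> sym n u x (T\<otimes>D) = sym i u x T * sym j u x D"
proof (induction n arbitrary: i j T D)
 case 0 thus ?case by (simp add: ev_mult)
next
 case (Suc n)
 have c: "T\<in>carrier R" "D\<in>carrier R" "u\<in>carrier R" using Suc.prems Pn_carrier by auto
 have 1: "T\<otimes>cmt D u\<in>Pn n \<and> sym n u x (T\<otimes>cmt D u) = real j * (sym i u x T * sym j u x D)"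
 proof (cases j)
  case 0 thus ?thesis using Suc.prems c subspaceD(2)[OF subspace_Pn] by (simp add: sym_zero)
 next
  case (Suc k)
  hence "cmt D u\<in>Pn k" "i + k = n" using Suc.prems by auto
  thus ?thesis using Suc.IH[of i k T "cmt D u"] Pn_mult Suc.prems Suc by simp
 qed
 have 2: "cmt T u\<otimes>D\<in>Pn n \<and> sym n u x (cmt T u\<otimes>D) = real i * (sym i u x T * sym j u x D)"
 proof (cases i)
  case 0 thus ?thesis using Suc.prems c subspaceD(2)[OF subspace_Pn] by (simp add: sym_zero)
 next
  case (Suc k)
  hence "cmt T u\<in>Pn k" "k + j = n" using Suc.prems by auto
  thus ?thesis using Suc.IH[of k j "cmt T u" D] Pn_mult Suc.prems Suc by simp
 qed
 have "sym (Suc n) u x (T\<otimes>D) = (real j * (sym i u x T * sym j u x D) + real i * (sym i u x T * sym j u x D)) / real (Suc n)"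
  using 1 2 c sym_add[OF Suc.prems(2,3), of "T\<otimes>cmt D u" n "cmt T u\<otimes>D"] by (simp add: cmt_mult_left)
 also have "\<dots> = (real (i + j) * (sym i u x T * sym j u x D)) / real (Suc n)" by (simp add: algebra_simps)
 finally show ?case using Suc.prems(1) by simp
qed

text \<open>Along the line u + t v the symbol is a polynomial in t whose linear coefficient is the
  symbol of \<open>cmt T v\<close>, one order lower. A symbol that vanishes for all \<open>u\<close>
  thus passes its vanishing on to all commutators.\<close>

lemma sym_polarize:
 assumes "x\<in>Omega" "u\<in>U" "v\<in>U"
 shows "T\<in>Pn i ==> \<exists>p. (\<forall>t. sym i (u\<oplus>t\<odot>v) x T = poly p t) \<and> poly.coeff p 0 = sym i u x T \<and>
  poly.coeff p 1 = (if i = 0 then 0 else sym (i - 1) u x (cmt T v))"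
proof (induction i arbitrary: T)
 case 0 thus ?case by (intro exI[of _ "[:ev x T:]"]) auto
next
 case (Suc i)
 have c: "T\<in>carrier R" "u\<in>carrier R" "v\<in>carrier R" using Suc.prems assms by auto
 have Tu: "cmt T u\<in>Pn i" and Tv: "cmt T v\<in>Pn i" using Suc.prems assms by auto
 obtain p where p: "\<forall>t. sym i (u\<oplus>t\<odot>v) x (cmt T u) = poly p t" "poly.coeff p 0 = sym i u x (cmt T u)"
  "poly.coeff p 1 = (if i = 0 then 0 else sym (i - 1) u x (cmt (cmt T u) v))" using Suc.IH[OF Tu] by blast
 obtain q where q: "\<forall>t. sym i (u\<oplus>t\<odot>v) x (cmt T v) = poly q t" "poly.coeff q 0 = sym i u x (cmt T v)"
  using Suc.IH[OF Tv] by blast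
 let ?r = "Polynomial.smult (1 / real (Suc i)) (p + pCons 0 q)"
 have "sym (Suc i) (u\<oplus>t\<odot>v) x T = poly ?r t" for t
 proof -
  have uv: "u\<oplus>t\<odot>v\<in>U" using assms by (simp add: U_add U_smult)
  have "cmt T (u\<oplus>t\<odot>v) = cmt T u\<oplus>t\<odot>cmt T v" using c by (simp add: cmt_add_right cmt_smult_right)
  thus ?thesis
   using p(1) q(1) sym_add[OF assms(1) uv Tu subspaceD(4)[OF subspace_Pn Tv]] sym_smult[OF assms(1) uv Tv]
   by simp
 qed
 moreover have "poly.coeff ?r 0 = sym (Suc i) u x T" using p(2) by simp
 moreover have "poly.coeff ?r 1 = sym i u x (cmt T v)"
 proof (cases i)
  case 0 thus ?thesis using p q by simp
 next
  case (Suc k)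
  have "sym k u x (cmt (cmt T v) u) = real i * sym i u x (cmt T v)" using Suc by simp
  hence "poly.coeff p 1 = real i * sym i u x (cmt T v)"
   using p(3) Suc cmt_cmt_U[OF c(1) assms(2,3)] by simp
  thus ?thesis using q(2) by (simp add: field_simps)
 qed
 ultimately show ?case by (intro exI[of _ ?r]) simp
qed

text \<open>Identifies the nilpotent part of the graded algebra: a vanishing scalar symbol lowers
  the order by one in the usual filtration \<open>Dn\<close>. By polarization the commutators have
  vanishing symbols too, which drives the induction.\<close>

lemma sym_zero_imp:
 assumes "T\<in>Pn i" "!!u x. u\<in>U ==> x\<in>Omega ==> sym i u x T = 0"
 shows "if i = 0 then T = \<zero> else T\<in>Dn (i - 1)"
 using assms
proof (induction i arbitrary: T)
 case 0
 thus ?case using ev_faithful[of T] U_one by auto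
next
 case (Suc i)
 have T: "T\<in>carrier R" using Suc.prems by simp
 have "if i = 0 then cmt T v = \<zero> else cmt T v\<in>Dn (i - 1)" if v: "v\<in>U" for v
 proof (rule Suc.IH)
  show "cmt T v\<in>Pn i" using Suc.prems v by simp
  fix u x assume u: "u\<in>U" and x: "x\<in>Omega"
  obtain p where p: "\<forall>t. sym (Suc i) (u\<oplus>t\<odot>v) x T = poly p t"
   "poly.coeff p 1 = sym i u x (cmt T v)"
   using sym_polarize[OF x u v Suc.prems(1)] by auto
  have "poly p t = 0" for t using p(1) Suc.prems(2)[OF U_add[OF u U_smult[OF v]] x] by metis
  hence "p = 0" using poly_all_0_iff_0 by blast
  thus "sym i u x (cmt T v) = 0" using p(2) by simp
 qed
 thus ?case using T by (cases i) auto
qed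

end

section \<open>The graded Poisson algebra in terms of representatives\<close>

lemma UN_constant_eq2: "A ~= {} ==> B ~= {} ==> (!!a b. a\<in>A ==> b\<in>B ==> f a b = c) ==> (\<Union>a\<in>A. \<Union>b\<in>B. f a b) = c"
 by auto

context diff_algebra begin

abbreviation symb :: "int => 't => 't set" where "symb \<equiv> symbol R P"
abbreviation "gr \<equiv> gr_part R P"
abbreviation S :: "(int => 't set) poisson_algebra" where "S \<equiv> gr_poisson R P"

lemma symbol_iff: "T\<in>carrier R ==> Z\<in>symb i T \<longleftrightarrow> Z\<in>carrier R \<and> Z\<ominus>T\<in>P (i - 1)"
proof
 assume T: "T\<in>carrier R"
 {
  assume "Z\<in>symb i T"
  then obtain h where h: "h\<in>P (i - 1)" "Z = h\<oplus>T" by (auto simp: symbol_def a_r_coset_def')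
  have hc: "h\<in>carrier R" by (rule P_carrier[OF h(1)])
  have "Z\<ominus>T = h" unfolding h(2) using hc T by algebra
  thus "Z\<in>carrier R \<and> Z\<ominus>T\<in>P (i - 1)" using h hc T by simp
 }
 {
  assume Z: "Z\<in>carrier R \<and> Z\<ominus>T\<in>P (i - 1)"
  hence "Z = (Z\<ominus>T)\<oplus>T" using T by algebra
  thus "Z\<in>symb i T" using Z by (auto simp: symbol_def a_r_coset_def')
 }
qed

lemma symbol_self: "T\<in>carrier R ==> T\<in>symb i T"
 using subspaceD(2)[OF subspace_P] by (simp add: symbol_iff minus_eq r_neg)

lemma symbol_eq_iff:
 assumes "T\<in>carrier R" "D\<in>carrier R"
 shows "symb i T = symb i D \<longleftrightarrow> T\<ominus>D\<in>P (i - 1)"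
proof
 assume "symb i T = symb i D"
 thus "T\<ominus>D\<in>P (i - 1)" using symbol_self[OF assms(1), of i] symbol_iff[OF assms(2)] by simp
next
 assume a: "T\<ominus>D\<in>P (i - 1)"
 have "Z\<ominus>T\<in>P (i - 1) \<longleftrightarrow> Z\<ominus>D\<in>P (i - 1)" if "Z\<in>carrier R" for Z
 proof -
  have "Z\<ominus>D = (Z\<ominus>T)\<oplus>(T\<ominus>D)" "Z\<ominus>T = (Z\<ominus>D)\<ominus>(T\<ominus>D)" using that assms by algebra+
  thus ?thesis using a subspaceD(3,6)[OF subspace_P] by metis
 qed
 thus "symb i T = symb i D"
  by (intro Set.set_eqI) (auto simp: symbol_iff[OF assms(1)] symbol_iff[OF assms(2)])
qed

lemma symbol_eqI: "T\<in>carrier R ==> D\<in>carrier R ==> T\<ominus>D\<in>P (i - 1) ==> symb i T = symb i D"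
 by (simp add: symbol_eq_iff)

lemma minus_telescope: "x\<in>carrier R ==> y\<in>carrier R ==> z\<in>carrier R ==> (x\<ominus>y)\<oplus>(y\<ominus>z) = x\<ominus>z"
 by algebra

lemma symbol_zero: "symb i \<zero> = P (i - 1)"
 using symbol_iff[of \<zero>] P_carrier by (auto simp: minus_eq)

lemma symbol_P: "T\<in>P i ==> Z\<in>symb i T ==> Z\<in>P i"
proof -
 assume T: "T\<in>P i" and Z: "Z\<in>symb i T"
 have c: "T\<in>carrier R" "Z\<in>carrier R" "Z\<ominus>T\<in>P (i - 1)"
  using Z symbol_iff[OF P_carrier[OF T]] P_carrier[OF T] by auto
 hence "Z\<ominus>T\<in>P i" using P_mono[of "i - 1" i] by auto
 moreover have "Z = (Z\<ominus>T)\<oplus>T" using c by algebra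
 ultimately show "Z\<in>P i" using subspaceD(3)[OF subspace_P] T by metis
qed

lemma carrier_gr: "carrier (gr k) = symb k ` P k"
 by (auto simp: gr_part_def A_FactGroup_def' A_RCOSETS_def' a_r_coset_def' symbol_def)

lemma one_gr: "\<one>\<^bsub>gr k\<^esub> = symb k \<zero>"
 by (simp add: gr_part_def A_FactGroup_def' symbol_zero)

lemma mult_gr:
 assumes "T\<in>P k" "D\<in>P k"
 shows "symb k T \<otimes>\<^bsub>gr k\<^esub> symb k D = symb k (T\<oplus>D)"
proof -
 have c: "T\<in>carrier R" "D\<in>carrier R" using assms P_carrier by auto
 have "symb k T \<otimes>\<^bsub>gr k\<^esub> symb k D = (\<Union>a\<in>symb k T. \<Union>b\<in>symb k D. {a\<oplus>b})"
  by (simp add: gr_part_def A_FactGroup_def' set_add_def')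
 also have "\<dots> = symb k (T\<oplus>D)"
 proof (intro Set.set_eqI iffI)
  fix Z assume "Z\<in>(\<Union>a\<in>symb k T. \<Union>b\<in>symb k D. {a\<oplus>b})"
  then obtain a b where ab: "a\<in>symb k T" "b\<in>symb k D" "Z = a\<oplus>b" by auto
  hence h: "a\<in>carrier R" "b\<in>carrier R" "a\<ominus>T\<in>P (k - 1)" "b\<ominus>D\<in>P (k - 1)"
   using symbol_iff c by auto
  have "Z\<ominus>(T\<oplus>D) = (a\<ominus>T)\<oplus>(b\<ominus>D)" unfolding ab(3) using h c by algebra
  thus "Z\<in>symb k (T\<oplus>D)" using h c ab(3) subspaceD(3)[OF subspace_P] by (simp add: symbol_iff)
 next
  fix Z assume "Z\<in>symb k (T\<oplus>D)"
  hence Z: "Z\<in>carrier R" "Z\<ominus>(T\<oplus>D)\<in>P (k - 1)" using symbol_iff c by auto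
  have e: "(Z\<ominus>D)\<ominus>T = Z\<ominus>(T\<oplus>D)" "Z = (Z\<ominus>D)\<oplus>D" using Z c by algebra+
  have "Z\<ominus>D\<in>symb k T" using Z c e by (simp add: symbol_iff)
  thus "Z\<in>(\<Union>a\<in>symb k T. \<Union>b\<in>symb k D. {a\<oplus>b})" using e(2) symbol_self[OF c(2)] by blast
 qed
 finally show ?thesis .
qed

lemma group_gr: "comm_group (gr k)"
proof (rule comm_groupI)
 note sP = subspaceD[OF subspace_P]
 show "x \<otimes>\<^bsub>gr k\<^esub> y\<in>carrier (gr k)"
  if "x\<in>carrier (gr k)" "y\<in>carrier (gr k)" for x y
  using that sP(3) by (auto simp: carrier_gr mult_gr)
 show "\<one>\<^bsub>gr k\<^esub>\<in>carrier (gr k)" using sP(2) by (auto simp: carrier_gr one_gr)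
 show "x \<otimes>\<^bsub>gr k\<^esub> y \<otimes>\<^bsub>gr k\<^esub> z = x \<otimes>\<^bsub>gr k\<^esub> (y \<otimes>\<^bsub>gr k\<^esub> z)"
  if "x\<in>carrier (gr k)" "y\<in>carrier (gr k)" "z\<in>carrier (gr k)" for x y z
  using that sP(1,3) by (auto simp: carrier_gr mult_gr a_assoc)
 show "x \<otimes>\<^bsub>gr k\<^esub> y = y \<otimes>\<^bsub>gr k\<^esub> x"
  if "x\<in>carrier (gr k)" "y\<in>carrier (gr k)" for x y
  using that sP(1) by (auto simp: carrier_gr mult_gr a_comm)
 show "\<one>\<^bsub>gr k\<^esub> \<otimes>\<^bsub>gr k\<^esub> x = x" if "x\<in>carrier (gr k)" for x
  using that sP(1,2) by (auto simp: carrier_gr mult_gr one_gr)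
 show "\<exists>y\<in>carrier (gr k). y \<otimes>\<^bsub>gr k\<^esub> x = \<one>\<^bsub>gr k\<^esub>"
  if x: "x\<in>carrier (gr k)" for x
 proof -
  obtain T where T: "T\<in>P k" "x = symb k T" using x by (auto simp: carrier_gr)
  thus ?thesis using sP(1,5)
   by (intro bexI[of _ "symb k (\<ominus> T)"]) (auto simp: mult_gr one_gr carrier_gr l_neg)
 qed
qed

lemma finprod_gr:
 assumes "finite I" "!!i. i\<in>I ==> g i\<in>P k"
 shows "finprod (gr k) (%i. symb k (g i)) I = symb k (finsum R g I)"
 using assms
proof (induction I rule: finite_induct)
 case empty
 interpret G: comm_group "gr k" by (rule group_gr)
 show ?case by (simp add: one_gr)
next
 case (insert i I)
 interpret G: comm_group "gr k" by (rule group_gr)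
 have "finprod (gr k) (%i. symb k (g i)) (insert i I) =
  symb k (g i) \<otimes>\<^bsub>gr k\<^esub> finprod (gr k) (%i. symb k (g i)) I"
  by (rule G.finprod_insert) (use insert in "auto simp: carrier_gr")
 moreover have "finsum R g (insert i I) = g i\<oplus>finsum R g I"
  by (rule finsum_insert) (use insert P_carrier in auto)
 moreover have "finsum R g I\<in>P k" by (rule subspace_finsum[OF subspace_P]) (use insert in auto)
 ultimately show ?case using insert by (simp add: mult_gr)
qed

text \<open>The operations of \<open>gr_poisson\<close> run over the degrees with nontrivial
  classes, those on representatives over an interval. The additional terms have lower order and are
  neutral in the quotient.\<close>

lemma finprod_gr_subset:
 assumes "finite J" "I\<subseteq>J" "!!i. i\<in>J ==> g i\<in>P k" "!!i. i\<in>J - I ==> g i\<in>P (k - 1)"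
 shows "finprod (gr k) (%i. symb k (g i)) I = symb k (finsum R g J)"
proof -
 interpret G: comm_group "gr k" by (rule group_gr)
 have "finprod (gr k) (%i. symb k (g i)) I = finprod (gr k) (%i. symb k (g i)) J"
 proof (rule G.finprod_mono_neutral_cong_left)
  show "symb k (g i) = \<one>\<^bsub>gr k\<^esub>" if "i\<in>J - I" for i
   unfolding one_gr by (rule symbol_eqI) (use assms(4)[OF that] P_carrier[OF assms(4)[OF that]] in "auto simp: minus_eq")
 qed (use assms carrier_gr in auto)
 thus ?thesis using finprod_gr[OF assms(1,3)] by simp
qed

text \<open>Treats the product (\<open>c = 0\<close>) and the commutator (\<open>c = 1\<close>) at
  once. The last clause is bilinearity in the form that shows independence of
  representatives.\<close>

definition graded_op :: "('t => 't => 't) => int => bool" where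
 "graded_op p c \<longleftrightarrow> (\<forall>i j. \<forall>T\<in>P i. \<forall>D\<in>P j. p T D\<in>P (i + j - c)) \<and> (\<forall>T\<in>carrier R. p T \<zero> = \<zero> \<and> p \<zero> T = \<zero>) \<and>
  (\<forall>a\<in>carrier R. \<forall>b\<in>carrier R. \<forall>T\<in>carrier R. \<forall>D\<in>carrier R. p a b\<ominus>p T D = p a (b\<ominus>D)\<oplus>p (a\<ominus>T) D)"

lemma graded_opD:
 assumes "graded_op p c"
 shows "T\<in>P i ==> D\<in>P j ==> p T D\<in>P (i + j - c)" "T\<in>carrier R ==> p T \<zero> = \<zero>" "T\<in>carrier R ==> p \<zero> T = \<zero>"
  "a\<in>carrier R ==> b\<in>carrier R ==> T\<in>carrier R ==> D\<in>carrier R ==> p a b\<ominus>p T D = p a (b\<ominus>D)\<oplus>p (a\<ominus>T) D"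
 using assms by (auto simp: graded_op_def)

lemma graded_mult: "graded_op (%T D. T\<otimes>D) 0"
proof -
 have "a\<otimes>b\<ominus>T\<otimes>D = a\<otimes>(b\<ominus>D)\<oplus>(a\<ominus>T)\<otimes>D"
  if "a\<in>carrier R" "b\<in>carrier R" "T\<in>carrier R" "D\<in>carrier R" for a b T D using that by algebra
 thus ?thesis using P_mult by (simp add: graded_op_def)
qed

lemma graded_cmt: "graded_op (%T D. cmt T D) 1"
 using P_cmt by (simp add: graded_op_def cmt_minus_right cmt_minus_left minus_telescope)

lemma symbol_smult_eq:
 assumes "T\<in>P i"
 shows "symbol_smult R P i c (symb i T) = symb i (c\<odot>T)"
proof -
 have c: "T\<in>carrier R" using assms P_carrier by auto
 have "symb i (c\<odot>a) = symb i (c\<odot>T)" if "a\<in>symb i T" for a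
 proof -
  have h: "a\<in>carrier R" "a\<ominus>T\<in>P (i - 1)" using that symbol_iff c by auto
  have "c\<odot>a\<ominus>c\<odot>T = c\<odot>(a\<ominus>T)" using h(1) c by (simp add: minus_eq smult_r_distr smult_minus)
  thus ?thesis using h c subspaceD(4)[OF subspace_P] by (intro symbol_eqI) auto
 qed
 hence "(\<Union>a\<in>symb i T. symb i (c\<odot>a)) = (\<Union>a\<in>symb i T. symb i (c\<odot>T))" by (rule SUP_cong[OF refl])
 also have "\<dots> = symb i (c\<odot>T)" using symbol_self[OF c, of i] by blast
 finally show ?thesis unfolding symbol_smult_def .
qed

text \<open>Families of operators stand for elements of the graded algebra. Representatives are
  zero, not merely of lower order, outside finitely many degrees, and in negative degrees they are
  zero automatically.\<close>

definition fam :: "(int => 't) set" where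
 "fam = {T. (\<forall>i. T i\<in>P i) \<and> finite {i. T i ~= \<zero>}}"

definition cls :: "(int => 't) => int => 't set" where
 "cls T = (%i. symb i (T i))"

definition conv :: "(int => 't) => (int => 't) => int => 't" where
 "conv T D k = (\<Oplus>i\<in>{0..k}. T i\<otimes>D (k - i))"

definition brk :: "(int => 't) => (int => 't) => int => 't" where
 "brk T D k = (\<Oplus>i\<in>{0..k + 1}. cmt (T i) (D (k + 1 - i)))"

definition emb :: "int => 't => int => 't" where
 "emb i T = (%j. if j = i then T else \<zero>)"

lemma famD: "T\<in>fam ==> T i\<in>P i" "T\<in>fam ==> T i\<in>carrier R"
 "T\<in>fam ==> finite {i. T i ~= \<zero>}" "T\<in>fam ==> i < 0 ==> T i = \<zero>"
proof -
 show "T\<in>fam ==> T i\<in>P i" "T\<in>fam ==> finite {i. T i ~= \<zero>}" for T by (auto simp: fam_def)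
 thus "T\<in>fam ==> T i\<in>carrier R" using P_carrier by blast
 assume "T\<in>fam" "i < 0"
 moreover have "T i\<in>P i" using \<open>T\<in>fam\<close> by (auto simp: fam_def)
 ultimately show "T i = \<zero>" by (simp add: P_def)
qed

lemma emb_fam: "T\<in>P i ==> emb i T\<in>fam"
proof -
 have "{j. emb i T j ~= \<zero>}\<subseteq>{i}" by (auto simp: emb_def)
 hence "finite {j. emb i T j ~= \<zero>}" using finite_subset by blast
 thus "T\<in>P i ==> emb i T\<in>fam" using subspaceD(2)[OF subspace_P] by (auto simp: fam_def emb_def)
qed

lemma cls_eq_iff:
 "T\<in>fam ==> D\<in>fam ==> cls T = cls D \<longleftrightarrow> (\<forall>i. T i\<ominus>D i\<in>P (i - 1))"
 by (auto simp: cls_def fun_eq_iff symbol_eq_iff famD(2))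

lemma carrier_S: "carrier S = cls ` fam"
proof -
 have g: "group (gr i)" for i using group_gr comm_group.axioms(2) by blast
 have c: "carrier S = {x\<in>\<Pi>\<^sub>E i\<in>UNIV. carrier (gr i). finite {i\<in>UNIV. x i ~= \<one>\<^bsub>gr i\<^esub>}}"
  by (simp only: gr_poisson_def partial_object.simps carrier_sum_group[OF g])
 show ?thesis
 proof (intro equalityI subsetI)
  fix x assume "x\<in>carrier S"
  hence x: "!!i. x i\<in>symb i ` P i" "finite {i. x i ~= symb i \<zero>}"
   unfolding c by (auto simp: carrier_gr one_gr PiE_iff)
  \<comment> \<open>Trivial classes get the representative 0, so that finiteness of the support
    passes from classes to operators.\<close>
  have "\<exists>T\<in>P i. x i = symb i T \<and> (x i = symb i \<zero> --> T = \<zero>)" for i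
   using x(1)[of i] subspaceD(2)[OF subspace_P] by (cases "x i = symb i \<zero>") auto
  then obtain T where T: "!!i. T i\<in>P i" "!!i. x i = symb i (T i)" "!!i. x i = symb i \<zero> --> T i = \<zero>" by metis
  have "{i. T i ~= \<zero>}\<subseteq>{i. x i ~= symb i \<zero>}" using T(3) by auto
  hence "T\<in>fam" using T(1) x(2) finite_subset by (auto simp: fam_def)
  moreover have "x = cls T" using T(2) by (auto simp: cls_def)
  ultimately show "x\<in>cls ` fam" by blast
 next
  fix x assume "x\<in>cls ` fam"
  then obtain T where T: "T\<in>fam" "x = cls T" by blast
  have "{i. cls T i ~= symb i \<zero>}\<subseteq>{i. T i ~= \<zero>}" by (auto simp: cls_def)
  hence "finite {i. cls T i ~= symb i \<zero>}" using famD(3)[OF T(1)] finite_subset by blast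
  thus "x\<in>carrier S" unfolding c T(2) using famD(1)[OF T(1)] by (auto simp: carrier_gr one_gr cls_def)
 qed
qed

lemma cls_carrier: "T\<in>fam ==> cls T\<in>carrier S" by (simp add: carrier_S)

lemma add_fam: "T\<in>fam ==> D\<in>fam ==> (%i. T i\<oplus>D i)\<in>fam"
proof -
 assume a: "T\<in>fam" "D\<in>fam"
 have "{i. T i\<oplus>D i ~= \<zero>}\<subseteq>{i. T i ~= \<zero>}\<union>{i. D i ~= \<zero>}" by auto
 hence "finite {i. T i\<oplus>D i ~= \<zero>}" using famD(3) a by (meson finite_UnI finite_subset)
 thus ?thesis using a subspaceD(3)[OF subspace_P] by (auto simp: fam_def)
qed

lemma add_S: "T\<in>fam ==> D\<in>fam ==> cls T \<oplus>\<^bsub>S\<^esub> cls D = cls (%i. T i\<oplus>D i)"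
 by (auto simp: gr_poisson_def cls_def mult_gr famD)

lemma zero_fam: "(%_. \<zero>)\<in>fam" using subspaceD(2)[OF subspace_P] by (simp add: fam_def)

lemma zero_S: "\<zero>\<^bsub>S\<^esub> = cls (%_. \<zero>)"
 by (auto simp: gr_poisson_def cls_def one_gr)

lemma smult_fam: "T\<in>fam ==> (%i. c\<odot>T i)\<in>fam"
proof -
 assume a: "T\<in>fam"
 have "{i. c\<odot>T i ~= \<zero>}\<subseteq>{i. T i ~= \<zero>}" by auto
 hence "finite {i. c\<odot>T i ~= \<zero>}" using famD(3) a by (meson finite_subset)
 thus ?thesis using a subspaceD(4)[OF subspace_P] by (auto simp: fam_def)
qed

lemma smult_S: "T\<in>fam ==> c \<odot>\<^bsub>S\<^esub> cls T = cls (%i. c\<odot>T i)"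
 by (auto simp: gr_poisson_def cls_def symbol_smult_eq famD)

lemma one_P: "\<one>\<in>P 0" using U_one by (simp add: P_def)

lemma one_S: "\<one>\<^bsub>S\<^esub> = cls (emb 0 \<one>)"
 by (rule ext) (simp add: gr_poisson_def cls_def one_gr emb_def)

definition prd :: "('t => 't => 't) => int => (int => 't) => (int => 't) => int => 't" where
 "prd p c T D k = (\<Oplus>i\<in>{0..k + c}. p (T i) (D (k + c - i)))"

lemma conv_prd: "conv = prd (%T D. T\<otimes>D) 0" and brk_prd: "brk = prd (%T D. cmt T D) 1"
 by (simp_all add: fun_eq_iff conv_def brk_def prd_def)

lemma prd_closed: "graded_op p c ==> T\<in>fam ==> D\<in>fam ==> p (T i) (D (k + c - i))\<in>P k"
 using graded_opD(1)[of p c "T i" i "D (k + c - i)" "k + c - i"] famD(1) by simp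

lemma prd_fam:
 assumes p: "graded_op p c" and T: "T\<in>fam" and D: "D\<in>fam" shows "prd p c T D\<in>fam"
proof -
 have "{k. prd p c T D k ~= \<zero>}\<subseteq>(%(i, j). i + j - c) ` ({i. T i ~= \<zero>}\<times>{i. D i ~= \<zero>})"
 proof
  fix k assume "k\<in>{k. prd p c T D k ~= \<zero>}"
  then obtain i where "p (T i) (D (k + c - i)) ~= \<zero>"
   using subspace_finsum[OF subspace_zero, of "{0..k + c}" "%i. p (T i) (D (k + c - i))"] unfolding prd_def by blast
  hence "T i ~= \<zero>" "D (k + c - i) ~= \<zero>" using graded_opD(2,3)[OF p] famD(2)[OF T] famD(2)[OF D] by metis+
  thus "k\<in>(%(i, j). i + j - c) ` ({i. T i ~= \<zero>}\<times>{i. D i ~= \<zero>})"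
   by (intro image_eqI[of _ _ "(i, k + c - i)"]) auto
 qed
 hence "finite {k. prd p c T D k ~= \<zero>}"
  by (rule finite_subset[OF _ finite_imageI[OF finite_cartesian_product[OF famD(3)[OF T] famD(3)[OF D]]]])
 moreover have "prd p c T D k\<in>P k" for k unfolding prd_def by (rule subspace_finsum[OF subspace_P prd_closed[OF p T D]])
 ultimately show ?thesis by (simp add: fam_def)
qed

lemmas conv_fam = prd_fam[OF graded_mult, folded conv_prd] and brk_fam = prd_fam[OF graded_cmt, folded brk_prd]

lemma cls_nontrivial: "T\<in>fam ==> cls T i = \<one>\<^bsub>gr i\<^esub> ==> T i\<in>P (i - 1)"
 using symbol_eq_iff[of "T i" \<zero> i] famD(2)[of T i] by (simp add: cls_def one_gr minus_eq)

text \<open>Another choice of representatives changes the result only in lower order, and the sum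
  over nontrivial classes is completed to an interval by negligible terms.\<close>

lemma prd_cls:
 assumes p: "graded_op p c" and T: "T\<in>fam" and D: "D\<in>fam"
 shows "finprod (gr k) (%i. \<Union>a\<in>cls T i. \<Union>b\<in>cls D (k + c - i). symb k (p a b))
  {i. cls T i ~= \<one>\<^bsub>gr i\<^esub> \<and> cls D (k + c - i) ~= \<one>\<^bsub>gr (k + c - i)\<^esub>} = symb k (prd p c T D k)"
  (is "finprod _ _ ?I = _")
proof -
 note c = famD(2)[OF T] famD(2)[OF D]
 have "(\<Union>a\<in>cls T i. \<Union>b\<in>cls D j. symb k (p a b)) = symb k (p (T i) (D j))" if j: "j = k + c - i" for i j
 proof (rule UN_constant_eq2)
  show "cls T i ~= {}" "cls D j ~= {}" using symbol_self[OF c(1), of i i] symbol_self[OF c(2), of j j] by (auto simp: cls_def)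
  fix a b assume "a\<in>cls T i" "b\<in>cls D j"
  hence h: "a\<in>carrier R" "b\<in>carrier R" "a\<ominus>T i\<in>P (i - 1)" "b\<ominus>D j\<in>P (j - 1)" "a\<in>P i" "b\<in>P j"
   using symbol_iff[OF c(1)[of i]] symbol_iff[OF c(2)[of j]] symbol_P[OF famD(1)[OF T, of i]] symbol_P[OF famD(1)[OF D, of j]]
   by (simp_all add: cls_def)
  have "p a (b\<ominus>D j)\<in>P (k - 1)" "p (a\<ominus>T i) (D j)\<in>P (k - 1)"
   using graded_opD(1)[OF p h(5,4)] graded_opD(1)[OF p h(3) famD(1)[OF D, of j]] by (simp_all add: j algebra_simps)
  thus "symb k (p a b) = symb k (p (T i) (D j))"
   using P_carrier[OF graded_opD(1)[OF p h(5,6)]] P_carrier[OF graded_opD(1)[OF p famD(1)[OF T, of i] famD(1)[OF D, of j]]]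
    graded_opD(4)[OF p h(1,2) c] subspaceD(3)[OF subspace_P] by (intro symbol_eqI) simp_all
 qed
 hence "finprod (gr k) (%i. \<Union>a\<in>cls T i. \<Union>b\<in>cls D (k + c - i). symb k (p a b)) ?I =
  finprod (gr k) (%i. symb k (p (T i) (D (k + c - i)))) ?I" by simp
 also have "\<dots> = symb k (prd p c T D k)"
  unfolding prd_def
 proof (rule finprod_gr_subset)
  show "?I\<subseteq>{0..k + c}"
  proof
   fix i assume "i\<in>?I"
   hence "T i ~= \<zero>" "D (k + c - i) ~= \<zero>" by (auto simp: cls_def one_gr)
   thus "i\<in>{0..k + c}" using famD(4)[OF T, of i] famD(4)[OF D, of "k + c - i"] by force
  qed
  show "p (T i) (D (k + c - i))\<in>P k" for i by (rule prd_closed[OF p T D])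
  show "p (T i) (D (k + c - i))\<in>P (k - 1)" if i: "i\<in>{0..k + c} - ?I" for i
  proof -
   have "T i\<in>P (i - 1) \<or> D (k + c - i)\<in>P (k + c - i - 1)"
    using i cls_nontrivial[OF T, of i] cls_nontrivial[OF D, of "k + c - i"] by blast
   thus ?thesis
    using graded_opD(1)[OF p _ famD(1)[OF D], of "T i" "i - 1" "k + c - i"] graded_opD(1)[OF p famD(1)[OF T], of "D (k + c - i)" "k + c - i - 1" i]
    by (auto simp: algebra_simps)
  qed
 qed simp
 finally show ?thesis .
qed

lemma mult_S: "T\<in>fam ==> D\<in>fam ==> cls T \<otimes>\<^bsub>S\<^esub> cls D = cls (conv T D)"
 using prd_cls[OF graded_mult] by (auto simp: gr_poisson_def symbol_mult_def conv_prd cls_def[of "prd _ _ _ _"])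

lemma bracket_S: "T\<in>fam ==> D\<in>fam ==> bracket S (cls T) (cls D) = cls (brk T D)"
 using prd_cls[OF graded_cmt] by (auto simp: gr_poisson_def symbol_bracket_def brk_prd cls_def[of "prd _ _ _ _"])

lemma finsum_only:
 assumes "finite I" "i\<in>I" "!!j. j\<in>I ==> g j\<in>carrier R" "!!j. j\<in>I ==> j ~= i ==> g j = \<zero>"
 shows "finsum R g I = g i"
proof -
 have "finsum R g (insert i (I - {i})) = g i\<oplus>finsum R g (I - {i})"
  by (rule finsum_insert) (use assms in auto)
 moreover have "finsum R g (I - {i})\<in>{\<zero>}" by (rule subspace_finsum[OF subspace_zero]) (use assms in auto)
 ultimately show ?thesis using assms(2) assms(3)[OF assms(2)] by (simp add: insert_absorb)
qed

lemma prd_emb: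
 assumes p: "graded_op p c" and T: "T\<in>P i" "0\<le>i" and D: "D\<in>fam" shows "prd p c (emb i T) D k = p T (D (k + c - i))"
proof -
 have c: "p (emb i T j) (D (k + c - j))\<in>carrier R" for j by (rule P_carrier[OF prd_closed[OF p emb_fam[OF T(1)] D]])
 have z: "p (emb i T j) (D (k + c - j)) = \<zero>" if "j ~= i" for j
  using that graded_opD(3)[OF p famD(2)[OF D]] by (simp add: emb_def)
 show ?thesis
 proof (cases "i\<le>k + c")
  case True
  have "prd p c (emb i T) D k = p (emb i T i) (D (k + c - i))" unfolding prd_def
   by (rule finsum_only) (use T c z True in auto)
  thus ?thesis by (simp add: emb_def)
 next
  case False
  have "prd p c (emb i T) D k\<in>{\<zero>}" unfolding prd_def
   by (rule subspace_finsum[OF subspace_zero]) (use False z in auto)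
  thus ?thesis using famD(4)[OF D, of "k + c - i"] False graded_opD(2)[OF p P_carrier[OF T(1)]] by simp
 qed
qed

lemma conv_emb: "T\<in>P i ==> D\<in>fam ==> 0\<le>i ==> conv (emb i T) D k = T\<otimes>D (k - i)"
 and brk_emb_1: "T\<in>P 1 ==> D\<in>fam ==> brk (emb 1 T) D k = cmt T (D k)"
 by (simp_all add: conv_prd brk_prd prd_emb[OF graded_mult] prd_emb[OF graded_cmt])

lemma int_intervals: "{0..1 :: int} = {0, 1}" "{0..2 :: int} = {0, 1, 2}" by auto

lemma prd_low:
 assumes "T\<in>fam" "D\<in>fam"
 shows "conv T D 0 = T 0\<otimes>D 0" "D 0 = \<zero> ==> conv T D 1 = T 0\<otimes>D 1"
  "T 0 = \<zero> ==> D 0 = \<zero> ==> brk T D 0 = \<zero>" "T 0 = \<zero> ==> D 0 = \<zero> ==> brk T D 1 = cmt (T 1) (D 1)"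
 using famD(2)[OF assms(1)] famD(2)[OF assms(2)] by (simp_all add: conv_def brk_def int_intervals)

lemma conv_one: assumes T: "T\<in>fam" shows "conv T (emb 0 \<one>) = T"
proof
 fix k
 show "conv T (emb 0 \<one>) k = T k"
 proof (cases "k < 0")
  case True thus ?thesis using famD(4)[OF T] by (simp add: conv_def)
 next
  case False
  hence "conv T (emb 0 \<one>) k = T k\<otimes>emb 0 \<one> (k - k)" unfolding conv_def
   by (intro finsum_only) (use famD(2)[OF T] in "auto simp: emb_def")
  thus ?thesis using famD(2)[OF T] by (simp add: emb_def)
 qed
qed

lemma sym_finsum:
 assumes "x\<in>Omega" "u\<in>U" "!!i. i\<in>I ==> g i\<in>Pn k" "finite I"
 shows "sym k u x (finsum R g I) = (\<Sum>i\<in>I. sym k u x (g i))"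
 using assms(4,3)
proof (induction I rule: finite_induct)
 case empty thus ?case by (simp add: sym_zero[OF assms(1,2)])
next
 case (insert i I)
 have "finsum R g (insert i I) = g i\<oplus>finsum R g I"
  by (rule finsum_insert) (use insert Pn_carrier in auto)
 moreover have "finsum R g I\<in>Pn k" by (rule subspace_finsum[OF subspace_Pn]) (use insert in auto)
 ultimately show ?case using insert sym_add[OF assms(1,2)] by simp
qed

text \<open>For fixed \<open>u\<close> and \<open>x\<close> the symbols of a family are the
  coefficients of a real polynomial, and the graded product becomes the product of
  polynomials.\<close>

lemma sym_conv:
 assumes "x\<in>Omega" "u\<in>U" "T\<in>fam" "D\<in>fam"
 shows "sym k u x (conv T D (int k)) = (\<Sum>i\<le>k. sym i u x (T (int i)) * sym (k - i) u x (D (int (k - i))))"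
proof -
 have P: "T (int i)\<in>Pn i" "D (int i)\<in>Pn i" for i
  using famD(1)[OF assms(3), of "int i"] famD(1)[OF assms(4), of "int i"] by (simp_all add: P_def)
 have m: "T i\<otimes>D (int k - i)\<in>Pn k \<and> sym k u x (T i\<otimes>D (int k - i)) =
   sym (nat i) u x (T i) * sym (k - nat i) u x (D (int k - i))" if "i\<in>{0..int k}" for i
 proof -
  have e: "int (nat i) = i" "int (k - nat i) = int k - i" "nat i + (k - nat i) = k" using that by auto
  show ?thesis using Pn_mult[OF e(3) P(1) P(2)] sym_mult[OF e(3) assms(1,2) P(1) P(2)] unfolding e by simp
 qed
 have "sym k u x (conv T D (int k)) = (\<Sum>i\<in>{0..int k}. sym k u x (T i\<otimes>D (int k - i)))"
  unfolding conv_def by (rule sym_finsum[OF assms(1,2)]) (use m in auto)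
 also have "\<dots> = (\<Sum>i\<in>{0..int k}. sym (nat i) u x (T i) * sym (k - nat i) u x (D (int k - i)))"
  by (rule sum.cong) (use m in auto)
 also have "\<dots> = (\<Sum>i\<le>k. sym i u x (T (int i)) * sym (k - i) u x (D (int (k - i))))"
  by (rule sum.reindex_bij_witness[of _ int nat]) (auto simp: of_nat_diff)
 finally show ?thesis .
qed

end

lemma poly_with_coeffs:
 fixes a :: "nat => real"
 assumes "finite {i. a i ~= 0}"
 obtains p where "!!i. poly.coeff p i = a i"
proof -
 let ?p = "\<Sum>i\<in>{i. a i ~= 0}. Polynomial.monom (a i) i"
 have "poly.coeff ?p j = a j" for j
 proof -
  have "poly.coeff ?p j = (\<Sum>i\<in>{i. a i ~= 0}. if i = j then a i else 0)" by (simp add: coeff_sum)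
  thus ?thesis by (simp add: sum.delta[OF assms])
 qed
 thus ?thesis by (rule that)
qed

text \<open>The sequences are coefficients of two polynomials with product 1, and the units of R[X]
  are constants.\<close>

lemma convolution_unit:
 fixes a :: "nat => real"
 assumes "finite {i. a i ~= 0}" "finite {i. b i ~= 0}"
  "!!k. (\<Sum>i\<le>k. a i * b (k - i)) = (if k = 0 then 1 else 0)"
 shows "i > 0 ==> a i = 0"
proof -
 obtain p where p: "!!i. poly.coeff p i = a i" by (rule poly_with_coeffs[OF assms(1)]) blast
 obtain q where q: "!!i. poly.coeff q i = b i" by (rule poly_with_coeffs[OF assms(2)]) blast
 have "p * q = 1" by (rule poly_eqI) (use assms(3) in "simp add: coeff_mult p q")
 hence "Polynomial.degree p = 0"
  by (metis Polynomial.degree_1 add_is_0 degree_mult_eq mult_zero_left mult_zero_right zero_neq_one)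
 thus "i > 0 ==> a i = 0" using p coeff_eq_0 by metis
qed

text \<open>Holds since R[X] has no nilpotent elements.\<close>

lemma convolution_square:
 fixes a :: "nat => real"
 assumes "finite {i. a i ~= 0}" "!!k. (\<Sum>i\<le>k. a i * a (k - i)) = 0"
 shows "a i = 0"
proof -
 obtain p where p: "!!i. poly.coeff p i = a i" by (rule poly_with_coeffs[OF assms(1)]) blast
 have "p * p = 0" by (rule poly_eqI) (use assms(2) in "simp add: coeff_mult p")
 thus ?thesis using p by (metis coeff_0 mult_eq_0_iff)
qed

context diff_algebra begin

lemma sym_fam_finite:
 assumes "x\<in>Omega" "u\<in>U" "T\<in>fam" shows "finite {i. sym i u x (T (int i)) ~= 0}"
proof -
 have "{i. sym i u x (T (int i)) ~= 0}\<subseteq>nat ` {i. T i ~= \<zero>}"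
  using sym_zero[OF assms(1,2)] by (force intro: image_eqI[of _ nat "int _"])
 thus ?thesis using famD(3)[OF assms(3)] finite_subset by blast
qed

lemma sym_cls_cong:
 assumes "x\<in>Omega" "u\<in>U" "T\<in>fam" "D\<in>fam" "cls T = cls D"
 shows "sym i u x (T (int i)) = sym i u x (D (int i))"
proof (rule sym_cong[OF assms(1,2)])
 show "T (int i)\<in>Pn i" "D (int i)\<in>Pn i"
  using famD(1)[OF assms(3), of "int i"] famD(1)[OF assms(4), of "int i"] by (simp_all add: P_def)
 show "T (int i)\<ominus>D (int i)\<in>P (int i - 1)" using assms(5) cls_eq_iff[OF assms(3,4)] by blast
qed

lemma unit_sym_zero:
 assumes "T\<in>fam" "D\<in>fam" "cls T \<otimes>\<^bsub>S\<^esub> cls D = \<one>\<^bsub>S\<^esub>" "x\<in>Omega" "u\<in>U" "i > 0"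
 shows "sym i u x (T (int i)) = 0"
proof (rule convolution_unit[OF sym_fam_finite[OF assms(4,5,1)] sym_fam_finite[OF assms(4,5,2)] _ assms(6)])
 fix k
 have "cls (conv T D) = cls (emb 0 \<one>)" using assms(3) mult_S[OF assms(1,2)] one_S by simp
 hence "sym k u x (conv T D (int k)) = sym k u x (emb 0 \<one> (int k))"
  by (rule sym_cls_cong[OF assms(4,5) conv_fam[OF assms(1,2)] emb_fam[OF one_P]])
 thus "(\<Sum>i\<le>k. sym i u x (T (int i)) * sym (k - i) u x (D (int (k - i)))) = (if k = 0 then 1 else 0)"
  using sym_conv[OF assms(4,5,1,2), of k] sym_zero[OF assms(4,5)] by (auto simp: emb_def ev_one assms(4))
qed

text \<open>Symbols take values in a reduced ring, so those of a square-zero element vanish in all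
  degrees. By \<open>sym_zero_imp\<close> its part of degree \<open>Suc k\<close> is then an
  operator of usual order \<open>k\<close>: operators that are not visible to scalar symbols are
  singled out by the algebra alone.\<close>

lemma square_zero_imp:
 assumes "T\<in>fam" "cls T \<otimes>\<^bsub>S\<^esub> cls T = \<zero>\<^bsub>S\<^esub>"
 shows "T 0 = \<zero>" "T (int (Suc k))\<in>Dn k"
proof -
 have s: "sym i u x (T (int i)) = 0" if "x\<in>Omega" "u\<in>U" for i x u
 proof (rule convolution_square[OF sym_fam_finite[OF that assms(1)]])
  fix k
  have "cls (conv T T) = cls (%_. \<zero>)" using assms(2) mult_S[OF assms(1,1)] zero_S by simp
  hence "sym k u x (conv T T (int k)) = sym k u x \<zero>"
   using sym_cls_cong[OF that conv_fam[OF assms(1,1)] zero_fam] by blast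
  thus "(\<Sum>i\<le>k. sym i u x (T (int i)) * sym (k - i) u x (T (int (k - i)))) = 0"
   using sym_conv[OF that assms(1,1), of k] sym_zero[OF that] by simp
 qed
 have P: "T (int i)\<in>Pn i" for i using famD(1)[OF assms(1), of "int i"] by (simp add: P_def)
 show "T 0 = \<zero>" using sym_zero_imp[OF P[of 0] s] by simp
 show "T (int (Suc k))\<in>Dn k" using sym_zero_imp[OF P[of "Suc k"] s] by simp
qed

lemma square_zero_family:
 assumes T: "T\<in>fam" "T 0 = \<zero>" "!!k. T (int (Suc k))\<in>Dn k"
 shows "cls T \<otimes>\<^bsub>S\<^esub> cls T = \<zero>\<^bsub>S\<^esub>"
proof -
 have p: "T i\<otimes>T (k - i)\<in>P (k - 1)" for i k
 proof (cases "i\<ge>1 \<and> k - i\<ge>1")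
  case True
  define m n where "m = nat (i - 1)" and "n = nat (k - i - 1)"
  have e: "i = int (Suc m)" "k - i = int (Suc n)" "k - 1 = int (Suc (m + n))" using True by (auto simp: m_def n_def)
  \<comment> \<open>The product has usual order \<open>m + n\<close>, hence lies in
    \<open>Pn (Suc (m + n))\<close>, one below its nominal degree \<open>m + n + 2\<close>.\<close>
  have "T (int (Suc m))\<otimes>T (int (Suc n))\<in>Dn (m + n)" by (rule Dn_mult[OF refl T(3) T(3)])
  hence "T i\<otimes>T (k - i)\<in>Pn (Suc (m + n))" unfolding e(1,2)[symmetric] using Dn_le_Pn by blast
  thus ?thesis unfolding e(3) P_def by (simp del: of_nat_Suc of_nat_add Pn.simps)
 next
  case False
  hence "i < 0 \<or> i = 0 \<or> k - i < 0 \<or> k - i = 0" by linarith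
  hence "T i = \<zero> \<or> T (k - i) = \<zero>" using T(2) famD(4)[OF T(1)] by metis
  thus ?thesis using famD(2)[OF T(1)] subspaceD(2)[OF subspace_P] by auto
 qed
 have "cls (conv T T) = cls (%_. \<zero>)"
  unfolding cls_eq_iff[OF conv_fam[OF T(1,1)] zero_fam]
 proof
  fix k
  have c: "conv T T k\<in>P (k - 1)" unfolding conv_def by (rule subspace_finsum[OF subspace_P p])
  thus "conv T T k\<ominus>\<zero>\<in>P (k - 1)" using P_carrier[OF c] by (simp add: minus_eq)
 qed
 thus ?thesis using mult_S[OF T(1,1)] zero_S by simp
qed

lemma emb_square_zero:
 assumes "T\<in>Dn 0" shows "cls (emb 1 T) \<otimes>\<^bsub>S\<^esub> cls (emb 1 T) = \<zero>\<^bsub>S\<^esub>"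
proof (rule square_zero_family)
 show "emb 1 T\<in>fam" by (rule emb_fam) (use subsetD[OF Dn_le_Pn assms] in "simp add: P_def del: Pn.simps")
 show "emb 1 T (int (Suc k))\<in>Dn k" for k
  using assms subspaceD(2)[OF subspace_Dn] by (cases k) (auto simp: emb_def)
qed (simp add: emb_def)

end

section \<open>Isomorphisms of the graded Poisson algebras\<close>

context diff_algebra begin

lemma U_eqI: "u\<in>U ==> v\<in>U ==> (!!x. x\<in>Omega ==> ev x u = ev x v) ==> u = v"
proof -
 assume u: "u\<in>U" and v: "v\<in>U" and e: "!!x. x\<in>Omega ==> ev x u = ev x v"
 have "u\<oplus>(-1)\<odot>v = \<zero>"
  by (rule ev_faithful) (use u v e in "auto simp: U_add U_smult ev_add ev_smult")
 hence "u\<ominus>v = \<zero>" using v by (simp add: smult_minus_one minus_eq)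
 thus "u = v" using u v by simp
qed

lemma cls_eq_0: "T\<in>fam ==> D\<in>fam ==> cls T = cls D ==> T 0 = D 0"
 using cls_eq_iff[of T D] famD(2)[of T 0] famD(2)[of D 0] by (auto simp: P_def dest!: spec[of _ 0])

lemma cls_eq_1: "T\<in>fam ==> D\<in>fam ==> cls T = cls D ==> T 1\<ominus>D 1\<in>U"
 using cls_eq_iff[of T D] by (auto simp: P_def dest!: spec[of _ 1])

lemma U_P0: "u\<in>U ==> u\<in>P 0" by (simp add: P_def)

lemma K_P1: "T\<in>Dn 0 ==> T\<in>P 1"
 using subsetD[OF Dn_le_Pn, of T 0] by (simp add: P_def del: Pn.simps)

lemma K_carrier: "T\<in>Dn 0 ==> T\<in>carrier R" by simp

lemma U_K: "u\<in>U ==> u\<in>Dn 0" by simp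

lemma K_mult: "T\<in>Dn 0 ==> D\<in>Dn 0 ==> T\<otimes>D\<in>Dn 0"
 using Dn_mult[of 0 0 0 T D] by (simp del: Dn.simps)

lemma K_cmt: "T\<in>Dn 0 ==> D\<in>Dn 0 ==> cmt T D\<in>Dn 0"
 unfolding commutator_def by (intro subspaceD(6)[OF subspace_Dn] K_mult)

lemma emb_fam_K: "T\<in>Dn 0 ==> emb 1 T\<in>fam" by (rule emb_fam[OF K_P1])
lemma emb_fam_U: "u\<in>U ==> emb 0 u\<in>fam" by (rule emb_fam[OF U_P0])

definition casimir :: "'i set => ('i => 't) => ('i => 't) => 't => 't" where
 "casimir I e f T = (\<Oplus>i\<in>I. cmt (e i) (cmt (f i) T))"

lemma finsum_cmt:
 assumes "finite I" "!!i. i\<in>I ==> g i\<in>carrier R" "u\<in>carrier R"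
 shows "cmt (finsum R g I) u = (\<Oplus>i\<in>I. cmt (g i) u)"
 using assms(1,2)
proof (induction I rule: finite_induct)
 case empty thus ?case using assms(3) by simp
next
 case (insert i I)
 have "finsum R g I\<in>carrier R" using insert by (intro finsum_closed) auto
 thus ?case using insert assms(3) by (simp add: cmt_add_left Pi_def)
qed

text \<open>\<open>e i\<close> and \<open>f i\<close> commute with \<open>U\<close>, so the Casimir
  sum commutes with taking brackets with \<open>U\<close>. An identity known for endomorphism fields
  modulo functions thus climbs to all orders.\<close>

lemma casimir_Dn:
 assumes fin: "finite I" and ef: "!!i. i\<in>I ==> e i\<in>Dn 0" "!!i. i\<in>I ==> f i\<in>Dn 0" and b: "b\<in>U"
  and K: "!!a. a\<in>Dn 0 ==> casimir I e f a\<ominus>b\<otimes>a\<in>U"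
 shows "T\<in>Dn m ==> casimir I e f T\<ominus>b\<otimes>T\<in>Pn m"
proof (induction m arbitrary: T)
 case 0 thus ?case using K by simp
next
 case (Suc m)
 have c: "T\<in>carrier R" "b\<in>carrier R" using Suc.prems b by auto
 have efc: "e i\<in>carrier R" "f i\<in>carrier R" "!!u. u\<in>U ==> cmt (e i) u = \<zero>" "!!u. u\<in>U ==> cmt (f i) u = \<zero>"
  if "i\<in>I" for i using ef that by auto
 have cc: "casimir I e f Z\<in>carrier R" if "Z\<in>carrier R" for Z
  unfolding casimir_def using efc that by (intro finsum_closed) auto
 have "cmt (casimir I e f T\<ominus>b\<otimes>T) u = casimir I e f (cmt T u)\<ominus>b\<otimes>cmt T u" if u: "u\<in>U" for u
 proof -
  have uc: "u\<in>carrier R" using u by simp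
  have 1: "cmt (cmt (e i) (cmt (f i) T)) u = cmt (e i) (cmt (f i) (cmt T u))" if i: "i\<in>I" for i
  proof -
   have "cmt (cmt (f i) T) u = cmt (f i) (cmt T u)"
    using cmt_jacobi[of "f i" T u] efc[OF i] u c by simp
   thus ?thesis using cmt_jacobi[of "e i" "cmt (f i) T" u] efc[OF i] u c by simp
  qed
  have "cmt (casimir I e f T) u = (\<Oplus>i\<in>I. cmt (cmt (e i) (cmt (f i) T)) u)"
   unfolding casimir_def by (rule finsum_cmt[OF fin]) (use efc c u in auto)
  also have "\<dots> = casimir I e f (cmt T u)"
   unfolding casimir_def by (rule finsum_cong') (use 1 efc c u in auto)
  finally have "cmt (casimir I e f T) u = casimir I e f (cmt T u)" .
  moreover have "cmt (b\<otimes>T) u = b\<otimes>cmt T u"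
   using cmt_mult_left[of b T u] u b c by simp
  ultimately show ?thesis using cmt_minus_left[of "casimir I e f T" "b\<otimes>T" u] cc[OF c(1)] c uc by simp
 qed
 thus ?case using Suc cc[OF c(1)] c by auto
qed

text \<open>The errors left by \<open>casimir_Dn\<close> have lower order and disappear in the
  graded algebra: on square-zero elements the Casimir sum is exactly multiplication by
  \<open>b\<close>.\<close>

lemma casimir_family:
 assumes fin: "finite I" and ef: "!!i. i\<in>I ==> e i\<in>Dn 0" "!!i. i\<in>I ==> f i\<in>Dn 0" and b: "b\<in>U"
  and K: "!!a. a\<in>Dn 0 ==> casimir I e f a\<ominus>b\<otimes>a\<in>U"
  and G: "G\<in>fam" "G 0 = \<zero>" "!!k. G (int (Suc k))\<in>Dn k" and C: "(%k. casimir I e f (G k))\<in>fam"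
 shows "cls (%k. casimir I e f (G k)) = cls (conv (emb 0 b) G)"
proof -
 have cz: "casimir I e f \<zero>\<in>{\<zero>}" unfolding casimir_def
  by (rule subspace_finsum[OF subspace_zero]) (use ef in auto)
 show ?thesis
  unfolding cls_eq_iff[OF C conv_fam[OF emb_fam_U[OF b] G(1)]]
 proof
  fix k
  have e: "conv (emb 0 b) G k = b\<otimes>G k" using conv_emb[OF U_P0[OF b] G(1)] by simp
  show "casimir I e f (G k)\<ominus>conv (emb 0 b) G k\<in>P (k - 1)"
  proof (cases "k\<ge>1")
   case True
   then obtain m where m: "k = int (Suc m)" by (metis int_one_le_iff_zero_less nonneg_int_cases zero_le_one order_trans gr0_implies_Suc of_nat_0_less_iff)
   have "casimir I e f (G k)\<ominus>b\<otimes>G k\<in>Pn m" unfolding m by (rule casimir_Dn[OF fin ef b K G(3)])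
   thus ?thesis unfolding e by (simp add: P_def m)
  next
   case False
   hence "G k = \<zero>" using G(2) famD(4)[OF G(1), of k] by (cases "k = 0") auto
   thus ?thesis unfolding e using cz b subspaceD(2)[OF subspace_P] by (simp add: minus_eq)
  qed
 qed
qed

end

text \<open>The inverse \<open>k\<close> is a parameter, which makes the situation symmetric: each
  result is available with the two algebras exchanged.\<close>

locale diff_algebra_iso =
 A: diff_algebra R U Omega ev + B: diff_algebra R' U' Omega' ev'
 for R :: "(real, 't) module" (structure) and U :: "'t set" and Omega :: "'x set" and ev
  and R' :: "(real, 's) module" and U' :: "'s set" and Omega' :: "'y set" and ev' +
 fixes h :: "(int => 't set) => int => 's set" and k :: "(int => 's set) => int => 't set"
 assumes h: "poisson_algebra_iso A.S B.S h" and k: "poisson_algebra_iso B.S A.S k"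
  and kh: "!!x. x\<in>carrier A.S ==> k (h x) = x" and hk: "!!y. y\<in>carrier B.S ==> h (k y) = y"
begin

lemma inverse: "diff_algebra_iso R' U' Omega' ev' R U Omega ev k h"
 by unfold_locales (rule k h kh hk; assumption?)+

text \<open>\<open>h\<close> acts on classes, whereas computations use representatives. This
  relation is compatible with all operations and determines the second family up to lower
  order.\<close>

definition rel :: "(int => 't) => (int => 's) => bool" where
 "rel T H \<longleftrightarrow> T\<in>A.fam \<and> H\<in>B.fam \<and> h (A.cls T) = B.cls H"

lemma relD: "rel T H ==> T\<in>A.fam" "rel T H ==> H\<in>B.fam" "rel T H ==> h (A.cls T) = B.cls H"
 by (simp_all add: rel_def)

lemma rel_inverse: "diff_algebra_iso.rel R' U' R U k H T \<longleftrightarrow> rel T H"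
proof -
 interpret I: diff_algebra_iso R' U' Omega' ev' R U Omega ev k h by (rule inverse)
 show ?thesis using kh[OF A.cls_carrier[of T]] hk[OF B.cls_carrier[of H]] by (auto simp: rel_def I.rel_def)
qed

definition lift :: "(int => 't) => int => 's" where "lift T = (SOME H. rel T H)"

lemma rel_lift: assumes "T\<in>A.fam" shows "rel T (lift T)"
proof -
 have "bij_betw h (carrier A.S) (carrier B.S)" using h by (simp add: poisson_algebra_iso_def)
 from bij_betwE[OF this, rule_format, OF A.cls_carrier[OF assms]]
 obtain H where "rel T H" unfolding B.carrier_S rel_def using assms by blast
 thus ?thesis unfolding lift_def by (rule someI[of "rel T"])
qed

lemma lift:
 assumes "T\<in>A.fam" shows "lift T\<in>B.fam" "h (A.cls T) = B.cls (lift T)"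
 using rel_lift[OF assms] by (simp_all add: rel_def)

lemma rel_hom:
 assumes T: "rel T H" and D: "rel D H'"
 shows "rel (%i. T i\<oplus>D i) (%i. H i \<oplus>\<^bsub>R'\<^esub> H' i)" "rel (%i. c\<odot>T i) (%i. c \<odot>\<^bsub>R'\<^esub> H i)"
  "rel (A.conv T D) (B.conv H H')" "rel (A.brk T D) (B.brk H H')"
proof -
 note t = relD[OF T] and d = relD[OF D]
 note c = A.cls_carrier[OF t(1)] A.cls_carrier[OF d(1)] and h = h[unfolded poisson_algebra_iso_def]
 have e: "h (A.cls T \<oplus>\<^bsub>A.S\<^esub> A.cls D) = B.cls H \<oplus>\<^bsub>B.S\<^esub> B.cls H'" "h (c \<odot>\<^bsub>A.S\<^esub> A.cls T) = c \<odot>\<^bsub>B.S\<^esub> B.cls H"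
  "h (A.cls T \<otimes>\<^bsub>A.S\<^esub> A.cls D) = B.cls H \<otimes>\<^bsub>B.S\<^esub> B.cls H'"
  "h (bracket A.S (A.cls T) (A.cls D)) = bracket B.S (B.cls H) (B.cls H')"
  unfolding t(3)[symmetric] d(3)[symmetric] using h c by blast+
 show "rel (%i. T i\<oplus>D i) (%i. H i \<oplus>\<^bsub>R'\<^esub> H' i)" "rel (%i. c\<odot>T i) (%i. c \<odot>\<^bsub>R'\<^esub> H i)"
  "rel (A.conv T D) (B.conv H H')" "rel (A.brk T D) (B.brk H H')"
  using e t(1,2) d(1,2) A.add_fam B.add_fam A.smult_fam B.smult_fam A.conv_fam B.conv_fam A.brk_fam B.brk_fam
  unfolding rel_def A.add_S[OF t(1) d(1)] B.add_S[OF t(2) d(2)] A.smult_S[OF t(1)] B.smult_S[OF t(2)]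
   A.mult_S[OF t(1) d(1)] B.mult_S[OF t(2) d(2)] A.bracket_S[OF t(1) d(1)] B.bracket_S[OF t(2) d(2)] by simp_all
qed

lemma rel_zero: "rel (%_. \<zero>) (%_. \<zero>\<^bsub>R'\<^esub>)"
 using rel_hom(2)[OF rel_lift rel_lift, OF A.zero_fam A.zero_fam, of 0] B.famD(2)[OF lift(1)[OF A.zero_fam]] by simp

lemma rel_finsum:
 "finite J ==> (!!i. i\<in>J ==> rel (T i) (H i)) ==> rel (%m. \<Oplus>i\<in>J. T i m) (%m. \<Oplus>\<^bsub>R'\<^esub>i\<in>J. H i m)"
proof (induction J rule: finite_induct)
 case empty thus ?case using rel_zero by simp
next
 case (insert i J)
 have "T j m\<in>carrier R" "H j m\<in>carrier R'" if "j\<in>insert i J" for j m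
  using relD(1,2)[OF insert.prems[OF that]] A.famD(2) B.famD(2) by auto
 hence "(%m. \<Oplus>i\<in>insert i J. T i m) = (%m. T i m\<oplus>(\<Oplus>i\<in>J. T i m))"
  "(%m. \<Oplus>\<^bsub>R'\<^esub>i\<in>insert i J. H i m) = (%m. H i m \<oplus>\<^bsub>R'\<^esub> (\<Oplus>\<^bsub>R'\<^esub>i\<in>J. H i m))"
  using insert.hyps by (auto simp: Pi_def)
 thus ?case using rel_hom(1)[OF insert.prems[of i] insert.IH] insert.prems by simp
qed

lemma rel_unique: assumes "rel T H" "rel D H'" "A.cls T = A.cls D" shows "B.cls H = B.cls H'"
 using assms by (simp add: rel_def)

text \<open>The filtration is zero in negative degrees, so a class of degree 0 has a single
  representative, and one of degree 1 is determined modulo functions.\<close>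

lemma rel_01: assumes "rel T H" "rel T H'" shows "H 0 = H' 0" "H 1 \<ominus>\<^bsub>R'\<^esub> H' 1\<in>U'"
 using B.cls_eq_0[OF relD(2)[OF assms(1)] relD(2)[OF assms(2)] rel_unique[OF assms refl]]
  B.cls_eq_1[OF relD(2)[OF assms(1)] relD(2)[OF assms(2)] rel_unique[OF assms refl]] .

lemma rel_lift_01: "rel T H ==> lift T 0 = H 0" "rel T H ==> lift T 1 \<ominus>\<^bsub>R'\<^esub> H 1\<in>U'"
 using rel_01[OF rel_lift[OF relD(1)]] by blast+

lemma rel_square_zero:
 assumes r: "rel T H" and z: "A.cls T \<otimes>\<^bsub>A.S\<^esub> A.cls T = \<zero>\<^bsub>A.S\<^esub>"
 shows "H 0 = \<zero>\<^bsub>R'\<^esub>" "H (int (Suc m))\<in>B.Dn m"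
proof -
 have "A.cls (A.conv T T) = A.cls (%_. \<zero>)" using z by (simp add: A.mult_S[OF relD(1)[OF r] relD(1)[OF r]] A.zero_S)
 from rel_unique[OF rel_hom(3)[OF r r] rel_zero this]
 have "B.cls H \<otimes>\<^bsub>B.S\<^esub> B.cls H = \<zero>\<^bsub>B.S\<^esub>" by (simp add: B.mult_S[OF relD(2)[OF r] relD(2)[OF r]] B.zero_S)
 thus "H 0 = \<zero>\<^bsub>R'\<^esub>" "H (int (Suc m))\<in>B.Dn m" using B.square_zero_imp[OF relD(2)[OF r]] by blast+
qed

lemma conv_emb_0: "u\<in>U ==> D\<in>A.fam ==> A.conv (A.emb 0 u) D = (%i. u\<otimes>D i)"
 by (rule ext) (simp add: A.conv_emb[OF A.U_P0])

lemma rel_U: "u\<in>U ==> rel (A.emb 0 u) (lift (A.emb 0 u))" by (rule rel_lift[OF A.emb_fam_U])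

lemma rel_K: "T\<in>A.Dn 0 ==> rel (A.emb 1 T) (lift (A.emb 1 T))" by (rule rel_lift[OF A.emb_fam_K])

text \<open>\<open>poisson_algebra_iso\<close> says nothing about units. The unit of the target
  comes from some \<open>D\<close>, and multiplying \<open>D\<close> by the unit of the source shows
  that the image of the latter is the unit.\<close>

lemma rel_one: "rel (A.emb 0 \<one>) (B.emb 0 \<one>\<^bsub>R'\<^esub>)"
proof -
 interpret I: diff_algebra_iso R' U' Omega' ev' R U Omega ev k h by (rule inverse)
 note L = rel_U[OF A.U_one]
 obtain D where D: "rel D (B.emb 0 \<one>\<^bsub>R'\<^esub>)" using I.rel_U[OF B.U_one] unfolding rel_inverse by blast
 have "A.conv (A.emb 0 \<one>) D = D" by (rule ext) (simp add: conv_emb_0[OF A.U_one relD(1)[OF D]] A.famD(2)[OF relD(1)[OF D]])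
 hence "rel D (lift (A.emb 0 \<one>))" using rel_hom(3)[OF L D] by (simp add: B.conv_one[OF relD(2)[OF L]])
 thus ?thesis using D L by (simp add: rel_def)
qed

text \<open>\<open>h\<close> need not preserve degrees; \<open>psi\<close> and \<open>theta\<close>
  keep just the component in the degree of the argument.\<close>

definition psi :: "'t => 's" where "psi u = lift (A.emb 0 u) 0"
definition theta :: "'t => 's" where "theta T = lift (A.emb 1 T) 1"

lemma psi_U: "u\<in>U ==> psi u\<in>U'"
 using B.famD(1)[OF lift(1)[OF A.emb_fam_U], of u 0] by (simp add: psi_def B.P_def)

lemma emb_add: "A.emb i (u\<oplus>v) = (%j. A.emb i u j\<oplus>A.emb i v j)"
 by (auto simp: A.emb_def)

lemma emb_smult: "A.emb i (c\<odot>v) = (%j. c\<odot>A.emb i v j)"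
 by (auto simp: A.emb_def)

lemma emb_mult: "u\<in>U ==> A.emb i v\<in>A.fam ==> A.emb i (u\<otimes>v) = A.conv (A.emb 0 u) (A.emb i v)"
 by (subst conv_emb_0) (auto simp: A.emb_def)

lemma psi_add: "u\<in>U ==> v\<in>U ==> psi (u\<oplus>v) = psi u \<oplus>\<^bsub>R'\<^esub> psi v"
 using rel_lift_01(1)[OF rel_hom(1)[OF rel_U rel_U]] by (simp add: psi_def emb_add)

lemma psi_smult: "u\<in>U ==> psi (c\<odot>u) = c \<odot>\<^bsub>R'\<^esub> psi u"
 using rel_lift_01(1)[OF rel_hom(2)[OF rel_U rel_U]] by (simp add: psi_def emb_smult)

lemma psi_mult: "u\<in>U ==> v\<in>U ==> psi (u\<otimes>v) = psi u \<otimes>\<^bsub>R'\<^esub> psi v"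
 using rel_lift_01(1)[OF rel_hom(3)[OF rel_U rel_U], of u v] B.prd_low(1)[OF relD(2)[OF rel_U] relD(2)[OF rel_U], of u v]
 by (simp add: psi_def emb_mult A.emb_fam_U)

lemma psi_one: "psi \<one> = \<one>\<^bsub>R'\<^esub>"
 using rel_lift_01(1)[OF rel_one] by (simp add: psi_def B.emb_def)

text \<open>\<open>u\<close> is pure if the symbols of positive order of its image vanish, a property of units preserved by sums.\<close>

definition pure :: "'t => bool" where
 "pure u \<longleftrightarrow> (\<forall>i>0. \<forall>x\<in>Omega'. \<forall>w\<in>U'. B.sym i w x (lift (A.emb 0 u) (int i)) = 0)"

lemma pure_unit:
 assumes u: "u\<in>U" "!!x. x\<in>Omega ==> ev x u ~= 0" shows "pure u"
proof -
 obtain v where v: "v\<in>U" "u\<otimes>v = \<one>" using A.ev_unit[OF u] by blast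
 note r = rel_U[OF u(1)] rel_U[OF v(1)]
 have "A.cls (A.conv (A.emb 0 u) (A.emb 0 v)) = A.cls (A.emb 0 \<one>)" by (simp add: emb_mult[OF u(1) relD(1)[OF r(2)], symmetric] v(2))
 from rel_unique[OF rel_hom(3)[OF r] rel_one this]
 have "B.cls (lift (A.emb 0 u)) \<otimes>\<^bsub>B.S\<^esub> B.cls (lift (A.emb 0 v)) = \<one>\<^bsub>B.S\<^esub>"
  by (simp add: B.one_S B.mult_S[OF relD(2)[OF r(1)] relD(2)[OF r(2)]])
 thus ?thesis unfolding pure_def
  using B.unit_sym_zero[OF relD(2)[OF r(1)] relD(2)[OF r(2)]] by blast
qed

lemma pure_add:
 assumes "u\<in>U" "v\<in>U" "pure u" "pure v" shows "pure (u\<oplus>v)"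
 unfolding pure_def
proof (intro allI impI ballI)
 fix i :: nat and x w assume a: "i > 0" "x\<in>Omega'" "w\<in>U'"
 note r = rel_U[OF A.U_add[OF assms(1,2)]] rel_hom(1)[OF rel_U[OF assms(1)] rel_U[OF assms(2)]]
 have "B.sym i w x (lift (A.emb 0 (u\<oplus>v)) (int i)) = B.sym i w x (lift (A.emb 0 u) (int i) \<oplus>\<^bsub>R'\<^esub> lift (A.emb 0 v) (int i))"
  using B.sym_cls_cong[OF a(2,3) relD(2)[OF r(1)] relD(2)[OF r(2)] rel_unique[OF r]] by (simp add: emb_add)
 also have "\<dots> = 0"
  using B.sym_add[OF a(2,3), of "lift (A.emb 0 u) (int i)" i] B.famD(1)[OF lift(1)[OF A.emb_fam_U[OF assms(1)]], of "int i"]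
   B.famD(1)[OF lift(1)[OF A.emb_fam_U[OF assms(2)]], of "int i"] assms(3,4) a by (simp add: pure_def B.P_def)
 finally show "B.sym i w x (lift (A.emb 0 (u\<oplus>v)) (int i)) = 0" .
qed

lemma pure_all:
 assumes u: "u\<in>U" shows "pure u"
proof -
 let ?one = "\<one>"
 \<comment> \<open>u = ((u + 1)^2 + 1)/2 - (u^2 + 1)/2 - 1/2 is a sum of three functions without
   zeros.\<close>
 let ?a = "(1/2)\<odot>((u\<oplus>?one)\<otimes>(u\<oplus>?one)\<oplus>?one)"
 let ?b = "(- (1/2))\<odot>(u\<otimes>u\<oplus>?one)"
 let ?c = "(- (1/2))\<odot>?one"
 note cl = A.U_add A.U_mult A.U_smult A.U_one u
 have mem: "?a\<in>U" "?b\<in>U" "?c\<in>U" by (intro cl)+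
 have e: "ev x ?a = ((ev x u + 1) * (ev x u + 1) + 1) / 2" "ev x ?b = - ((ev x u * ev x u + 1) / 2)" "ev x ?c = - (1/2)"
  if "x\<in>Omega" for x using that by (simp_all add: A.ev_add A.ev_mult A.ev_smult A.ev_one cl)
 have pos: "t * t + 1 > (0::real)" for t by (rule add_nonneg_pos) auto
 have nz: "ev x ?a ~= 0" "ev x ?b ~= 0" "ev x ?c ~= 0" if "x\<in>Omega" for x
  using pos[of "ev x u + 1"] pos[of "ev x u"] by (simp_all add: e[OF that])
 have "pure ((?a\<oplus>?b)\<oplus>?c)"
  by (intro pure_add pure_unit A.U_add mem nz)
 moreover have "(?a\<oplus>?b)\<oplus>?c = u"
 proof (rule A.U_eqI)
  fix x assume x: "x\<in>Omega"
  have "ev x ((?a\<oplus>?b)\<oplus>?c) = ev x ?a + ev x ?b + ev x ?c"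
   by (simp only: A.ev_add[OF x] A.U_add mem)
  also have "\<dots> = ev x u" unfolding e[OF x] by (simp add: field_simps)
  finally show "ev x ((?a\<oplus>?b)\<oplus>?c) = ev x u" .
 qed (intro A.U_add mem u)+
 ultimately show ?thesis by simp
qed

text \<open>The part of positive degree in the image of \<open>u\<close> is square-zero because
  \<open>u\<close> is pure, and the preimage of a square-zero element has no component in degree 0.
  Discarding that part therefore changes nothing in degree 0 after mapping back.\<close>

lemma psi_inverse:
 assumes u: "u\<in>U" and G: "G\<in>A.fam" "A.cls G = k (B.cls (B.emb 0 (psi u)))"
 shows "G 0 = u"
proof -
 interpret I: diff_algebra_iso R' U' Omega' ev' R U Omega ev k h by (rule inverse)
 let ?H = "lift (A.emb 0 u)"
 let ?H' = "%i. if i = 0 then \<zero>\<^bsub>R'\<^esub> else ?H i"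
 note H = rel_U[OF u]
 have "{i. ?H' i ~= \<zero>\<^bsub>R'\<^esub>}\<subseteq>{i. ?H i ~= \<zero>\<^bsub>R'\<^esub>}" by auto
 hence "finite {i. ?H' i ~= \<zero>\<^bsub>R'\<^esub>}" using B.famD(3)[OF relD(2)[OF H]] finite_subset by blast
 hence H': "?H'\<in>B.fam" using B.famD(1)[OF relD(2)[OF H]] B.subspaceD(2)[OF B.subspace_P] by (auto simp: B.fam_def)
 have "B.cls ?H' \<otimes>\<^bsub>B.S\<^esub> B.cls ?H' = \<zero>\<^bsub>B.S\<^esub>"
 proof (rule B.square_zero_family[OF H'])
  fix m
  have "?H (int (Suc m))\<in>B.Pn (Suc m)" using B.famD(1)[OF relD(2)[OF H], of "int (Suc m)"] by (simp add: B.P_def del: B.Pn.simps of_nat_Suc)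
  hence "?H (int (Suc m))\<in>B.Dn m"
   using B.sym_zero_imp[of "?H (int (Suc m))" "Suc m"] pure_all[OF u] unfolding pure_def by (metis diff_Suc_1 nat.distinct(1) zero_less_Suc)
  thus "?H' (int (Suc m))\<in>B.Dn m" by simp
 qed simp
 hence z: "I.lift ?H' 0 = \<zero>" by (rule I.rel_square_zero(1)[OF I.rel_lift[OF H']])
 have G': "I.rel (B.emb 0 (psi u)) G" using G B.emb_fam_U[OF psi_U[OF u]] by (simp add: I.rel_def)
 have "(%i. B.emb 0 (psi u) i \<oplus>\<^bsub>R'\<^esub> ?H' i) = ?H"
  using B.famD(2)[OF relD(2)[OF H]] by (auto simp: B.emb_def psi_def)
 hence "I.rel ?H (%i. G i\<oplus>I.lift ?H' i)" using I.rel_hom(1)[OF G' I.rel_lift[OF H']] by simp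
 from I.rel_01(1)[OF this] have "G 0\<oplus>I.lift ?H' 0 = A.emb 0 u 0" using H unfolding rel_inverse by blast
 thus ?thesis using z A.famD(2)[OF G(1)] by (simp add: A.emb_def)
qed

text \<open>Being square-zero is preserved by \<open>h\<close>. The missing component in degree 0 is
  what keeps products and brackets of such images free of mixed terms in degree 1.\<close>

lemma theta_lift: "T\<in>A.Dn 0 ==> lift (A.emb 1 T) 0 = \<zero>\<^bsub>R'\<^esub>" "T\<in>A.Dn 0 ==> theta T\<in>B.Dn 0"
 using rel_square_zero(1)[OF rel_K A.emb_square_zero] rel_square_zero(2)[OF rel_K A.emb_square_zero, of T 0]
 by (simp_all add: theta_def)

lemma theta_add: "T\<in>A.Dn 0 ==> D\<in>A.Dn 0 ==> theta (T\<oplus>D) \<ominus>\<^bsub>R'\<^esub> (theta T \<oplus>\<^bsub>R'\<^esub> theta D)\<in>U'"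
 using rel_lift_01(2)[OF rel_hom(1)[OF rel_K rel_K], of T D] by (simp add: theta_def emb_add)

lemma theta_mult:
 assumes u: "u\<in>U" and T: "T\<in>A.Dn 0" shows "theta (u\<otimes>T) \<ominus>\<^bsub>R'\<^esub> psi u \<otimes>\<^bsub>R'\<^esub> theta T\<in>U'"
proof -
 note r = rel_hom(3)[OF rel_U[OF u] rel_K[OF T]]
 from rel_lift_01(2)[OF r] show ?thesis
  by (simp add: psi_def theta_def emb_mult[OF u A.emb_fam_K[OF T]] B.prd_low(2)[OF relD(2)[OF rel_U[OF u]] relD(2)[OF rel_K[OF T]] theta_lift(1)[OF T]])
qed

lemma theta_cmt:
 assumes T: "T\<in>A.Dn 0" and D: "D\<in>A.Dn 0"
 shows "theta (commutator R T D) \<ominus>\<^bsub>R'\<^esub> commutator R' (theta T) (theta D)\<in>U'"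
proof -
 note r = rel_hom(4)[OF rel_K[OF T] rel_K[OF D]]
 have "A.emb 1 (commutator R T D) = A.brk (A.emb 1 T) (A.emb 1 D)"
  using A.K_carrier[OF T] A.brk_emb_1[OF A.K_P1[OF T] A.emb_fam_K[OF D]] by (auto simp: A.emb_def fun_eq_iff)
 thus ?thesis using rel_lift_01(2)[OF r]
  by (simp add: theta_def B.prd_low(4)[OF relD(2)[OF rel_K[OF T]] relD(2)[OF rel_K[OF D]] theta_lift(1)[OF T] theta_lift(1)[OF D]])
qed

text \<open>As a representative in degree 1 a function is of lower order, so its class there is
  0.\<close>

lemma theta_U: assumes u: "u\<in>U" shows "theta u\<in>U'"
proof -
 note r = rel_K[OF A.U_K[OF u]]
 have "A.cls (A.emb 1 u) = A.cls (%_. \<zero>)"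
  unfolding A.cls_eq_iff[OF relD(1)[OF r] A.zero_fam]
  using A.U_P0[OF u] u A.subspaceD(2)[OF A.subspace_P] by (auto simp: A.emb_def a_minus_def)
 from B.cls_eq_1[OF relD(2)[OF r] B.zero_fam rel_unique[OF r rel_zero this]] show ?thesis
  using B.famD(2)[OF relD(2)[OF r], of 1] by (simp add: theta_def a_minus_def)
qed

text \<open>The preimage of the class of \<open>z\<close> is square-zero but may spread over many
  degrees, which is why the Casimir identity is established in all orders. Mapping forward and
  reading degree 1 gives the identity for every \<open>z\<close>, not only for values of
  \<open>theta\<close>.\<close>

lemma theta_casimir:
 assumes fin: "finite I" and ef: "!!i. i\<in>I ==> e i\<in>A.Dn 0" "!!i. i\<in>I ==> f i\<in>A.Dn 0" and b: "b\<in>U"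
  and K: "!!a. a\<in>A.Dn 0 ==> A.casimir I e f a\<ominus>b\<otimes>a\<in>U"
  and z: "z\<in>B.Dn 0"
 shows "B.casimir I (%i. theta (e i)) (%i. theta (f i)) z \<ominus>\<^bsub>R'\<^esub> psi b \<otimes>\<^bsub>R'\<^esub> z\<in>U'"
proof -
 interpret I: diff_algebra_iso R' U' Omega' ev' R U Omega ev k h by (rule inverse)
 note fz = B.emb_fam_K[OF z]
 define G where "G = I.lift (B.emb 1 z)"
 note G0 = I.rel_square_zero[OF I.rel_K[OF z] B.emb_square_zero[OF z], folded G_def]
 have rG: "rel G (B.emb 1 z)" using I.rel_K[OF z] by (simp add: rel_inverse G_def)
 note G = relD(1)[OF rG]
 let ?X = "%i. B.brk (lift (A.emb 1 (f i))) (B.emb 1 z)" and ?Y = "%i. B.brk (lift (A.emb 1 (e i))) (B.brk (lift (A.emb 1 (f i))) (B.emb 1 z))"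
 have "A.brk (A.emb 1 (e i)) (A.brk (A.emb 1 (f i)) G) m = commutator R (e i) (commutator R (f i) (G m))" if "i\<in>I" for i m
  using A.brk_emb_1[OF A.K_P1[OF ef(1)[OF that]] A.brk_fam[OF A.emb_fam_K[OF ef(2)[OF that]] G], of m]
   A.brk_emb_1[OF A.K_P1[OF ef(2)[OF that]] G, of m] by simp
 moreover have "commutator R (e i) (commutator R (f i) (G m))\<in>carrier R" if "i\<in>I" for i m
  using A.K_carrier ef that A.famD(2)[OF G] by auto
 ultimately have F: "(\<Oplus>i\<in>I. A.brk (A.emb 1 (e i)) (A.brk (A.emb 1 (f i)) G) m) = A.casimir I e f (G m)" for m
  unfolding A.casimir_def by (intro A.finsum_cong'[OF refl]) auto
 have C: "rel (%m. A.casimir I e f (G m)) (%m. \<Oplus>\<^bsub>R'\<^esub>i\<in>I. ?Y i m)"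
  unfolding F[symmetric] by (intro rel_finsum[OF fin] rel_hom(4) rel_K ef rG)
 have z1: "B.emb 1 z 0 = \<zero>\<^bsub>R'\<^esub>" "B.emb 1 z 1 = z" by (simp_all add: B.emb_def)
 have "?Y i 1 = commutator R' (theta (e i)) (commutator R' (theta (f i)) z)" if i: "i\<in>I" for i
 proof -
  note l = relD(2)[OF rel_K[OF ef(1)[OF i]]] relD(2)[OF rel_K[OF ef(2)[OF i]]] and t = theta_lift(1)[OF ef(1)[OF i]] theta_lift(1)[OF ef(2)[OF i]]
  note X = B.prd_low(3,4)[OF l(2) fz t(2) z1(1)]
  show ?thesis using B.prd_low(4)[OF l(1) B.brk_fam[OF l(2) fz] t(1) X(1)] by (simp add: X(2) theta_def z1)
 qed
 moreover have "theta (e i)\<in>carrier R'" "theta (f i)\<in>carrier R'" if "i\<in>I" for i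
  using theta_lift(2)[OF ef(1)[OF that]] theta_lift(2)[OF ef(2)[OF that]] by simp_all
 ultimately have Y1: "(\<Oplus>\<^bsub>R'\<^esub>i\<in>I. ?Y i 1) = B.casimir I (%i. theta (e i)) (%i. theta (f i)) z"
  unfolding B.casimir_def using B.K_carrier[OF z] by (intro B.finsum_cong'[OF refl]) auto
 note r = rel_hom(3)[OF rel_U[OF b] rG]
 have "A.cls (%m. A.casimir I e f (G m)) = A.cls (A.conv (A.emb 0 b) G)"
  by (rule A.casimir_family[OF fin ef b K G G0 relD(1)[OF C]])
 from B.cls_eq_1[OF relD(2)[OF C] relD(2)[OF r] rel_unique[OF C r this]] show ?thesis
  using B.prd_low(2)[OF relD(2)[OF rel_U[OF b]] fz] by (simp add: Y1 z1 psi_def)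
qed

end

section \<open>Lie algebra homomorphisms between matrix algebras\<close>

definition lie :: "real^'n^'n => real^'n^'n => real^'n^'n" where
 "lie A B = A**B - B**A"

definition outer :: "real^'n => real^'n => real^'n^'n" where
 "outer v w = (\<chi> i j. v $ i * w $ j)"

definition munit :: "'n => 'n => real^'n^'n" where
 "munit i j = outer (axis i 1) (axis j 1)"

abbreviation scal :: "real => real^'n^'n" where "scal c \<equiv> c *R mat 1"

lemma matrix_diff_ldistrib: "A**(B - C) = A**B - A**(C :: real^'k^'n)"
 by (simp add: matrix_matrix_mult_def vec_eq_iff sum_subtractf algebra_simps)

lemma matrix_diff_rdistrib: "(B - C)**A = B**A - C**(A :: real^'k^'n)"
 by (simp add: matrix_matrix_mult_def vec_eq_iff sum_subtractf algebra_simps)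

lemma matrix_add_right_distrib: "(B + C)**A = B**A + C**(A :: real^'k^'n)"
 by (simp add: matrix_matrix_mult_def vec_eq_iff sum.distrib algebra_simps)

lemma matrix_minus_left: "(- A)**B = - (A**(B :: real^'k^'n))"
 by (simp add: matrix_matrix_mult_def vec_eq_iff sum_negf)

lemma matrix_minus_right: "A**(- B) = - (A**(B :: real^'k^'n))"
 by (simp add: matrix_matrix_mult_def vec_eq_iff sum_negf)

lemma matrix_scaleR_left: "(c *R A)**B = c *R (A**(B :: real^'k^'n))"
 by (simp add: matrix_matrix_mult_def vec_eq_iff sum_distrib_left algebra_simps)

lemma matrix_scaleR_right: "A**(c *R B) = c *R (A**(B :: real^'k^'n))"
 by (simp add: matrix_matrix_mult_def vec_eq_iff sum_distrib_left algebra_simps)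

lemma matrix_zero_left [simp]: "0**(B :: real^'k^'n) = 0"
 by (simp add: matrix_matrix_mult_def vec_eq_iff)

lemma matrix_zero_right [simp]: "(B :: real^'k^'n)**0 = 0"
 by (simp add: matrix_matrix_mult_def vec_eq_iff)

lemmas matrix_ring = matrix_diff_ldistrib matrix_diff_rdistrib matrix_add_ldistrib matrix_add_right_distrib
 matrix_minus_left matrix_minus_right matrix_scaleR_left matrix_scaleR_right matrix_mul_assoc

lemma matrix_sum_left: "(\<Sum>i\<in>I. f i)**B = (\<Sum>i\<in>I. f i**(B :: real^'k^'n))"
 by (induction I rule: infinite_finite_induct) (simp_all add: matrix_add_right_distrib)

lemma matrix_sum_right: "B**(\<Sum>i\<in>I. f i) = (\<Sum>i\<in>I. B**(f i :: real^'k^'n))"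
 by (induction I rule: infinite_finite_induct) (simp_all add: matrix_add_ldistrib)

lemma trace_simps:
 "trace (A + B :: real^'n^'n) = trace A + trace B" "trace (A - B :: real^'n^'n) = trace A - trace B"
 "trace (c *R A :: real^'n^'n) = c * trace A" "trace (scal c :: real^'n^'n) = c * real CARD('n)"
 "trace (- A :: real^'n^'n) = - trace A" "trace (transpose A :: real^'n^'n) = trace A"
 by (simp_all add: trace_def sum.distrib sum_subtractf sum_distrib_left sum_negf mat_def transpose_def)

lemma trace_lie: "trace (lie A B) = 0"
 using trace_mul_sym[of A B] by (simp add: lie_def trace_simps)

lemma lie_scal: "lie (scal c) A = 0" "lie A (scal c) = 0"
 by (simp_all add: lie_def matrix_ring)

lemma lie_add: "lie (A + B) C = lie A C + lie B C" "lie C (A + B) = lie C A + lie C B"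
 by (simp_all add: lie_def matrix_ring)

lemma lie_diff: "lie (A - B) C = lie A C - lie B C" "lie C (A - B) = lie C A - lie C B"
 by (simp_all add: lie_def matrix_ring)

lemma lie_scaleR: "lie (c *R A) B = c *R lie A B" "lie A (c *R B) = c *R lie A B"
 by (simp_all add: lie_def matrix_ring algebra_simps)

lemma matrix_eqI: "(!!v. A *v v = B *v v) ==> A = (B :: real^'n^'n)"
 by (simp add: matrix_eq)

lemma outer_mult:
 "A**outer v w = outer (A *v v) w" "outer v w**A = outer v (w v* A)"
 "outer v w *v x = (w\<bullet>x) *R v" "transpose (outer v w) = outer w v"
 by (simp_all add: outer_def matrix_matrix_mult_def matrix_vector_mult_def vector_matrix_mult_def transpose_def vec_eq_iff
   sum_distrib_left sum_distrib_right inner_vec_def algebra_simps)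

lemma trace_outer: "trace (outer v w) = v\<bullet>w"
 by (simp add: trace_def outer_def inner_vec_def)

lemma outer_zero_iff: "outer v w = 0 \<longleftrightarrow> v = 0 \<or> w = 0"
 by (auto simp: outer_def vec_eq_iff)

lemma outer_scaleR: "outer (c *R v) w = c *R outer v w" "outer v (c *R w) = c *R outer v w"
 by (simp_all add: outer_def vec_eq_iff)

lemma munit_mult: "munit i j**munit k l = (if j = k then munit i l else (0 :: real^'n^'n))"
proof -
 have "munit i j**munit k l = (axis j 1\<bullet>axis k (1::real)) *R (munit i l :: real^'n^'n)"
  by (simp only: munit_def outer_mult outer_scaleR)
 thus ?thesis by (simp add: inner_axis_axis)
qed

lemma munit_conj: "munit i j**A**munit k l = (A $ j $ k) *R (munit i l :: real^'n^'n)"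
proof -
 have "munit i j**A**munit k l = (axis j 1\<bullet>(A *v axis k 1)) *R (munit i l :: real^'n^'n)"
  by (simp only: munit_def outer_mult outer_scaleR dot_lmul_matrix[symmetric])
 thus ?thesis by (simp add: inner_axis' matrix_vector_mult_basis column_def)
qed

lemma munit_component: "(munit i j :: real^'n^'n) $ a $ b = (if a = i \<and> b = j then 1 else 0)"
 by (simp add: munit_def outer_def axis_def)

lemma munit_expand: "A = (\<Sum>i\<in>UNIV. \<Sum>j\<in>UNIV. (A $ i $ j) *R (munit i j :: real^'n^'n))"
proof -
 have "(\<Sum>i\<in>UNIV. \<Sum>j\<in>UNIV. (A $ i $ j) *R munit i j) $ a $ b = A $ a $ b" for a b
 proof -
  have "(\<Sum>j\<in>UNIV. A $ i $ j * (if a = i \<and> b = j then 1 else 0)) = (if i = a then A $ a $ b else 0)" for i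
   by (simp add: if_distrib[where f = "(*) _"] cong: if_cong)
  thus ?thesis by (simp add: munit_component)
 qed
 thus ?thesis by (simp add: vec_eq_iff)
qed

lemma sum_munit_diag: "(\<Sum>i\<in>UNIV. munit i i) = (mat 1 :: real^'n^'n)"
proof -
 have "(\<Sum>i\<in>UNIV. munit i i :: real^'n^'n) $ a $ b = (mat 1 :: real^'n^'n) $ a $ b" for a b
 proof (cases "a = b")
  case True thus ?thesis by (simp add: munit_component mat_def)
 next
  case False thus ?thesis by (simp add: munit_component mat_def) (auto intro!: sum.neutral)
 qed
 thus ?thesis by (simp add: vec_eq_iff)
qed

lemma trace_munit: "trace (munit i j :: real^'n^'n) = (if i = j then 1 else 0)"
 by (simp add: munit_def trace_outer inner_axis_axis)

lemma scal_mult [simp]: "scal c**A = c *R (A :: real^'n^'n)" "A**scal c = c *R (A :: real^'n^'n)"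
 by (simp_all add: matrix_scaleR_left matrix_scaleR_right)

lemma scaleR_3: "(3::real) *R x = x + x + (x :: 'a::real_vector)"
 using scaleR_left_distrib[of "1 + 1" 1 x] scaleR_left_distrib[of 1 1 x] by simp

lemma lie_munit_offdiag: "k ~= l ==> lie (munit k l) (munit l k) = munit k k - (munit l l :: real^'n^'n)"
 by (simp add: lie_def munit_mult)

lemmas munit_sums = sum.distrib sum_subtractf scaleR_sum_left[symmetric] scaleR_sum_right[symmetric] matrix_sum_left[symmetric]
 matrix_sum_right[symmetric] sum_munit_diag sum_constant_scaleR trace_def[symmetric]

text \<open>The quadratic Casimir element of gl_n in the adjoint representation: 2n on trace-free
  matrices, 0 on scalars.\<close>

lemma casimir_matrix:
 "(\<Sum>i\<in>UNIV. \<Sum>j\<in>UNIV. lie (munit i j) (lie (munit j i) A)) =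
  (2 * real CARD('n)) *R A - scal (2 * trace (A :: real^'n^'n))"
proof -
 have "lie (munit i j) (lie (munit j i) A) = munit i i**A + A**munit j j - (A $ j $ j) *R munit i i - (A $ i $ i) *R munit j j"
  for i j
  by (simp add: lie_def matrix_ring munit_mult munit_conj matrix_mul_assoc[symmetric, of A])
 hence "(\<Sum>i\<in>UNIV. \<Sum>j\<in>UNIV. lie (munit i j) (lie (munit j i) A)) =
   real CARD('n) *R A + real CARD('n) *R A - scal (trace A) - scal (trace A)"
  by (simp only: munit_sums) (simp add: munit_sums matrix_scaleR_left del: sum_constant)
 thus ?thesis by (simp only: mult_2 scaleR_add_left diff_diff_eq)
qed

text \<open>The kernel is a Lie ideal; summing double brackets against the matrix units shows that it contains all products
  with its trace-free part.\<close>
lemma lie_kernel_trivial: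
 fixes rho :: "real^'n^'n => real^'p^'p"
 assumes lin: "linear rho" and hom: "!!a b. rho (lie a b) = lie (rho a) (rho b)" and one: "rho (mat 1) = 0"
  and m: "rho m = 0" "!!c. m ~= scal c"
 shows "rho x = 0"
proof -
 have I: "rho (lie a b) = 0" "rho (lie b a) = 0" if "rho a = 0" for a b by (simp_all add: hom that) (simp_all add: lie_def)
 define h where "h = m - scal (trace m / real CARD('n))"
 have h: "rho h = 0" "trace h = 0" using m(1) one by (simp_all add: h_def linear_diff[OF lin] linear_scale[OF lin] trace_simps(2,3) trace_I)
 have hp: "rho (h**p) = 0" for p
 proof -
  have "lie (lie h (p**munit i j)) (munit j i) =
    h**p**munit i i - (h $ j $ j) *R (p**munit i i) - ((h**p) $ i $ i) *R munit j j + (p $ i $ i) *R (munit j j**h)" for i j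
  proof -
   have "p**munit i j**h**munit j i = (h $ j $ j) *R (p**munit i i)"
    using munit_conj[of i j h j i] by (metis matrix_mul_assoc matrix_scaleR_right)
   moreover have "munit j i**h**p**munit i j = ((h**p) $ i $ i) *R munit j j"
    using munit_conj[of j i "h**p" i j] by (simp only: matrix_mul_assoc)
   moreover have "munit j i**p**munit i j**h = (p $ i $ i) *R (munit j j**h)"
    by (simp only: munit_conj matrix_scaleR_left)
   moreover have "h**p**munit i j**munit j i = h**p**munit i i"
    by (simp add: matrix_mul_assoc[symmetric] munit_mult)
   ultimately show ?thesis by (simp add: lie_def matrix_ring)
  qed
  hence "(\<Sum>i\<in>UNIV. \<Sum>j\<in>UNIV. lie (lie h (p**munit i j)) (munit j i)) =
    real CARD('n) *R (h**p) - scal (trace (h**p)) + trace p *R h"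
   by (simp only: munit_sums) (simp add: munit_sums h(2) matrix_scaleR_left del: sum_constant)
  moreover have "rho (\<Sum>i\<in>UNIV. \<Sum>j\<in>UNIV. lie (lie h (p**munit i j)) (munit j i)) = 0"
   by (simp add: linear_sum[OF lin] I(1)[OF I(1)[OF h(1)]])
  ultimately show ?thesis by (simp add: linear_diff[OF lin] linear_add[OF lin] linear_scale[OF lin] one h(1))
 qed
 \<comment> \<open>The commutator of \<open>q\<close> with \<open>h**p\<close> is in the kernel, and
   so is \<open>h**p**q\<close>; their sum is \<open>q**h**p\<close>. Matrix units for
   \<open>q\<close> and \<open>p\<close> then isolate a single entry of \<open>h\<close>.\<close>
 have "rho (q**h**p) = 0" for p q
  using I(2)[OF hp, of q p] hp[of "p**q"] by (simp add: lie_def linear_diff[OF lin] matrix_mul_assoc)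
 note c = this[of "munit _ _" "munit _ _", unfolded munit_conj linear_scale[OF lin]]
 have "h ~= 0" using m(2) by (simp add: h_def)
 then obtain i j where "h $ i $ j ~= 0" by (metis vec_eq_iff zero_index)
 hence "rho (munit r s) = 0" for r s using c[of i j r s] c[of j i] by simp
 thus ?thesis by (subst munit_expand) (simp add: linear_sum[OF lin] linear_scale[OF lin])
qed

lemma separating_vector:
 assumes "x\<notin>span (S :: 'a::euclidean_space set)"
 obtains q where "!!y. y\<in>S ==> q\<bullet>y = 0" "q\<bullet>x = 1"
proof -
 obtain y z where yz: "y\<in>span S" "!!w. w\<in>span S ==> orthogonal z w" "x = y + z"
  using orthogonal_subspace_decomp_exists[of S x] by metis
 have "z ~= 0" using yz assms by auto
 moreover have "z\<bullet>x = z\<bullet>z" using yz(2)[OF yz(1)] by (simp add: yz(3) orthogonal_def inner_add_right)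
 ultimately show ?thesis using yz(2) span_base
  by (intro that[of "(1 / (z\<bullet>z)) *R z"]) (auto simp: orthogonal_def)
qed

lemma lie_cubed:
 "lie f (lie f (lie f z)) = f**f**f**z - 3 *R (f**f**z**f) + 3 *R (f**z**f**f) - z**f**f**f"
 by (simp only: lie_def matrix_ring scaleR_3) (simp only: algebra_simps)

lemma munit_between: "(A**munit j k**B) $ a $ b = (A :: real^'n^'n) $ a $ j * (B :: real^'n^'n) $ k $ b"
proof -
 have "(axis k 1 v* B) $ b = B $ k $ b" using dot_lmul_matrix[of "axis k 1" B "axis b 1"]
  by (simp add: inner_axis inner_axis' matrix_vector_mult_basis column_def)
 thus ?thesis by (simp only: munit_def outer_mult) (simp add: outer_def matrix_vector_mult_basis column_def)
qed

text \<open>Paired with a functional that vanishes on 1 but not on \<open>f\<close>, the cubic identity becomes a quadratic equation for \<open>f\<close>.\<close>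
lemma ad_cubed_idempotent:
 fixes f :: "real^'n^'n"
 assumes ad: "!!z. lie f (lie f (lie f z)) = lie f z" and ns: "!!c. f ~= scal c"
 obtains e c where "f = e + scal c" "e**e = e"
proof -
 let ?J = "mat 1 :: real^'n^'n" and ?f2 = "f**f" and ?f3 = "f**f**f"
 have "f\<notin>span {?J}" using ns by (auto simp: span_singleton)
 then obtain q where q: "q\<bullet>?J = 0" "q\<bullet>f = 1" using separating_vector[of f "{?J}"] by (metis insertI1)
 have "(?f3**z**?J - 3 *R (?f2**z**f) + 3 *R (f**z**?f2) - ?J**z**?f3) = f**z**?J - ?J**z**f" for z
  using ad[of z] unfolding lie_cubed by (simp add: lie_def matrix_mul_assoc)
 from arg_cong[OF this[of "munit _ _"], of "%A. A $ _ $ _"]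
 have c: "?f3 $ a $ j * ?J $ k $ b - 3 * (?f2 $ a $ j * f $ k $ b) + 3 * (f $ a $ j * ?f2 $ k $ b) - ?J $ a $ j * ?f3 $ k $ b
   = f $ a $ j * ?J $ k $ b - ?J $ a $ j * f $ k $ b" for a j k b
  by (simp only: munit_between vector_add_component vector_minus_component vector_scaleR_component real_scaleR_def)
 have "(?J $ k $ b) *R ?f3 - (3 * f $ k $ b) *R ?f2 + (3 * ?f2 $ k $ b) *R f - (?f3 $ k $ b) *R ?J = (?J $ k $ b) *R f - (f $ k $ b) *R ?J" for k b
  unfolding vec_eq_iff using c[of _ _ k b] by (simp add: algebra_simps)
 from arg_cong[OF this, of "(\<bullet>) q"]
 have e: "?J $ k $ b * (q\<bullet>?f3) - 3 * f $ k $ b * (q\<bullet>?f2) + 3 * ?f2 $ k $ b = ?J $ k $ b" for k b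
  by (simp add: inner_diff_right inner_add_right q)
 define alpha gamma where "alpha = q\<bullet>?f2" and "gamma = (1 - q\<bullet>?f3) / 3"
 have ff: "?f2 = alpha *R f + scal gamma" unfolding vec_eq_iff
 proof (intro allI)
  show "?f2 $ k $ b = (alpha *R f + scal gamma) $ k $ b" for k b using e[of k b] by (simp add: alpha_def gamma_def field_simps)
 qed
 have "?f3 = alpha *R ?f2 + gamma *R f" by (subst ff) (simp add: matrix_ring)
 hence "q\<bullet>?f3 = alpha * alpha + gamma" using q by (simp add: inner_add_right alpha_def)
 hence gamma: "gamma = (1 - alpha * alpha) / 4" by (simp add: gamma_def field_simps)
 \<comment> \<open>The roots of x^2 = alpha x + gamma are (alpha - 1)/2 and (alpha + 1)/2. They
   differ by 1, so subtracting the smaller one from \<open>f\<close> leaves an idempotent.\<close>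
 let ?c = "(alpha - 1) / 2"
 let ?e = "f - scal ?c"
 have "?e**?e = ?f2 - ?c *R f - ?c *R f + scal (?c * ?c)"
  by (simp only: matrix_diff_ldistrib matrix_diff_rdistrib scal_mult scaleR_diff_right scaleR_scaleR)
   (simp only: algebra_simps)
 also have "\<dots> = (alpha - ?c - ?c) *R f + scal (gamma + ?c * ?c)" unfolding ff
  by (simp only: scaleR_diff_left scaleR_add_left) simp
 also have "alpha - ?c - ?c = 1" by (simp add: field_simps)
 also have "gamma + ?c * ?c = - ?c" unfolding gamma by (simp add: field_simps)
 finally have "?e**?e = ?e" by simp
 thus ?thesis by (intro that[of ?e ?c]) auto
qed

lemma rank_one_idempotent:
 fixes e :: "real^'n^'n"
 assumes "e**e = e" "e *v u ~= 0" "!!v. \<exists>r. e *v v = r *R (e *v u)"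
 obtains a b where "e = outer a b" "b\<bullet>a = 1"
proof -
 let ?a = "e *v u"
 let ?b = "(1 / (?a\<bullet>?a)) *R (transpose e *v ?a)"
 have e: "e = outer ?a ?b"
 proof (rule matrix_eqI)
  fix v
  obtain r where r: "e *v v = r *R ?a" using assms(3) by blast
  have "?a\<bullet>(e *v v) = (transpose e *v ?a)\<bullet>v" by (simp add: dot_lmul_matrix)
  hence "r * (?a\<bullet>?a) = (transpose e *v ?a)\<bullet>v" by (simp add: r)
  hence "r = ?b\<bullet>v" using assms(2) by (simp add: field_simps)
  thus "e *v v = outer ?a ?b *v v" by (simp add: outer_mult r)
 qed
 have "e *v ?a = ?a" using assms(1) by (simp add: mv_assoc)
 hence "(?b\<bullet>?a) *R ?a = ?a" by (subst (asm) e) (simp add: outer_mult)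
 hence "?b\<bullet>?a = 1" using assms(2) by (metis scaleR_cancel_right scaleR_one)
 thus ?thesis using e that by blast
qed

text \<open>\<open>r1\<close> concerns the maps from the kernel of \<open>e\<close> to its image: if
  all of them have rank at most 1, then image or kernel is a line. The second alternative is needed
  only for an image of dimension at least 2 and a nonzero kernel, whence its dimension
  bound.\<close>

lemma idempotent_dichotomy:
 fixes e :: "real^'n^'n"
 assumes e: "e**e = e" "e ~= 0" "e ~= mat 1"
  and r1: "!!z. e**z = z ==> z**e = 0 ==> \<exists>a b. z = outer a b"
 shows "(\<exists>a b. e = outer a b \<and> b\<bullet>a = 1) \<or> (CARD('n)\<ge>3 \<and> (\<exists>a b. mat 1 - e = outer a b \<and> b\<bullet>a = 1))"
proof -
 obtain u where u: "e *v u ~= 0" using e(2) matrix_eqI[of e 0] by auto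
 show ?thesis
 proof (cases "\<forall>v. \<exists>r. e *v v = r *R (e *v u)")
  case True
  thus ?thesis using rank_one_idempotent[OF e(1) u] by metis
 next
  case False
  then obtain v where v: "!!r. e *v v ~= r *R (e *v u)" by blast
  let ?a = "e *v u" and ?a' = "e *v v"
  have av: "?a'\<notin>span {?a}" using v by (auto simp: span_singleton)
  have card3: "CARD('n)\<ge>3"
  proof (rule ccontr)
   assume "\<not> CARD('n)\<ge>3"
   have ind: "independent {?a', ?a}" using av u by (simp add: independent_insert)
   have "?a' ~= ?a" using v[of 1] by auto
   hence "card {?a', ?a} = 2" by simp
   hence sp: "UNIV\<subseteq>span {?a', ?a}"
    using \<open>\<not> CARD('n)\<ge>3\<close> by (intro card_ge_dim_independent ind) (simp_all add: dim_UNIV)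
   have fx: "e *v x = x" if "x\<in>span {?a', ?a}" for x
    using that
   proof (induction rule: span_induct_alt)
    case base thus ?case by simp
   next
    case (step c x y)
    thus ?case using e(1) by (auto simp: matrix_vector_right_distrib matrix_vector_mult_scaleR mv_assoc)
   qed
   have "e *v x = mat 1 *v x" for x using fx[of x] sp by (simp add: subset_iff)
   hence "e = mat 1" by (rule matrix_eqI)
   thus False using e(3) by simp
  qed
  let ?e' = "transpose (mat 1 - e)"
  have "(mat 1 - e)**(mat 1 - e) = mat 1 - e" using e(1) by (simp add: matrix_ring)
  hence e': "?e'**?e' = ?e'" by (metis matrix_transpose_mul)
  have "?e' ~= 0"
  proof
   assume "?e' = 0"
   hence "transpose ?e' = 0" by (simp add: transpose_def vec_eq_iff)
   thus False using e(3) by simp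
  qed
  then obtain p where p: "?e' *v p ~= 0" using matrix_eqI[of ?e' 0] by auto
  have te: "(?e' *v x) v* e = 0" for x
   using e(1) by (simp add: vector_matrix_mul_assoc matrix_ring)
  have "\<exists>r. ?e' *v q = r *R (?e' *v p)" for q
  proof (rule ccontr)
   assume n: "\<nexists>r. ?e' *v q = r *R (?e' *v p)"
   let ?b = "?e' *v p" and ?b' = "?e' *v q"
   \<comment> \<open>Two independent vectors of the image combined with two independent functionals
     vanishing on the image would give a map of rank 2.\<close>
   let ?z = "outer ?a ?b + outer ?a' ?b'"
   have "e**?z = ?z" using e(1) by (simp add: matrix_ring outer_mult mv_assoc)
   moreover have "?z**e = 0" by (simp only: matrix_add_right_distrib outer_mult te) (simp add: outer_def vec_eq_iff)
   ultimately obtain c d where cd: "?z = outer c d" using r1 by blast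
   have zx: "(?b\<bullet>x) *R ?a + (?b'\<bullet>x) *R ?a' = (d\<bullet>x) *R c" for x
    using arg_cong[OF cd, of "%A. A *v x"] by (simp add: outer_mult matrix_vector_mult_add_rdistrib)
   have b'b: "?b'\<notin>span {?b}" using n by (auto simp: span_singleton)
   have bb': "?b\<notin>span {?b'}"
   proof
    assume "?b\<in>span {?b'}"
    then obtain r where r: "?b = r *R ?b'" by (auto simp: span_singleton)
    hence "r ~= 0" using p by auto
    hence "?b' = (1 / r) *R ?b" by (subst r) simp
    thus False using n by blast
   qed
   obtain x where x: "x\<bullet>?b' = 0" "x\<bullet>?b = 1" using separating_vector[OF bb'] by auto
   obtain y where y: "y\<bullet>?b = 0" "y\<bullet>?b' = 1" using separating_vector[OF b'b] by auto
   have 1: "?a = (d\<bullet>x) *R c" using zx[of x] x by (simp add: inner_commute)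
   have 2: "?a' = (d\<bullet>y) *R c" using zx[of y] y by (simp add: inner_commute)
   have "d\<bullet>x ~= 0" using 1 u by auto
   hence "?a' = ((d\<bullet>y) / (d\<bullet>x)) *R ?a" using 1 2 by simp
   thus False using v by blast
  qed
  then obtain b a where ab: "?e' = outer b a" "a\<bullet>b = 1" using rank_one_idempotent[OF e' p] by metis
  hence "mat 1 - e = outer a b" by (metis outer_mult(4) transpose_transpose)
  thus ?thesis using card3 ab(2) by (metis inner_commute)
 qed
qed

lemma linear_injective_surjective:
 fixes f :: "'a::euclidean_space => 'b::euclidean_space"
 assumes "linear f" "inj f" "DIM('a) = DIM('b)" shows "surj f"
proof -
 have "dim (range f) = DIM('b)" using dim_image_eq[OF assms(1), of UNIV] assms(2,3) by (simp add: dim_UNIV)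
 hence "span (range f) = UNIV" by (simp only: dim_eq_full)
 moreover have "subspace (range f)" using linear_subspace_image[OF assms(1) subspace_UNIV] .
 ultimately show ?thesis by (metis span_eq_iff)
qed

lemma trace_zero [simp]: "trace (0 :: real^'n^'n) = 0"
 by (simp add: trace_def)

lemmas trace_rules = trace_simps trace_I

lemma other_index: "CARD('p)\<ge>2 ==> \<exists>j. j ~= (i :: 'p::finite)"
proof (rule ccontr)
 assume c: "CARD('p)\<ge>2" and "\<nexists>j. j ~= i"
 hence "(UNIV :: 'p set) = {i}" by auto
 hence "CARD('p) = 1" by (metis card_1_singleton_iff One_nat_def)
 thus False using c by simp
qed

lemma self_neg_zero: "x = - x ==> x = (0 :: 'a::real_vector)"
proof -
 assume "x = - x"
 hence "x + x = 0" by (metis add.right_inverse)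
 hence "2 *R x = 0" by (simp only: scaleR_2)
 thus "x = 0" by simp
qed

lemma transpose_zero: "transpose (0 :: real^'n^'m) = 0"
 by (simp add: transpose_def vec_eq_iff)

lemma transpose_arith:
 "transpose (A + B :: real^'n^'m) = transpose A + transpose B" "transpose (A - B :: real^'n^'m) = transpose A - transpose B"
 "transpose (- A :: real^'n^'m) = - transpose A" "transpose (scal c) = scal c"
 by (simp_all add: transpose_def vec_eq_iff mat_def)

lemma transpose_munit: "transpose (munit i j) = munit j i"
 by (simp add: munit_def outer_mult)

lemma matrix_sum_vector: "(\<Sum>i\<in>I. A i) *v x = (\<Sum>i\<in>I. A i *v (x :: real^'n))"
 by (induction I rule: infinite_finite_induct) (simp_all add: matrix_vector_mult_add_rdistrib)

lemma munit_vector: "munit i j *v w = (w $ j) *R axis i 1"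
 by (simp add: munit_def outer_mult inner_axis')

lemma linear_transpose: "linear (transpose :: real^'n^'m => real^'m^'n)"
 by (simp add: linear_iff transpose_arith transpose_scalar)

lemma linear_trace: "linear (trace :: real^'n^'n => real)"
 by (simp add: linear_iff trace_simps)

text \<open>A linear lift of a homomorphism between matrix Lie algebras modulo scalars. In the last
  clause the images of the matrix units act on the whole target with the Casimir value of the
  source.\<close>

definition lie_mod_scalars :: "(real^'n^'n => real^'p^'p) => bool" where
 "lie_mod_scalars Theta \<longleftrightarrow> linear Theta \<and> (\<forall>a b. \<exists>c. Theta (lie a b) = lie (Theta a) (Theta b) + scal c) \<and>
  (\<exists>c. Theta (mat 1) = scal c) \<and>
  (\<forall>z. \<exists>c. (\<Sum>i\<in>UNIV. \<Sum>j\<in>UNIV. lie (Theta (munit i j)) (lie (Theta (munit j i)) z)) = (2 * real CARD('n)) *R z + scal c)"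

text \<open>The trace-free lift turns relations modulo scalars into exact ones, because commutators
  have trace 0. It kills the identity, which \<open>unital\<close> repairs in order to reach a
  bijection in equal rank.\<close>

definition traceless :: "(real^'n^'n => real^'p^'p) => real^'n^'n => real^'p^'p" where
 "traceless Theta m = Theta m - scal (trace (Theta m) / real CARD('p))"

definition unital :: "(real^'n^'n => real^'p^'p) => real^'n^'n => real^'p^'p" where
 "unital Theta m = traceless Theta m + scal (trace m / real CARD('n))"

lemma traceless_props:
 fixes Theta :: "real^'n^'n => real^'p^'p"
 assumes "lie_mod_scalars Theta"
 shows "linear (traceless Theta)" "traceless Theta (lie a b) = lie (traceless Theta a) (traceless Theta b)"
  "traceless Theta (mat 1) = 0" "trace (traceless Theta m) = 0"
proof -
 have lin: "linear Theta" using assms by (simp add: lie_mod_scalars_def)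
 show "linear (traceless Theta)"
  unfolding linear_iff traceless_def
  by (simp add: linear_add[OF lin] linear_scale[OF lin] trace_rules add_divide_distrib scaleR_add_left algebra_simps)
 show tr: "trace (traceless Theta m) = 0" for m by (simp add: traceless_def trace_rules)
 obtain c where c: "Theta (lie a b) = lie (Theta a) (Theta b) + scal c" using assms unfolding lie_mod_scalars_def by blast
 have "trace (Theta (lie a b)) / real CARD('p) = c" by (simp add: c trace_rules trace_lie)
 thus "traceless Theta (lie a b) = lie (traceless Theta a) (traceless Theta b)"
  by (simp add: traceless_def c lie_diff lie_scal)
 obtain d where "Theta (mat 1) = scal d" using assms by (auto simp: lie_mod_scalars_def)
 thus "traceless Theta (mat 1) = 0" by (simp add: traceless_def trace_rules)
qed

text \<open>If every \<open>Theta x\<close> were scalar, the Casimir sum would vanish, whereas its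
  prescribed value on an off-diagonal matrix unit is not scalar. Rank at least 2 provides such a
  matrix unit.\<close>

lemma traceless_nonzero:
 fixes Theta :: "real^'n^'n => real^'p^'p"
 assumes "lie_mod_scalars Theta" "CARD('p)\<ge>2"
 obtains x where "traceless Theta x ~= 0"
proof (rule ccontr)
 assume "\<not> thesis"
 hence z: "traceless Theta x = 0" for x using that by blast
 have s: "Theta x = scal (trace (Theta x) / real CARD('p))" for x using z[of x] by (simp add: traceless_def)
 have l0: "lie (Theta x) z = 0" for x z by (subst s) (rule lie_scal)
 obtain k l :: 'p where kl: "k ~= l" using other_index[OF assms(2)] by blast
 obtain c where "(\<Sum>i\<in>UNIV. \<Sum>j\<in>UNIV. lie (Theta (munit i j)) (lie (Theta (munit j i)) (munit k l))) = (2 * real CARD('n)) *R munit k l + scal c"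
  using assms(1) unfolding lie_mod_scalars_def by blast
 hence "(0 :: real^'p^'p) = (2 * real CARD('n)) *R munit k l + scal c" by (simp add: l0)
 hence "(0 :: real^'p^'p) $ k $ l = ((2 * real CARD('n)) *R munit k l + scal c) $ k $ l" by simp
 thus False using kl by (simp add: munit_component mat_def)
qed

lemma unital_props:
 fixes Theta :: "real^'n^'n => real^'p^'p"
 assumes "lie_mod_scalars Theta" "CARD('p)\<ge>2"
 shows "linear (unital Theta)" "unital Theta (lie a b) = lie (unital Theta a) (unital Theta b)"
  "unital Theta (mat 1) = mat 1" "trace (unital Theta m) = trace m * (real CARD('p) / real CARD('n))" "inj (unital Theta)"
proof -
 note t = traceless_props[OF assms(1)]
 show lin: "linear (unital Theta)"
  unfolding linear_iff unital_def
  by (simp add: linear_add[OF t(1)] linear_scale[OF t(1)] trace_rules add_divide_distrib scaleR_add_left algebra_simps)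
 show "unital Theta (lie a b) = lie (unital Theta a) (unital Theta b)"
  by (simp add: unital_def t(2) lie_add lie_scal trace_lie)
 show "unital Theta (mat 1) = mat 1" by (simp add: unital_def t(3) trace_rules)
 show tr: "trace (unital Theta m) = trace m * (real CARD('p) / real CARD('n))" for m
  by (simp add: unital_def t(4) trace_rules)
 have "m = 0" if "unital Theta m = 0" for m
 proof -
  have tm: "trace m = 0" using tr[of m] that by simp
  hence "traceless Theta m = 0" using that by (simp add: unital_def)
  hence "\<exists>c. m = scal c"
   using lie_kernel_trivial[OF t(1,2,3)] traceless_nonzero[OF assms] by metis
  thus ?thesis using tm by (auto simp: trace_rules)
 qed
 thus "inj (unital Theta)" using linear_injective_0[OF lin] by blast
qed

text \<open>A dimension count: \<open>unital Theta\<close> is injective, because the trace-free lift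
  is nonzero and so has only scalars in its kernel.\<close>

lemma lie_mod_scalars_card:
 fixes Theta :: "real^'n^'n => real^'p^'p"
 assumes "lie_mod_scalars Theta" "CARD('p)\<ge>2"
 shows "CARD('n)\<le>CARD('p)"
proof -
 note u = unital_props[OF assms]
 have "dim (range (unital Theta)) = DIM(real^'n^'n)"
  using dim_image_eq[OF u(1), of UNIV] u(5) by (simp add: dim_UNIV)
 hence "DIM(real^'n^'n)\<le>DIM(real^'p^'p)" using dim_subset_UNIV by metis
 hence "CARD('n) * CARD('n)\<le>CARD('p) * CARD('p)" by simp
 thus ?thesis by (metis mult_le_mono le_cases nat_mult_le_cancel_disj le_square mult_le_cancel2 order_antisym_conv power2_eq_square power2_nat_le_eq_le)
qed

definition lie_iso :: "(real^'n^'n => real^'p^'p) => bool" where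
 "lie_iso theta \<longleftrightarrow> linear theta \<and> (\<forall>a b. theta (lie a b) = lie (theta a) (theta b)) \<and> theta (mat 1) = mat 1 \<and>
  (\<forall>m. trace (theta m) = trace m) \<and> bij theta"

lemma lie_iso_unital:
 fixes Theta :: "real^'n^'n => real^'p^'p"
 assumes "lie_mod_scalars Theta" "CARD('p)\<ge>2" "CARD('n) = CARD('p)"
 shows "lie_iso (unital Theta)"
proof -
 note u = unital_props[OF assms(1,2)]
 have "surj (unital Theta)" by (rule linear_injective_surjective[OF u(1,5)]) (simp add: assms(3))
 thus ?thesis using u assms(3) by (auto simp: lie_iso_def bij_def)
qed

text \<open>Turns minus an anti-automorphism into an automorphism; the trace term keeps the map unital.\<close>

definition dual_map :: "(real^'n^'n => real^'p^'p) => real^'n^'n => real^'p^'p" where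
 "dual_map theta m = - theta (transpose m) + scal (2 * trace m / real CARD('p))"

lemma lie_iso_dual:
 fixes theta :: "real^'n^'n => real^'p^'p"
 assumes "lie_iso theta" "CARD('n) = CARD('p)" shows "lie_iso (dual_map theta)"
proof -
 have g: "linear theta" "!!a b. theta (lie a b) = lie (theta a) (theta b)" "theta (mat 1) = mat 1" "!!m. trace (theta m) = trace m" "bij theta"
  using assms by (auto simp: lie_iso_def)
 have lin: "linear (dual_map theta)"
  unfolding linear_iff dual_map_def
  by (simp add: linear_add[OF g(1)] linear_scale[OF g(1)] transpose_arith transpose_scalar trace_rules add_divide_distrib
    scaleR_add_left algebra_simps)
 have lt: "transpose (lie a b) = - lie (transpose a) (transpose b)" for a b :: "real^'n^'n"
  by (simp add: lie_def transpose_arith matrix_transpose_mul)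
 have hom: "dual_map theta (lie a b) = lie (dual_map theta a) (dual_map theta b)" for a b
  by (simp add: dual_map_def lt trace_lie linear_neg[OF g(1)] g(2) lie_diff lie_scal)
 have tr: "trace (dual_map theta m) = trace m" for m by (simp add: dual_map_def trace_rules g(4))
 have one: "dual_map theta (mat 1) = mat 1"
  using assms(2) by (simp add: dual_map_def g(3) trace_rules) (simp add: scaleR_2)
 have "m = 0" if "dual_map theta m = 0" for m
 proof -
  have "trace m = 0" using tr[of m] that by simp
  hence "theta (transpose m) = theta 0" using that linear_0[OF g(1)] by (simp add: dual_map_def)
  hence "transpose m = 0" using g(5) by (simp add: bij_def inj_eq)
  hence "transpose (transpose m) = transpose 0" by (rule arg_cong)
  thus ?thesis by (simp add: transpose_zero)
 qed
 hence inj: "inj (dual_map theta)" using linear_injective_0[OF lin] by blast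
 have "surj (dual_map theta)" by (rule linear_injective_surjective[OF lin inj]) (simp add: assms(2))
 thus ?thesis using lin hom tr one inj by (auto simp: lie_iso_def bij_def)
qed

text \<open>Peirce decomposition for the idempotent \<open>f\<close>: eigenvalue 1 of ad f means a
  map from the kernel of \<open>f\<close> to its image.\<close>

lemma lie_eigen_1:
 fixes f x :: "real^'n^'n"
 assumes "f**f = f" "lie f x = x" shows "x**f = 0" "f**x = x" "x**x = 0"
proof -
 have e: "f**x - x**f = x" using assms(2) by (simp add: lie_def)
 have "f**(f**x - x**f) = f**x" by (simp only: e)
 hence 1: "f**x**f = 0" using assms(1) by (simp add: matrix_ring)
 have "(f**x - x**f)**f = x**f" by (simp only: e)
 hence "f**x**f - x**f = x**f" using assms(1) by (simp add: matrix_diff_rdistrib matrix_mul_assoc[symmetric])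
 hence "x**f = - (x**f)" using 1 by simp
 thus xf: "x**f = 0" by (rule self_neg_zero)
 thus fx: "f**x = x" using e by simp
 have "x**x = x**f**x" by (simp only: matrix_mul_assoc[symmetric] fx)
 thus "x**x = 0" unfolding xf by simp
qed

lemma lie_eigen_minus_1:
 fixes f x :: "real^'n^'n"
 assumes "f**f = f" "lie f x = - x" shows "x**f = x" "f**x = 0"
proof -
 have e: "f**x - x**f = - x" using assms(2) by (simp add: lie_def)
 have "f**(f**x - x**f) = f**(- x)" by (simp only: e)
 hence 1: "f**x - f**x**f = - (f**x)" using assms(1) by (simp add: matrix_ring)
 have "x**f - f**x = x" using arg_cong[OF e, of uminus] by simp
 hence "(x**f - f**x)**f = x**f" by (simp only:)
 hence 2: "f**x**f = 0" using assms(1) by (simp add: matrix_diff_rdistrib matrix_mul_assoc[symmetric])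
 have "f**x = - (f**x)" using 1 unfolding 2 diff_zero .
 thus fx: "f**x = 0" by (rule self_neg_zero)
 thus "x**f = x" using e by simp
qed

lemma munit_idempotent: "munit i i**munit i i = (munit i i :: real^'n^'n)" by (simp add: munit_mult)

text \<open>For \<open>z**z = 0\<close> the double bracket is -2 z u z. With \<open>u\<close> of
  rank 1 and suitably chosen this has rank 1, and by hypothesis it is a multiple of
  \<open>z\<close>.\<close>

lemma extremal_rank_one:
 fixes z :: "real^'n^'n"
 assumes "z**z = 0" "!!u. \<exists>c. lie z (lie z u) = c *R z"
 shows "\<exists>a b. z = outer a b"
proof (cases "z = 0")
 case True thus ?thesis by (metis outer_zero_iff)
next
 case False
 obtain p where p: "z *v p ~= 0" using False matrix_eqI[of z 0] by auto
 have "\<exists>q. q v* z ~= 0"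
 proof (rule ccontr)
  assume "\<nexists>q. q v* z ~= 0"
  hence "transpose z = 0" by (intro matrix_eqI) simp
  hence "transpose (transpose z) = transpose 0" by (rule arg_cong)
  thus False using False by (simp add: transpose_zero)
 qed
 then obtain q where q: "q v* z ~= 0" by blast
 obtain c where c: "lie z (lie z (outer p q)) = c *R z" using assms(2) by blast
 have "lie z (lie z u) = z**z**u - 2 *R (z**u**z) + u**(z**z)" for u
  by (simp only: lie_def matrix_ring scaleR_2) (simp only: algebra_simps)
 hence "- 2 *R outer (z *v p) (q v* z) = c *R z" using c by (simp add: assms(1) outer_mult)
 hence "(- 1 / 2) *R (- 2 *R outer (z *v p) (q v* z)) = (- 1 / 2) *R (c *R z)" by (rule arg_cong)
 hence e: "outer (z *v p) (q v* z) = (- c / 2) *R z" by simp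
 have "c ~= 0"
 proof
  assume "c = 0"
  hence "outer (z *v p) (q v* z) = 0" using e by simp
  thus False using p q by (simp add: outer_zero_iff)
 qed
 hence "z = outer ((- 2 / c) *R (z *v p)) (q v* z)" unfolding outer_scaleR e by simp
 thus ?thesis by blast
qed

text \<open>The Lie structure recognises \<open>munit i i\<close>: its ad satisfies ad^3 = ad, and
  the eigenvectors for eigenvalue 1 are extremal. Both properties pass through \<open>theta\<close>,
  so the image is, up to adding a scalar, an idempotent whose image or kernel is a line.
  Preservation of the trace fixes the scalar.\<close>

lemma lie_iso_dichotomy:
 fixes theta :: "real^'n^'n => real^'p^'p"
 assumes g: "lie_iso theta" and n: "CARD('n)\<ge>2" "CARD('n) = CARD('p)"
 shows "(\<exists>a b. theta (munit i i) = outer a b \<and> b\<bullet>a = 1) \<or>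
  (CARD('p)\<ge>3 \<and> (\<exists>a b. dual_map theta (munit i i) = outer a b \<and> b\<bullet>a = 1) \<and>
   theta (munit i i)**theta (munit i i) ~= theta (munit i i))"
proof -
 have lin: "linear theta" and hom: "!!a b. theta (lie a b) = lie (theta a) (theta b)" and one: "theta (mat 1) = mat 1"
  and tr: "!!m. trace (theta m) = trace m" and bij: "bij theta"
  using g by (auto simp: lie_iso_def)
 let ?E = "munit i i :: real^'n^'n" and ?f = "theta (munit i i)"
 have ns: "?f ~= scal c" for c
 proof
  assume "?f = scal c"
  hence "theta ?E = theta (scal c)" by (simp add: linear_scale[OF lin] one)
  hence E: "?E = scal c" using bij by (simp add: bij_def inj_eq)
  obtain j where "j ~= i" using other_index[OF n(1)] by blast
  hence "?E $ i $ i = scal c $ i $ i" "?E $ j $ j = scal c $ j $ j" using E by simp_all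
  thus False using \<open>j ~= i\<close> by (simp add: munit_component mat_def)
 qed
 have "lie ?f (lie ?f (lie ?f z)) = lie ?f z" for z
 proof -
  obtain y where y: "z = theta y" using bij by (meson bij_pointE)
  have EE: "?E**?E = ?E" by (rule munit_idempotent)
  have "lie ?E (lie ?E (lie ?E y)) = lie ?E y"
   unfolding lie_cubed by (simp add: EE matrix_mul_assoc[of _ ?E ?E, symmetric] lie_def)
  thus ?thesis unfolding y by (metis hom)
 qed
 then obtain e c where ec: "?f = e + scal c" "e**e = e" by (rule ad_cubed_idempotent[OF _ ns])
 have r1: "\<exists>a b. z = outer a b" if z: "e**z = z" "z**e = 0" for z
 proof -
  have fz: "lie ?f z = z" by (simp add: ec(1) lie_add lie_scal) (simp add: lie_def z)
  obtain y where y: "z = theta y" using bij by (meson bij_pointE)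
  have "theta (lie ?E y) = theta y" using fz by (simp add: hom y)
  hence Ey: "lie ?E y = y" using bij by (simp add: bij_def inj_eq)
  note ly = lie_eigen_1[OF munit_idempotent Ey]
  have ext: "\<exists>c. lie y (lie y u) = c *R y" for u
  proof -
   have "y**u**y = ?E**(y**u)**?E**y"
    using ly(2) by (simp add: matrix_mul_assoc[symmetric]) (simp add: matrix_mul_assoc)
   also have "\<dots> = ((y**u) $ i $ i) *R y" by (simp add: munit_conj matrix_scaleR_left ly(2))
   finally have yuy: "y**u**y = ((y**u) $ i $ i) *R y" .
   have "lie y (lie y u) = y**y**u - 2 *R (y**u**y) + u**(y**y)"
    by (simp only: lie_def matrix_ring scaleR_2) (simp only: algebra_simps)
   hence "lie y (lie y u) = (- 2 * ((y**u) $ i $ i)) *R y" by (simp add: ly(3) yuy)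
   thus ?thesis by blast
  qed
  have "\<exists>c. lie z (lie z u) = c *R z" for u
  proof -
   obtain x where x: "u = theta x" using bij by (meson bij_pointE)
   obtain c where "lie y (lie y x) = c *R y" using ext by blast
   hence "theta (lie y (lie y x)) = c *R theta y" by (simp add: linear_scale[OF lin])
   thus ?thesis by (auto simp: x y hom)
  qed
  moreover have "z**z = 0"
  proof -
   have "z**z = z**e**z" by (simp only: matrix_mul_assoc[symmetric] z(1))
   thus ?thesis using z(2) by simp
  qed
  ultimately show ?thesis by (intro extremal_rank_one)
 qed
 have e01: "e ~= 0" "e ~= mat 1" using ec(1) ns[of c] ns[of "1 + c"] by (auto simp: scaleR_add_left)
 have p0: "real CARD('p) ~= 0" by simp
 have trf: "trace ?f = 1" by (simp add: tr trace_munit)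
 from idempotent_dichotomy[OF ec(2) e01 r1]
 consider a b where "e = outer a b" "b\<bullet>a = 1" | a b where "CARD('p)\<ge>3" "mat 1 - e = outer a b" "b\<bullet>a = 1"
  by blast
 thus ?thesis
 proof cases
  case 1
  have "c = 0" using trf p0 by (simp add: ec(1) trace_rules 1(1) trace_outer 1(2) inner_commute[of a b])
  thus ?thesis using 1 ec(1) by auto
 next
  case 2
  have e: "e = mat 1 - outer a b" using 2(2) by (metis diff_diff_eq2 add_diff_cancel_left' diff_add_cancel)
  have c: "real CARD('p) - 1 + c * real CARD('p) = 1"
   using trf by (simp add: ec(1) trace_rules e trace_outer 2(3) inner_commute[of a b] trace_rules)
  have "dual_map theta ?E = outer a b + scal (2 / real CARD('p) - 1 - c)"
   by (simp add: dual_map_def transpose_munit ec(1) e trace_munit scaleR_diff_left)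
  \<comment> \<open>Trace 1 forces c = 2/p - 1, which is just the constant that
    \<open>dual_map\<close> cancels.\<close>
  also have "2 / real CARD('p) - 1 - c = 0" using c by (simp add: field_simps)
  finally have d: "dual_map theta ?E = outer a b" by simp
  have "?f**?f ~= ?f"
  proof
   assume ff: "?f**?f = ?f"
   have "?f**?f = e + (2 * c) *R e + scal (c * c)"
    by (simp only: ec(1) matrix_add_ldistrib matrix_add_right_distrib ec(2) scal_mult scaleR_scaleR mult_2 scaleR_add_left)
     (simp only: algebra_simps scaleR_scaleR)
   hence ce: "(2 * c) *R e = scal (c - c * c)" using ff ec(1) by (simp add: scaleR_diff_left algebra_simps)
   have "c = 0"
   proof (rule ccontr)
    assume "c ~= 0"
    hence "e = (1 / (2 * c)) *R ((2 * c) *R e)" by simp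
    hence "e = scal ((c - c * c) / (2 * c))" unfolding ce by simp
    hence "?f = scal ((c - c * c) / (2 * c) + c)" using ec(1) by (simp add: scaleR_add_left)
    thus False using ns by blast
   qed
   thus False using c 2(1) by simp
  qed
  thus ?thesis using 2 d by blast
 qed
qed

text \<open>An arbitrary but fixed index: a single diagonal matrix unit detects the type and starts
  the construction of the intertwiner.\<close>

definition frame_index :: 'n where "frame_index = undefined"

abbreviation eprobe :: "real^'n^'n" where "eprobe \<equiv> munit frame_index frame_index"

text \<open>Meant for \<open>a\<close> in the image of \<open>theta eprobe\<close>, which plays the
  role of the basis vector with index \<open>frame_index\<close>; the columns are the images of
  \<open>a\<close> that correspond to the other basis vectors. The explicit formula makes smooth
  dependence on \<open>theta\<close> and \<open>a\<close> evident.\<close>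

definition intertwiner :: "(real^'n^'n => real^'p^'p) => real^'p => real^'n^'p" where
 "intertwiner theta a = (\<chi> r c. (theta (munit c frame_index) *v a) $ r)"

lemma lie_iso_type:
 fixes theta :: "real^'n^'n => real^'p^'p"
 assumes g: "lie_iso theta" and n: "CARD('n)\<ge>2" "CARD('n) = CARD('p)"
 shows "theta eprobe**theta eprobe = theta eprobe \<or> CARD('p)\<ge>3 \<and> dual_map theta eprobe**dual_map theta eprobe = dual_map theta eprobe"
  "CARD('p)\<ge>3 ==> theta eprobe**theta eprobe = theta eprobe ==> dual_map theta eprobe**dual_map theta eprobe ~= dual_map theta eprobe"
  "theta eprobe**theta eprobe = theta eprobe ==> \<exists>a b. theta eprobe = outer a b \<and> b\<bullet>a = 1"
proof -
 have o: "outer a b**outer a b = outer a b" if "b\<bullet>a = 1" for a b :: "real^'p"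
  using that by (simp add: outer_mult)
 show "theta eprobe**theta eprobe = theta eprobe \<or> CARD('p)\<ge>3 \<and> dual_map theta eprobe**dual_map theta eprobe = dual_map theta eprobe"
  using lie_iso_dichotomy[OF g n, of frame_index] o by metis
 show r1: "theta eprobe**theta eprobe = theta eprobe ==> \<exists>a b. theta eprobe = outer a b \<and> b\<bullet>a = 1"
  using lie_iso_dichotomy[OF g n, of frame_index] by blast
 assume p: "CARD('p)\<ge>3" and f: "theta eprobe**theta eprobe = theta eprobe"
 show "dual_map theta eprobe**dual_map theta eprobe ~= dual_map theta eprobe"
 proof
  assume d: "dual_map theta eprobe**dual_map theta eprobe = dual_map theta eprobe"
  let ?f = "theta eprobe" and ?r = "2 / real CARD('p)"
  have df: "dual_map theta eprobe = scal ?r - ?f" by (simp add: dual_map_def transpose_munit trace_munit)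
  obtain a b where ab: "?f = outer a b" "b\<bullet>a = 1" using r1[OF f] by blast
  have fa: "?f *v a = a" by (simp add: ab outer_mult)
  have dfa: "dual_map theta eprobe *v a = (?r - 1) *R a"
   by (simp add: df matrix_vector_mult_diff_rdistrib fa scaleR_matrix_vector_assoc[symmetric] scaleR_diff_left)
  have "(dual_map theta eprobe**dual_map theta eprobe) *v a = ((?r - 1) * (?r - 1)) *R a"
   by (simp add: mv_assoc[symmetric] dfa matrix_vector_mult_scaleR)
  hence "((?r - 1) * (?r - 1)) *R a = (?r - 1) *R a" unfolding d dfa by simp
  moreover have "a ~= 0" using ab(2) by auto
  ultimately have "(?r - 1) * (?r - 1) = ?r - 1" by simp
  \<comment> \<open>On \<open>a\<close> the dual map acts by 2/p - 1, and an idempotent allows only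
    0 and 1, that is p = 2 or p = 1.\<close>
  hence "?r = 1 \<or> ?r = 2" by (metis eq_iff_diff_eq_0 mult_cancel_right1 diff_eq_eq one_add_one)
  moreover have "?r < 1" using p by simp
  ultimately show False by simp
 qed
qed

lemma linear_munit_eqI:
 "linear f ==> linear g ==> (!!i j. f (munit i j) = g (munit i j)) ==> f x = g (x :: real^'n^'n)"
 by (subst (1 2) munit_expand) (simp add: linear_sum linear_scale)

text \<open>Brackets with the fixed diagonal unit show that \<open>theta (munit j k)\<close> kills
  \<open>a\<close> unless \<open>k\<close> is the fixed index. The commutation rules of matrix units
  then make \<open>theta\<close> act on the columns of the intertwiner as matrices act on basis
  vectors.\<close>

lemma intertwiner_exists:
 fixes theta :: "real^'n^'n => real^'p^'p"
 assumes g: "lie_iso theta" and n: "CARD('n)\<ge>2" "CARD('n) = CARD('p)"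
  and f: "theta eprobe**theta eprobe = theta eprobe" and a: "theta eprobe *v a = a" "a ~= 0"
 shows "theta m**intertwiner theta a = intertwiner theta a**m" "invertible (intertwiner theta a)"
proof -
 have lin: "linear theta" and hom: "!!a b. theta (lie a b) = lie (theta a) (theta b)" and one: "theta (mat 1) = mat 1"
  using g by (auto simp: lie_iso_def)
 define o' where "o' = (frame_index :: 'n)"
 define Z where "Z = (%j k. theta (munit j k))"
 let ?f = "Z o' o'" and ?G = "intertwiner theta a"
 have ff: "?f**?f = ?f" and fa: "?f *v a = a" using f a by (simp_all add: Z_def o'_def)
 obtain a0 b0 where ab: "?f = outer a0 b0" "b0\<bullet>a0 = 1"
  using lie_iso_type(3)[OF g n f] by (auto simp: Z_def o'_def)
 have a0: "a = (b0\<bullet>a) *R a0" using fa by (simp add: ab outer_mult)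
 hence ba: "b0\<bullet>a ~= 0" using a(2) by auto
 have eig: "\<exists>r. v = r *R a" if "?f *v v = v" for v
 proof -
  have "v = (b0\<bullet>v) *R a0" using that by (simp add: ab outer_mult)
  also have "a0 = (1 / (b0\<bullet>a)) *R ((b0\<bullet>a) *R a0)" using ba by simp
  also have "\<dots> = (1 / (b0\<bullet>a)) *R a" by (simp only: a0[symmetric])
  finally show ?thesis by (auto simp del: a0)
 qed
 have row: "Z o' j *v a = 0" if "j ~= o'" for j
 proof -
  have "lie (munit o' o') (munit o' j) = munit o' j" using that by (simp add: lie_def munit_mult)
  hence "lie ?f (Z o' j) = Z o' j" using hom[of "munit o' o'" "munit o' j"] by (simp add: Z_def)
  hence "Z o' j**?f = 0" using lie_eigen_1(1)[OF ff] by blast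
  hence "(Z o' j**?f) *v a = 0" by simp
  thus ?thesis by (simp add: mv_assoc[symmetric] fa)
 qed
 have col: "Z j o'**?f = Z j o'" "?f**Z j o' = 0" if "j ~= o'" for j
 proof -
  have "lie (munit o' o') (munit j o') = - munit j o'" using that by (simp add: lie_def munit_mult)
  hence "lie ?f (Z j o') = - Z j o'" using hom[of "munit o' o'" "munit j o'"] by (simp add: Z_def linear_neg[OF lin])
  thus "Z j o'**?f = Z j o'" "?f**Z j o' = 0" using lie_eigen_minus_1[OF ff] by blast+
 qed
 have comm: "\<exists>r. Z j k *v a = r *R a" if "j ~= o'" "k ~= o'" for j k
 proof (rule eig)
  have "lie (munit o' o') (munit j k) = 0" using that by (simp add: lie_def munit_mult)
  hence "lie ?f (Z j k) = 0" using hom[of "munit o' o'" "munit j k"] by (simp add: Z_def linear_0[OF lin])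
  hence "?f**Z j k = Z j k**?f" by (simp add: lie_def)
  hence "(?f**Z j k) *v a = (Z j k**?f) *v a" by simp
  thus "?f *v (Z j k *v a) = Z j k *v a" by (simp add: mv_assoc[symmetric] fa)
 qed
 then obtain r where r: "!!j k. j ~= o' ==> k ~= o' ==> Z j k *v a = r j k *R a" by metis
 have lie_a: "lie (Z j k) (Z l m) *v a = 0" if "j ~= o'" "k ~= o'" "l ~= o'" "m ~= o'" for j k l m
  using r[OF that(1,2)] r[OF that(3,4)]
  by (simp add: lie_def matrix_vector_mult_diff_rdistrib mv_assoc[symmetric] matrix_vector_mult_scaleR)
 have off: "Z j k *v a = 0" if "j ~= o'" "k ~= o'" "j ~= k" for j k
 proof -
  have "lie (munit j j) (munit j k) = munit j k" using that by (simp add: lie_def munit_mult)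
  hence "Z j k = lie (Z j j) (Z j k)" using hom[of "munit j j" "munit j k"] by (simp add: Z_def)
  thus ?thesis using lie_a[OF that(1,1,1,2)] by simp
 qed
 have same: "Z j j *v a = Z k k *v a" if "j ~= o'" "k ~= o'" for j k
 proof (cases "j = k")
  case False
  have "Z j j - Z k k = lie (Z j k) (Z k j)"
   using hom[of "munit j k" "munit k j"] by (simp add: Z_def lie_munit_offdiag[OF False] linear_diff[OF lin])
  hence "(Z j j - Z k k) *v a = 0" using lie_a[OF that that(2,1)] by simp
  thus ?thesis by (simp add: matrix_vector_mult_diff_rdistrib)
 qed simp
 \<comment> \<open>The matrix units away from \<open>o'\<close> act on the line of \<open>a\<close>,
   so their commutators act by 0 and the diagonal ones all act by the same number. Since
   \<open>theta\<close> fixes the identity and \<open>Z o' o'\<close> already fixes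
   \<open>a\<close>, that number is 0.\<close>
 have diag: "Z k k *v a = 0" if k: "k ~= o'" for k
 proof -
  have "(\<Sum>j\<in>UNIV. Z j j) = mat 1"
   unfolding Z_def linear_sum[OF lin, symmetric] sum_munit_diag one ..
  hence "(\<Sum>j\<in>UNIV. Z j j *v a) = a"
   by (simp only: matrix_sum_vector[symmetric] matrix_vector_mul_lid)
  hence "Z o' o' *v a + (\<Sum>j\<in>UNIV - {o'}. Z j j *v a) = a" using sum.remove[of UNIV o' "%j. Z j j *v a"] by simp
  moreover have "(\<Sum>j\<in>UNIV - {o'}. Z j j *v a) = (\<Sum>j\<in>UNIV - {o'}. Z k k *v a)"
   by (intro sum.cong refl same k) simp
  ultimately have "real (card (UNIV - {o'})) *R (Z k k *v a) = 0" using fa by (simp add: sum_constant_scaleR del: sum_constant)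
  moreover have "card (UNIV - {o'}) ~= 0" using k by (auto simp only: card_eq_0_iff finite)
  ultimately show ?thesis by simp
 qed
 have Za: "Z j k *v a = (if k = o' then Z j o' *v a else 0)" for j k
  using row[of k] off[of j k] diag[of k] by (cases "k = o'"; cases "j = o'"; cases "j = k") auto
 have Gaxis: "?G *v axis c 1 = Z c o' *v a" for c
  by (simp add: matrix_vector_mult_basis column_def intertwiner_def vec_eq_iff Z_def o'_def)
 have ZZ: "Z k o' *v (Z j o' *v a) = (if j = o' then Z k o' *v a else 0)" for j k
 proof (cases "j = o'")
  case False
  have "?f *v (Z j o' *v a) = 0" using col(2)[OF False] by (simp add: mv_assoc)
  moreover have "Z k o'**?f = Z k o'" using col(1)[of k] ff by (cases "k = o'") auto
  hence "Z k o' *v w = Z k o' *v (?f *v w)" for w by (simp add: mv_assoc)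
  ultimately show ?thesis using False by (metis matrix_vector_mult_0_right)
 qed (simp add: fa)
 have "theta x *v (Z l o' *v a) = ?G *v (x *v axis l 1)" for x l
 proof (rule linear_munit_eqI[of "%x. theta x *v (Z l o' *v a)"])
  show "linear (%x. theta x *v (Z l o' *v a))" "linear (%x. ?G *v (x *v axis l 1))"
   by (simp_all add: linear_iff linear_add[OF lin] linear_scale[OF lin] matrix_vector_mult_add_rdistrib matrix_vector_right_distrib
     matrix_vector_mult_scaleR scaleR_matrix_vector_assoc[symmetric])
  fix j k
  have "Z j k**Z l o' - Z l o'**Z j k = theta (lie (munit j k) (munit l o'))" unfolding hom by (simp only: lie_def Z_def)
  also have "\<dots> = (if k = l then Z j o' else 0) - (if o' = j then Z l k else 0)"
   by (simp add: lie_def munit_mult linear_diff[OF lin] linear_0[OF lin] Z_def)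
  finally have "Z j k**Z l o' = (if k = l then Z j o' else 0) - (if o' = j then Z l k else 0) + Z l o'**Z j k"
   by (simp only: diff_eq_eq)
  hence "Z j k *v (Z l o' *v a) = ((if k = l then Z j o' else 0) - (if o' = j then Z l k else 0) + Z l o'**Z j k) *v a"
   by (simp add: mv_assoc)
  also have "\<dots> = (if k = l then Z j o' *v a else 0)"
   by (cases "j = o'") (simp_all add: matrix_vector_mult_add_rdistrib matrix_vector_mult_diff_rdistrib mv_assoc[symmetric] Za[of _ k] ZZ fa)
  finally show "theta (munit j k) *v (Z l o' *v a) = ?G *v (munit j k *v axis l 1)"
   by (simp add: Z_def[THEN fun_cong, THEN fun_cong, symmetric] munit_vector axis_def[of l] matrix_vector_mult_scaleR Gaxis)
 qed
 hence "(theta x**?G) *v axis l 1 = (?G**x) *v axis l 1" for x l by (simp add: mv_assoc[symmetric] Gaxis)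
 hence inter: "theta x**?G = ?G**x" for x
  by (simp add: matrix_vector_mult_basis column_def vec_eq_iff)
 thus "theta m**?G = ?G**m" .
 have inj0: "u = 0" if "?G *v u = 0" for u
 proof (rule ccontr)
  assume u: "u ~= 0"
  \<comment> \<open>A rank-one matrix that sends \<open>u\<close> to the basis vector of index
    \<open>o'\<close> would put this vector into the kernel together with \<open>u\<close>, although
    it is mapped to \<open>a\<close>.\<close>
  let ?x = "outer (axis o' 1) ((1 / (u\<bullet>u)) *R u)"
  have "?x *v u = axis o' 1" using u by (simp add: outer_mult)
  hence "?G *v axis o' 1 = (theta ?x**?G) *v u" by (simp add: inter mv_assoc[symmetric])
  hence "?G *v axis o' 1 = 0" by (simp add: mv_assoc[symmetric] that)
  thus False using fa a(2) by (simp add: Gaxis)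
 qed
 have injG: "inj ((*v) ?G)" using linear_injective_0[OF matrix_vector_mul_linear[of ?G]] inj0 by auto
 have surjG: "surj ((*v) ?G)" by (rule linear_injective_surjective[OF matrix_vector_mul_linear injG]) (simp add: n(2))
 obtain H where H: "H**?G = mat 1" using matrix_left_invertible_injective[of ?G] injG by blast
 obtain H' where H': "?G**H' = mat 1" using matrix_right_invertible_surjective[of ?G] surjG by blast
 have "H = H'" by (metis H H' matrix_mul_assoc matrix_mul_lid matrix_mul_rid)
 thus "invertible ?G" using H H' by (auto simp: invertible_def)
qed

lemma commuting_scalar:
 assumes "!!m. m**C = C**(m :: real^'n^'n)" shows "\<exists>c. C = scal c"
proof -
 fix u :: 'n
 have "C**munit i i = (C $ u $ u) *R munit i i" for i
 proof -
  have "C**(munit i u**munit u i) = munit i u**C**munit u i" by (simp only: matrix_mul_assoc assms[of "munit i u"])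
  thus ?thesis by (simp add: munit_mult munit_conj)
 qed
 hence "C**(\<Sum>i\<in>UNIV. munit i i) = (C $ u $ u) *R (\<Sum>i\<in>UNIV. munit i i)" by (simp only: matrix_sum_right scaleR_sum_right)
 thus ?thesis by (auto simp: sum_munit_diag)
qed

text \<open>Schur's lemma modulo scalars: traces show that the scalar corrections of both
  intertwiners agree, so their quotient commutes with all matrices.\<close>

lemma intertwiner_unique:
 fixes G G' :: "real^'n^'p" and f :: "'c => real^'p^'p" and m :: "'c => real^'n^'n"
 assumes inv: "invertible G" "invertible G'" and m: "range m = UNIV"
  and G: "!!x. \<exists>s. f x**G = G**m x + s *R G" and G': "!!x. \<exists>s. f x**G' = G'**m x + s *R G'"
 shows "\<exists>c. c ~= 0 \<and> G' = c *R G"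
proof -
 obtain H where H: "G**H = mat 1" "H**G = mat 1" using inv(1) by (auto simp: invertible_def)
 obtain H' where H': "G'**H' = mat 1" "H'**G' = mat 1" using inv(2) by (auto simp: invertible_def)
 have tr: "trace (f x) = trace (m x) + s * real CARD('n)"
  if "f x**K = K**m x + s *R K" "K**L = mat 1" "L**K = mat 1" for K :: "real^'n^'p" and L x s
 proof -
  have "trace (f x) = trace (f x**K**L)" by (simp add: matrix_mul_assoc[symmetric] that(2))
  also have "\<dots> = trace (L**(f x**K))" by (rule trace_mul_sym)
  also have "\<dots> = trace (m x + scal s)" by (simp add: that(1) matrix_ring that(3))
  finally show ?thesis by (simp add: trace_rules)
 qed
 have "m x**(H**G') = (H**G')**m x" for x
 proof -
  obtain s where s: "f x**G = G**m x + s *R G" using G by blast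
  obtain s' where s': "f x**G' = G'**m x + s' *R G'" using G' by blast
  have "s = s'" using tr[OF s H] tr[OF s' H'] by simp
  have "H**(f x**G) = m x + scal s" by (simp add: s matrix_ring H(2))
  hence "(H**f x**G)**(H**G') = (m x + scal s)**(H**G')" by (simp add: matrix_mul_assoc)
  moreover have "(H**f x**G)**(H**G') = H**(f x**((G**H)**G'))" by (simp add: matrix_mul_assoc)
  ultimately have "(m x + scal s)**(H**G') = H**(f x**G')" by (simp add: H(1))
  also have "\<dots> = (H**G')**m x + s' *R (H**G')" by (simp add: s' matrix_ring)
  finally show ?thesis using \<open>s = s'\<close> by (simp add: matrix_add_right_distrib)
 qed
 hence "y**(H**G') = (H**G')**y" for y using m by (metis UNIV_I imageE)
 then obtain c where c: "H**G' = scal c" using commuting_scalar by blast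
 have "G**(H**G') = G'" by (simp add: matrix_mul_assoc H(1))
 hence "G' = G**scal c" by (simp add: c)
 hence G'c: "G' = c *R G" by (simp add: matrix_matrix_mult_def mat_def vec_eq_iff if_distrib[where f = "(*) _"] cong: if_cong)
 moreover have "c ~= 0"
 proof
  assume "c = 0"
  hence "G' = 0" using G'c by simp
  hence "mat 1 = (0 :: real^'n^'n)" using H'(2) by (simp add: matrix_matrix_mult_def vec_eq_iff)
  hence "(mat 1 :: real^'n^'n) $ i $ i = 0" for i by simp
  thus False by (simp add: mat_def)
 qed
 ultimately show ?thesis by blast
qed

text \<open>The conjugation type, tested on one matrix unit. In the other case
  \<open>dual_map\<close> passes the test instead.\<close>

definition inner_type :: "(real^'n^'n => real^'p^'p) => bool" where
 "inner_type Theta \<longleftrightarrow> unital Theta eprobe**unital Theta eprobe = unital Theta eprobe"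

definition typed :: "bool => (real^'n^'n => real^'p^'p) => real^'n^'n => real^'p^'p" where
 "typed t Theta = (if t then unital Theta else dual_map (unital Theta))"

text \<open>For the second type this is the negative adjoint with respect to the bilinear form
  \<open>g\<close>. It lets both types satisfy one intertwining equation between the same
  bundles.\<close>

definition twist :: "bool => real^'n^'n => real^'n^'n => real^'n^'n" where
 "twist t g m = (if t then m else - (minv g**transpose m**g))"

lemma typed_props:
 fixes Theta :: "real^'n^'n => real^'p^'p"
 assumes "lie_mod_scalars Theta" "CARD('p)\<ge>2" "CARD('n) = CARD('p)" "inner_type Theta = t"
 shows "lie_iso (typed t Theta)" "typed t Theta eprobe**typed t Theta eprobe = typed t Theta eprobe"
  "\<exists>w. typed t Theta eprobe *v w ~= 0"
proof -
 have n: "CARD('n)\<ge>2" using assms(2,3) by simp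
 have u: "lie_iso (unital Theta)" by (rule lie_iso_unital[OF assms(1-3)])
 show l: "lie_iso (typed t Theta)" unfolding typed_def using u lie_iso_dual[OF u assms(3)] by simp
 show i: "typed t Theta eprobe**typed t Theta eprobe = typed t Theta eprobe"
  using lie_iso_type(1)[OF u n assms(3)] assms(4) by (cases t) (auto simp: typed_def inner_type_def)
 obtain a b where ab: "typed t Theta eprobe = outer a b" "b\<bullet>a = 1" using lie_iso_type(3)[OF l n assms(3) i] by blast
 have "a ~= 0" using ab(2) by auto
 thus "\<exists>w. typed t Theta eprobe *v w ~= 0" by (intro exI[of _ a]) (simp add: ab outer_mult)
qed

text \<open>Together with the definition this writes both the type and its negation as the failure
  of a matrix equation, hence as open conditions.\<close>

lemma inner_type_iff:
 fixes Theta :: "real^'n^'n => real^'p^'p"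
 assumes "lie_mod_scalars Theta" "CARD('p)\<ge>3" "CARD('n) = CARD('p)"
 shows "inner_type Theta \<longleftrightarrow> dual_map (unital Theta) eprobe**dual_map (unital Theta) eprobe ~= dual_map (unital Theta) eprobe"
proof -
 have u: "lie_iso (unital Theta)" by (rule lie_iso_unital) (use assms in auto)
 have n: "CARD('n)\<ge>2" using assms(2,3) by simp
 show ?thesis using lie_iso_type(1,2)[OF u n assms(3)] assms(2) unfolding inner_type_def by blast
qed

lemma inner_type_2:
 fixes Theta :: "real^'n^'n => real^'p^'p"
 assumes "lie_mod_scalars Theta" "CARD('p) = 2" "CARD('n) = CARD('p)"
 shows "inner_type Theta"
proof -
 have u: "lie_iso (unital Theta)" by (rule lie_iso_unital) (use assms in auto)
 have n: "CARD('n)\<ge>2" using assms(2,3) by simp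
 show ?thesis using lie_iso_type(1)[OF u n assms(3)] assms(2) unfolding inner_type_def by auto
qed

lemma invertible_matrix_inv:
 fixes A :: "real^'n^'m"
 assumes "invertible A" shows "A**minv A = mat 1" "minv A**A = mat 1"
proof -
 have "\<exists>A'. A**A' = mat 1 \<and> A'**A = mat 1" using assms by (simp add: invertible_def)
 from someI_ex[OF this] show "A**minv A = mat 1" "minv A**A = mat 1" by (simp_all add: matrix_inv_def)
qed

lemma inv_cancel:
 fixes P :: "real^'n^'m"
 assumes "invertible P"
 shows "P**minv P = mat 1" "minv P**P = mat 1" "C**P**minv P = C" "D**minv P**P = D"
 by (simp_all add: invertible_matrix_inv[OF assms] matrix_mul_assoc[symmetric])

text \<open>For the second type the intertwiner of the dual map is composed with \<open>g\<close>,
  which turns the transpose into an adjoint.\<close>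

lemma typed_intertwiner:
 fixes Theta :: "real^'n^'n => real^'p^'p"
 assumes Theta: "lie_mod_scalars Theta" "CARD('p)\<ge>2" "CARD('n) = CARD('p)" "inner_type Theta = t"
  and w: "typed t Theta eprobe *v w ~= 0" and g: "invertible g"
 defines "G \<equiv> intertwiner (typed t Theta) (typed t Theta eprobe *v w)**(if t then mat 1 else g)"
 shows "invertible G" "\<exists>s. Theta m**G = G**twist t g m + s *R G"
proof -
 note p = typed_props[OF Theta]
 have n: "CARD('n)\<ge>2" using Theta(2,3) by simp
 define K where "K = intertwiner (typed t Theta) (typed t Theta eprobe *v w)"
 have a: "typed t Theta eprobe *v (typed t Theta eprobe *v w) = typed t Theta eprobe *v w"
  by (simp add: mv_assoc p(2))
 note K = intertwiner_exists[OF p(1) n Theta(3) p(2) a w, folded K_def]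
 have "invertible (if t then mat 1 else g)" using g by (simp add: invertible_def exI[of _ "mat 1"])
 thus "invertible G" unfolding G_def K_def[symmetric] by (rule invertible_mult[OF K(2)])
 have un: "\<exists>s. Theta m = unital Theta m + scal s" for m
  by (intro exI[of _ "trace (Theta m) / real CARD('p) - trace m / real CARD('n)"]) (simp add: unital_def traceless_def scaleR_diff_left)
 have ty: "\<exists>s. Theta m = (if t then typed t Theta m else - typed t Theta (transpose m)) + scal s" for m
 proof -
  obtain s where s: "Theta m = unital Theta m + scal s" using un by blast
  show ?thesis
  proof (cases t)
   case True thus ?thesis using s by (auto simp: typed_def)
  next
   case False
   have "Theta m = - typed t Theta (transpose m) + scal (s + 2 * trace m / real CARD('p))"
    using False by (simp add: typed_def dual_map_def s scaleR_add_left trace_simps)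
   thus ?thesis using False by auto
  qed
 qed
 obtain s where s: "Theta m = (if t then typed t Theta m else - typed t Theta (transpose m)) + scal s" using ty by blast
 have Gs: "scal s**G = s *R G" by (simp add: matrix_ring)
 show "\<exists>s. Theta m**G = G**twist t g m + s *R G"
 proof (cases t)
  case True
  hence G: "G = K" by (simp add: G_def K_def)
  have "Theta m**G = G**m + s *R G" using s True K(1)[of m] Gs by (simp only: if_True matrix_add_right_distrib G)
  thus ?thesis using True by (auto simp: twist_def)
 next
  case False
  hence G: "G = K**g" by (simp add: G_def K_def)
  have e: "typed t Theta (transpose m)**G = G**(minv g**transpose m**g)"
   by (simp add: G matrix_mul_assoc K(1) inv_cancel[OF g])
  have "Theta m**G = G**twist t g m + s *R G"
   using s False Gs e by (simp only: if_False matrix_add_right_distrib matrix_minus_left matrix_minus_right twist_def)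
  thus ?thesis by blast
 qed
qed

text \<open>Comparing traces removes the scalar correction in the unital form and leaves a conjugate
  of an idempotent.\<close>

lemma inner_type_intertwiner:
 fixes Theta :: "real^'n^'n => real^'p^'p" and G :: "real^'n^'p"
 assumes "CARD('n) = CARD('p)" and G: "invertible G" and i: "Theta eprobe**G = G**eprobe + s *R G"
 shows "inner_type Theta"
proof -
 define H where "H = minv G"
 note c = inv_cancel[OF G, folded H_def]
 have "Theta eprobe = (Theta eprobe**G)**H" by (simp add: c)
 hence e: "Theta eprobe = G**eprobe**H + scal s" by (simp add: i matrix_ring c)
 have tr: "trace (G**eprobe**H) = 1"
  using trace_mul_sym[of "G**eprobe" H] by (simp add: matrix_mul_assoc c trace_munit)
 have u: "unital Theta eprobe = G**eprobe**H"
  using assms(1) by (simp add: unital_def traceless_def e trace_rules tr trace_munit add_divide_distrib scaleR_add_left scaleR_diff_left)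
 have "G**eprobe**H**(G**eprobe**H) = G**(eprobe**eprobe)**H" by (simp add: matrix_mul_assoc c del: munit_idempotent)
 thus ?thesis unfolding inner_type_def u by (simp add: munit_idempotent)
qed

lemma twist_surjective:
 assumes "invertible g" shows "\<exists>m. twist t g m = y"
proof (cases t)
 case True thus ?thesis by (auto simp: twist_def)
next
 case False
 hence "twist t g (transpose (- (g**y**minv g))) = y"
  by (simp add: twist_def transpose_arith matrix_ring inv_cancel[OF assms])
 thus ?thesis by blast
qed

section \<open>Sign cocycles and the first cohomology group\<close>

text \<open>A sign cocycle on an open cover describes a double covering; a lift of a path to it is recorded by
  its sheet relative to the member \<open>W z\<close> of the cover at each point \<open>z\<close>. The monodromy along paths is a
  singular 1-cocycle, and a primitive of it trivialises the sign cocycle.\<close>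

locale sign_cocycle =
 fixes Z :: "'a topology" and W :: "'a => 'a set" and r :: "'a => 'a => 'a => real"
 assumes W_open: "openin Z (W p)" and W_cover: "x\<in>topspace Z ==> x\<in>W x"
  and sign: "x\<in>W p ==> x\<in>W q ==> r p q x\<in>{1, -1}"
  and locally_constant: "x\<in>W p ==> x\<in>W q ==> \<exists>Q. openin Z Q \<and> x\<in>Q \<and> Q\<subseteq>W p\<inter>W q \<and> (\<forall>z\<in>Q. r p q z = r p q x)"
  and cocycle: "x\<in>W p ==> x\<in>W q ==> x\<in>W q' ==> r p q' x = r p q x * r q q' x"
begin

lemma continuous: "continuous_map (subtopology Z (W p\<inter>W q)) euclideanreal (r p q)"
proof -
 have "openin Z {y\<in>W p\<inter>W q. r p q y\<in>S}" for S
 proof (rule openin_subopen[THEN iffD2], safe)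
  show "\<exists>T. openin Z T \<and> x\<in>T \<and> T\<subseteq>{y\<in>W p\<inter>W q. r p q y\<in>S}" if "x\<in>W p" "x\<in>W q" "r p q x\<in>S" for x
   using locally_constant[OF that(1,2)] that(3) by (smt (verit) mem_Collect_eq subset_iff)
 qed
 moreover have "{y\<in>topspace (subtopology Z (W p\<inter>W q)). r p q y\<in>S} = {y\<in>W p\<inter>W q. r p q y\<in>S}" for S
  using openin_subset[OF W_open[of p]] by auto
 ultimately show ?thesis
  unfolding continuous_map_def by (auto simp: openin_open_subtopology openin_Int W_open)
qed

lemma square: "x\<in>W p ==> x\<in>W q ==> r p q x * r p q x = 1" using sign by fastforce

lemma W_point: "x\<in>W p ==> x\<in>W x" using W_cover openin_subset[OF W_open] by blast

text \<open>The factor \<open>r p (gamma t) (gamma t)\<close> converts the sheet into one relative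
  to the fixed \<open>W p\<close>; only in this form can continuity be asked.\<close>

definition lift :: "'c::topological_space set => ('c => 'a) => ('c => real) => bool" where
 "lift K gamma f \<longleftrightarrow> f ` K\<subseteq>{1, -1} \<and> (\<forall>p. continuous_on {t\<in>K. gamma t\<in>W p} (%t. f t * r p (gamma t) (gamma t)))"

lemma lift_sign: "lift K gamma f ==> t\<in>K ==> f t\<in>{1, -1}" unfolding lift_def by blast

lemma lift_compose:
 assumes "lift K gamma f" "continuous_on K' g" "g ` K'\<subseteq>K"
 shows "lift K' (%t. gamma (g t)) (%t. f (g t))"
 unfolding lift_def
proof (intro conjI allI)
 fix p
 have "continuous_on {t\<in>K. gamma t\<in>W p} (%t. f t * r p (gamma t) (gamma t))" using assms(1) by (simp add: lift_def)
 thus "continuous_on {t\<in>K'. gamma (g t)\<in>W p} (%t. f (g t) * r p (gamma (g t)) (gamma (g t)))"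
  by (rule continuous_on_compose2) (use assms(2,3) in "auto intro: continuous_on_subset")
qed (use assms in "auto simp: lift_def")

lemma lift_cong:
 assumes "lift K gamma f" "!!t. t\<in>K ==> gamma' t = gamma t" shows "lift K gamma' f"
proof -
 have "{t\<in>K. gamma' t\<in>W p} = {t\<in>K. gamma t\<in>W p}" for p using assms(2) by auto
 thus ?thesis using assms unfolding lift_def by (auto intro: continuous_on_eq)
qed

text \<open>Over a single \<open>W p\<close> the constant sheet is a lift; \<open>r p z z\<close> is
  its sign relative to \<open>W z\<close>.\<close>

lemma lift_local:
 assumes g: "continuous_map (top_of_set K) Z gamma" and p: "!!t. t\<in>K ==> gamma t\<in>W p"
 shows "lift K gamma (%t. r p (gamma t) (gamma t))"
 unfolding lift_def
proof (intro conjI allI)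
 show "(%t. r p (gamma t) (gamma t)) ` K\<subseteq>{1, -1}" using sign[OF p W_point[OF p]] by auto
 fix q
 have "continuous_map (top_of_set {t\<in>K. gamma t\<in>W q}) (subtopology Z (W p\<inter>W q)) gamma"
  using p continuous_map_from_subtopology_mono[OF g, of "{t\<in>K. gamma t\<in>W q}"] by (auto simp: continuous_map_in_subtopology)
 hence "continuous_map (top_of_set {t\<in>K. gamma t\<in>W q}) euclideanreal (r p q\<circ>gamma)" by (rule continuous_map_compose[OF _ continuous])
 hence "continuous_on {t\<in>K. gamma t\<in>W q} (r p q\<circ>gamma)" by simp
 moreover have "(r p q\<circ>gamma) t = r p (gamma t) (gamma t) * r q (gamma t) (gamma t)" if t: "t\<in>{t\<in>K. gamma t\<in>W q}" for t
 proof -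
  have m: "gamma t\<in>W p" "gamma t\<in>W q" "gamma t\<in>W (gamma t)" using t p W_point by auto
  show ?thesis using cocycle[OF m] square[OF m(2,3)] by (simp add: mult.assoc)
 qed
 ultimately show "continuous_on {t\<in>K. gamma t\<in>W q} (%t. r p (gamma t) (gamma t) * r q (gamma t) (gamma t))"
  by (rule continuous_on_eq)
qed

text \<open>In the product of two lifts the conversion signs square to 1, so the product is a
  continuous sign on a connected set.\<close>

lemma lift_unique:
 assumes g: "continuous_map (top_of_set K) Z gamma" and f: "lift K gamma f" "lift K gamma f'" and K: "convex (K :: 'c::real_normed_vector set)"
 shows "\<exists>c\<in>{1, -1}. \<forall>t\<in>K. f t = c * f' t"
proof -
 let ?S = "%p. {t\<in>K. gamma t\<in>W p}"
 have pm: "f t\<in>{1, -1}" "f' t\<in>{1, -1}" if "t\<in>K" for t using lift_sign[OF f(1) that] lift_sign[OF f(2) that] .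
 have W: "gamma t\<in>W (gamma t)" if "t\<in>K" for t using g that by (intro W_cover) (auto simp: continuous_map_def)
 have "continuous_map (top_of_set K) euclideanreal (%t. f t * f' t)"
 proof (rule pasting_lemma[where T = ?S and I = UNIV and f = "%_ t. f t * f' t"])
  show "openin (top_of_set K) (?S p)" for p using g W_open[of p] by (simp add: continuous_map_def)
  fix p
  have "continuous_on (?S p) (%t. (f t * r p (gamma t) (gamma t)) * (f' t * r p (gamma t) (gamma t)))"
   by (rule continuous_on_mult) (use f in "simp_all add: lift_def")
  hence "continuous_on (?S p) (%t. f t * f' t)"
  proof (rule continuous_on_eq)
   fix t assume "t\<in>?S p"
   hence "r p (gamma t) (gamma t) * r p (gamma t) (gamma t) = 1" using square W_point by blast
   thus "(f t * r p (gamma t) (gamma t)) * (f' t * r p (gamma t) (gamma t)) = f t * f' t" by (metis mult.assoc mult.commute mult_1_right)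
  qed
  thus "continuous_map (subtopology (top_of_set K) (?S p)) euclideanreal (%t. f t * f' t)"
   by (simp add: subtopology_subtopology Int_absorb1)
 qed (use W in auto)
 hence "continuous_on K (%t. f t * f' t)" by simp
 moreover have "(%t. f t * f' t) ` K\<subseteq>{1, -1}" using pm by fastforce
 ultimately have "(%t. f t * f' t) constant_on K"
  using continuous_finite_range_constant[OF convex_connected[OF K]] finite_subset by blast
 then obtain c where "!!t. t\<in>K ==> f t * f' t = c" unfolding constant_on_def by blast
 hence "\<forall>t\<in>K. f t = c * f' t \<and> c\<in>{1, -1}" using pm by fastforce
 thus ?thesis by (cases "K = {}") auto
qed

text \<open>On the convex overlap the two lifts agree up to one sign by uniqueness; after flipping
  one of them they can be pasted along closed sets.\<close>

lemma lift_join: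
 fixes gamma :: "real\<times>real => 'a"
 assumes g: "continuous_map (top_of_set C) Z gamma" and cl: "closed A" "closed B" and AB: "A\<union>B = C" and cv: "convex (A\<inter>B)"
  and f: "lift A gamma f" "lift B gamma f'"
 shows "\<exists>f. lift C gamma f"
proof -
 have "lift (A\<inter>B) gamma f" "lift (A\<inter>B) gamma f'" using lift_compose[OF f(1), of _ id] lift_compose[OF f(2), of _ id] by auto
 moreover have "A\<inter>B\<subseteq>C" using AB by blast
 ultimately obtain c where c: "c\<in>{1, -1}" "!!t. t\<in>A\<inter>B ==> f t = c * f' t"
  using lift_unique[OF continuous_map_from_subtopology_mono[OF g] _ _ cv, of f f'] by blast
 have "lift C gamma (%t. if t\<in>A then f t else c * f' t)"
  unfolding lift_def
 proof (intro conjI allI)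
  have "f t\<in>{1, -1}" if "t\<in>A" for t using lift_sign[OF f(1) that] .
  moreover have "c * f' t\<in>{1, -1}" if "t\<in>B" for t using lift_sign[OF f(2) that] c(1) by auto
  ultimately show "(%t. if t\<in>A then f t else c * f' t) ` C\<subseteq>{1, -1}" using AB by (intro image_subsetI) (simp only: Un_iff split: if_split, blast)
  fix p
  let ?A = "{t\<in>A. gamma t\<in>W p}" and ?B = "{t\<in>B. gamma t\<in>W p}" and ?r = "%t. r p (gamma t) (gamma t)"
  have "continuous_on (?A\<union>?B) (%t. if t\<in>A then f t * ?r t else c * (f' t * ?r t))"
  proof (rule continuous_on_cases_local)
   show "closedin (top_of_set (?A\<union>?B)) ?A" "closedin (top_of_set (?A\<union>?B)) ?B" using cl by (auto simp: closedin_closed)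
   show "continuous_on ?A (%t. f t * ?r t)" "continuous_on ?B (%t. c * (f' t * ?r t))"
    using f unfolding lift_def by (auto intro: continuous_on_mult_left)
  qed (use c(2) in auto)
  moreover have "?A\<union>?B = {t\<in>C. gamma t\<in>W p}" using AB by auto
  ultimately show "continuous_on {t\<in>C. gamma t\<in>W p} (%t. (if t\<in>A then f t else c * f' t) * ?r t)"
   by (auto elim: continuous_on_eq)
 qed
 thus ?thesis by blast
qed

text \<open>Nested bisection: small rectangles lie over a single \<open>W p\<close> and lift;
  bisection in the second coordinate lifts thin strips of full height, and bisection in the first
  coordinate lifts the square.\<close>

lemma lift_square:
 fixes gamma :: "real\<times>real => 'a"
 assumes g: "continuous_map (top_of_set ({0..1}\<times>{0..1})) Z gamma"
 shows "\<exists>f. lift ({0..1}\<times>{0..1}) gamma f"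
proof -
 let ?I = "{0..1::real}"
 define C where "C = (%a b c d :: real. ({a..b}\<inter>?I)\<times>({c..d}\<inter>?I))"
 define L where "L = (%a b c d. \<exists>f. lift (C a b c d) gamma f)"
 have gC: "continuous_map (top_of_set (C a b c d)) Z gamma" for a b c d
  by (rule continuous_map_from_subtopology_mono[OF g]) (auto simp: C_def)
 have join: "L a b c d" if "L a1 b1 c1 d1" "L a2 b2 c2 d2" "C a1 b1 c1 d1\<union>C a2 b2 c2 d2 = C a b c d" for a b c d a1 b1 c1 d1 a2 b2 c2 d2
  using that lift_join[OF gC _ _ that(3)] unfolding L_def C_def
  by (metis closed_Times closed_Int closed_atLeastAtMost convex_Times convex_Int convex_real_interval(5))
 have small: "\<exists>d>0. \<forall>a b c e. b - a < d --> e - c < d --> a\<le>x --> x\<le>b --> c\<le>y --> y\<le>e --> L a b c e"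
  if xy: "x\<in>?I" "y\<in>?I" for x y
 proof -
  let ?p = "gamma (x, y)"
  have "?p\<in>topspace Z" using g xy by (auto simp: continuous_map_def)
  hence "(x, y)\<in>{z\<in>?I\<times>?I. gamma z\<in>W ?p}" using W_cover xy by simp
  moreover have "openin (top_of_set (?I\<times>?I)) {z\<in>?I\<times>?I. gamma z\<in>W ?p}"
   using g W_open[of ?p] by (simp add: continuous_map_def)
  ultimately have "\<exists>d>0. \<forall>z\<in>?I\<times>?I. dist z (x, y) < d --> z\<in>{z\<in>?I\<times>?I. gamma z\<in>W ?p}"
   unfolding openin_euclidean_subtopology_iff by blast
  then obtain d where d: "d > 0" "!!z. z\<in>?I\<times>?I ==> dist z (x, y) < d ==> gamma z\<in>W ?p" by blast
  have "L a b c e" if "b - a < d / 2" "e - c < d / 2" "a\<le>x" "x\<le>b" "c\<le>y" "y\<le>e" for a b c e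
  proof -
   have "gamma z\<in>W ?p" if z: "z\<in>C a b c e" for z
   proof (rule d(2))
    have "dist z (x, y)\<le>\<bar>fst z - x\<bar> + \<bar>snd z - y\<bar>"
     unfolding dist_prod_def dist_real_def using sqrt_sum_squares_le_sum_abs[of "fst z - x" "snd z - y"] by simp
    thus "dist z (x, y) < d" using z \<open>b - a < d / 2\<close> \<open>e - c < d / 2\<close> \<open>a\<le>x\<close> \<open>x\<le>b\<close> \<open>c\<le>y\<close> \<open>y\<le>e\<close> by (auto simp: C_def)
   qed (use z in "auto simp: C_def")
   thus ?thesis using lift_local[OF gC, of a b c e ?p] unfolding L_def by blast
  qed
  thus ?thesis using d(1) by (intro exI[of _ "d / 2"]) simp
 qed
 have strip: "\<exists>d>0. \<forall>a b. b - a < d --> a\<le>x --> x\<le>b --> L a b 0 1" if x: "x\<in>?I" for x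
 proof (rule Bolzano[where P = "%c e. \<exists>d>0. \<forall>a b. b - a < d --> a\<le>x --> x\<le>b --> L a b c e"])
  fix c e l assume P: "\<exists>d>0. \<forall>a b. b - a < d --> a\<le>x --> x\<le>b --> L a b c e"
   "\<exists>d>0. \<forall>a b. b - a < d --> a\<le>x --> x\<le>b --> L a b e l" and le: "c\<le>e" "e\<le>l"
  obtain d d' where d: "d > 0" "!!a b. b - a < d ==> a\<le>x ==> x\<le>b ==> L a b c e"
   and d': "d' > 0" "!!a b. b - a < d' ==> a\<le>x ==> x\<le>b ==> L a b e l" using P by blast
  have U: "C a b c e\<union>C a b e l = C a b c l" for a b using le by (auto simp: C_def)
  show "\<exists>d>0. \<forall>a b. b - a < d --> a\<le>x --> x\<le>b --> L a b c l"
   by (intro exI[of _ "min d d'"] conjI allI impI join[OF d(2) d'(2) U]) (use d(1) d'(1) in auto)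
 next
  fix y :: real assume "0\<le>y" "y\<le>1"
  thus "\<exists>d>0. \<forall>c e. c\<le>y \<and> y\<le>e \<and> e - c < d --> (\<exists>d>0. \<forall>a b. b - a < d --> a\<le>x --> x\<le>b --> L a b c e)"
   using small[OF x, of y] by (metis atLeastAtMost_iff)
 qed simp
 have "L 0 1 0 1"
 proof (rule Bolzano[where P = "%a b. L a b 0 1"])
  show "L a c 0 1" if "L a b 0 1" "L b c 0 1" "a\<le>b" "b\<le>c" for a b c
   by (rule join[OF that(1,2)]) (use that(3,4) in "auto simp: C_def")
  show "\<exists>d>0. \<forall>a b. a\<le>x \<and> x\<le>b \<and> b - a < d --> L a b 0 1" if "0\<le>x" "x\<le>1" for x
   using strip[of x] that by auto
 qed simp
 moreover have "C 0 1 0 1 = ?I\<times>?I" by (auto simp: C_def)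
 ultimately show ?thesis by (simp add: L_def)
qed

end

definition edge_point :: "real => nat => real" where
 "edge_point t = (%i. if i = 0 then 1 - t else if i = 1 then t else 0)"

text \<open>Parametrises the triangle by a square whose side \<open>u = 0\<close> collapses to a
  vertex, because lifts are constructed over squares.\<close>

definition triangle_point :: "real\<times>real => nat => real" where
 "triangle_point = (%(u, t) i. if i = 0 then 1 - u else if i = 1 then u * (1 - t) else if i = 2 then u * t else 0)"

lemma edge_point_simplex: "t\<in>{0..1} ==> edge_point t\<in>standard_simplex (Suc 0)"
 by (simp add: standard_simplex_def edge_point_def)

lemma triangle_point_simplex: "z\<in>{0..1}\<times>{0..1} ==> triangle_point z\<in>standard_simplex 2"
 by (auto simp: standard_simplex_def triangle_point_def numeral_2_eq_2 mult_le_one) (simp add: algebra_simps)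

lemma continuous_edge_point:
 "continuous_map (top_of_set {0..1}) (subtopology (powertop_real UNIV) (standard_simplex 1)) edge_point"
 unfolding continuous_map_in_subtopology
proof (intro conjI continuous_map_componentwise_UNIV[THEN iffD2] allI)
 show "continuous_map (top_of_set {0..1}) euclidean (%t. edge_point t i)" for i
  by (cases "i = 0"; cases "i = 1") (auto simp: edge_point_def intro!: continuous_intros)
qed (use edge_point_simplex in auto)

lemma continuous_triangle_point:
 "continuous_map (top_of_set ({0..1}\<times>{0..1})) (subtopology (powertop_real UNIV) (standard_simplex 2)) triangle_point"
 unfolding continuous_map_in_subtopology
proof (intro conjI continuous_map_componentwise_UNIV[THEN iffD2] allI)
 show "continuous_map (top_of_set ({0..1}\<times>{0..1})) euclidean (%t. triangle_point t i)" for i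
  by (cases "i = 0"; cases "i = 1"; cases "i = 2")
   (auto simp: triangle_point_def case_prod_beta intro!: continuous_intros)
qed (use triangle_point_simplex in auto)

lemma triangle_edges:
 "simplical_face 0 (edge_point t) = triangle_point (1, t)" "simplical_face 1 (edge_point t) = triangle_point (t, 1)"
 "simplical_face 2 (edge_point t) = triangle_point (t, 0)"
 by (auto simp: simplical_face_def edge_point_def triangle_point_def fun_eq_iff)

lemma coboundary_0_1:
 "singular_simplex 1 Z \<sigma> ==> coboundary 0 Z g \<sigma> = g (singular_face 1 0 \<sigma>) + g (singular_face 1 1 \<sigma>)"
 "singular_simplex 2 Z \<sigma> ==> coboundary 1 Z g \<sigma> =
  g (singular_face 2 0 \<sigma>) + g (singular_face 2 1 \<sigma>) + g (singular_face 2 2 \<sigma>)"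
proof -
 have "(-1 :: bit) = 1" by simp
 hence m: "(-1 :: bit) ^ k = 1" for k by (simp only: power_one)
 show "singular_simplex 1 Z \<sigma> ==> coboundary 0 Z g \<sigma> = g (singular_face 1 0 \<sigma>) + g (singular_face 1 1 \<sigma>)"
  "singular_simplex 2 Z \<sigma> ==> coboundary 1 Z g \<sigma> =
  g (singular_face 2 0 \<sigma>) + g (singular_face 2 1 \<sigma>) + g (singular_face 2 2 \<sigma>)"
  unfolding coboundary_def m One_nat_def numeral_2_eq_2 sum.atMost_Suc atMost_0 by (simp_all only: if_True mult_1_left sum.empty sum.insert finite.emptyI empty_iff not_False_eq_True add_0_right)
qed

text \<open>In a trivial factor group all cosets coincide; comparing that of \<open>c\<close> with
  that of 0 puts \<open>c\<close> among the coboundaries.\<close>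

lemma coboundary_trivial:
 assumes t: "trivial_group (cohomology_group 1 Z)" and c: "c\<in>carrier (cochain_group 1 Z)" "coboundary 1 Z c = (%f. 0)"
 shows "\<exists>g. c = coboundary 0 Z g"
proof -
 let ?G = "cocycle_group 1 Z" and ?B = "coboundary_set 1 Z"
 have cb0: "coboundary p Z (%f. 0) = (%f. 0)" for p
  unfolding coboundary_def by (simp only: mult_zero_right sum.neutral_const if_cancel)
 have zB: "(%f. 0)\<in>?B"
  by (auto simp: coboundary_set_def cb0 cochain_group_def intro!: image_eqI[where x = "%f. 0"])
 have G: "c\<in>carrier ?G" "(%f. 0)\<in>carrier ?G" "monoid.mult ?G = (%c d f. c f + d f)"
  using c by (simp_all add: cocycle_group_def cochain_group_def cb0)
 have "?B #>\<^bsub>?G\<^esub> a\<in>carrier (cohomology_group 1 Z)" if "a\<in>carrier ?G" for a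
  using that by (auto simp: cohomology_group_def FactGroup_def RCOSETS_def)
 hence "?B #>\<^bsub>?G\<^esub> c = ?B #>\<^bsub>?G\<^esub> (%f. 0)" using t G(1,2) unfolding trivial_group_def by blast
 moreover have "c\<in>?B #>\<^bsub>?G\<^esub> c" unfolding r_coset_def G(3) using zB by (auto intro!: bexI[of _ "%f. 0"])
 ultimately have "c\<in>?B #>\<^bsub>?G\<^esub> (%f. 0)" by (simp only:)
 then obtain b where "b\<in>?B" "c = (%f. b f + 0)" unfolding r_coset_def G(3) UN_iff singleton_iff by (elim bexE)
 hence "c\<in>?B" by (simp only: add_0_right)
 thus ?thesis unfolding coboundary_set_def One_nat_def nat.case by blast
qed

context sign_cocycle begin

definition holonomy :: "((nat => real) => 'a) => bit" where
 "holonomy \<sigma> = (if singular_simplex 1 Z \<sigma> \<and> (\<exists>f. lift {0..1} (%t. \<sigma> (edge_point t)) f \<and> f 0 ~= f 1) then 1 else 0)"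

lemma simplex_path:
 assumes "singular_simplex 1 Z \<sigma>" shows "continuous_map (top_of_set {0..1}) Z (%t. \<sigma> (edge_point t))"
 using continuous_map_compose[OF continuous_edge_point, of Z \<sigma>] assms by (simp add: singular_simplex_def comp_def)

text \<open>Any two lifts differ by one sign on the whole path, so the existential in
  \<open>holonomy\<close> may be read with any given lift.\<close>

lemma holonomy_eq:
 assumes s: "singular_simplex 1 Z \<sigma>" and f: "lift {0..1} (%t. \<sigma> (edge_point t)) f"
 shows "holonomy \<sigma> = (if f 0 ~= f 1 then 1 else 0)"
proof -
 have "f' 0 ~= f' 1 \<longleftrightarrow> f 0 ~= f 1" if f': "lift {0..1} (%t. \<sigma> (edge_point t)) f'" for f'
  using lift_unique[OF simplex_path[OF s] f' f convex_real_interval(5)] by auto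
 hence "(\<exists>f. lift {0..1} (%t. \<sigma> (edge_point t)) f \<and> f 0 ~= f 1) \<longleftrightarrow> f 0 ~= f 1" using f by blast
 thus ?thesis using s by (simp only: holonomy_def simp_thms)
qed

text \<open>A lift over the square restricts to lifts of the three edges. It is constant along the
  collapsed side, so the sign changes around the boundary add up to 0 modulo 2.\<close>

lemma holonomy_cocycle:
 assumes s: "singular_simplex 2 Z \<sigma>"
 shows "holonomy (singular_face 2 0 \<sigma>) + holonomy (singular_face 2 1 \<sigma>) + holonomy (singular_face 2 2 \<sigma>) = 0"
proof -
 let ?gamma = "%z. \<sigma> (triangle_point z)"
 have g: "continuous_map (top_of_set ({0..1}\<times>{0..1})) Z ?gamma"
  using continuous_map_compose[OF continuous_triangle_point, of Z \<sigma>] s by (simp add: singular_simplex_def comp_def)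
 obtain f where f: "lift ({0..1}\<times>{0..1}) ?gamma f" using lift_square[OF g] by blast
 have edge: "holonomy (singular_face 2 k \<sigma>) = (if f (j 0) ~= f (j 1) then 1 else 0)"
  if k: "k\<le>2" and j: "continuous_on {0..1} j" "j ` {0..1}\<subseteq>{0..1}\<times>{0..1}"
   and e: "!!t. simplical_face k (edge_point t) = triangle_point (j t)" for j k
 proof (rule holonomy_eq)
  show "singular_simplex 1 Z (singular_face 2 k \<sigma>)" using singular_simplex_singular_face[OF s, of k] k by simp
  show "lift {0..1} (%t. singular_face 2 k \<sigma> (edge_point t)) (%t. f (j t))"
   by (rule lift_cong[OF lift_compose[OF f j]]) (simp add: singular_face_def e edge_point_simplex)
 qed
 have e0: "holonomy (singular_face 2 0 \<sigma>) = (if f (1, 0) ~= f (1, 1) then 1 else 0)"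
  by (rule edge[of 0 "%t. (1, t)"]) (auto simp: triangle_edges intro!: continuous_intros)
 have e1: "holonomy (singular_face 2 1 \<sigma>) = (if f (0, 1) ~= f (1, 1) then 1 else 0)"
  by (rule edge[of 1 "%t. (t, 1)"]) (auto simp: triangle_edges simp del: One_nat_def intro!: continuous_intros)
 have e2: "holonomy (singular_face 2 2 \<sigma>) = (if f (0, 0) ~= f (1, 0) then 1 else 0)"
  by (rule edge[of 2 "%t. (t, 0)"]) (auto simp: triangle_edges intro!: continuous_intros)
 have "f (0, 0) = f (0, 1)"
 proof -
  let ?x = "?gamma (0, 0)"
  have x: "?x\<in>topspace Z" using g by (auto simp: continuous_map_def)
  have cst: "?gamma (0, t) = ?x" for t by (rule arg_cong[where f = \<sigma>]) (auto simp: triangle_point_def)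
  have "lift {0..1} (%t. ?gamma (0, t)) (%t. f (0, t))"
   by (rule lift_compose[OF f]) (auto intro!: continuous_intros)
  hence 1: "lift {0..1::real} (%t. ?x) (%t. f (0, t))" by (rule lift_cong) (rule cst[symmetric])
  have cx: "continuous_map (top_of_set {0..1::real}) Z (%t. ?x)" using x by simp
  show ?thesis using lift_unique[OF cx 1 lift_local[OF cx W_cover[OF x]] convex_real_interval(5)] by auto
 qed
 moreover have "f (0, 1)\<in>{1, -1}" "f (1, 0)\<in>{1, -1}" "f (1, 1)\<in>{1, -1}" by (rule lift_sign[OF f], simp)+
 moreover have "(if c ~= b then 1 else 0) + (if a ~= b then 1 else 0) + (if a ~= c then 1 else 0) = (0 :: bit)"
  if "a\<in>{1, -1}" "b\<in>{1, -1}" "c\<in>{1, -1}" for a b c :: real using that by auto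
 ultimately show ?thesis unfolding e0 e1 e2 by (simp only:)
qed

text \<open>A primitive of the holonomy gives each point a sign \<open>G\<close> that changes along
  a path exactly as a lift does. Measured against \<open>G\<close>, the constant sheet over
  \<open>W p\<close> does not jump along short paths and is therefore locally constant. The value 0
  marks points outside \<open>W p\<close>.\<close>

lemma trivialized:
 assumes t: "trivial_group (cohomology_group 1 Z)"
  and paths: "!!x U. openin Z U ==> x\<in>U ==> \<exists>Q. openin Z Q \<and> x\<in>Q \<and>
   (\<forall>z\<in>Q. \<exists>gamma. continuous_map (top_of_set {0..1::real}) Z gamma \<and> gamma 0 = x \<and> gamma 1 = z \<and> gamma ` {0..1}\<subseteq>U)"
 obtains eps :: "'a => 'a => real" where "!!p x. eps p x = 0 \<longleftrightarrow> x\<notin>W p"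
  "!!p q x. x\<in>W p ==> x\<in>W q ==> eps p x = r p q x * eps q x"
  "!!p x. x\<in>W p ==> \<exists>Q. openin Z Q \<and> x\<in>Q \<and> (\<forall>z\<in>Q. eps p z = eps p x)"
proof -
 have "coboundary 1 Z holonomy \<sigma> = 0" for \<sigma>
 proof (cases "singular_simplex 2 Z \<sigma>")
  case True
  thus ?thesis by (simp only: coboundary_0_1(2) holonomy_cocycle)
 next
  case False
  thus ?thesis by (simp add: coboundary_def numeral_2_eq_2)
 qed
 moreover have "holonomy\<in>carrier (cochain_group 1 Z)" by (simp add: cochain_group_def holonomy_def)
 ultimately obtain g where g: "holonomy = coboundary 0 Z g" using coboundary_trivial[OF t] by blast
 define G where "G = (%x. if g (restrict (%_. x) (standard_simplex 0)) = 0 then 1 else - 1 :: real)"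
 have path: "f 0 * f 1 = G (gamma 0) * G (gamma 1)"
  if c: "continuous_map (top_of_set {0..1::real}) Z gamma" and f: "lift {0..1} gamma f" for gamma f
 proof -
  let ?T = "subtopology (powertop_real UNIV) (standard_simplex 1)"
  \<comment> \<open>The path as a singular 1-simplex, with the barycentric coordinate of index 1 as
    time.\<close>
  define \<sigma> where "\<sigma> = restrict (%v. gamma (v 1)) (standard_simplex 1)"
  have "continuous_map ?T (top_of_set {0..1::real}) (%v. v (1::nat))"
   unfolding continuous_map_in_subtopology
   by (auto simp: standard_simplex_def intro: continuous_map_from_subtopology continuous_map_product_projection)
  hence "continuous_map ?T Z (gamma\<circ>(%v. v (1::nat)))" by (rule continuous_map_compose[OF _ c])
  hence "continuous_map ?T Z \<sigma>" by (rule continuous_map_eq) (auto simp: \<sigma>_def)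
  hence s: "singular_simplex 1 Z \<sigma>" by (simp add: singular_simplex_def \<sigma>_def)
  have "lift {0..1} (%t. \<sigma> (edge_point t)) f"
   by (rule lift_cong[OF f]) (use edge_point_simplex in "auto simp: \<sigma>_def edge_point_def")
  note h = holonomy_eq[OF s this]
  have face: "singular_face 1 k \<sigma> = restrict (%_. gamma (if k = 0 then 1 else 0)) (standard_simplex 0)" if k: "k\<le>1" for k
  proof
   fix v
   have "singular_face 1 k \<sigma> v = gamma (if k = 0 then 1 else 0)" if v: "v\<in>standard_simplex 0"
   proof -
    have "v = (%i. if i = 0 then 1 else 0)" using v by (simp add: standard_simplex_0)
    hence "simplical_face k v 1 = (if k = 0 then 1 else 0)" using k by (auto simp: simplical_face_def le_Suc_eq)
    thus ?thesis using simplical_face_in_standard_simplex[of 1 k v] v k by (simp add: singular_face_def \<sigma>_def)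
   qed
   thus "singular_face 1 k \<sigma> v = restrict (%_. gamma (if k = 0 then 1 else 0)) (standard_simplex 0) v"
    by (cases "v\<in>standard_simplex 0") (simp_all add: singular_face_def)
  qed
  have "holonomy \<sigma> = g (restrict (%_. gamma 1) (standard_simplex 0)) + g (restrict (%_. gamma 0) (standard_simplex 0))"
   unfolding g coboundary_0_1(1)[OF s] by (subst face, simp, subst face, simp, simp only: refl if_True if_False one_neq_zero)
  moreover have "f 0\<in>{1, -1}" "f 1\<in>{1, -1}" by (rule lift_sign[OF f], simp)+
  ultimately show ?thesis unfolding h G_def
   by (cases "g (restrict (%_. gamma 1) (standard_simplex 0))"; cases "g (restrict (%_. gamma 0) (standard_simplex 0))") (auto split: if_splits)
 qed
 have G: "G x * G x = 1" "G x ~= 0" for x by (simp_all add: G_def)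
 define eps where "eps = (%p z. if z\<in>W p then G z * r p z z else 0)"
 show thesis
 proof (rule that[of eps])
  show "eps p x = 0 \<longleftrightarrow> x\<notin>W p" for p x using sign[of x p x] W_point G by (auto simp: eps_def)
  show "eps p x = r p q x * eps q x" if "x\<in>W p" "x\<in>W q" for p q x
   using that cocycle[OF that W_point[OF that(1)]] by (simp add: eps_def)
  show "\<exists>Q. openin Z Q \<and> x\<in>Q \<and> (\<forall>z\<in>Q. eps p z = eps p x)" if x: "x\<in>W p" for p x
  proof -
   obtain Q where Q: "openin Z Q" "x\<in>Q" "!!z. z\<in>Q ==> \<exists>gamma. continuous_map (top_of_set {0..1::real}) Z gamma \<and> gamma 0 = x \<and> gamma 1 = z \<and> gamma ` {0..1}\<subseteq>W p"
    using paths[OF W_open x] by metis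
   have "eps p z = eps p x" if z: "z\<in>Q" for z
   proof -
    obtain gamma where gamma: "continuous_map (top_of_set {0..1::real}) Z gamma" "gamma 0 = x" "gamma 1 = z" "gamma ` {0..1}\<subseteq>W p" using Q(3)[OF z] by metis
    have l: "lift {0..1} gamma (%t. r p (gamma t) (gamma t))" by (rule lift_local[OF gamma(1)]) (use gamma(4) in auto)
    have zW: "z\<in>W p" using gamma(3,4) by force
    have "r p x x * r p z z = G x * G z" using path[OF gamma(1) l] gamma(2,3) by simp
    moreover have "r p x x\<in>{1, -1}" "r p z z\<in>{1, -1}" using sign x zW W_point by auto
    ultimately show ?thesis using x zW by (auto simp: eps_def G_def)
   qed
   thus ?thesis using Q(1,2) by (intro exI[of _ Q] conjI ballI)
  qed
 qed
qed

end

section \<open>Smooth functions with values in vectors and matrices\<close>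

lemma smooth_fun_component:
 assumes "atlas M" "smooth_fun M (f :: 'a => ('v::euclidean_space)^'n) x"
 shows "smooth_fun M (%z. f z $ i) x"
 by (rule smooth_fun_linear[OF assms bounded_linear_vec_nth])

lemma smooth_fun_vec:
 assumes "atlas M" "x\<in>points M" "!!i. smooth_fun M (%z. f z $ i :: 'v::euclidean_space) x"
 shows "smooth_fun M (f :: 'a => 'v^'n) x"
proof -
 have l: "bounded_linear (axis i :: 'v => 'v^'n)" for i
  unfolding linear_conv_bounded_linear[symmetric] by (auto simp: linear_iff axis_def vec_eq_iff)
 have "smooth_fun M (%z. \<Sum>i\<in>UNIV. axis i (f z $ i) :: 'v^'n) x"
  by (intro smooth_fun_sum[OF assms(1,2)] smooth_fun_linear[OF assms(1,3) l])
 moreover have "(\<Sum>i\<in>UNIV. axis i (f z $ i)) = f z" for z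
  by (simp add: vec_eq_iff axis_def sum.delta if_distrib cong: if_cong)
 ultimately show ?thesis by simp
qed

lemma smooth_fun_matrix_mult:
 assumes "atlas M" "smooth_fun M (f :: 'a => real^'n^'m) x" "smooth_fun M (g :: 'a => real^'k^'n) x"
 shows "smooth_fun M (%z. f z**g z) x"
proof -
 have "bounded_bilinear ((**) :: real^'n^'m => real^'k^'n => real^'k^'m)"
  unfolding bilinear_conv_bounded_bilinear[symmetric] by (simp add: bilinear_def linear_iff matrix_ring)
 thus ?thesis
  by (rule smooth_fun_bilinear[OF assms(1) fin_dim_euclidean fin_dim_euclidean fin_dim_euclidean _ assms(2,3)])
qed

lemma smooth_fun_matrix_vector:
 assumes "atlas M" "smooth_fun M (f :: 'a => real^'n^'m) x" "smooth_fun M (g :: 'a => real^'n) x"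
 shows "smooth_fun M (%z. f z *v g z) x"
proof -
 have "bounded_bilinear ((*v) :: real^'n^'m => real^'n => real^'m)"
  unfolding bilinear_conv_bounded_bilinear[symmetric]
  by (simp add: bilinear_def linear_iff matrix_vector_mult_add_rdistrib matrix_vector_mult_scaleR matrix_vector_right_distrib scaleR_matrix_vector_assoc)
 thus ?thesis
  by (rule smooth_fun_bilinear[OF assms(1) fin_dim_euclidean fin_dim_euclidean fin_dim_euclidean _ assms(2,3)])
qed

lemma smooth_fun_transpose:
 assumes "atlas M" "smooth_fun M (f :: 'a => real^'n^'m) x" shows "smooth_fun M (%z. transpose (f z)) x"
 by (rule smooth_fun_linear[OF assms]) (simp add: linear_conv_bounded_linear[symmetric] linear_transpose)

lemma smooth_fun_det:
 assumes "atlas M" "x\<in>points M" "smooth_fun M (f :: 'a => real^'n^'n) x" shows "smooth_fun M (%z. det (f z)) x"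
 unfolding det_def
 by (intro smooth_fun_sum smooth_fun_mult smooth_fun_const smooth_fun_prod smooth_fun_component assms)

text \<open>Cramer's rule, which exhibits the inverse as a rational and hence smooth function of the
  entries.\<close>

lemma matrix_inv_entry:
 fixes A :: "real^'n^'n"
 assumes "det A ~= 0"
 shows "minv A $ k $ l = inverse (det A) * det (\<chi> i j. if j = k then axis l 1 $ i else A $ i $ j)"
proof -
 have "A *v column l (minv A) = axis l 1"
  using invertible_matrix_inv(1)[of A] assms invertible_det_nz[of A]
  by (metis mv_assoc matrix_vector_mul_lid matrix_vector_mult_basis)
 hence "column l (minv A) = (\<chi> k. det (\<chi> i j. if j = k then axis l 1 $ i else A $ i $ j) / det A)"
  using cramer[OF assms] by blast
 hence "column l (minv A) $ k = (\<chi> k. det (\<chi> i j. if j = k then axis l 1 $ i else A $ i $ j) / det A) $ k" by simp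
 thus ?thesis by (simp add: column_def divide_inverse mult.commute)
qed

lemma smooth_fun_matrix_inv:
 fixes f :: "'a => real^'n^'n"
 assumes M: "atlas M" "x\<in>points M" and f: "smooth_fun M f x" "invertible (f x)"
 shows "smooth_fun M (%z. minv (f z)) x"
proof -
 have d: "smooth_fun M (%z. det (f z)) x" by (rule smooth_fun_det[OF M f(1)])
 have nz: "det (f x) ~= 0" using f(2) by (simp add: invertible_det_nz)
 have at: "atlas (model_manifold :: (real, real) manifold)" by simp
 have op: "openin (mtop (model_manifold :: (real, real) manifold)) (- {0})" by (simp add: model_manifold_def open_Compl)
 obtain Q where Q: "opn M Q" "x\<in>Q" "(%z. det (f z)) ` Q\<subseteq>- {0}"
  by (rule smooth_at_nhd[OF d M(1) at op]) (use nz in simp)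
 have e: "smooth_fun M (%z. det (\<chi> i j. if j = k then axis l 1 $ i else f z $ i $ j)) x" for k l :: 'n
 proof (rule smooth_fun_det[OF M], intro smooth_fun_vec[OF M])
  fix i j :: 'n
  show "smooth_fun M (%z. (\<chi> i j. if j = k then axis l 1 $ i else f z $ i $ j) $ i $ j) x"
   using smooth_fun_const[OF M, of "axis l 1 $ i :: real"] smooth_fun_component[OF M(1) smooth_fun_component[OF M(1) f(1), of i], of j]
   by (cases "j = k") (simp_all only: vec_lambda_beta if_True if_False refl)
 qed
 have "smooth_fun M (%z. minv (f z) $ k $ l) x" for k l
 proof (rule smooth_at_cong[OF _ M(1) Q(1,2)])
  show "smooth_fun M (%z. inverse (det (f z)) * det (\<chi> i j. if j = k then axis l 1 $ i else f z $ i $ j)) x"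
   by (intro smooth_fun_mult smooth_fun_inverse M d nz e)
  fix z assume "z\<in>Q"
  hence "det (f z) ~= 0" using Q(3) by auto
  thus "inverse (det (f z)) * det (\<chi> i j. if j = k then axis l 1 $ i else f z $ i $ j) = minv (f z) $ k $ l"
   by (rule matrix_inv_entry[symmetric])
 qed
 thus ?thesis by (intro smooth_fun_vec[OF M])
qed

lemma matrix_inv_unique:
 fixes A :: "real^'n^'m"
 assumes "A**B = mat 1" "B**A = mat 1" shows "minv A = B"
proof -
 have "invertible A" using assms by (auto simp: invertible_def)
 hence "minv A**(A**B) = B" by (simp add: matrix_mul_assoc invertible_matrix_inv)
 thus ?thesis by (simp add: assms(1))
qed

text \<open>The index types may differ although their cardinalities agree, so there is no
  determinant. Multiplication by the constant inverse at \<open>x\<close> leads back to square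
  matrices.\<close>

lemma smooth_fun_rect_inv:
 fixes f :: "'a => real^'n^'m"
 assumes M: "atlas M" "x\<in>points M" and f: "smooth_fun M f x" and Q: "opn M Q" "x\<in>Q" "!!z. z\<in>Q ==> invertible (f z)"
 shows "smooth_fun M (%z. minv (f z)) x"
proof -
 let ?R = "minv (f x)"
 note R = inv_cancel[OF Q(3)[OF Q(2)]]
 have iR: "invertible ?R" using R(1,2) unfolding invertible_def by blast
 have "smooth_fun M (%z. ?R**minv (f z**?R)) x"
  by (intro smooth_fun_matrix_mult smooth_fun_matrix_inv smooth_fun_const M f) (simp add: R invertible_def exI[of _ "mat 1"])
 thus ?thesis
 proof (rule smooth_at_cong[OF _ M(1) Q(1,2)])
  fix z assume z: "z\<in>Q"
  note i = inv_cancel[OF Q(3)[OF z]] and s = inv_cancel[OF invertible_mult[OF Q(3)[OF z] iR]]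
  have "minv (f z)**(f z**?R)**minv (f z**?R) = ?R**minv (f z**?R)" by (simp add: matrix_mul_assoc i)
  thus "?R**minv (f z**?R) = minv (f z)" by (simp only: s)
 qed
qed

section \<open>Fields of matrices and their intertwiners\<close>

text \<open>A vector bundle reduced to matrices. Each fibre is identified with R^n by arbitrary
  linear coordinates, without continuity in the point; \<open>A x\<close> converts these into a
  local trivialization over \<open>U\<close>. Only the transition matrices are required to be
  smooth.\<close>

locale frames =
 fixes M :: "('a, 'm::real_normed_vector) manifold" and Fr :: "('a set\<times>('a => real^'n^'n)) set"
 assumes manifold: "smooth_manifold M"
  and frame_open: "(U, A)\<in>Fr ==> opn M U"
  and frame_invertible: "(U, A)\<in>Fr ==> x\<in>U ==> invertible (A x)"
  and transition: "(U, A)\<in>Fr ==> (V, B)\<in>Fr ==> x\<in>U ==> x\<in>V ==> smooth_fun M (%z. B z**minv (A z)) x"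
  and frame_cover: "x\<in>points M ==> \<exists>U A. (U, A)\<in>Fr \<and> x\<in>U"
begin

lemma atlas: "atlas M" using manifold by (rule manifold_atlas)

lemma frame_points: "(U, A)\<in>Fr ==> x\<in>U ==> x\<in>points M" using frame_open openin_subset by blast

lemma frame_inv: "(U, A)\<in>Fr ==> x\<in>U ==> A x**minv (A x) = mat 1" "(U, A)\<in>Fr ==> x\<in>U ==> minv (A x)**A x = mat 1"
 using invertible_matrix_inv frame_invertible by blast+

lemma frame_cancel:
 assumes "(U, A)\<in>Fr" "x\<in>U"
 shows "minv (A x)**(A x**C) = C" "A x**(minv (A x)**C) = C"
  "D**A x**minv (A x) = D" "D**minv (A x)**A x = D"
 by (simp_all add: matrix_mul_assoc frame_inv[OF assms]) (simp_all add: matrix_mul_assoc[symmetric] frame_inv[OF assms])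

end

text \<open>\<open>G\<close> is written in the arbitrary fibre coordinates and can be judged smooth
  only after conversion to frames; by \<open>smooth_hom_frame\<close> the choice of frames is
  immaterial.\<close>

definition smooth_hom ::
 "('a, 'm::real_normed_vector) manifold => ('a set\<times>('a => real^'n^'n)) set => ('a set\<times>('a => real^'p^'p)) set =>
 ('a => real^'n^'p) => 'a => bool"
where
 "smooth_hom M FE FF G x \<longleftrightarrow> (\<exists>U A V B. (U, A)\<in>FE \<and> (V, B)\<in>FF \<and> x\<in>U \<and> x\<in>V \<and>
  smooth_fun M (%z. B z**G z**minv (A z)) x)"

lemma smooth_hom_frame:
 assumes E: "frames M FE" and F: "frames M FF" and G: "smooth_hom M FE FF G x"
  and A: "(U, A)\<in>FE" "x\<in>U" and B: "(V, B)\<in>FF" "x\<in>V"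
 shows "smooth_fun M (%z. B z**G z**minv (A z)) x"
proof -
 interpret E: frames M FE by (rule E)
 interpret F: frames M FF by (rule F)
 obtain U' A' V' B' where A': "(U', A')\<in>FE" "x\<in>U'" and B': "(V', B')\<in>FF" "x\<in>V'"
  and s: "smooth_fun M (%z. B' z**G z**minv (A' z)) x" using G by (auto simp: smooth_hom_def)
 have "smooth_fun M (%z. (B z**minv (B' z))**(B' z**G z**minv (A' z))**(A' z**minv (A z))) x"
  by (intro smooth_fun_matrix_mult[OF E.atlas] F.transition[OF B'(1) B(1) B'(2) B(2)] s E.transition[OF A(1) A'(1) A(2) A'(2)])
 thus ?thesis
 proof (rule smooth_at_cong[OF _ E.atlas])
  show "opn M (U'\<inter>V')" using E.frame_open[OF A'(1)] F.frame_open[OF B'(1)] by (rule openin_Int)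
  show "x\<in>U'\<inter>V'" using A' B' by simp
  fix z assume z: "z\<in>U'\<inter>V'"
  show "(B z**minv (B' z))**(B' z**G z**minv (A' z))**(A' z**minv (A z)) = B z**G z**minv (A z)"
   using z by (simp add: matrix_mul_assoc E.frame_cancel(4)[OF A'(1)] F.frame_cancel(4)[OF B'(1)])
 qed
qed

lemma smooth_hom_cong:
 assumes "atlas M" "smooth_hom M FE FF G x" "opn M Q" "x\<in>Q" "!!z. z\<in>Q ==> G z = G' z"
 shows "smooth_hom M FE FF G' x"
proof -
 obtain U A V B where A: "(U, A)\<in>FE" "x\<in>U" and B: "(V, B)\<in>FF" "x\<in>V"
  and s: "smooth_fun M (%z. B z**G z**minv (A z)) x" using assms(2) by (auto simp: smooth_hom_def)
 have "smooth_fun M (%z. B z**G' z**minv (A z)) x"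
  by (rule smooth_at_cong[OF s assms(1,3,4)]) (simp add: assms(5))
 thus ?thesis using A B by (auto simp: smooth_hom_def)
qed

lemma smooth_hom_lift2:
 assumes E: "frames M FE" and F: "frames M FF" and G: "smooth_hom M FE FF G x" "smooth_hom M FE FF G' x"
  and op: "!!U A V B. (U, A)\<in>FE ==> x\<in>U ==> (V, B)\<in>FF ==> x\<in>V ==>
   smooth_fun M (%z. B z**G z**minv (A z)) x ==> smooth_fun M (%z. B z**G' z**minv (A z)) x ==>
   smooth_fun M (%z. B z**H z**minv (A z)) x"
 shows "smooth_hom M FE FF H x"
proof -
 obtain U A V B where A: "(U, A)\<in>FE" "x\<in>U" and B: "(V, B)\<in>FF" "x\<in>V" using G by (auto simp: smooth_hom_def)
 show ?thesis
  using op[OF A B smooth_hom_frame[OF E F G(1) A B] smooth_hom_frame[OF E F G(2) A B]] A B by (auto simp: smooth_hom_def)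
qed

lemma smooth_hom_arith:
 assumes E: "frames M FE" and F: "frames M FF" and G: "smooth_hom M FE FF G x" "smooth_hom M FE FF G' x"
 shows "smooth_hom M FE FF (%z. G z + G' z) x" "smooth_hom M FE FF (%z. G z - G' z) x"
  "smooth_fun M u x ==> smooth_hom M FE FF (%z. u z *R G z) x"
proof -
 have M: "atlas M" using E by (rule frames.atlas)
 show "smooth_hom M FE FF (%z. G z + G' z) x"
  by (rule smooth_hom_lift2[OF E F G]) (simp add: matrix_add_ldistrib matrix_add_right_distrib smooth_fun_add[OF M])
 show "smooth_hom M FE FF (%z. G z - G' z) x"
  by (rule smooth_hom_lift2[OF E F G]) (simp add: matrix_diff_ldistrib matrix_diff_rdistrib smooth_fun_minus[OF M])
 show "smooth_hom M FE FF (%z. u z *R G z) x" if u: "smooth_fun M u x"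
  by (rule smooth_hom_lift2[OF E F G]) (simp add: matrix_scaleR_left matrix_scaleR_right smooth_fun_scaleR[OF M u])
qed

lemma smooth_hom_compose:
 assumes E: "frames M FE" and F: "frames M FF" and H: "frames M FH"
  and G: "smooth_hom M FE FF G x" "smooth_hom M FF FH G' x"
 shows "smooth_hom M FE FH (%z. G' z**G z) x"
proof -
 interpret F: frames M FF by (rule F)
 obtain U A V B where A: "(U, A)\<in>FE" "x\<in>U" and B: "(V, B)\<in>FF" "x\<in>V" using G by (auto simp: smooth_hom_def)
 obtain W C where C: "(W, C)\<in>FH" "x\<in>W" using G by (auto simp: smooth_hom_def)
 have "smooth_fun M (%z. (C z**G' z**minv (B z))**(B z**G z**minv (A z))) x"
  by (intro smooth_fun_matrix_mult[OF F.atlas] smooth_hom_frame[OF E F G(1) A B] smooth_hom_frame[OF F H G(2) B C])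
 hence "smooth_fun M (%z. C z**(G' z**G z)**minv (A z)) x"
  by (rule smooth_at_cong[OF _ F.atlas F.frame_open[OF B(1)] B(2)]) (simp add: matrix_mul_assoc F.frame_cancel(4)[OF B(1)])
 thus ?thesis using A C by (auto simp: smooth_hom_def)
qed

lemma smooth_hom_zero:
 assumes E: "frames M FE" and F: "frames M FF" and x: "x\<in>points M" shows "smooth_hom M FE FF (%z. 0) x"
proof -
 obtain U A where A: "(U, A)\<in>FE" "x\<in>U" using frames.frame_cover[OF E x] by blast
 obtain V B where B: "(V, B)\<in>FF" "x\<in>V" using frames.frame_cover[OF F x] by blast
 have "smooth_fun M (%z. B z**0**minv (A z)) x" using smooth_fun_const[OF frames.atlas[OF E] x, of 0] by simp
 thus ?thesis using A B unfolding smooth_hom_def by blast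
qed

lemma smooth_hom_id:
 assumes E: "frames M FE" and x: "x\<in>points M" shows "smooth_hom M FE FE (%z. mat 1) x"
proof -
 obtain U A where A: "(U, A)\<in>FE" "x\<in>U" using frames.frame_cover[OF E x] by blast
 have "smooth_fun M (%z. A z**mat 1**minv (A z)) x" using frames.transition[OF E A(1,1,2,2)] by simp
 thus ?thesis using A unfolding smooth_hom_def by blast
qed

lemma smooth_hom_cutoff:
 assumes E: "frames M FE" and F: "frames M FF" and A: "(U, A)\<in>FE" and B: "(V, B)\<in>FF" and b: "cutoff M (U\<inter>V) b"
  and g: "x\<in>U ==> x\<in>V ==> smooth_fun M (g :: 'a => real^'n^'p) x" and x: "x\<in>points M"
 shows "smooth_hom M FE FF (%z. b z *R (minv (B z)**g z**A z)) x"
proof (cases "x\<in>U\<inter>V")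
 case True
 interpret E: frames M FE by (rule E)
 interpret F: frames M FF by (rule F)
 have bx: "smooth_fun M b x" using b smooth_functions_iff[OF E.atlas] x by (auto simp: cutoff_def)
 have "smooth_fun M (%z. b z *R g z) x" using True by (intro smooth_fun_scaleR[OF E.atlas bx] g) auto
 hence "smooth_fun M (%z. B z**(b z *R (minv (B z)**g z**A z))**minv (A z)) x"
 proof (rule smooth_at_cong[OF _ E.atlas])
  show "opn M (U\<inter>V)" using E.frame_open[OF A] F.frame_open[OF B] by (rule openin_Int)
  fix z assume z: "z\<in>U\<inter>V"
  thus "b z *R g z = B z**(b z *R (minv (B z)**g z**A z))**minv (A z)"
   using z by (simp add: matrix_ring E.frame_inv[OF A] F.frame_inv[OF B] E.frame_cancel[OF A])
 qed (use True in simp)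
 thus ?thesis using A B True unfolding smooth_hom_def by blast
next
 case False
 obtain Q where Q: "opn M Q" "x\<in>Q" "!!z. z\<in>Q ==> b z = 0"
  using cutoff_zero_nhd[OF frames.manifold[OF E] b x False] by metis
 show ?thesis by (rule smooth_hom_cong[OF frames.atlas[OF E] smooth_hom_zero[OF E F x] Q(1,2)]) (simp add: Q(3))
qed

lemma smooth_hom_inverse:
 fixes G :: "'a => real^'n^'p"
 assumes E: "frames M FE" and F: "frames M FF" and G: "smooth_hom M FE FF G x" and inv: "!!z. z\<in>points M ==> invertible (G z)"
 shows "smooth_hom M FF FE (%z. minv (G z)) x"
proof -
 interpret E: frames M FE by (rule E)
 interpret F: frames M FF by (rule F)
 obtain U A V B where A: "(U, A)\<in>FE" "x\<in>U" and B: "(V, B)\<in>FF" "x\<in>V"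
  and s: "smooth_fun M (%z. B z**G z**minv (A z)) x" using G by (auto simp: smooth_hom_def)
 have e: "(B z**G z**minv (A z))**(A z**minv (G z)**minv (B z)) = mat 1"
  "(A z**minv (G z)**minv (B z))**(B z**G z**minv (A z)) = mat 1" if z: "z\<in>U\<inter>V" for z
  using z by (simp_all add: inv_cancel[OF inv[OF E.frame_points[OF A(1)]]] E.frame_cancel[OF A(1)] F.frame_cancel[OF B(1)]
    matrix_mul_assoc E.frame_inv[OF A(1)] F.frame_inv[OF B(1)])
 have oUV: "opn M (U\<inter>V)" using E.frame_open[OF A(1)] F.frame_open[OF B(1)] by (rule openin_Int)
 have xUV: "x\<in>U\<inter>V" using A B by simp
 have ix: "invertible (B z**G z**minv (A z))" if "z\<in>U\<inter>V" for z using e[OF that] by (auto simp: invertible_def)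
 have "smooth_fun M (%z. minv (B z**G z**minv (A z))) x"
  by (rule smooth_fun_rect_inv[OF E.atlas E.frame_points[OF A] s oUV xUV ix])
 hence "smooth_fun M (%z. A z**minv (G z)**minv (B z)) x"
  by (rule smooth_at_cong[OF _ E.atlas oUV xUV]) (rule matrix_inv_unique[OF e])
 thus ?thesis using A B unfolding smooth_hom_def by blast
qed

context frames begin

abbreviation field :: "('a => real^'n^'n) => bool" where "field T \<equiv> \<forall>x\<in>points M. smooth_hom M Fr Fr T x"

lemma frames_self: "frames M Fr" by (rule frames_axioms)

lemma field_add: "field S ==> field T ==> field (%z. S z + T z)"
 using smooth_hom_arith(1)[OF frames_self frames_self] by blast

lemma field_diff: "field S ==> field T ==> field (%z. S z - T z)"
 using smooth_hom_arith(2)[OF frames_self frames_self] by blast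

lemma field_mult: "field S ==> field T ==> field (%z. S z**T z)"
 using smooth_hom_compose[OF frames_self frames_self frames_self] by blast

lemma field_lie: "field S ==> field T ==> field (%z. lie (S z) (T z))"
 unfolding lie_def by (intro field_diff field_mult)

lemma field_scaleR: "u\<in>Cinf M ==> field T ==> field (%z. u z *R T z)"
 using smooth_hom_arith(3)[OF frames_self frames_self] smooth_functions_iff[OF atlas] by blast

lemma field_zero: "field (%z. 0)" using smooth_hom_zero[OF frames_self frames_self] by blast

lemma field_scal: "u\<in>Cinf M ==> field (%z. scal (u z))"
 by (intro field_scaleR ballI smooth_hom_id[OF frames_self])

lemma field_sum: "(!!i. i\<in>I ==> field (T i)) ==> field (%z. \<Sum>i\<in>I. T i z)"
 by (induction I rule: infinite_finite_induct) (simp_all add: field_zero field_add)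

lemma field_cutoff:
 assumes "(U, A)\<in>Fr" "cutoff M U b" "!!x. x\<in>U ==> smooth_fun M g x"
 shows "field (%z. b z *R (minv (A z)**g z**A z))"
 using smooth_hom_cutoff[OF frames_self frames_self assms(1,1), where b = b and g = g] assms(2,3) by simp

lemma field_scalar_part:
 assumes T: "field T" and s: "!!x. x\<in>points M ==> T x = scal (u x)"
 shows "u\<in>Cinf M"
 unfolding smooth_functions_iff[OF atlas]
proof
 fix x assume x: "x\<in>points M"
 obtain U A where A: "(U, A)\<in>Fr" "x\<in>U" using frame_cover[OF x] by blast
 have "smooth_fun M (%z. A z**T z**minv (A z)) x"
  using smooth_hom_frame[OF frames_self frames_self _ A A] T x by blast
 hence c: "smooth_fun M (%z. (A z**T z**minv (A z)) $ i $ i) x" for i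
  by (intro smooth_fun_component[OF atlas])
 show "smooth_fun M u x"
 proof (rule smooth_at_cong[OF c[of frame_index] atlas frame_open[OF A(1)] A(2)])
  fix z assume z: "z\<in>U"
  have "A z**scal (u z)**minv (A z) = scal (u z)" by (simp add: matrix_ring frame_inv[OF A(1) z])
  thus "(A z**T z**minv (A z)) $ frame_index $ frame_index = u z"
   using s[OF frame_points[OF A(1) z]] by (simp add: mat_def)
 qed
qed

end

section \<open>Conjugation and congruence modulo scalar matrices\<close>

definition conjugate :: "real^'n^'n => real^'n^'n => real^'n^'n" where
 "conjugate P m = P**m**minv P"

lemma conjugate_arith:
 "conjugate P (m + n) = conjugate P m + conjugate P n" "conjugate P (m - n) = conjugate P m - conjugate P n"
 "conjugate P (c *R m) = c *R conjugate P m" "conjugate P (sum f I) = (\<Sum>i\<in>I. conjugate P (f i))"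
 by (simp_all add: conjugate_def matrix_ring matrix_sum_left matrix_sum_right)

lemma conjugate_invertible:
 assumes "invertible P"
 shows "conjugate P (m**n) = conjugate P m**conjugate P n" "conjugate P (lie m n) = lie (conjugate P m) (conjugate P n)"
  "conjugate P (scal c) = scal c" "conjugate P (minv P**m**P) = m" "minv P**conjugate P m**P = m"
 by (simp_all add: conjugate_def lie_def matrix_ring inv_cancel[OF assms])

definition eq_scal :: "real^'n^'n => real^'n^'n => bool" (infix \<open>\<asymp>\<close> 50) where
 "a\<asymp>b \<longleftrightarrow> (\<exists>c. a = b + scal c)"

lemma eq_scal_refl: "a\<asymp>a" unfolding eq_scal_def by (intro exI[of _ 0]) simp

lemma eq_scal_sym: "a\<asymp>b ==> b\<asymp>a"
 unfolding eq_scal_def by (metis add_diff_cancel diff_conv_add_uminus scaleR_minus_left)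

lemma eq_scal_add: assumes "a\<asymp>b" "a'\<asymp>b'" shows "a + a'\<asymp>b + b'"
proof -
 obtain c c' where "a = b + scal c" "a' = b' + scal c'" using assms unfolding eq_scal_def by blast
 hence "a + a' = b + b' + scal (c + c')" by (simp add: scaleR_add_left)
 thus ?thesis unfolding eq_scal_def by blast
qed

lemma eq_scal_trans [trans]: "a\<asymp>b ==> b\<asymp>c ==> a\<asymp>c"
 unfolding eq_scal_def by (metis add.assoc scaleR_add_left)

lemma eq_scal_lie: assumes "a\<asymp>b" "a'\<asymp>b'" shows "lie a a' = lie b b'"
 using assms by (auto simp: eq_scal_def lie_add lie_scal)

lemma eq_scal_sum: "(!!i. i\<in>I ==> f i\<asymp>g i) ==> sum f I\<asymp>sum g I"
 by (induction I rule: infinite_finite_induct) (simp_all add: eq_scal_add eq_scal_refl)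

lemma eq_scal_conjugate: assumes "a\<asymp>b" "invertible P" shows "conjugate P a\<asymp>conjugate P b"
 using assms(1) by (auto simp: eq_scal_def conjugate_arith(1) conjugate_invertible(3)[OF assms(2)])

lemma scal_eq_0: "scal c\<asymp>0" unfolding eq_scal_def by simp

lemma lie_mod_scalars_iff:
 "lie_mod_scalars Theta \<longleftrightarrow> linear Theta \<and> (\<forall>a b. Theta (lie a b)\<asymp>lie (Theta a) (Theta b)) \<and> Theta (mat 1)\<asymp>0 \<and>
  (\<forall>z. (\<Sum>i\<in>UNIV. \<Sum>j\<in>UNIV. lie (Theta (munit i j)) (lie (Theta (munit j i)) z))\<asymp>(2 * real CARD('n)) *R z)"
 for Theta :: "real^'n^'n => real^'p^'p"
 by (simp add: lie_mod_scalars_def eq_scal_def)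

text \<open>The last condition excludes the zero homomorphism, which satisfies the others.\<close>

locale field_map = E: frames M FE + F: frames M FF
 for M :: "('a, 'm::real_normed_vector) manifold" and FE :: "('a set\<times>('a => real^'n^'n)) set"
  and FF :: "('a set\<times>('a => real^'p^'p)) set" +
 fixes theta :: "('a => real^'n^'n) => 'a => real^'p^'p"
 assumes theta_field: "E.field T ==> F.field (theta T)"
  and theta_add: "E.field S ==> E.field T ==> x\<in>points M ==> theta (%z. S z + T z) x\<asymp>theta S x + theta T x"
  and theta_mult: "u\<in>Cinf M ==> E.field T ==> x\<in>points M ==> theta (%z. u z *R T z) x\<asymp>u x *R theta T x"
  and theta_lie: "E.field S ==> E.field T ==> x\<in>points M ==> theta (%z. lie (S z) (T z)) x\<asymp>lie (theta S x) (theta T x)"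
  and theta_scal: "u\<in>Cinf M ==> x\<in>points M ==> theta (%z. scal (u z)) x\<asymp>0"
  and theta_casimir: "(!!i j :: 'n. E.field (e i j)) ==> b\<in>Cinf M ==>
   (!!a x. E.field a ==> x\<in>points M ==>
    (\<Sum>i\<in>UNIV. \<Sum>j\<in>UNIV. lie (e i j x) (lie (e j i x) (a x)))\<asymp>b x *R a x) ==>
   F.field a' ==> x\<in>points M ==>
   (\<Sum>i\<in>UNIV. \<Sum>j\<in>UNIV. lie (theta (e i j) x) (lie (theta (e j i) x) (a' x)))\<asymp>b x *R a' x"
begin

lemma theta_sum:
 assumes "finite I" "!!i. i\<in>I ==> E.field (T i)" "x\<in>points M"
 shows "theta (%z. \<Sum>i\<in>I. T i z) x\<asymp>(\<Sum>i\<in>I. theta (T i) x)"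
 using assms(1,2)
proof (induction I rule: finite_induct)
 case empty
 have "(%x. 0)\<in>Cinf M" by (simp add: smooth_functions_iff[OF E.atlas] smooth_fun_const[OF E.atlas])
 thus ?case using theta_scal[OF _ assms(3), of "%x. 0"] by simp
next
 case (insert i I)
 have "theta (%z. T i z + (\<Sum>i\<in>I. T i z)) x\<asymp>theta (T i) x + theta (%z. \<Sum>i\<in>I. T i z) x"
  by (rule theta_add[OF _ E.field_sum assms(3)]) (use insert.prems in auto)
 also have "\<dots>\<asymp>theta (T i) x + (\<Sum>i\<in>I. theta (T i) x)"
  by (intro eq_scal_add eq_scal_refl insert.IH insert.prems) auto
 finally show ?case using insert.hyps by simp
qed

end

text \<open>\<open>theta\<close> accepts only global fields. To study it near a point, matrices that
  are constant in the frame \<open>A\<close> are cut off by \<open>b\<close>, and the result is read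
  in the frame \<open>B\<close>; on \<open>W\<close> the cutoff is invisible.\<close>

locale local_fields = field_map M FE FF theta
 for M :: "('a, 'm::real_normed_vector) manifold" and FE :: "('a set\<times>('a => real^'n^'n)) set"
  and FF :: "('a set\<times>('a => real^'p^'p)) set" and theta +
 fixes U A V B b W
 assumes A: "(U, A)\<in>FE" and B: "(V, B)\<in>FF" and b: "cutoff M (U\<inter>V) b"
  and W: "opn M W" "W\<subseteq>U\<inter>V" "!!z. z\<in>W ==> b z = 1"
begin

definition loc :: "real^'n^'n => 'a => real^'n^'n" where
 "loc m = (%z. b z *R (minv (A z)**m**A z))"

text \<open>The values on matrix units are extended linearly: this map is exactly linear, while
  \<open>theta (loc m)\<close> is linear in \<open>m\<close> only modulo scalars.\<close>

definition Theta :: "'a => real^'n^'n => real^'p^'p" where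
 "Theta z m = (\<Sum>i\<in>UNIV. \<Sum>j\<in>UNIV. (m $ i $ j) *R conjugate (B z) (theta (loc (munit i j)) z))"

lemma b_zero: "z\<notin>U\<inter>V ==> b z = 0" using b unfolding cutoff_def by blast

lemma b_smooth: "b\<in>Cinf M" using b unfolding cutoff_def by blast

lemma W_points: "z\<in>W ==> z\<in>points M" using openin_subset[OF W(1)] by blast

lemma cutoff_U: "cutoff M U b" and cutoff_V: "cutoff M V b" using b unfolding cutoff_def by blast+

lemma loc_field: "E.field (loc m)"
 unfolding loc_def by (rule E.field_cutoff[OF A cutoff_U]) (rule smooth_fun_const[OF E.atlas E.frame_points[OF A]])

lemma loc_W: "z\<in>W ==> conjugate (A z) (loc m z) = m"
 using W(2,3) by (simp add: loc_def conjugate_arith conjugate_invertible(4)[OF E.frame_invertible[OF A]] subset_iff)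

lemma Theta_munit: "Theta z (munit i j) = conjugate (B z) (theta (loc (munit i j)) z)" (is "_ = ?c")
proof -
 have "(\<Sum>j'\<in>UNIV. (munit i j $ i' $ j') *R conjugate (B z) (theta (loc (munit i' j')) z)) = (if i' = i then ?c else 0)" for i'
  by (cases "i' = i") (simp_all add: munit_component if_distrib[where f = "%r. r *R _"] cong: if_cong)
 thus ?thesis by (simp add: Theta_def)
qed

lemma linear_Theta: "linear (Theta z)"
 unfolding Theta_def linear_iff by (simp add: scaleR_add_left sum.distrib scaleR_sum_right)

text \<open>Tensoriality: linearity over functions modulo scalars makes \<open>theta T z\<close>
  depend, modulo scalars, only on the value \<open>T z\<close>.\<close>

lemma theta_Theta:
 assumes T: "E.field T" and z: "z\<in>W"
 shows "conjugate (B z) (theta T z)\<asymp>Theta z (conjugate (A z) (T z))"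
proof -
 have zM: "z\<in>points M" using W_points[OF z] .
 have bz: "b z = 1" using W(3)[OF z] .
 \<comment> \<open>One factor \<open>b\<close> turns the local coefficients into global functions, a
   second one is contained in \<open>loc\<close>; this is why \<open>T\<close> is expanded after
   multiplication by the square of \<open>b\<close>.\<close>
 define u where "u = (%i j y. b y * conjugate (A y) (T y) $ i $ j)"
 have u: "u i j\<in>Cinf M" for i j
  unfolding smooth_functions_iff[OF E.atlas]
 proof
  fix x assume x: "x\<in>points M"
  have "smooth_fun M (%y. b y *R conjugate (A y) (T y) $ i $ j) x"
  proof (rule cutoff_smooth[OF E.manifold cutoff_U _ x])
   assume "x\<in>U"
   hence "smooth_fun M (%y. conjugate (A y) (T y)) x"
    unfolding conjugate_def using smooth_hom_frame[OF E.frames_self E.frames_self _ A _ A] T x by blast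
   thus "smooth_fun M (%y. conjugate (A y) (T y) $ i $ j) x" by (intro smooth_fun_component[OF E.atlas])
  qed
  thus "smooth_fun M (u i j) x" by (simp add: u_def)
 qed
 have uL: "E.field (%y. u i j y *R loc (munit i j) y)" for i j by (rule E.field_scaleR[OF u loc_field])
 have b2: "(%y. b y * b y)\<in>Cinf M"
  using b_smooth smooth_fun_mult[OF E.atlas] by (simp add: smooth_functions_iff[OF E.atlas])
 have exp: "(b y * b y) *R T y = (\<Sum>i\<in>UNIV. \<Sum>j\<in>UNIV. u i j y *R loc (munit i j) y)" for y
 proof (cases "y\<in>U\<inter>V")
  case True
  note inv = E.frame_invertible[OF A, of y]
  have "T y = minv (A y)**conjugate (A y) (T y)**A y" using True by (simp add: conjugate_invertible(5) inv)
  also have "\<dots> = minv (A y)**(\<Sum>i\<in>UNIV. \<Sum>j\<in>UNIV. (conjugate (A y) (T y) $ i $ j) *R munit i j)**A y"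
   by (subst munit_expand[symmetric]) (rule refl)
  also have "\<dots> = (\<Sum>i\<in>UNIV. \<Sum>j\<in>UNIV. (conjugate (A y) (T y) $ i $ j) *R (minv (A y)**munit i j**A y))"
   by (simp add: matrix_sum_left matrix_sum_right matrix_scaleR_left matrix_scaleR_right)
  finally have "(b y * b y) *R T y = (b y * b y) *R \<dots>" by (rule arg_cong)
  also have "\<dots> = (\<Sum>i\<in>UNIV. \<Sum>j\<in>UNIV. u i j y *R loc (munit i j) y)"
   by (simp add: scaleR_sum_right u_def loc_def mult_ac)
  finally show ?thesis .
 next
  case False thus ?thesis by (simp add: b_zero u_def)
 qed
 have "theta T z = (b z * b z) *R theta T z" by (simp add: bz)
 also have "\<dots>\<asymp>theta (%y. (b y * b y) *R T y) z" by (rule eq_scal_sym[OF theta_mult[OF b2 T zM]])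
 also have "theta (%y. (b y * b y) *R T y) z = theta (%y. \<Sum>i\<in>UNIV. \<Sum>j\<in>UNIV. u i j y *R loc (munit i j) y) z"
  by (simp only: exp)
 also have "\<dots>\<asymp>(\<Sum>i\<in>UNIV. theta (%y. \<Sum>j\<in>UNIV. u i j y *R loc (munit i j) y) z)"
  by (rule theta_sum[OF finite E.field_sum[OF uL] zM])
 also have "\<dots>\<asymp>(\<Sum>i\<in>UNIV. \<Sum>j\<in>UNIV. theta (%y. u i j y *R loc (munit i j) y) z)"
  by (rule eq_scal_sum) (rule theta_sum[OF finite uL zM])
 also have "\<dots>\<asymp>(\<Sum>i\<in>UNIV. \<Sum>j\<in>UNIV. u i j z *R theta (loc (munit i j)) z)"
  by (intro eq_scal_sum theta_mult[OF u loc_field zM])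
 finally have "conjugate (B z) (theta T z)\<asymp>conjugate (B z) (\<Sum>i\<in>UNIV. \<Sum>j\<in>UNIV. u i j z *R theta (loc (munit i j)) z)"
  by (rule eq_scal_conjugate) (use F.frame_invertible[OF B] z W(2) in blast)
 thus ?thesis by (simp add: Theta_def conjugate_arith u_def bz)
qed

lemma lie_mod_scalars_Theta:
 assumes z: "z\<in>W" shows "lie_mod_scalars (Theta z)"
 unfolding lie_mod_scalars_iff
proof (intro conjI allI)
 have zM: "z\<in>points M" using W_points[OF z] .
 have bz: "b z = 1" using W(3)[OF z] .
 have iA: "invertible (A z)" and iB: "invertible (B z)" using E.frame_invertible[OF A] F.frame_invertible[OF B] z W(2) by blast+
 show "linear (Theta z)" by (rule linear_Theta)
 have loc: "conjugate (B z) (theta (loc m) z)\<asymp>Theta z m" for m using theta_Theta[OF loc_field z, of m] by (simp add: loc_W[OF z])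
 show "Theta z (lie m m')\<asymp>lie (Theta z m) (Theta z m')" for m m'
 proof -
  have "Theta z (lie m m') = Theta z (conjugate (A z) (lie (loc m z) (loc m' z)))"
   by (simp add: conjugate_invertible(2)[OF iA] loc_W[OF z])
  also have "\<dots>\<asymp>conjugate (B z) (theta (%y. lie (loc m y) (loc m' y)) z)"
   by (rule eq_scal_sym[OF theta_Theta[OF E.field_lie[OF loc_field loc_field] z]])
  also have "\<dots>\<asymp>conjugate (B z) (lie (theta (loc m) z) (theta (loc m') z))"
   by (rule eq_scal_conjugate[OF theta_lie[OF loc_field loc_field zM] iB])
  also have "\<dots> = lie (conjugate (B z) (theta (loc m) z)) (conjugate (B z) (theta (loc m') z))"
   by (rule conjugate_invertible(2)[OF iB])
  also have "\<dots> = lie (Theta z m) (Theta z m')" by (rule eq_scal_lie[OF loc loc])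
  finally show ?thesis .
 qed
 show "Theta z (mat 1)\<asymp>0"
 proof -
  have one: "(%x. 1)\<in>Cinf M" by (simp add: smooth_functions_iff[OF E.atlas] smooth_fun_const[OF E.atlas])
  have "Theta z (mat 1) = Theta z (conjugate (A z) (scal 1))" by (simp add: conjugate_invertible(3)[OF iA, of 1, simplified])
  also have "\<dots>\<asymp>conjugate (B z) (theta (%y. scal 1) z)" by (rule eq_scal_sym[OF theta_Theta[OF E.field_scal[OF one] z]])
  also have "\<dots>\<asymp>conjugate (B z) 0" by (rule eq_scal_conjugate[OF theta_scal[OF one zM] iB])
  also have "\<dots> = 0" by (simp add: conjugate_def)
  finally show ?thesis .
 qed
 show "(\<Sum>i\<in>UNIV. \<Sum>j\<in>UNIV. lie (Theta z (munit i j)) (lie (Theta z (munit j i)) m))\<asymp>(2 * real CARD('n)) *R m" for m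
 proof -
  \<comment> \<open>Each of the two brackets with a cut-off field contributes a factor
    \<open>b\<close>. The Casimir identity thus holds with 2n b^2 on all of \<open>M\<close>, both
    sides being 0 outside \<open>U\<close> and \<open>V\<close>.\<close>
  define c where "c = (%y. 2 * real CARD('n) * (b y * b y))"
  have c: "c\<in>Cinf M"
   using b_smooth unfolding c_def smooth_functions_iff[OF E.atlas]
   by (intro ballI smooth_fun_mult[OF E.atlas] smooth_fun_const[OF E.atlas]) blast+
  have K: "(\<Sum>i\<in>UNIV. \<Sum>j\<in>UNIV. lie (loc (munit i j) y) (lie (loc (munit j i) y) (a y)))\<asymp>c y *R a y"
   if y: "y\<in>points M" for a y
  proof (cases "y\<in>U\<inter>V")
   case True
   define P where "P = A y"
   have iP: "invertible P" using E.frame_invertible[OF A] True by (simp add: P_def)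
   have lc: "conjugate P (loc m y) = b y *R m" for m
    by (simp add: loc_def P_def[symmetric] conjugate_arith conjugate_invertible(4)[OF iP])
   have "conjugate P (\<Sum>i\<in>UNIV. \<Sum>j\<in>UNIV. lie (loc (munit i j) y) (lie (loc (munit j i) y) (a y)))
    = (b y * b y) *R (\<Sum>i\<in>UNIV. \<Sum>j\<in>UNIV. lie (munit i j) (lie (munit j i) (conjugate P (a y))))"
    by (simp add: conjugate_arith conjugate_invertible(2)[OF iP] lc lie_scaleR scaleR_sum_right)
   also have "\<dots> = conjugate P (c y *R a y) + scal (- (b y * b y) * (2 * trace (conjugate P (a y))))"
    by (simp add: casimir_matrix c_def conjugate_arith scaleR_diff_right mult_ac)
   also have "\<dots> = conjugate P (c y *R a y + scal (- (b y * b y) * (2 * trace (conjugate P (a y)))))"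
    by (simp only: conjugate_arith(1) conjugate_invertible(3)[OF iP])
   finally have "minv P**conjugate P (\<Sum>i\<in>UNIV. \<Sum>j\<in>UNIV. lie (loc (munit i j) y) (lie (loc (munit j i) y) (a y)))**P
    = minv P**conjugate P (c y *R a y + scal (- (b y * b y) * (2 * trace (conjugate P (a y)))))**P" by (simp only:)
   thus ?thesis unfolding conjugate_invertible(5)[OF iP] eq_scal_def by blast
  next
   case False thus ?thesis by (simp add: loc_def b_zero c_def lie_def eq_scal_refl)
  qed
  define m' where "m' = (%y. b y *R (minv (B y)**m**B y))"
  have m': "F.field m'" unfolding m'_def
   by (rule F.field_cutoff[OF B cutoff_V]) (rule smooth_fun_const[OF E.atlas F.frame_points[OF B]])
  have m'z: "conjugate (B z) (m' z) = m" by (simp add: m'_def bz conjugate_invertible(4)[OF iB])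
  have "(\<Sum>i\<in>UNIV. \<Sum>j\<in>UNIV. lie (theta (loc (munit i j)) z) (lie (theta (loc (munit j i)) z) (m' z)))\<asymp>c z *R m' z"
   by (rule theta_casimir[where e = "%i j. loc (munit i j)", OF loc_field c _ m' zM]) (rule K)
  hence "conjugate (B z) (\<Sum>i\<in>UNIV. \<Sum>j\<in>UNIV. lie (theta (loc (munit i j)) z) (lie (theta (loc (munit j i)) z) (m' z)))\<asymp>conjugate (B z) (c z *R m' z)"
   by (rule eq_scal_conjugate) (rule iB)
  thus ?thesis
   by (simp add: conjugate_arith conjugate_invertible(2)[OF iB] m'z Theta_munit c_def bz)
 qed
qed

lemma Theta_smooth:
 assumes z: "z\<in>W" shows "smooth_fun M (%y. Theta y m) z"
 unfolding Theta_def
proof (intro smooth_fun_sum smooth_fun_scaleR smooth_fun_const E.atlas W_points[OF z])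
 fix i j
 have "z\<in>V" using W(2) z by blast
 thus "smooth_fun M (%z. conjugate (B z) (theta (loc (munit i j)) z)) z"
  unfolding conjugate_def using smooth_hom_frame[OF F.frames_self F.frames_self _ B _ B] theta_field[OF loc_field] W_points[OF z] by blast
qed

end

context field_map begin

lemma local_fields_exist:
 assumes x: "x\<in>points M"
 obtains U A V B b W where "local_fields M FE FF theta U A V B b W" "x\<in>W"
proof -
 obtain U A where A: "(U, A)\<in>FE" "x\<in>U" using E.frame_cover[OF x] by blast
 obtain V B where B: "(V, B)\<in>FF" "x\<in>V" using F.frame_cover[OF x] by blast
 have o: "opn M (U\<inter>V)" using E.frame_open[OF A(1)] F.frame_open[OF B(1)] by (rule openin_Int)
 have xUV: "x\<in>U\<inter>V" using A B by simp
 obtain b W where b: "cutoff M (U\<inter>V) b" "opn M W" "x\<in>W" "W\<subseteq>U\<inter>V" "!!z. z\<in>W ==> b z = 1"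
  using cutoff_exists[OF E.manifold o xUV] by metis
 have "local_fields M FE FF theta U A V B b W" by unfold_locales (use A B b in auto)
 thus thesis using that b(3) by blast
qed

lemma card_le:
 assumes "x\<in>points M" "CARD('p)\<ge>2" shows "CARD('n)\<le>CARD('p)"
proof -
 obtain U A V B b W where l: "local_fields M FE FF theta U A V B b W" "x\<in>W" using local_fields_exist[OF assms(1)] by metis
 show ?thesis using lie_mod_scalars_card[OF local_fields.lie_mod_scalars_Theta[OF l] assms(2)] .
qed

end

text \<open>Straight segments inside a coordinate ball serve as the paths that link points to
  singular cohomology.\<close>

lemma local_paths:
 assumes M: "atlas (M :: ('a, 'm::real_normed_vector) manifold)" and U: "opn M U" "x\<in>U"
 shows "\<exists>Q. opn M Q \<and> x\<in>Q \<and>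
  (\<forall>z\<in>Q. \<exists>gamma. continuous_map (top_of_set {0..1::real}) (mtop M) gamma \<and> gamma 0 = x \<and> gamma 1 = z \<and> gamma ` {0..1}\<subseteq>U)"
proof -
 have "x\<in>points M" using U openin_subset by blast
 then obtain C phi where C: "(C, phi)\<in>charts M" "x\<in>C" using atlas_chart[OF M] by metis
 have oCU: "opn M (C\<inter>U)" using atlasD(2)[OF M C(1)] U(1) by (rule openin_Int)
 have "open (phi ` (C\<inter>U))" by (rule atlasD(5)[OF M C(1) oCU]) simp
 moreover have "phi x\<in>phi ` (C\<inter>U)" using C U by blast
 ultimately obtain e where e: "e > 0" "ball (phi x) e\<subseteq>phi ` (C\<inter>U)" by (meson open_contains_ball)
 define Q where "Q = {z\<in>C. phi z\<in>ball (phi x) e}"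
 have Q: "opn M Q" unfolding Q_def by (rule atlasD(6)[OF M C(1)]) simp
 have "\<exists>gamma. continuous_map (top_of_set {0..1::real}) (mtop M) gamma \<and> gamma 0 = x \<and> gamma 1 = z \<and> gamma ` {0..1}\<subseteq>U" if z: "z\<in>Q" for z
 proof -
  let ?l = "%t::real. (1 - t) *R phi x + t *R phi z"
  have l: "?l t\<in>ball (phi x) e" if "t\<in>{0..1}" for t
   using convex_ball[of "phi x" e] that z e(1) unfolding convex_alt Q_def by auto
  have cl: "continuous_map (top_of_set {0..1}) (top_of_set (phi ` C)) ?l"
   unfolding continuous_map_in_subtopology
  proof
   show "continuous_map (top_of_set {0..1}) euclidean ?l" by (auto intro!: continuous_intros)
   show "?l\<in>topspace (top_of_set {0..1}) \<rightarrow> phi ` C"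
   proof
    fix t :: real assume "t\<in>topspace (top_of_set {0..1})"
    hence "?l t\<in>phi ` (C\<inter>U)" using l[of t] e(2) by auto
    thus "?l t\<in>phi ` C" by blast
   qed
  qed
  have "continuous_map (top_of_set {0..1}) (mtop M) (inv_into C phi\<circ>?l)" by (rule continuous_map_compose[OF cl chart_inverse_continuous[OF M C(1)]])
  moreover have "(inv_into C phi\<circ>?l) 0 = x" "(inv_into C phi\<circ>?l) 1 = z" using atlasD(8)[OF M C(1)] C(2) z by (simp_all add: Q_def)
  moreover have "(inv_into C phi\<circ>?l) ` {0..1}\<subseteq>U"
  proof
   fix y assume "y\<in>(inv_into C phi\<circ>?l) ` {0..1}"
   then obtain t where t: "t\<in>{0..1}" "y = inv_into C phi (?l t)" by auto
   obtain y' where "y'\<in>C\<inter>U" "?l t = phi y'" using l[OF t(1)] e(2) by blast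
   thus "y\<in>U" using t(2) atlasD(8)[OF M C(1)] by simp
  qed
  ultimately show ?thesis by blast
 qed
 thus ?thesis using Q C e(1) unfolding Q_def by (intro exI[of _ Q]) (auto simp: Q_def)
qed

text \<open>The quadratic form of the sum is the sum of the nonnegative terms r_i |A_i v|^2, and the
  term of index \<open>i0\<close> vanishes only at v = 0.\<close>

lemma positive_gram:
 fixes A :: "'i => real^'n^'n"
 assumes "finite I" "!!i. i\<in>I ==> 0\<le>r i" "i0\<in>I" "r i0 > 0" "invertible (A i0)"
 shows "invertible (\<Sum>i\<in>I. r i *R (transpose (A i)**A i))"
proof -
 let ?S = "\<Sum>i\<in>I. r i *R (transpose (A i)**A i)"
 have q: "v\<bullet>(?S *v v) = (\<Sum>i\<in>I. r i * ((A i *v v)\<bullet>(A i *v v)))" for v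
 proof -
  have "v\<bullet>(transpose (A i) *v w) = (A i *v v)\<bullet>w" for i w by (metis dot_lmul_matrix vector_transpose_matrix inner_commute transpose_transpose)
  thus ?thesis
   by (simp only: matrix_sum_vector scaleR_matrix_vector_assoc[symmetric] inner_sum_right inner_scaleR_right mv_assoc[symmetric])
 qed
 have "v = 0" if "?S *v v = 0" for v
 proof -
  have "(\<Sum>i\<in>I. r i * ((A i *v v)\<bullet>(A i *v v))) = 0" using q[of v] that by simp
  hence "\<forall>i\<in>I. r i * ((A i *v v)\<bullet>(A i *v v)) = 0" by (subst (asm) sum_nonneg_eq_0_iff) (simp_all add: assms(1,2))
  hence "A i0 *v v = 0" using assms(3,4) by force
  hence "minv (A i0) *v (A i0 *v v) = 0" by simp
  thus ?thesis by (simp add: mv_assoc invertible_matrix_inv(2)[OF assms(5)])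
 qed
 hence "inj ((*v) ?S)" using linear_injective_0[OF matrix_vector_mul_linear[of ?S]] by blast
 hence "\<exists>B. B**?S = mat 1" by (simp only: matrix_left_invertible_injective)
 thus ?thesis by (simp only: invertible_left_inverse)
qed

text \<open>A fibre metric, glued by a partition of unity. Since the fibre coordinates are
  arbitrary, smoothness is stated for the form as seen in a frame, after multiplication by the
  inverse frame on both sides.\<close>

lemma (in frames) metric_exists:
 obtains S where "!!x. x\<in>points M ==> invertible (S x)"
  "!!U A x. (U, A)\<in>Fr ==> x\<in>U ==> smooth_fun M (%z. transpose (minv (A z))**S z**minv (A z)) x"
proof (cases "points M = {}")
 case True
 thus thesis using that[of "%x. mat 1"] frame_points by blast
next
 case False
 obtain U A where UA: "!!p. p\<in>points M ==> (U p, A p)\<in>Fr \<and> p\<in>U p" using frame_cover by metis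
 obtain rho p K V where pou: "pou_on M U rho p K V"
  using partition_of_unity_exists[OF manifold False, of U] UA frame_open by metis
 note pu = pou_onD[OF pou]
 let ?A = "%k. A (p k)"
 have fr: "(U (p k), ?A k)\<in>Fr" for k using UA pu(3) by blast
 have cut: "cutoff M (U (p k)) (rho k)" for k unfolding cutoff_def using pu(1,4,5,6) by blast
 define S where "S = locally_finite_sum V (%k z. rho k z *R (transpose (?A k z)**?A k z))"
 have S: "S z = (\<Sum>j\<le>k. rho j z *R (transpose (?A j z)**?A j z))" if "z\<in>V k" for z k
  unfolding S_def using that by (rule locally_finite_sum_eq) (simp add: pu(9))
 show thesis
 proof (rule that)
  fix x assume x: "x\<in>points M"
  obtain k where k: "x\<in>V k" using pu(8)[OF x] by blast
  have "\<exists>j\<le>k. rho j x ~= 0"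
  proof (rule ccontr)
   assume "\<not> (\<exists>j\<le>k. rho j x ~= 0)"
   hence "(\<Sum>j\<le>k. rho j x) = 0" by simp
   thus False using pu(10)[OF k order_refl] by simp
  qed
  then obtain j where j: "j\<le>k" "rho j x ~= 0" by blast
  have "x\<in>U (p j)" using pu(5,6) j(2) by blast
  hence "invertible (?A j x)" by (rule frame_invertible[OF fr])
  thus "invertible (S x)" unfolding S[OF k]
   by (intro positive_gram[where ?i0.0 = j]) (use j pu(2) in "auto simp: order.strict_iff_order")
 next
  fix U' A' x assume A': "(U', A')\<in>Fr" "x\<in>U'"
  have x: "x\<in>points M" using frame_points[OF A'] .
  obtain k where k: "x\<in>V k" using pu(8)[OF x] by blast
  have "smooth_fun M (%z. \<Sum>j\<le>k. rho j z *R (transpose (?A j z**minv (A' z))**(?A j z**minv (A' z)))) x"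
   by (intro smooth_fun_sum[OF atlas x] cutoff_smooth[OF manifold cut _ x] smooth_fun_matrix_mult[OF atlas]
     smooth_fun_transpose[OF atlas] transition[OF A'(1) fr A'(2)])
  thus "smooth_fun M (%z. transpose (minv (A' z))**S z**minv (A' z)) x"
   by (rule smooth_at_cong[OF _ atlas pu(7) k])
    (simp add: S matrix_sum_left matrix_sum_right matrix_scaleR_left matrix_scaleR_right matrix_transpose_mul matrix_mul_assoc)
 qed
qed

context field_map begin

definition intertwines :: "bool => real^'n^'n => 'a => real^'n^'p => bool" where
 "intertwines t g z G \<longleftrightarrow> invertible G \<and> (\<forall>T. E.field T --> (\<exists>s. theta T z**G = G**twist t g (T z) + s *R G))"

text \<open>A frame-free counterpart of \<open>inner_type\<close>, so that types found in different
  frames can be compared; for \<open>True\<close> the form in \<open>twist\<close> is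
  ignored.\<close>

definition inner_at :: "'a => bool" where
 "inner_at z \<longleftrightarrow> (\<exists>G. intertwines True (mat 1) z G)"

lemma field_through:
 assumes x: "x\<in>points M" obtains T where "E.field T" "T x = m"
proof -
 obtain U A V B b W where l: "local_fields M FE FF theta U A V B b W" "x\<in>W" using local_fields_exist[OF x] by metis
 interpret l: local_fields M FE FF theta U A V B b W by (rule l(1))
 have i: "invertible (A x)" using E.frame_invertible[OF l.A] l.W(2) l(2) by blast
 have "l.loc (conjugate (A x) m) x = m"
  using conjugate_invertible(5)[OF i, of "l.loc (conjugate (A x) m) x"] by (simp add: l.loc_W[OF l(2)] conjugate_invertible(5)[OF i])
 thus thesis using that[OF l.loc_field] by blast
qed

lemma intertwines_unique:
 assumes x: "x\<in>points M" and g: "invertible g" and G: "intertwines t g x G" "intertwines t g x G'"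
 shows "\<exists>c. c ~= 0 \<and> G' = c *R G"
proof -
 have "\<exists>T. E.field T \<and> twist t g (T x) = m" for m
  using twist_surjective[OF g, of t m] field_through[OF x] by metis
 then obtain T where T: "!!m. E.field (T m) \<and> twist t g (T m x) = m" by metis
 show ?thesis
 proof (rule intertwiner_unique[where f = "%m. theta (T m) x" and m = "%m. m"])
  show "invertible G" "invertible G'" using G by (simp_all add: intertwines_def)
  show "range (%m::real^'n^'n. m) = UNIV" by simp
  show "\<exists>s. theta (T m) x**G = G**m + s *R G" "\<exists>s. theta (T m) x**G' = G'**m + s *R G'" for m
   using G T[of m] unfolding intertwines_def by metis+
 qed
qed

end

text \<open>A bilinear form changes by the inverse frame on both sides, and this makes the adjoint
  compatible with a change of frame.\<close>

lemma twist_conjugate: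
 assumes A: "invertible A" and S: "invertible (S :: real^'n^'n)"
 shows "twist t (transpose (minv A)**S**minv A) (conjugate A m) = conjugate A (twist t S m)"
  "invertible (transpose (minv A)**S**minv A)"
proof -
 let ?g = "transpose (minv A)**S**minv A" and ?h = "A**minv S**transpose A"
 note a = inv_cancel[OF A] and s = inv_cancel[OF S]
 have at: "transpose (minv A)**transpose A = mat 1" "transpose A**transpose (minv A) = mat 1"
  by (simp_all add: matrix_transpose_mul[symmetric] a)
 hence at': "C**transpose (minv A)**transpose A = C" "C**transpose A**transpose (minv A) = C" for C :: "real^'n^'n"
  by (simp_all add: matrix_mul_assoc[symmetric])
 have gh: "?g**?h = mat 1" "?h**?g = mat 1" by (simp_all add: matrix_mul_assoc a s at at')
 thus "invertible ?g" by (auto simp: invertible_def)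
 show "twist t ?g (conjugate A m) = conjugate A (twist t S m)"
  by (simp add: twist_def matrix_inv_unique[OF gh] conjugate_def matrix_ring matrix_transpose_mul at')
qed

lemma smooth_fun_typed:
 assumes M: "atlas M" "x\<in>points M" and Theta: "!!m. smooth_fun M (%y. Theta y m :: real^'p^'p) x"
 shows "smooth_fun M (%y. typed t (Theta y) (m :: real^'n^'n)) x"
proof -
 have tr: "smooth_fun M (%y. trace (f y :: real^'p^'p)) x" if "smooth_fun M f x" for f
  by (rule smooth_fun_linear[OF M(1) that]) (simp add: linear_conv_bounded_linear[symmetric] linear_trace)
 have u: "smooth_fun M (%y. unital (Theta y) m) x" for m
  unfolding unital_def traceless_def divide_inverse
  by (intro smooth_fun_add smooth_fun_minus smooth_fun_scaleR smooth_fun_mult smooth_fun_const tr Theta M)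
 have "smooth_fun M (%y. scal (2 * trace m / real CARD('p)) - unital (Theta y) (transpose m)) x"
  by (intro smooth_fun_minus smooth_fun_const u M)
 moreover have "dual_map (unital (Theta y)) m = scal (2 * trace m / real CARD('p)) - unital (Theta y) (transpose m)" for y
  by (simp add: dual_map_def)
 ultimately show ?thesis using u unfolding typed_def by (cases t) simp_all
qed

lemma smooth_fun_nonzero_nhd:
 assumes M: "atlas M" "opn M W" and f: "!!y. y\<in>W ==> smooth_fun M (f :: 'a => 'v::euclidean_space) y"
  and x: "x\<in>W" "f x ~= 0"
 obtains Q where "opn M Q" "x\<in>Q" "Q\<subseteq>W" "!!y. y\<in>Q ==> f y ~= 0"
proof -
 have "opn M {y\<in>W. f y\<in>- {0}}"
  by (rule smooth_at_imp_openin[OF M fin_dim_euclidean f]) auto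
 thus thesis by (rule that) (use x in auto)
qed

context local_fields begin

text \<open>Converts an intertwiner between frames into one between fibre coordinates; the scalar
  ambiguity of \<open>theta_Theta\<close> is absorbed by the scalar in
  \<open>intertwines\<close>.\<close>

lemma intertwines_transfer:
 assumes z: "z\<in>W" and S: "invertible S" and G: "invertible G"
  and i: "!!m. \<exists>s. Theta z m**G = G**twist t (transpose (minv (A z))**S**minv (A z)) m + s *R G"
 shows "intertwines t S z (minv (B z)**G**A z)"
 unfolding intertwines_def
proof (intro conjI allI impI)
 have iA: "invertible (A z)" and iB: "invertible (B z)" using E.frame_invertible[OF A] F.frame_invertible[OF B] z W(2) by blast+
 have iB': "invertible (minv (B z))" using invertible_matrix_inv[OF iB] unfolding invertible_def by blast
 show "invertible (minv (B z)**G**A z)" by (rule invertible_mult[OF invertible_mult[OF iB' G] iA])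
 fix T assume T: "E.field T"
 let ?g = "transpose (minv (A z))**S**minv (A z)" and ?m = "conjugate (A z) (T z)"
 obtain c where c: "conjugate (B z) (theta T z) = Theta z ?m + scal c" using theta_Theta[OF T z] by (auto simp: eq_scal_def)
 obtain s where s: "Theta z ?m**G = G**twist t ?g ?m + s *R G" using i by blast
 have "(Theta z ?m + scal c)**G = G**conjugate (A z) (twist t S (T z)) + (s + c) *R G"
  by (simp add: matrix_add_right_distrib s twist_conjugate(1)[OF iA S] matrix_scaleR_left scaleR_add_left)
 from arg_cong[OF this[folded c], of "%m. minv (B z)**m**A z"]
 show "\<exists>s. theta T z**(minv (B z)**G**A z) = (minv (B z)**G**A z)**twist t S (T z) + s *R (minv (B z)**G**A z)"
  by (intro exI[of _ "s + c"]) (simp add: conjugate_def matrix_ring inv_cancel[OF iA] inv_cancel[OF iB])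
qed

context assumes card: "CARD('n) = CARD('p)" "CARD('p)\<ge>2" begin

text \<open>Links the frame-free notion with a test on one matrix, which depends smoothly on the
  point.\<close>

lemma inner_at_iff:
 assumes z: "z\<in>W" shows "inner_at z \<longleftrightarrow> inner_type (Theta z)"
proof
 have iA: "invertible (A z)" and iB: "invertible (B z)" using E.frame_invertible[OF A] F.frame_invertible[OF B] z W(2) by blast+
 have iA': "invertible (minv (A z))" using invertible_matrix_inv[OF iA] unfolding invertible_def by blast
 assume "inner_at z"
 then obtain G where G: "invertible G" "!!T. E.field T ==> \<exists>s. theta T z**G = G**T z + s *R G"
  unfolding inner_at_def intertwines_def twist_def by auto
 let ?T = "loc eprobe" and ?G = "B z**G**minv (A z)"
 obtain s where s: "theta ?T z**G = G**?T z + s *R G" using G(2)[OF loc_field] by blast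
 obtain c where c: "Theta z eprobe = conjugate (B z) (theta ?T z) + scal c"
  using theta_Theta[OF loc_field z, of eprobe, THEN eq_scal_sym] by (auto simp: eq_scal_def loc_W[OF z])
 from arg_cong[OF s, of "%m. B z**m**minv (A z)"]
 have "Theta z eprobe**?G = ?G**eprobe + (s + c) *R ?G" unfolding c
  by (simp add: loc_def W(3)[OF z] conjugate_def matrix_ring inv_cancel[OF iA] inv_cancel[OF iB] scaleR_add_left)
 moreover have "invertible ?G" by (rule invertible_mult[OF invertible_mult[OF iB G(1)] iA'])
 ultimately show "inner_type (Theta z)" by (intro inner_type_intertwiner[OF card(1)])
next
 assume t: "inner_type (Theta z)"
 have iA: "invertible (A z)" using E.frame_invertible[OF A] z W(2) by blast
 have one: "invertible (mat 1 :: real^'n^'n)" by (simp add: invertible_def exI[of _ "mat 1"])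
 have t1: "inner_type (Theta z) = True" using t by simp
 note l = lie_mod_scalars_Theta[OF z]
 obtain w where w: "typed True (Theta z) eprobe *v w ~= 0" using typed_props(3)[OF l card(2,1) t1] by blast
 define G where "G = intertwiner (typed True (Theta z)) (typed True (Theta z) eprobe *v w)**(if True then mat 1 else mat 1)"
 note G = typed_intertwiner[OF l card(2,1) t1 w one, folded G_def]
 have "intertwines True (mat 1) z (minv (B z)**G**A z)"
  by (rule intertwines_transfer[OF z one G(1)]) (use G(2) in "simp add: twist_def")
 thus "inner_at z" unfolding inner_at_def by blast
qed

text \<open>In rank at least 3 the type and its negation each say that a smooth matrix function is
  nonzero, an open condition. In rank 2 every point has conjugation type.\<close>

lemma inner_at_locally_constant:
 assumes x: "x\<in>W"
 obtains Q where "opn M Q" "x\<in>Q" "Q\<subseteq>W" "!!y. y\<in>Q ==> inner_at y = inner_at x"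
proof -
 have sm: "smooth_fun M (%y. typed t (Theta y) eprobe**typed t (Theta y) eprobe - typed t (Theta y) eprobe) y" if "y\<in>W" for y t
  by (intro smooth_fun_minus smooth_fun_matrix_mult smooth_fun_typed E.atlas W_points[OF that] Theta_smooth[OF that])
 consider "CARD('p) = 2" | "CARD('p)\<ge>3" "inner_at x" | "CARD('p)\<ge>3" "\<not> inner_at x" using card(2) by linarith
 thus thesis
 proof cases
  case 1
  have "inner_at y" if "y\<in>W" for y using inner_type_2[OF lie_mod_scalars_Theta[OF that] 1 card(1)] inner_at_iff[OF that] by blast
  thus thesis using that[OF W(1) x] x by blast
 next
  case 2
  have iff: "inner_at y \<longleftrightarrow> typed False (Theta y) eprobe**typed False (Theta y) eprobe - typed False (Theta y) eprobe ~= 0" if "y\<in>W" for y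
   using inner_type_iff[OF lie_mod_scalars_Theta[OF that] 2(1) card(1)] inner_at_iff[OF that] by (simp add: typed_def)
  obtain Q where Q: "opn M Q" "x\<in>Q" "Q\<subseteq>W"
   "!!y. y\<in>Q ==> typed False (Theta y) eprobe**typed False (Theta y) eprobe - typed False (Theta y) eprobe ~= 0"
   using smooth_fun_nonzero_nhd[OF E.atlas W(1) sm x iff[OF x, THEN iffD1, OF 2(2)]] by metis
  thus thesis using that[OF Q(1-3)] iff 2(2) by blast
 next
  case 3
  have iff: "(\<not> inner_at y) \<longleftrightarrow> typed True (Theta y) eprobe**typed True (Theta y) eprobe - typed True (Theta y) eprobe ~= 0" if "y\<in>W" for y
   using inner_at_iff[OF that] by (simp add: typed_def inner_type_def)
  obtain Q where Q: "opn M Q" "x\<in>Q" "Q\<subseteq>W"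
   "!!y. y\<in>Q ==> typed True (Theta y) eprobe**typed True (Theta y) eprobe - typed True (Theta y) eprobe ~= 0"
   using smooth_fun_nonzero_nhd[OF E.atlas W(1) sm x iff[OF x, THEN iffD1, OF 3(2)]] by metis
  thus thesis using that[OF Q(1-3)] iff 3(2) by blast
 qed
qed

text \<open>A vector \<open>w\<close> that the image of the probe does not kill at \<open>x\<close>
  is not killed nearby either, so one formula with fixed \<open>w\<close> gives intertwiners with
  smooth entries in a neighbourhood.\<close>

lemma local_intertwiner:
 assumes S: "!!x. x\<in>points M ==> invertible (S x)"
  "!!U A x. (U, A)\<in>FE ==> x\<in>U ==> smooth_fun M (%z. transpose (minv (A z))**S z**minv (A z)) x"
  and x: "x\<in>W"
 shows "\<exists>Q J. opn M Q \<and> x\<in>Q \<and> (\<forall>y\<in>Q. intertwines (inner_at y) (S y) y (J y) \<and> smooth_hom M FE FF J y)"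
proof -
 define t where "t = inner_at x"
 obtain Q1 where Q1: "opn M Q1" "x\<in>Q1" "Q1\<subseteq>W" "!!y. y\<in>Q1 ==> inner_at y = t"
  using inner_at_locally_constant[OF x] unfolding t_def by metis
 have ty: "inner_type (Theta y) = t" if "y\<in>Q1" for y using inner_at_iff Q1(3,4) that by blast
 obtain w where w: "typed t (Theta x) eprobe *v w ~= 0"
  using typed_props(3)[OF lie_mod_scalars_Theta[OF x] card(2,1) ty[OF Q1(2)]] by blast
 have sa: "smooth_fun M (%y. typed t (Theta y) m *v w) y" if "y\<in>W" for y m
  by (intro smooth_fun_matrix_vector smooth_fun_const smooth_fun_typed E.atlas W_points[OF that] Theta_smooth[OF that])
 obtain Q2 where Q2: "opn M Q2" "x\<in>Q2" "Q2\<subseteq>W" "!!y. y\<in>Q2 ==> typed t (Theta y) eprobe *v w ~= 0"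
  using smooth_fun_nonzero_nhd[OF E.atlas W(1) sa x w] by metis
 define g where "g = (%y. transpose (minv (A y))**S y**minv (A y))"
 define G where "G = (%y. intertwiner (typed t (Theta y)) (typed t (Theta y) eprobe *v w)**(if t then mat 1 else g y))"
 define J where "J = (%y. minv (B y)**G y**A y)"
 have "intertwines (inner_at y) (S y) y (J y) \<and> smooth_hom M FE FF J y" if y: "y\<in>Q1\<inter>Q2" for y
 proof
  have yW: "y\<in>W" and yM: "y\<in>points M" using y Q1(3) W_points by auto
  have yU: "y\<in>U" "y\<in>V" using yW W(2) by auto
  have iA: "invertible (A y)" using E.frame_invertible[OF A yU(1)] .
  have ig: "invertible (g y)" unfolding g_def by (rule twist_conjugate(2)[OF iA S(1)[OF yM]])
  have y1: "inner_type (Theta y) = t" using ty y by blast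
  have y2: "typed t (Theta y) eprobe *v w ~= 0" using Q2(4) y by blast
  note G = typed_intertwiner[OF lie_mod_scalars_Theta[OF yW] card(2,1) y1 y2 ig]
  have "intertwines t (S y) y (J y)"
   unfolding J_def by (rule intertwines_transfer[OF yW S(1)[OF yM]]) (use G in "simp_all add: G_def g_def")
  thus "intertwines (inner_at y) (S y) y (J y)" using Q1(4) y by simp
  have sI: "smooth_fun M (%y. intertwiner (typed t (Theta y)) (typed t (Theta y) eprobe *v w)) y"
  proof (intro smooth_fun_vec E.atlas yM)
   fix r c
   have "smooth_fun M (%y. (typed t (Theta y) (munit c frame_index) *v (typed t (Theta y) eprobe *v w)) $ r) y"
    by (intro smooth_fun_component smooth_fun_matrix_vector sa yW smooth_fun_typed E.atlas yM Theta_smooth)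
   thus "smooth_fun M (%y. intertwiner (typed t (Theta y)) (typed t (Theta y) eprobe *v w) $ r $ c) y"
    by (simp add: intertwiner_def)
  qed
  have "smooth_fun M (%y. if t then mat 1 else g y) y"
   using smooth_fun_const[OF E.atlas yM] S(2)[OF A yU(1)] by (cases t) (simp_all add: g_def)
  hence sG: "smooth_fun M G y" unfolding G_def by (intro smooth_fun_matrix_mult[OF E.atlas sI])
  have "smooth_fun M (%z. B z**J z**minv (A z)) y"
  proof (rule smooth_at_cong[OF sG E.atlas W(1) yW])
   fix z assume z: "z\<in>W"
   thus "G z = B z**J z**minv (A z)" using W(2)
    by (simp add: J_def matrix_mul_assoc F.frame_inv[OF B] E.frame_cancel[OF A] subset_iff)
  qed
  thus "smooth_hom M FE FF J y" unfolding smooth_hom_def using A B yU by blast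
 qed
 moreover have "opn M (Q1\<inter>Q2)" using Q1(1) Q2(1) by (rule openin_Int)
 ultimately show ?thesis using Q1(2) Q2(2) by blast
qed

end

end

lemma invertible_scaleR:
 fixes G :: "real^'n^'m"
 assumes "invertible G" "c ~= 0" shows "invertible (c *R G)"
proof -
 have "(c *R G)**(inverse c *R minv G) = mat 1" "(inverse c *R minv G)**(c *R G) = mat 1"
  using assms by (simp_all add: matrix_scaleR_left matrix_scaleR_right invertible_matrix_inv)
 thus ?thesis unfolding invertible_def by blast
qed

lemma invertible_nonzero:
 fixes G :: "real^'n^'m"
 assumes "invertible G" shows "G ~= 0"
proof
 assume "G = 0"
 hence "(mat 1 :: real^'n^'n) = 0" using invertible_matrix_inv(2)[OF assms] by simp
 hence "(mat 1 :: real^'n^'n) $ i $ i = 0" for i by simp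
 thus False by (simp add: mat_def)
qed

text \<open>A convex combination of positive multiples of one invertible matrix is invertible; hence
  only the signs of the factors between local intertwiners obstruct the gluing, not their absolute
  values.\<close>

theorem (in field_map) smooth_intertwiner_exists:
 assumes card: "CARD('n) = CARD('p)" "CARD('p)\<ge>2" and H1: "trivial_group (cohomology_group 1 (mtop M))"
 shows "\<exists>G. \<forall>x\<in>points M. invertible (G x) \<and> smooth_hom M FE FF G x"
proof (cases "points M = {}")
 case True thus ?thesis by blast
next
 case False
 obtain S where S: "!!x. x\<in>points M ==> invertible (S x)"
  "!!U A x. (U, A)\<in>FE ==> x\<in>U ==> smooth_fun M (%z. transpose (minv (A z))**S z**minv (A z)) x"
  by (rule E.metric_exists) (rule that, assumption+)
 have "\<exists>Q J. opn M Q \<and> x\<in>Q \<and> (\<forall>y\<in>Q. intertwines (inner_at y) (S y) y (J y) \<and> smooth_hom M FE FF J y)"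
  if x: "x\<in>points M" for x
 proof -
  obtain U A V B b W where l: "local_fields M FE FF theta U A V B b W" "x\<in>W" using local_fields_exist[OF x] by metis
  show ?thesis by (rule local_fields.local_intertwiner[OF l(1) card _ _ l(2)]) (use S in auto)
 qed
 then obtain W' J where W': "!!x. x\<in>points M ==> opn M (W' x) \<and> x\<in>W' x \<and>
   (\<forall>y\<in>W' x. intertwines (inner_at y) (S y) y (J x y) \<and> smooth_hom M FE FF (J x) y)" by metis
 define W where "W = (%p. if p\<in>points M then W' p else {})"
 have W: "opn M (W p)" "x\<in>points M ==> x\<in>W x" for p x using W' by (auto simp: W_def)
 have WM: "y\<in>points M" if "y\<in>W p" for y p using openin_subset[OF W(1)] that by blast
 have J: "intertwines (inner_at y) (S y) y (J p y)" "smooth_hom M FE FF (J p) y" if "y\<in>W p" for y p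
  using W'[of p] that by (auto simp: W_def split: if_splits)
 have Jinv: "invertible (J p y)" if "y\<in>W p" for y p using J(1)[OF that] by (simp add: intertwines_def)
 have ratio: "\<exists>c. c ~= 0 \<and> J q y = c *R J p y" if "y\<in>W p" "y\<in>W q" for p q y
  using intertwines_unique[OF WM[OF that(1)] S(1)[OF WM[OF that(1)]] J(1)[OF that(1)] J(1)[OF that(2)]] .
 define r where "r = (%p q y. if \<exists>c<0. J q y = c *R J p y then - 1 else 1 :: real)"
 have r: "r p q y = sgn c" if "y\<in>W p" "J q y = c *R J p y" "c ~= 0" for p q y c
  using invertible_nonzero[OF Jinv[OF that(1)]] that(2,3) by (auto simp: r_def)
 interpret sc: sign_cocycle "mtop M" W r
 proof
  show "r p q' x = r p q x * r q q' x" if x: "x\<in>W p" "x\<in>W q" "x\<in>W q'" for x p q q'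
  proof -
   obtain c d where c: "c ~= 0" "J q x = c *R J p x" and d: "d ~= 0" "J q' x = d *R J q x" using ratio x by metis
   show ?thesis using r[OF x(1) c(2,1)] r[OF x(2) d(2,1)] r[OF x(1), of q' "d * c"] c d by (simp add: sgn_mult)
  qed
  show "\<exists>Q. opn M Q \<and> x\<in>Q \<and> Q\<subseteq>W p\<inter>W q \<and> (\<forall>z\<in>Q. r p q z = r p q x)" if x: "x\<in>W p" "x\<in>W q" for x p q
  proof -
   obtain U A where A: "(U, A)\<in>FE" "x\<in>U" using E.frame_cover[OF WM[OF x(1)]] by blast
   obtain V B where B: "(V, B)\<in>FF" "x\<in>V" using F.frame_cover[OF WM[OF x(1)]] by blast
   define Q where "Q = W p\<inter>W q\<inter>(U\<inter>V)"
   have Q: "opn M Q" unfolding Q_def using W(1) E.frame_open[OF A(1)] F.frame_open[OF B(1)] by (intro openin_Int)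
   define H where "H = (%p y. B y**J p y**minv (A y))"
   \<comment> \<open>In frames the intertwiners are smooth, and this inner product is the factor
     between them times a positive number. It is nonzero and has the sign of the factor, so the sign
     is locally constant.\<close>
   define f where "f = (%y. H q y\<bullet>H p y)"
   have sH: "smooth_fun M (H p) y" if "y\<in>W p" "y\<in>U" "y\<in>V" for p y unfolding H_def
    by (rule smooth_hom_frame[OF E.frames_self F.frames_self J(2) A(1) _ B(1)]) (use that in auto)
   have sf: "smooth_fun M f y" if "y\<in>Q" for y
    unfolding f_def by (rule smooth_fun_bilinear[OF E.atlas fin_dim_euclidean fin_dim_euclidean
       fin_dim_euclidean bounded_bilinear_inner]) (use that sH in "auto simp: Q_def")
   have rf: "f y ~= 0" "r p q y = sgn (f y)" if y: "y\<in>Q" for y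
   proof -
    have y': "y\<in>W p" "y\<in>W q" "y\<in>U" "y\<in>V" using y by (auto simp: Q_def)
    obtain c where c: "c ~= 0" "J q y = c *R J p y" using ratio y' by blast
    have "invertible (minv (A y))" using invertible_matrix_inv[OF E.frame_invertible[OF A(1) y'(3)]] unfolding invertible_def by blast
    hence "invertible (H p y)" unfolding H_def
     by (intro invertible_mult F.frame_invertible[OF B(1) y'(4)] Jinv y')
    hence "H p y ~= 0" by (rule invertible_nonzero)
    moreover have "f y = c * (H p y\<bullet>H p y)" by (simp add: f_def H_def c(2) matrix_scaleR_left matrix_scaleR_right)
    ultimately show "f y ~= 0" "r p q y = sgn (f y)" using c(1) r[OF y'(1) c(2,1)] by (simp_all add: sgn_mult)
   qed
   have xQ: "x\<in>Q" using x A B by (simp add: Q_def)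
   have "opn M {y\<in>Q. f y\<in>{t. 0 < t * f x}}"
    by (rule smooth_at_imp_openin[OF E.atlas Q fin_dim_euclidean sf]) (auto intro!: open_Collect_less continuous_intros)
   moreover have "sgn (f y) = sgn (f x)" if "0 < f y * f x" for y using that by (auto simp: zero_less_mult_iff)
   ultimately show ?thesis using xQ rf(1)[OF xQ] by (intro exI[of _ "{y\<in>Q. f y\<in>{t. 0 < t * f x}}"])
    (auto simp: rf(2) zero_less_mult_iff Q_def)
  qed
 qed (use W in "auto simp: r_def")
 obtain \<sigma> where \<sigma>: "!!p x. \<sigma> p x = 0 \<longleftrightarrow> x\<notin>W p" "!!p q x. x\<in>W p ==> x\<in>W q ==> \<sigma> p x = r p q x * \<sigma> q x"
  "!!p x. x\<in>W p ==> \<exists>Q. opn M Q \<and> x\<in>Q \<and> (\<forall>z\<in>Q. \<sigma> p z = \<sigma> p x)"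
  by (rule sc.trivialized[OF H1 local_paths[OF E.atlas]]) (assumption | rule that)+
 have rel: "\<exists>c>0. \<sigma> q y *R J q y = c *R (\<sigma> p y *R J p y)" if w: "y\<in>W p" "y\<in>W q" for p q y
 proof -
  obtain c where c: "c ~= 0" "J q y = c *R J p y" using ratio[OF w] by blast
  \<comment> \<open>The cocycle relation absorbs the sign of \<open>c\<close> and leaves the
    positive factor \<open>\<bar>c\<bar>\<close>.\<close>
  have "\<sigma> q y * c = \<bar>c\<bar> * \<sigma> p y" using \<sigma>(2)[OF w] r[OF w(1) c(2,1)] by (simp add: sgn_if)
  thus ?thesis using c by (intro exI[of _ "\<bar>c\<bar>"]) simp
 qed
 have sJ: "smooth_fun M (%y. \<sigma> p y *R (B y**J p y**minv (A y))) x"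
  if sj: "x\<in>W p" "(U, A)\<in>FE" "x\<in>U" "(V, B)\<in>FF" "x\<in>V" for x p U A V B
 proof (rule smooth_fun_scaleR[OF E.atlas])
  obtain Q where Q: "opn M Q" "x\<in>Q" "!!z. z\<in>Q ==> \<sigma> p z = \<sigma> p x" using \<sigma>(3)[OF sj(1)] by metis
  show "smooth_fun M (\<sigma> p) x"
   by (rule smooth_at_cong[OF smooth_fun_const[OF E.atlas WM[OF sj(1)], of "\<sigma> p x"] E.atlas Q(1,2)]) (simp add: Q(3))
  show "smooth_fun M (%y. B y**J p y**minv (A y)) x"
   by (rule smooth_hom_frame[OF E.frames_self F.frames_self J(2)[OF sj(1)] sj(2-5)])
 qed
 obtain rho p K V where pou: "pou_on M W rho p K V"
  using partition_of_unity_exists[OF E.manifold False, of W] W by metis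
 note pu = pou_onD[OF pou]
 have cut: "cutoff M (W (p k)) (rho k)" for k unfolding cutoff_def using pu(1,4,5,6) by blast
 define G where "G = locally_finite_sum V (%k y. rho k y *R (\<sigma> (p k) y *R J (p k) y))"
 have G: "G y = (\<Sum>j\<le>k. rho j y *R (\<sigma> (p j) y *R J (p j) y))" if "y\<in>V k" for y k
  unfolding G_def using that by (rule locally_finite_sum_eq) (simp add: pu(9))
 have "invertible (G x) \<and> smooth_hom M FE FF G x" if x: "x\<in>points M" for x
 proof
  obtain k where k: "x\<in>V k" using pu(8)[OF x] by blast
  have "\<exists>c>0. rho j x *R (\<sigma> (p j) x *R J (p j) x) = (rho j x * c) *R (\<sigma> x x *R J x x)" for j
  proof (cases "x\<in>W (p j)")
   case True
   thus ?thesis using rel[OF W(2)[OF x] True] by (metis scaleR_scaleR)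
  next
   case False
   hence "rho j x = 0" using pu(5,6) by blast
   thus ?thesis by (intro exI[of _ 1]) simp
  qed
  then obtain c where c: "!!j. c j > 0" "!!j. rho j x *R (\<sigma> (p j) x *R J (p j) x) = (rho j x * c j) *R (\<sigma> x x *R J x x)"
   by metis
  have Gx: "G x = (\<Sum>j\<le>k. rho j x * c j) *R (\<sigma> x x *R J x x)" unfolding G[OF k] c(2) scaleR_sum_left ..
  have "(\<Sum>j\<le>k. rho j x * c j) ~= 0"
  proof
   assume "(\<Sum>j\<le>k. rho j x * c j) = 0"
   hence "\<forall>j\<in>{..k}. rho j x * c j = 0"
    by (subst (asm) sum_nonneg_eq_0_iff) (simp_all add: pu(2) less_imp_le[OF c(1)])
   hence "rho j x = 0" if "j\<le>k" for j using that c(1)[of j] by force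
   hence "(\<Sum>j\<le>k. rho j x) = 0" by simp
   thus False using pu(10)[OF k order_refl] by simp
  qed
  thus "invertible (G x)" unfolding Gx using W(2)[OF x] \<sigma>(1) by (intro invertible_scaleR Jinv) auto
  obtain U A where A: "(U, A)\<in>FE" "x\<in>U" using E.frame_cover[OF x] by blast
  obtain V' B where B: "(V', B)\<in>FF" "x\<in>V'" using F.frame_cover[OF x] by blast
  have "smooth_fun M (%y. \<Sum>j\<le>k. rho j y *R (\<sigma> (p j) y *R (B y**J (p j) y**minv (A y)))) x"
   by (intro smooth_fun_sum[OF E.atlas x] cutoff_smooth[OF E.manifold cut _ x] sJ[OF _ A B])
  hence "smooth_fun M (%y. B y**G y**minv (A y)) x"
   by (rule smooth_at_cong[OF _ E.atlas pu(7) k])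
    (simp add: G matrix_sum_left matrix_sum_right matrix_scaleR_left matrix_scaleR_right)
  thus "smooth_hom M FE FF G x" unfolding smooth_hom_def using A B by blast
 qed
 thus ?thesis by blast
qed

section \<open>Vector bundles and operators on their sections\<close>

locale vbundle =
 fixes E :: "('a, 'm::real_normed_vector, 'e, 'n::finite) vector_bundle" and M :: "('a, 'm) manifold"
 assumes vector_bundle: "smooth_vector_bundle E M"
begin

lemma base_manifold: "smooth_manifold M" and total_manifold: "smooth_manifold (total E)"
 and proj_smooth: "smooth_map (total E) M (proj E)"
 using vector_bundle by (auto simp: smooth_vector_bundle_def)

lemma base_atlas: "atlas M" and total_atlas: "atlas (total E)"
 using base_manifold total_manifold by (auto intro: manifold_atlas)

lemma fibre_closed:
 assumes "x\<in>points M" "e\<in>fibre E x" "e'\<in>fibre E x"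
 shows "fadd E e e'\<in>fibre E x" "fscale E c e\<in>fibre E x"
 using vector_bundle assms by (auto simp: smooth_vector_bundle_def)

lemma proj_points: "e\<in>points (total E) ==> proj E e\<in>points M"
 using proj_smooth by (auto simp: smooth_map_def continuous_map_def)

lemma fibreD: "e\<in>fibre E x ==> e\<in>points (total E)" "e\<in>fibre E x ==> proj E e = x"
 by (auto simp: fibre_def)

lemma proj_smooth_at: "e\<in>points (total E) ==> smooth_at (total E) M (proj E) e"
 using proj_smooth smooth_map_iff[OF total_atlas base_atlas] by blast

abbreviation triv :: "'a set => ('e => real^'n) => bool" where "triv U tau \<equiv> local_trivialization E M U tau"

abbreviation part_over :: "'a set => 'e set" where "part_over U \<equiv> {e\<in>points (total E). proj E e\<in>U}"

lemma triv_exists: "x\<in>points M ==> \<exists>U tau. x\<in>U \<and> triv U tau"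
 using vector_bundle by (auto simp: smooth_vector_bundle_def)

lemma triv_open: "triv U tau ==> opn M U" by (simp add: local_trivialization_def)

lemma triv_points: "triv U tau ==> x\<in>U ==> x\<in>points M" using triv_open openin_subset by blast

lemma part_over_open: "opn M U ==> opn (total E) (part_over U)"
 using proj_smooth by (simp add: smooth_map_def continuous_map_def)

lemma triv_linear:
 assumes "triv U tau" "x\<in>U" "e\<in>fibre E x" "e'\<in>fibre E x"
 shows "tau (fadd E e e') = tau e + tau e'" "tau (fscale E c e) = c *R tau e"
 using assms by (auto simp: local_trivialization_def)

lemma triv_bij: assumes "triv U tau" shows "bij_betw (%e. (proj E e, tau e)) (part_over U) (U\<times>UNIV)"
 using assms triv_open[OF assms] part_over_open[OF triv_open[OF assms]]
 by (simp add: local_trivialization_def diffeomorphism_def open_submanifold_def prod_manifold_def inf_absorb2 openin_subset)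

lemma triv_fibre_bij:
 assumes t: "triv U tau" and x: "x\<in>U" shows "bij_betw tau (fibre E x) UNIV"
proof -
 note b = triv_bij[OF t]
 have "inj_on tau (fibre E x)"
 proof (rule inj_onI)
  fix e e' assume e: "e\<in>fibre E x" "e'\<in>fibre E x" "tau e = tau e'"
  have "e\<in>part_over U" "e'\<in>part_over U" using e x by (auto simp: fibre_def)
  thus "e = e'" using bij_betw_imp_inj_on[OF b] e by (auto simp: fibre_def dest: inj_onD)
 qed
 moreover have "v\<in>tau ` fibre E x" for v
 proof -
  have "(x, v)\<in>(%e. (proj E e, tau e)) ` part_over U" using bij_betw_imp_surj_on[OF b] x by blast
  thus ?thesis by (auto simp: fibre_def)
 qed
 ultimately show ?thesis by (auto simp: bij_betw_def)
qed

lemma total_chart: "(V, mu)\<in>charts (total E) ==> (V\<inter>part_over U, mu)\<in>charts (open_submanifold (total E) (part_over U))"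
 unfolding open_submanifold_def by (simp add: image_iff) (rule bexI[of _ "(V, mu)"], simp_all)

lemma product_chart:
 "(W, phi)\<in>charts M ==> ((W\<inter>U)\<times>UNIV, map_prod phi id)\<in>charts (prod_manifold (open_submanifold M U) model_manifold)"
 unfolding open_submanifold_def prod_manifold_def model_manifold_def manifold.simps mem_Collect_eq
 by (intro exI[of _ "W\<inter>U"] exI[of _ phi] exI[of _ UNIV] exI[of _ id] conjI refl image_eqI[of _ _ "(W, phi)"]) simp_all

lemma triv_smooth:
 assumes t: "triv U tau" and e: "e\<in>part_over U" shows "smooth_fun (total E) tau e"
proof -
 obtain V mu where V: "(V, mu)\<in>charts (total E)" "e\<in>V" using atlas_chart[OF total_atlas, of e] e by auto
 obtain W phi where W: "(W, phi)\<in>charts M" "proj E e\<in>W" using atlas_chart[OF base_atlas, of "proj E e"] e proj_points by auto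
 define Q where "Q = V\<inter>part_over (W\<inter>U)"
 have oQ: "opn (total E) Q" unfolding Q_def
  by (intro openin_Int part_over_open triv_open[OF t] atlasD(2)[OF base_atlas W(1)] atlasD(2)[OF total_atlas V(1)])
 have o: "open (mu ` Q)" by (rule atlasD(5)[OF total_atlas V(1) oQ]) (simp add: Q_def)
 let ?h = "map_prod phi id\<circ>(%e. (proj E e, tau e))\<circ>inv_into (V\<inter>part_over U) mu"
 have "smooth_map (open_submanifold (total E) (part_over U)) (prod_manifold (open_submanifold M U) model_manifold) (%e. (proj E e, tau e))"
  using t by (simp add: local_trivialization_def diffeomorphism_def)
 from smooth_mapD[OF this total_chart[OF V(1)] product_chart[OF W(1)]]
 have "smooth_on (mu ` Q) ?h" by (rule smooth_on_mono) (auto simp: Q_def)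
 hence "smooth_on (mu ` Q) (%y. snd (?h y))"
  by (rule smooth_on_linear_compose[OF o bounded_linear_snd])
 hence "smooth_on (mu ` Q) (tau\<circ>inv_into V mu)"
  by (rule smooth_on_cong[OF o, rotated]) (auto simp: Q_def atlasD(8)[OF total_atlas V(1)]
    inv_into_f_f[OF inj_on_subset[OF atlasD(4)[OF total_atlas V(1)]]])
 thus ?thesis using e V W oQ smooth_fun_iff[OF total_atlas fin_dim_euclidean V, of tau]
  by (auto simp: Q_def intro!: exI[of _ Q])
qed

definition lift_triv :: "'a set => ('e => real^'n) => 'a\<times>(real^'n) => 'e" where
 "lift_triv U tau = inv_into (part_over U) (%e. (proj E e, tau e))"

lemma lift_triv:
 assumes t: "triv U tau" and x: "x\<in>U"
 shows "lift_triv U tau (x, v)\<in>fibre E x" "tau (lift_triv U tau (x, v)) = v" "e\<in>fibre E x ==> lift_triv U tau (x, tau e) = e"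
proof -
 note b = triv_bij[OF t]
 have im: "(x, v)\<in>(%e. (proj E e, tau e)) ` part_over U" using bij_betw_imp_surj_on[OF b] x by blast
 have "lift_triv U tau (x, v)\<in>part_over U" unfolding lift_triv_def by (rule inv_into_into[OF im])
 moreover have "(proj E (lift_triv U tau (x, v)), tau (lift_triv U tau (x, v))) = (x, v)"
  unfolding lift_triv_def using f_inv_into_f[OF im] by simp
 ultimately show "lift_triv U tau (x, v)\<in>fibre E x" "tau (lift_triv U tau (x, v)) = v" by (auto simp: fibre_def)
 assume e: "e\<in>fibre E x"
 hence "e\<in>part_over U" using x by (auto simp: fibre_def)
 hence "inv_into (part_over U) (%e. (proj E e, tau e)) (proj E e, tau e) = e"
  using inv_into_f_f[OF bij_betw_imp_inj_on[OF b]] by simp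
 thus "lift_triv U tau (x, tau e) = e" using e by (simp add: lift_triv_def fibre_def)
qed

text \<open>Base point and fibre vector vary together, so a product neighbourhood on which the
  inverse trivialization stays in one chart of the total space has to be found first.\<close>

lemma lift_triv_smooth:
 assumes t: "triv U tau" and P: "atlas P" and g: "smooth_at P M g x" and f: "smooth_fun P f x" and x: "g x\<in>U"
 shows "smooth_at P (total E) (%z. lift_triv U tau (g z, f z)) x"
proof -
 let ?T = "open_submanifold (total E) (part_over U)" and ?P = "prod_manifold (open_submanifold M U) (model_manifold :: (real^'n, real^'n) manifold)"
 let ?l = "lift_triv U tau"
 have am: "atlas (model_manifold :: (real^'n, real^'n) manifold)" by simp
 have l: "?l (z, v)\<in>part_over U" if "z\<in>U" for z v using lift_triv(1)[OF t that, of v] that by (auto simp: fibre_def)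
 obtain V mu where V: "(V, mu)\<in>charts (total E)" "?l (g x, f x)\<in>V" using atlas_chart[OF total_atlas, of "?l (g x, f x)"] l[OF x] by auto
 obtain W phi where W: "(W, phi)\<in>charts M" "g x\<in>W" using atlas_chart[OF base_atlas, of "g x"] triv_points[OF t x] by auto
 obtain Y omega where Y: "(Y, omega)\<in>charts P" "x\<in>Y" using atlas_chart[OF P smooth_at_points(1)[OF g P base_atlas]] .
 have top: "points ?T = part_over U" using part_over_open[OF triv_open[OF t]]
  by (simp add: open_submanifold_def inf_absorb2 openin_subset)
 have sm: "smooth_map ?P ?T ?l" using t unfolding local_trivialization_def diffeomorphism_def lift_triv_def top by blast
 have "openin (mtop ?T) (V\<inter>part_over U)"
  using atlasD(2)[OF total_atlas V(1)] by (auto simp: open_submanifold_def openin_subtopology)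
 hence "openin (mtop ?P) {z\<in>points ?P. ?l z\<in>V\<inter>part_over U}"
  using sm openin_continuous_map_preimage unfolding smooth_map_def by blast
 hence "openin (prod_topology (subtopology (mtop M) U) euclidean) {z\<in>points ?P. ?l z\<in>V\<inter>part_over U}"
  by (simp add: prod_manifold_def open_submanifold_def model_manifold_def)
 note nhd = this[unfolded openin_prod_topology_alt open_openin[symmetric], rule_format]
 have "(g x, f x)\<in>{z\<in>points ?P. ?l z\<in>V\<inter>part_over U}"
  using V(2) l[OF x] x triv_points[OF t x] by (simp add: prod_manifold_def open_submanifold_def model_manifold_def)
 from nhd[OF this] obtain A B where A: "openin (subtopology (mtop M) U) A" "open B" "g x\<in>A" "f x\<in>B"
  and AB: "A\<times>B\<subseteq>{z. ?l z\<in>V}" by blast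
 have oA: "opn M (A\<inter>W)" and AU: "A\<subseteq>U"
  using A(1) atlasD(2)[OF base_atlas W(1)] triv_open[OF t] by (auto simp: openin_open_subtopology)
 have oS: "open (phi ` (A\<inter>W)\<times>B)" using atlasD(5)[OF base_atlas W(1) oA] A(2) by (intro open_Times) auto
 let ?h = "mu\<circ>?l\<circ>inv_into ((W\<inter>U)\<times>UNIV) (map_prod phi id)"
 have sh: "smooth_on (phi ` (A\<inter>W)\<times>B) ?h"
 proof (rule smooth_on_mono[OF smooth_mapD[OF sm product_chart[OF W(1)] total_chart[OF V(1)]]], safe)
  fix z v assume "z\<in>A" "z\<in>W" "v\<in>B"
  hence "(z, v)\<in>{y\<in>(W\<inter>U)\<times>UNIV. ?l y\<in>V\<inter>part_over U}" using AB AU l[of z v] by blast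
  thus "(phi z, v)\<in>map_prod phi id ` {y\<in>(W\<inter>U)\<times>UNIV. ?l y\<in>V\<inter>part_over U}" by (rule image_eqI[rotated]) simp
 qed
 have inv: "inv_into ((W\<inter>U)\<times>UNIV) (map_prod phi id) (phi z, v) = (z, v)" if "z\<in>A\<inter>W" for z and v :: "real^'n"
  using inv_into_f_f[of "map_prod phi (id :: real^'n => _)" "(W\<inter>U)\<times>UNIV" "(z, v)"] atlasD(4)[OF base_atlas W(1)] that AU
  by (auto simp: inj_on_def)
 obtain Q1 where Q1: "x\<in>Q1" "smooth_in_charts P g (Y, omega) (W, phi) Q1" using smooth_atE[OF g P base_atlas Y W] .
 obtain Q2 where Q2: "opn P Q2" "x\<in>Q2" "g ` Q2\<subseteq>A\<inter>W"
  by (rule smooth_at_nhd[OF g P base_atlas oA]) (use A(3) W(2) in auto)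
 obtain Q3 where Q3: "opn P Q3" "x\<in>Q3" "smooth_on (omega ` Q3) (f\<circ>inv_into Y omega)"
  using smooth_fun_iff[OF P fin_dim_euclidean Y, of f] f by blast
 obtain Q4 where Q4: "opn P Q4" "x\<in>Q4" "f ` Q4\<subseteq>B"
  by (rule smooth_at_nhd[OF f P am, of B]) (use A(2,4) in "auto simp: model_manifold_def")
 define Q where "Q = Q1\<inter>Q2\<inter>Q3\<inter>Q4"
 have Q: "opn P Q" "Q\<subseteq>Y" using Q1 Q2 Q3 Q4 by (auto simp: Q_def smooth_in_charts_def)
 have lV: "?l (g z, f z)\<in>V" if "z\<in>Q" for z using AB Q2(3) Q4(3) that unfolding Q_def by blast
 have o: "open (omega ` Q)" by (rule atlasD(5)[OF P Y(1) Q])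
 have s1: "smooth_on (omega ` Q1) (phi\<circ>g\<circ>inv_into Y omega)" using Q1(2) by (simp add: smooth_in_charts_def)
 have "smooth_on (omega ` Q) (%y. ((phi\<circ>g\<circ>inv_into Y omega) y, (f\<circ>inv_into Y omega) y))"
  by (rule smooth_on_prod[OF o smooth_on_mono[OF s1 image_mono] smooth_on_mono[OF Q3(3) image_mono]]) (auto simp: Q_def)
 hence "smooth_on (omega ` Q) (%y. ?h ((phi\<circ>g\<circ>inv_into Y omega) y, (f\<circ>inv_into Y omega) y))"
  by (rule smooth_on_compose[OF o oS atlasD(1)[OF total_atlas] _ sh])
   (use Q(2) Q2 Q4 in "auto simp: Q_def atlasD(8)[OF P Y(1)] subset_iff image_subset_iff")
 hence "smooth_on (omega ` Q) (mu\<circ>(%z. ?l (g z, f z))\<circ>inv_into Y omega)"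
  by (rule smooth_on_cong[OF o, rotated])
   (use Q(2) Q2(3) in "auto simp: Q_def atlasD(8)[OF P Y(1)] subset_iff inv image_subset_iff")
 hence "smooth_in_charts P (%z. ?l (g z, f z)) (Y, omega) (V, mu) Q"
  using Q lV by (auto simp: smooth_in_charts_def)
 thus ?thesis by (rule smooth_atI[OF Y(1) V(1), rotated]) (use Q1 Q2 Q3 Q4 in "auto simp: Q_def")
qed

text \<open>At every point one trivialization is chosen independently of the neighbouring points.
  Fibres thereby become copies of R^n, and smoothness is recovered through the matrices
  \<open>frm\<close>.\<close>

definition crd :: "'a => 'e => real^'n" where
 "crd x = (SOME tau. \<exists>U. x\<in>U \<and> triv U tau)"

definition pt :: "'a => real^'n => 'e" where
 "pt x = inv_into (fibre E x) (crd x)"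

lemma crd_triv: assumes "x\<in>points M" obtains U where "x\<in>U" "triv U (crd x)"
 using someI_ex[of "%tau. \<exists>U. x\<in>U \<and> triv U tau"] triv_exists[OF assms] unfolding crd_def by blast

lemma crd_linear:
 assumes "x\<in>points M" "e\<in>fibre E x" "e'\<in>fibre E x"
 shows "crd x (fadd E e e') = crd x e + crd x e'" "crd x (fscale E c e) = c *R crd x e"
 using crd_triv[OF assms(1)] triv_linear assms(2,3) by metis+

lemma crd_bij: "x\<in>points M ==> bij_betw (crd x) (fibre E x) UNIV"
 using crd_triv triv_fibre_bij by metis

lemma pt:
 assumes "x\<in>points M"
 shows "pt x v\<in>fibre E x" "crd x (pt x v) = v" "e\<in>fibre E x ==> pt x (crd x e) = e"
 using crd_bij[OF assms] unfolding pt_def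
 by (auto simp: bij_betw_def inv_into_into f_inv_into_f inv_into_f_f)

definition frm :: "('e => real^'n) => 'a => real^'n^'n" where
 "frm tau x = matrix (%v. tau (pt x v))"

lemma crd_eqI: "x\<in>points M ==> e\<in>fibre E x ==> e'\<in>fibre E x ==> crd x e = crd x e' ==> e = e'"
 using pt(3) by metis

lemma frm:
 assumes t: "triv U tau" and x: "x\<in>U"
 shows "e\<in>fibre E x ==> frm tau x *v crd x e = tau e" "frm tau x *v v = tau (pt x v)" "invertible (frm tau x)"
proof -
 have xM: "x\<in>points M" using triv_points[OF t x] .
 have add: "pt x (v + w) = fadd E (pt x v) (pt x w)" for v w
  by (rule crd_eqI[OF xM]) (simp_all add: pt[OF xM] fibre_closed[OF xM] crd_linear[OF xM])
 have sc: "pt x (c *R v) = fscale E c (pt x v)" for v c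
  by (rule crd_eqI[OF xM]) (simp_all add: pt[OF xM] fibre_closed[OF xM _ pt(1)[OF xM]] crd_linear[OF xM _ pt(1)[OF xM]])
 have "linear (%v. tau (pt x v))"
  unfolding linear_iff by (simp add: add sc triv_linear[OF t x] pt[OF xM]) (metis pt(1)[OF xM] triv_linear(2)[OF t x])
 thus f: "frm tau x *v v = tau (pt x v)" for v unfolding frm_def by (simp add: matrix_works)
 show "e\<in>fibre E x ==> frm tau x *v crd x e = tau e" by (simp add: f pt(3)[OF xM])
 have "v = 0" if "frm tau x *v v = 0" for v
 proof -
  have "tau (pt x v) = tau (pt x 0)" using that f[of v] f[of 0] by simp
  hence "pt x v = pt x 0" using triv_fibre_bij[OF t x] pt(1)[OF xM] by (meson bij_betw_imp_inj_on inj_onD)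
  thus ?thesis using pt(2)[OF xM] by metis
 qed
 hence "inj ((*v) (frm tau x))" using linear_injective_0[OF matrix_vector_mul_linear[of "frm tau x"]] by blast
 thus "invertible (frm tau x)" by (simp only: matrix_left_invertible_injective[symmetric] invertible_left_inverse)
qed

definition Fr :: "('a set\<times>('a => real^'n^'n)) set" where
 "Fr = {(U, frm tau) | U tau. triv U tau}"

sublocale fr: frames M Fr
proof
 show "smooth_manifold M" by (rule base_manifold)
 show "opn M U" if "(U, A)\<in>Fr" for U A using that triv_open by (auto simp: Fr_def)
 show "invertible (A x)" if "(U, A)\<in>Fr" "x\<in>U" for U A x using that frm(3) by (auto simp: Fr_def)
 show "\<exists>U A. (U, A)\<in>Fr \<and> x\<in>U" if "x\<in>points M" for x using triv_exists[OF that] by (auto simp: Fr_def)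
 show "smooth_fun M (%z. B z**minv (A z)) x" if "(U, A)\<in>Fr" "(V, B)\<in>Fr" "x\<in>U" "x\<in>V" for U A V B x
 proof -
  obtain tau tau' where t: "triv U tau" "A = frm tau" "triv V tau'" "B = frm tau'" using \<open>(U, A)\<in>Fr\<close> \<open>(V, B)\<in>Fr\<close> by (auto simp: Fr_def)
  have xM: "x\<in>points M" using triv_points[OF t(1)] \<open>x\<in>U\<close> .
  \<comment> \<open>Applied to \<open>v\<close>, the transition matrix lifts it by one
    trivialization and reads it in the other, so its columns are smooth.\<close>
  have ent: "(frm tau' z**minv (frm tau z)) *v v = tau' (lift_triv U tau (z, v))" if z: "z\<in>U" "z\<in>V" for z v
  proof -
   have "frm tau z *v crd z (lift_triv U tau (z, v)) = v" using frm(1)[OF t(1) z(1)] lift_triv[OF t(1) z(1)] by simp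
   hence "minv (frm tau z) *v v = minv (frm tau z) *v (frm tau z *v crd z (lift_triv U tau (z, v)))" by simp
   also have "\<dots> = crd z (lift_triv U tau (z, v))"
    by (simp add: mv_assoc invertible_matrix_inv(2)[OF frm(3)[OF t(1) z(1)]])
   finally show ?thesis using frm(1)[OF t(3) z(2) lift_triv(1)[OF t(1) z(1)]] by (simp add: mv_assoc[symmetric])
  qed
  have am: "atlas (model_manifold :: (real^'n, real^'n) manifold)" by simp
  have oUV: "opn M (U\<inter>V)" using triv_open t by blast
  note id = smooth_at_id[OF base_atlas xM]
  have col: "smooth_fun M (%z. tau' (lift_triv U tau (z, v))) x" for v
  proof (rule smooth_at_compose[OF base_atlas total_atlas am])
   show "smooth_at M (total E) (%z. lift_triv U tau (z, v)) x"
    by (rule lift_triv_smooth[OF t(1) base_atlas id smooth_fun_const[OF base_atlas xM] \<open>x\<in>U\<close>])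
   show "smooth_at (total E) model_manifold tau' (lift_triv U tau (x, v))"
    by (rule triv_smooth[OF t(3)]) (use lift_triv(1)[OF t(1) \<open>x\<in>U\<close>, of v] \<open>x\<in>V\<close> in "auto simp: fibre_def")
  qed
  have "smooth_fun M (%z. frm tau' z**minv (frm tau z)) x"
  proof (intro smooth_fun_vec[OF base_atlas xM])
   fix i j
   show "smooth_fun M (%z. (frm tau' z**minv (frm tau z)) $ i $ j) x"
   proof (rule smooth_at_cong[OF smooth_fun_component[OF base_atlas col[of "axis j 1"], of i] base_atlas oUV])
    fix z assume "z\<in>U\<inter>V"
    thus "tau' (lift_triv U tau (z, axis j 1)) $ i = (frm tau' z**minv (frm tau z)) $ i $ j"
     by (simp add: ent[symmetric] matrix_vector_mult_basis column_def)
   qed (use \<open>x\<in>U\<close> \<open>x\<in>V\<close> in simp)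
  qed
  thus ?thesis by (simp add: t)
 qed
qed

definition smooth_vec :: "('a => real^'n) => 'a => bool" where
 "smooth_vec v x \<longleftrightarrow> (\<exists>U A. (U, A)\<in>Fr \<and> x\<in>U \<and> smooth_fun M (%z. A z *v v z) x)"

lemma smooth_vec_frame:
 assumes v: "smooth_vec v x" and A: "(U, A)\<in>Fr" "x\<in>U" shows "smooth_fun M (%z. A z *v v z) x"
proof -
 obtain V B where B: "(V, B)\<in>Fr" "x\<in>V" and s: "smooth_fun M (%z. B z *v v z) x" using v by (auto simp: smooth_vec_def)
 have "smooth_fun M (%z. (A z**minv (B z)) *v (B z *v v z)) x"
  by (intro smooth_fun_matrix_vector[OF base_atlas] s fr.transition[OF B(1) A(1) B(2) A(2)])
 thus ?thesis
  by (rule smooth_at_cong[OF _ base_atlas fr.frame_open[OF B(1)] B(2)])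
   (simp add: mv_assoc matrix_mul_assoc fr.frame_cancel(4)[OF B(1)])
qed

lemma smooth_vec_arith:
 assumes "smooth_vec v x" "smooth_vec w x"
 shows "smooth_vec (%z. v z + w z) x" "smooth_fun M u x ==> smooth_vec (%z. u z *R v z) x"
  "smooth_hom M Fr Fr m x ==> smooth_vec (%z. m z *v v z) x"
proof -
 obtain U A where A: "(U, A)\<in>Fr" "x\<in>U" using assms(1) by (auto simp: smooth_vec_def)
 note s = smooth_vec_frame[OF assms(1) A] smooth_vec_frame[OF assms(2) A]
 have "smooth_fun M (%z. A z *v (v z + w z)) x" using smooth_fun_add[OF base_atlas s] by (simp add: matrix_vector_right_distrib)
 thus "smooth_vec (%z. v z + w z) x" using A by (auto simp: smooth_vec_def)
 show "smooth_vec (%z. u z *R v z) x" if "smooth_fun M u x"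
  using smooth_fun_scaleR[OF base_atlas that s(1)] A by (auto simp: smooth_vec_def matrix_vector_mult_scaleR)
 assume m: "smooth_hom M Fr Fr m x"
 have "smooth_fun M (%z. (A z**m z**minv (A z)) *v (A z *v v z)) x"
  by (intro smooth_fun_matrix_vector[OF base_atlas] s smooth_hom_frame[OF fr.frames_self fr.frames_self m A A])
 hence "smooth_fun M (%z. A z *v (m z *v v z)) x"
  by (rule smooth_at_cong[OF _ base_atlas fr.frame_open[OF A(1)] A(2)])
   (simp add: mv_assoc fr.frame_cancel(4)[OF A(1)])
 thus "smooth_vec (%z. m z *v v z) x" using A by (auto simp: smooth_vec_def)
qed

lemma smooth_vec_cutoff:
 assumes A: "(U, A)\<in>Fr" and b: "cutoff M U b" and x: "x\<in>points M" and g: "x\<in>U ==> smooth_fun M g x"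
 shows "smooth_vec (%z. b z *R (minv (A z) *v g z)) x"
proof (cases "x\<in>U")
 case True
 have "smooth_fun M (%z. b z *R g z) x" by (rule cutoff_smooth[OF base_manifold b g x])
 hence "smooth_fun M (%z. A z *v (b z *R (minv (A z) *v g z))) x"
  by (rule smooth_at_cong[OF _ base_atlas fr.frame_open[OF A] True])
   (simp add: matrix_vector_mult_scaleR mv_assoc fr.frame_inv[OF A])
 thus ?thesis using A True by (auto simp: smooth_vec_def)
next
 case False
 obtain V B where B: "(V, B)\<in>Fr" "x\<in>V" using fr.frame_cover[OF x] by blast
 obtain Q where Q: "opn M Q" "x\<in>Q" "!!z. z\<in>Q ==> b z = 0" using cutoff_zero_nhd[OF base_manifold b x False] by metis
 have "smooth_fun M (%z. B z *v (b z *R (minv (A z) *v g z))) x"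
  by (rule smooth_at_cong[OF smooth_fun_const[OF base_atlas x, of 0] base_atlas Q(1,2)]) (simp add: Q(3))
 thus ?thesis using B by (auto simp: smooth_vec_def)
qed

lemma vec_through:
 assumes x: "x\<in>points M" obtains v where "!!z. z\<in>points M ==> smooth_vec v z" "v x = w"
proof -
 obtain U A where A: "(U, A)\<in>Fr" "x\<in>U" using fr.frame_cover[OF x] by blast
 obtain b V where b: "cutoff M U b" "x\<in>V" "!!z. z\<in>V ==> b z = 1" using cutoff_exists[OF base_manifold fr.frame_open[OF A(1)] A(2)] by metis
 show thesis
 proof (rule that)
  show "smooth_vec (%z. b z *R (minv (A z) *v (A x *v w))) z" if "z\<in>points M" for z
   by (rule smooth_vec_cutoff[OF A(1) b(1) that smooth_fun_const[OF base_atlas that]])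
  show "b x *R (minv (A x) *v (A x *v w)) = w" using b(2,3) by (simp add: mv_assoc fr.frame_inv[OF A])
 qed
qed

abbreviation sec :: "('a => 'e) set" where "sec \<equiv> smooth_sections E M"

definition cr :: "('a => 'e) => 'a => real^'n" where "cr s x = crd x (s x)"

definition sec_of :: "('a => real^'n) => 'a => 'e" where "sec_of v = (\<lambda>x\<in>points M. pt x (v x))"

lemma section_smooth_iff:
 assumes x: "x\<in>points M" and s: "!!z. z\<in>points M ==> s z\<in>fibre E z"
 shows "smooth_at M (total E) s x \<longleftrightarrow> smooth_vec (cr s) x"
proof -
 obtain U tau where t: "x\<in>U" "triv U tau" using triv_exists[OF x] by blast
 have F: "(U, frm tau)\<in>Fr" using t by (auto simp: Fr_def)
 have am: "atlas (model_manifold :: (real^'n, real^'n) manifold)" by simp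
 have e: "frm tau z *v cr s z = tau (s z)" if "z\<in>U" for z unfolding cr_def using frm(1)[OF t(2) that] s triv_points[OF t(2) that] by blast
 note id = smooth_at_id[OF base_atlas x]
 show ?thesis
 proof
  assume "smooth_at M (total E) s x"
  hence "smooth_fun M (%z. tau (s z)) x"
   by (rule smooth_at_compose[OF base_atlas total_atlas am])
    (rule triv_smooth[OF t(2)], use s[OF x] t(1) in "auto simp: fibre_def")
  hence "smooth_fun M (%z. frm tau z *v cr s z) x"
   by (rule smooth_at_cong[OF _ base_atlas triv_open[OF t(2)] t(1)]) (simp add: e)
  thus "smooth_vec (cr s) x" using F t(1) by (auto simp: smooth_vec_def)
 next
  assume "smooth_vec (cr s) x"
  hence "smooth_fun M (%z. frm tau z *v cr s z) x" using smooth_vec_frame[OF _ F t(1)] by blast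
  hence "smooth_at M (total E) (%z. lift_triv U tau (z, frm tau z *v cr s z)) x"
   by (rule lift_triv_smooth[OF t(2) base_atlas id _ t(1)])
  thus "smooth_at M (total E) s x"
  proof (rule smooth_at_cong[OF _ base_atlas triv_open[OF t(2)] t(1)])
   fix z assume z: "z\<in>U"
   show "lift_triv U tau (z, frm tau z *v cr s z) = s z"
    unfolding e[OF z] by (rule lift_triv(3)[OF t(2) z s[OF triv_points[OF t(2) z]]])
  qed
 qed
qed

lemma sec_iff:
 "s\<in>sec \<longleftrightarrow> s\<in>extensional (points M) \<and> (\<forall>x\<in>points M. s x\<in>fibre E x \<and> smooth_vec (cr s) x)"
proof -
 have "s\<in>sec \<longleftrightarrow> s\<in>extensional (points M) \<and> (\<forall>x\<in>points M. s x\<in>fibre E x) \<and> (\<forall>x\<in>points M. smooth_at M (total E) s x)"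
  unfolding smooth_sections_def smooth_map_iff[OF base_atlas total_atlas] by (auto simp: fibre_def)
 also have "\<dots> \<longleftrightarrow> s\<in>extensional (points M) \<and> (\<forall>x\<in>points M. s x\<in>fibre E x \<and> smooth_vec (cr s) x)"
  using section_smooth_iff by blast
 finally show ?thesis .
qed

lemma sec_fibre: "s\<in>sec ==> x\<in>points M ==> s x\<in>fibre E x"
 and sec_smooth: "s\<in>sec ==> x\<in>points M ==> smooth_vec (cr s) x" by (auto simp: sec_iff)

lemma sec_eqI: assumes "s\<in>sec" "t\<in>sec" "!!x. x\<in>points M ==> cr s x = cr t x" shows "s = t"
proof (rule extensionalityI)
 show "s\<in>extensional (points M)" "t\<in>extensional (points M)" using assms by (auto simp: sec_iff)
 show "s x = t x" if "x\<in>points M" for x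
  using crd_eqI[OF that sec_fibre[OF assms(1) that] sec_fibre[OF assms(2) that]] assms(3)[OF that] by (simp add: cr_def)
qed

lemma cr_sec_of [simp]: "x\<in>points M ==> cr (sec_of v) x = v x" by (simp add: cr_def sec_of_def pt)

lemma smooth_vec_cong:
 assumes "smooth_vec v x" "!!z. z\<in>points M ==> v z = w z" shows "smooth_vec w x"
proof -
 obtain U A where A: "(U, A)\<in>Fr" "x\<in>U" "smooth_fun M (%z. A z *v v z) x" using assms(1) by (auto simp: smooth_vec_def)
 have "smooth_fun M (%z. A z *v w z) x"
  by (rule smooth_at_cong[OF A(3) base_atlas fr.frame_open[OF A(1)] A(2)]) (simp add: assms(2) fr.frame_points[OF A(1)])
 thus ?thesis using A by (auto simp: smooth_vec_def)
qed

lemma sec_of_sec: assumes "!!x. x\<in>points M ==> smooth_vec v x" shows "sec_of v\<in>sec"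
 unfolding sec_iff
proof (intro conjI ballI)
 show "sec_of v\<in>extensional (points M)" by (simp add: sec_of_def)
 show "sec_of v x\<in>fibre E x" if "x\<in>points M" for x using that by (simp add: sec_of_def pt)
 show "smooth_vec (cr (sec_of v)) x" if "x\<in>points M" for x by (rule smooth_vec_cong[OF assms[OF that]]) simp
qed

lemma const_smooth: "(%x. c)\<in>Cinf M"
 by (simp add: smooth_functions_iff[OF base_atlas] smooth_fun_const[OF base_atlas])

lemma section_cr:
 assumes "s\<in>sec" "x\<in>points M"
 shows "t\<in>sec ==> cr (section_add E M s t) x = cr s x + cr t x"
  "cr (section_mult E M u s) x = u x *R cr s x" "cr (section_scale E M c s) x = c *R cr s x"
 using crd_linear[OF assms(2) sec_fibre[OF assms] sec_fibre] assms
 by (auto simp: cr_def section_add_def section_mult_def section_scale_def)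

lemma section_closed:
 assumes s: "s\<in>sec"
 shows "t\<in>sec ==> section_add E M s t\<in>sec" "u\<in>Cinf M ==> section_mult E M u s\<in>sec" "section_scale E M c s\<in>sec"
proof -
 note f = sec_fibre[OF s] sec_smooth[OF s]
 show mult: "section_mult E M u s\<in>sec" if u: "u\<in>Cinf M" for u
  unfolding sec_iff
 proof (intro conjI ballI)
  fix x assume x: "x\<in>points M"
  show "section_mult E M u s x\<in>fibre E x" using x fibre_closed(2)[OF x f(1)[OF x] f(1)[OF x]] by (simp add: section_mult_def)
  have "smooth_fun M u x" using u x smooth_functions_iff[OF base_atlas] by blast
  thus "smooth_vec (cr (section_mult E M u s)) x"
   by (rule smooth_vec_cong[OF smooth_vec_arith(2)[OF f(2)[OF x] f(2)[OF x]]]) (simp add: section_cr s)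
 qed (simp add: section_mult_def)
 show "section_scale E M c s\<in>sec" unfolding section_scale_def by (rule mult[OF const_smooth])
 assume t: "t\<in>sec"
 show "section_add E M s t\<in>sec"
  unfolding sec_iff
 proof (intro conjI ballI)
  fix x assume x: "x\<in>points M"
  show "section_add E M s t x\<in>fibre E x" using x fibre_closed(1)[OF x f(1)[OF x] sec_fibre[OF t x]] by (simp add: section_add_def)
  show "smooth_vec (cr (section_add E M s t)) x"
   by (rule smooth_vec_cong[OF smooth_vec_arith(1)[OF f(2)[OF x] sec_smooth[OF t x]]]) (simp add: section_cr s t)
 qed (simp add: section_add_def)
qed

lemmas section_ops = section_closed section_cr

lemma section_through:
 assumes x: "x\<in>points M" obtains s where "s\<in>sec" "cr s x = w"
proof -
 obtain v where v: "!!z. z\<in>points M ==> smooth_vec v z" "v x = w" using vec_through[OF x, of w] by metis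
 show thesis by (rule that[OF sec_of_sec[OF v(1)]]) (simp_all add: x v(2))
qed

end

lemma eq_scal_diff: "a - b\<asymp>0 \<longleftrightarrow> a\<asymp>b"
 by (auto simp: eq_scal_def algebra_simps)

section \<open>Operators on sections as an instance of the abstract algebra\<close>

context vbundle begin

abbreviation EndE :: "(real, ('a, 'e) section_operator) module" where "EndE \<equiv> End_sections E M"

abbreviation gam :: "('a => real) => ('a, 'e) section_operator" where "gam \<equiv> multiplication_op E M"

lemma End_apply:
 assumes "s\<in>sec"
 shows "(T \<oplus>\<^bsub>EndE\<^esub> D) s = section_add E M (T s) (D s)" "(c \<odot>\<^bsub>EndE\<^esub> T) s = section_scale E M c (T s)"
  "(T \<otimes>\<^bsub>EndE\<^esub> D) s = T (D s)" "\<one>\<^bsub>EndE\<^esub> s = s" "\<zero>\<^bsub>EndE\<^esub> s = section_scale E M 0 s" "gam u s = section_mult E M u s"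
 using assms by (simp_all add: End_sections_def compose_def multiplication_op_def)

lemma End_extensional:
 "T \<oplus>\<^bsub>EndE\<^esub> D\<in>extensional sec" "c \<odot>\<^bsub>EndE\<^esub> T\<in>extensional sec" "T \<otimes>\<^bsub>EndE\<^esub> D\<in>extensional sec"
 "\<one>\<^bsub>EndE\<^esub>\<in>extensional sec" "\<zero>\<^bsub>EndE\<^esub>\<in>extensional sec" "gam u\<in>extensional sec"
 by (simp_all add: End_sections_def multiplication_op_def)

lemma carrier_EndI:
 assumes T: "T\<in>extensional sec" "!!s. s\<in>sec ==> T s\<in>sec"
  and add: "!!s t x. s\<in>sec ==> t\<in>sec ==> x\<in>points M ==> cr (T (section_add E M s t)) x = cr (T s) x + cr (T t) x"
  and scale: "!!c s x. s\<in>sec ==> x\<in>points M ==> cr (T (section_scale E M c s)) x = c *R cr (T s) x"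
 shows "T\<in>carrier EndE"
proof -
 have "T (section_add E M s t) = section_add E M (T s) (T t)" if "s\<in>sec" "t\<in>sec" for s t
  by (rule sec_eqI) (simp_all add: T section_ops add that)
 moreover have "T (section_scale E M c s) = section_scale E M c (T s)" if "s\<in>sec" for s c
  by (rule sec_eqI) (simp_all add: T section_ops scale that)
 ultimately show ?thesis using T by (auto simp: End_sections_def PiE_def)
qed

lemma carrier_EndD:
 assumes "T\<in>carrier EndE"
 shows "T\<in>extensional sec" "s\<in>sec ==> T s\<in>sec"
  "s\<in>sec ==> t\<in>sec ==> T (section_add E M s t) = section_add E M (T s) (T t)"
  "s\<in>sec ==> T (section_scale E M c s) = section_scale E M c (T s)"
 using assms by (auto simp: End_sections_def PiE_def)

lemma op_eqI:
 assumes "T\<in>carrier EndE" "D\<in>carrier EndE" "!!s x. s\<in>sec ==> x\<in>points M ==> cr (T s) x = cr (D s) x"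
 shows "T = D"
proof (rule extensionalityI[OF carrier_EndD(1)[OF assms(1)] carrier_EndD(1)[OF assms(2)]])
 show "T s = D s" if "s\<in>sec" for s
  by (rule sec_eqI) (simp_all add: carrier_EndD(2)[OF assms(1) that] carrier_EndD(2)[OF assms(2) that] assms(3) that)
qed

lemma smooth_functions_arith:
 assumes "u\<in>Cinf M"
 shows "v\<in>Cinf M ==> (%x. u x + v x)\<in>Cinf M"
  "v\<in>Cinf M ==> (%x. u x * v x)\<in>Cinf M" "(%x. c * u x)\<in>Cinf M"
 using assms smooth_fun_add[OF base_atlas] smooth_fun_mult[OF base_atlas] smooth_fun_const[OF base_atlas]
 unfolding smooth_functions_iff[OF base_atlas] by blast+

lemma End_closed:
 "T\<in>carrier EndE ==> D\<in>carrier EndE ==> T \<oplus>\<^bsub>EndE\<^esub> D\<in>carrier EndE" "T\<in>carrier EndE ==> c \<odot>\<^bsub>EndE\<^esub> T\<in>carrier EndE"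
 "T\<in>carrier EndE ==> D\<in>carrier EndE ==> T \<otimes>\<^bsub>EndE\<^esub> D\<in>carrier EndE"
 "\<one>\<^bsub>EndE\<^esub>\<in>carrier EndE" "\<zero>\<^bsub>EndE\<^esub>\<in>carrier EndE" "u\<in>Cinf M ==> gam u\<in>carrier EndE"
 by (rule carrier_EndI; simp add: End_extensional End_apply section_ops carrier_EndD scaleR_add_right)+

lemmas End_simps = End_closed End_apply section_ops carrier_EndD const_smooth smooth_functions_arith

text \<open>The scalar by which an operator acts at \<open>x\<close>. For multiplications it is well
  defined because sections attain every value at \<open>x\<close>.\<close>

definition gval :: "'a => ('a, 'e) section_operator => real" where
 "gval x T = (SOME c. \<forall>s\<in>sec. cr (T s) x = c *R cr s x)"

lemma gval_eq:
 assumes x: "x\<in>points M" and c: "!!s. s\<in>sec ==> cr (T s) x = c *R cr s x"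
 shows "gval x T = c"
proof -
 obtain s where s: "s\<in>sec" "cr s x = 1" using section_through[OF x, of 1] by metis
 have e: "\<forall>s\<in>sec. cr (T s) x = c *R cr s x" using c by blast
 hence "\<forall>s\<in>sec. cr (T s) x = gval x T *R cr s x" unfolding gval_def by (rule someI)
 hence "gval x T *R (1 :: real^'n) = c *R 1" using c[OF s(1)] s by simp
 hence "(gval x T *R (1 :: real^'n)) $ i = (c *R 1) $ i" for i by simp
 thus ?thesis by simp
qed

lemma gval_gam: "u\<in>Cinf M ==> x\<in>points M ==> gval x (gam u) = u x"
 by (rule gval_eq) (simp_all add: End_simps)

lemma gam_eqI: "u\<in>Cinf M ==> v\<in>Cinf M ==> (!!x. x\<in>points M ==> u x = v x) ==> gam u = gam v"
 by (rule op_eqI) (simp_all add: End_simps)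

lemma gam_arith:
 "u\<in>Cinf M ==> v\<in>Cinf M ==> gam u \<oplus>\<^bsub>EndE\<^esub> gam v = gam (%x. u x + v x)"
 "u\<in>Cinf M ==> v\<in>Cinf M ==> gam u \<otimes>\<^bsub>EndE\<^esub> gam v = gam (%x. u x * v x)"
 "u\<in>Cinf M ==> c \<odot>\<^bsub>EndE\<^esub> gam u = gam (%x. c * u x)"
 "\<one>\<^bsub>EndE\<^esub> = gam (%x. 1)" "\<zero>\<^bsub>EndE\<^esub> = gam (%x. 0)"
 by (rule op_eqI; simp add: End_simps scaleR_add_left)+

lemma End_ring: "ring EndE"
proof (rule ringI)
 show "abelian_group EndE"
 proof (rule abelian_groupI)
  show "\<exists>D\<in>carrier EndE. D \<oplus>\<^bsub>EndE\<^esub> T = \<zero>\<^bsub>EndE\<^esub>" if "T\<in>carrier EndE" for T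
   by (rule bexI[of _ "(-1) \<odot>\<^bsub>EndE\<^esub> T"], rule op_eqI) (simp_all add: End_simps that)
 qed ((rule op_eqI)?; simp add: End_simps add_ac)+
 show "monoid EndE" by (rule monoidI; (rule op_eqI)?; simp add: End_simps)
qed (rule op_eqI; simp add: End_simps)+

abbreviation UE :: "('a, 'e) section_operator set" where "UE \<equiv> gam ` Cinf M"

text \<open>The analytic content: a function without zeros has a smooth inverse, and a
  multiplication is determined by the values of its function.\<close>

sublocale alg: diff_algebra EndE UE "points M" gval
proof -
 interpret ring EndE by (rule End_ring)
 note A = smooth_functions_arith and g = gam_arith
 show "diff_algebra EndE UE (points M) gval"
 proof
  show "UE\<subseteq>carrier EndE" using End_closed(6) by blast
  show "\<one>\<^bsub>EndE\<^esub>\<in>UE" using g(4) const_smooth by simp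
 next
  fix u v c assume "u\<in>UE"
  then obtain a where a: "a\<in>Cinf M" "u = gam a" by blast
  show "c \<odot>\<^bsub>EndE\<^esub> u\<in>UE" using a A(3) by (simp add: g(3))
  show "gval x (c \<odot>\<^bsub>EndE\<^esub> u) = c * gval x u" if "x\<in>points M" for x using a that A(3) by (simp add: g(3) gval_gam)
  assume "v\<in>UE"
  then obtain b where b: "b\<in>Cinf M" "v = gam b" by blast
  show "u \<oplus>\<^bsub>EndE\<^esub> v\<in>UE" "u \<otimes>\<^bsub>EndE\<^esub> v\<in>UE" using a b A by (simp_all add: g)
  show "u \<otimes>\<^bsub>EndE\<^esub> v = v \<otimes>\<^bsub>EndE\<^esub> u" using a b by (simp add: g mult.commute)
  show "gval x (u \<oplus>\<^bsub>EndE\<^esub> v) = gval x u + gval x v" "gval x (u \<otimes>\<^bsub>EndE\<^esub> v) = gval x u * gval x v" if "x\<in>points M" for x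
   using a b A that by (simp_all add: g gval_gam)
 next
  show "gval x \<one>\<^bsub>EndE\<^esub> = 1" if "x\<in>points M" for x using that by (simp add: g gval_gam const_smooth)
 next
  fix u assume "u\<in>UE"
  then obtain a where a: "a\<in>Cinf M" "u = gam a" by blast
  {
   assume z: "!!x. x\<in>points M ==> gval x u = 0"
   show "u = \<zero>\<^bsub>EndE\<^esub>" unfolding g(5) a(2) using z a by (intro gam_eqI const_smooth) (simp_all add: gval_gam)
  }
  {
   assume z: "!!x. x\<in>points M ==> gval x u ~= 0"
   hence nz: "a x ~= 0" if "x\<in>points M" for x using that a by (simp add: gval_gam)
   have i: "(%x. inverse (a x))\<in>Cinf M"
    using a(1) nz smooth_fun_inverse[OF base_atlas] by (simp add: smooth_functions_iff[OF base_atlas])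
   have "u \<otimes>\<^bsub>EndE\<^esub> gam (%x. inverse (a x)) = \<one>\<^bsub>EndE\<^esub>"
    unfolding a(2) g(4) g(2)[OF a(1) i] by (rule gam_eqI[OF A(2)[OF a(1) i] const_smooth]) (simp add: nz)
   thus "\<exists>v\<in>UE. u \<otimes>\<^bsub>EndE\<^esub> v = \<one>\<^bsub>EndE\<^esub>" using i by blast
  }
 qed ((rule op_eqI)?; simp add: End_simps scaleR_add_left scaleR_add_right)+
qed

lemma cr_minus:
 assumes "T\<in>carrier EndE" "D\<in>carrier EndE" "s\<in>sec" "x\<in>points M"
 shows "cr ((T \<ominus>\<^bsub>EndE\<^esub> D) s) x = cr (T s) x - cr (D s) x"
proof -
 have "T \<ominus>\<^bsub>EndE\<^esub> D = T \<oplus>\<^bsub>EndE\<^esub> (-1) \<odot>\<^bsub>EndE\<^esub> D" using assms by (simp add: alg.minus_eq alg.smult_minus_one)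
 thus ?thesis using assms by (simp add: End_simps)
qed

lemma cr_commutator:
 assumes "T\<in>carrier EndE" "D\<in>carrier EndE" "s\<in>sec" "x\<in>points M"
 shows "cr (commutator EndE T D s) x = cr (T (D s)) x - cr (D (T s)) x"
 unfolding commutator_def using assms by (simp add: cr_minus End_simps)

lemma P_nat_Pn: "P_nat E M i = alg.Pn i"
 by (induction i) simp_all

lemma P_filtration_P: "P_filtration E M = alg.P"
 by (rule ext) (simp add: P_filtration_def alg.P_def P_nat_Pn)

lemma symbol_poisson_algebra_S: "symbol_poisson_algebra E M = alg.S"
 by (simp add: symbol_poisson_algebra_def P_filtration_P)

lemma K_gam:
 assumes T: "T\<in>alg.Dn 0" and u: "u\<in>Cinf M" and s: "s\<in>sec" and x: "x\<in>points M"
 shows "cr (T (section_mult E M u s)) x = u x *R cr (T s) x"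
proof -
 have "T\<in>carrier EndE" "commutator EndE T (gam u) = \<zero>\<^bsub>EndE\<^esub>" using T u by simp_all
 thus ?thesis using cr_commutator[of T "gam u" s x] u s x by (simp add: End_simps)
qed

lemma K_sum:
 assumes T: "T\<in>alg.Dn 0" and I: "finite I" and e: "!!i. e i\<in>sec" and u: "!!i. u i\<in>Cinf M" and x: "x\<in>points M"
 shows "\<exists>s\<in>sec. (\<forall>z\<in>points M. cr s z = (\<Sum>i\<in>I. u i z *R cr (e i) z)) \<and> cr (T s) x = (\<Sum>i\<in>I. u i x *R cr (T (e i)) x)"
 using I
proof (induction I rule: finite_induct)
 case empty
 have TK: "T\<in>carrier EndE" using T by simp
 obtain s where "s\<in>sec" using section_through[OF x] by metis
 thus ?case by (intro bexI[of _ "section_scale E M 0 s"]) (simp_all add: section_ops carrier_EndD[OF TK] x)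
next
 case (insert i I)
 have TK: "T\<in>carrier EndE" using T by simp
 obtain s where s: "s\<in>sec" "\<forall>z\<in>points M. cr s z = (\<Sum>i\<in>I. u i z *R cr (e i) z)" "cr (T s) x = (\<Sum>i\<in>I. u i x *R cr (T (e i)) x)"
  using insert.IH by blast
 thus ?case using insert.hyps K_gam[OF T u e x]
  by (intro bexI[of _ "section_add E M (section_mult E M (u i) (e i)) s"]) (simp_all add: section_ops carrier_EndD[OF TK] x e u)
qed

text \<open>An operator commuting with functions sees only the value of a section at the point:
  multiplication by the square of \<open>b\<close> writes \<open>s\<close> as a combination of
  finitely many global sections \<open>e i\<close> with global coefficients.\<close>

lemma K_local:
 assumes A: "(U, A)\<in>Fr" and b: "cutoff M U b"
 defines "e \<equiv> %i. sec_of (%z. b z *R (minv (A z) *v axis i 1))"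
 shows "e i\<in>sec" "T\<in>alg.Dn 0 ==> s\<in>sec ==> x\<in>U ==> b x = 1 ==>
  cr (T s) x = (\<Sum>i\<in>UNIV. (A x *v cr s x) $ i *R cr (T (e i)) x)"
proof -
 show es: "e i\<in>sec" for i unfolding e_def by (rule sec_of_sec[OF smooth_vec_cutoff[OF A b _ smooth_fun_const[OF base_atlas]]])
 assume T: "T\<in>alg.Dn 0" and s: "s\<in>sec" and x: "x\<in>U" "b x = 1"
 have xM: "x\<in>points M" by (rule fr.frame_points[OF A x(1)])
 have b2: "(%z. b z * b z)\<in>Cinf M" using b by (simp add: cutoff_def smooth_functions_arith)
 define u where "u = (%i z. b z * (A z *v cr s z) $ i)"
 have u: "u i\<in>Cinf M" for i
  unfolding smooth_functions_iff[OF base_atlas]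
 proof
  fix z assume z: "z\<in>points M"
  have "smooth_fun M (%z. b z *R (A z *v cr s z) $ i) z"
   by (rule cutoff_smooth[OF base_manifold b _ z])
    (rule smooth_fun_component[OF base_atlas smooth_vec_frame[OF sec_smooth[OF s z] A]])
  thus "smooth_fun M (u i) z" by (simp add: u_def)
 qed
 obtain t where t: "t\<in>sec" "!!z. z\<in>points M ==> cr t z = (\<Sum>i\<in>UNIV. u i z *R cr (e i) z)"
  "cr (T t) x = (\<Sum>i\<in>UNIV. u i x *R cr (T (e i)) x)" using K_sum[where I = UNIV and e = e and u = u, OF T finite es u xM] by blast
 have bt: "section_mult E M (%z. b z * b z) s = t"
 proof (rule sec_eqI[OF section_closed(2)[OF s b2] t(1)])
  fix z assume z: "z\<in>points M"
  have "b z = 0" if "z\<notin>U" using b that by (auto simp: cutoff_def)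
  moreover have "cr s z = (\<Sum>i\<in>UNIV. (A z *v cr s z) $ i *R (minv (A z) *v axis i 1))" if "z\<in>U"
   using matrix_mult_sum[of "minv (A z)" "A z *v cr s z"] fr.frame_inv[OF A that]
   by (simp add: mv_assoc scalar_mult_eq_scaleR matrix_vector_mult_basis)
  ultimately have "(b z * b z) *R cr s z = (b z * b z) *R (\<Sum>i\<in>UNIV. (A z *v cr s z) $ i *R (minv (A z) *v axis i 1))"
   by (cases "z\<in>U") simp_all
  thus "cr (section_mult E M (%z. b z * b z) s) z = cr t z"
   using z by (simp add: section_cr s t(2) u_def e_def scaleR_sum_right mult_ac)
 qed
 thus "cr (T s) x = (\<Sum>i\<in>UNIV. (A x *v cr s x) $ i *R cr (T (e i)) x)"
  using K_gam[OF T b2 s xM] by (simp add: bt t(3) x(2) u_def)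
qed

text \<open>The columns of the matrix are the images of the cut-off basis sections. These images are
  smooth sections, so the matrix is smooth in a frame.\<close>

lemma K_field:
 assumes T: "T\<in>alg.Dn 0"
 shows "\<exists>m. fr.field m \<and> (\<forall>s\<in>sec. \<forall>x\<in>points M. cr (T s) x = m x *v cr s x)"
proof -
 have TK: "T\<in>carrier EndE" using T by simp
 have "\<exists>m. \<forall>s\<in>sec. cr (T s) x = m *v cr s x" if x: "x\<in>points M" for x
 proof -
  obtain U A where A: "(U, A)\<in>Fr" "x\<in>U" using fr.frame_cover[OF x] by blast
  obtain b V where b: "cutoff M U b" "x\<in>V" "!!z. z\<in>V ==> b z = 1" using cutoff_exists[OF base_manifold fr.frame_open[OF A(1)] A(2)] by metis
  let ?e = "%i. cr (T (sec_of (%z. b z *R (minv (A z) *v axis i 1)))) x"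
  have "cr (T s) x = ((\<chi> r c. ?e c $ r)**A x) *v cr s x" if "s\<in>sec" for s
   unfolding K_local(2)[OF A(1) b(1) T that A(2) b(3)[OF b(2)]] mv_assoc[symmetric]
   by (simp add: vec_eq_iff matrix_vector_mult_def mult.commute)
  thus ?thesis by blast
 qed
 then obtain m where m: "!!x s. x\<in>points M ==> s\<in>sec ==> cr (T s) x = m x *v cr s x" by metis
 have "smooth_hom M Fr Fr m x" if x: "x\<in>points M" for x
 proof -
  obtain U A where A: "(U, A)\<in>Fr" "x\<in>U" using fr.frame_cover[OF x] by blast
  obtain b V where b: "cutoff M U b" "opn M V" "x\<in>V" "V\<subseteq>U" "!!z. z\<in>V ==> b z = 1"
   using cutoff_exists[OF base_manifold fr.frame_open[OF A(1)] A(2)] by metis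
  let ?e = "%i. sec_of (%z. b z *R (minv (A z) *v axis i 1))"
  have es: "?e i\<in>sec" for i by (rule K_local(1)[OF A(1) b(1)])
  have c: "smooth_fun M (%z. A z *v cr (T (?e i)) z) x" for i
   by (rule smooth_vec_frame[OF sec_smooth[OF carrier_EndD(2)[OF TK es] x] A])
  have "smooth_fun M (%z. A z**m z**minv (A z)) x"
  proof (intro smooth_fun_vec[OF base_atlas x])
   fix i j
   show "smooth_fun M (%z. (A z**m z**minv (A z)) $ i $ j) x"
   proof (rule smooth_at_cong[OF smooth_fun_component[OF base_atlas c[of j], of i] base_atlas b(2,3)])
    fix z assume z: "z\<in>V"
    have zM: "z\<in>points M" using fr.frame_points[OF A(1)] b(4) z by blast
    have "cr (T (?e j)) z = m z *v (minv (A z) *v axis j 1)" using m[OF zM es] b(5)[OF z] zM by simp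
    hence "A z *v cr (T (?e j)) z = column j (A z**m z**minv (A z))"
     by (simp only: mv_assoc matrix_mul_assoc matrix_vector_mult_basis[symmetric])
    thus "(A z *v cr (T (?e j)) z) $ i = (A z**m z**minv (A z)) $ i $ j" by (simp add: column_def)
   qed
  qed
  thus ?thesis using A unfolding smooth_hom_def by blast
 qed
 thus ?thesis using m by blast
qed

definition mat_of :: "('a, 'e) section_operator => 'a => real^'n^'n" where
 "mat_of T = (SOME m. fr.field m \<and> (\<forall>s\<in>sec. \<forall>x\<in>points M. cr (T s) x = m x *v cr s x))"

definition op_of :: "('a => real^'n^'n) => ('a, 'e) section_operator" where
 "op_of m = (\<lambda>s\<in>sec. sec_of (%x. m x *v cr s x))"

lemma mat_of:
 assumes "T\<in>alg.Dn 0"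
 shows "fr.field (mat_of T)" "s\<in>sec ==> x\<in>points M ==> cr (T s) x = mat_of T x *v cr s x"
 using someI_ex[OF K_field[OF assms]] unfolding mat_of_def by blast+

lemma mat_of_eq:
 assumes T: "T\<in>alg.Dn 0" and x: "x\<in>points M" and m: "!!s. s\<in>sec ==> cr (T s) x = m *v cr s x"
 shows "mat_of T x = m"
proof (rule matrix_eqI)
 fix v
 obtain s where s: "s\<in>sec" "cr s x = v" using section_through[OF x, of v] by metis
 show "mat_of T x *v v = m *v v" using mat_of(2)[OF T s(1) x] m[OF s(1)] s(2) by simp
qed

lemma op_of:
 assumes m: "fr.field m"
 shows "op_of m\<in>alg.Dn 0" "s\<in>sec ==> x\<in>points M ==> cr (op_of m s) x = m x *v cr s x"
  "x\<in>points M ==> mat_of (op_of m) x = m x"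
proof -
 have v: "smooth_vec (%x. m x *v cr s x) x" if "s\<in>sec" "x\<in>points M" for s x
  using smooth_vec_arith(3)[OF sec_smooth[OF that] sec_smooth[OF that]] m that(2) by blast
 have os: "op_of m s\<in>sec" if "s\<in>sec" for s using sec_of_sec[OF v[OF that]] that by (simp add: op_of_def)
 show c: "cr (op_of m s) x = m x *v cr s x" if "s\<in>sec" "x\<in>points M" for s x using that by (simp add: op_of_def)
 note o = os c section_ops matrix_vector_right_distrib matrix_vector_mult_scaleR
 have car: "op_of m\<in>carrier EndE" by (rule carrier_EndI) (simp_all add: o, simp add: op_of_def)
 have "commutator EndE (op_of m) (gam u) = \<zero>\<^bsub>EndE\<^esub>" if "u\<in>Cinf M" for u
  by (rule op_eqI) (simp_all add: car that cr_commutator o End_closed End_apply)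
 thus K: "op_of m\<in>alg.Dn 0" using car by auto
 show "x\<in>points M ==> mat_of (op_of m) x = m x" by (rule mat_of_eq[OF K]) (simp_all add: c)
qed

lemma K_ext: "T\<in>alg.Dn 0 ==> D\<in>alg.Dn 0 ==> (!!x. x\<in>points M ==> mat_of T x = mat_of D x) ==> T = D"
 by (rule op_eqI) (simp_all add: mat_of(2) del: alg.Dn.simps, auto)

lemma mat_of_ops:
 assumes T: "T\<in>alg.Dn 0" and D: "D\<in>alg.Dn 0" and x: "x\<in>points M"
 shows "mat_of (T \<oplus>\<^bsub>EndE\<^esub> D) x = mat_of T x + mat_of D x" "mat_of (T \<ominus>\<^bsub>EndE\<^esub> D) x = mat_of T x - mat_of D x"
  "mat_of (T \<otimes>\<^bsub>EndE\<^esub> D) x = mat_of T x**mat_of D x" "mat_of (commutator EndE T D) x = lie (mat_of T x) (mat_of D x)"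
proof -
 have c: "T\<in>carrier EndE" "D\<in>carrier EndE" using T D by auto
 note sub = alg.subspaceD[OF alg.subspace_Dn[of 0]]
 note m = mat_of(2)[OF T _ x] mat_of(2)[OF D _ x]
 note cl = carrier_EndD(2)[OF c(1)] carrier_EndD(2)[OF c(2)]
 show "mat_of (T \<oplus>\<^bsub>EndE\<^esub> D) x = mat_of T x + mat_of D x"
  by (rule mat_of_eq[OF sub(3)[OF T D] x]) (simp add: End_apply section_cr cl x m matrix_vector_mult_add_rdistrib)
 show "mat_of (T \<ominus>\<^bsub>EndE\<^esub> D) x = mat_of T x - mat_of D x"
  by (rule mat_of_eq[OF sub(6)[OF T D] x]) (simp add: cr_minus[OF c] x m matrix_vector_mult_diff_rdistrib)
 show "mat_of (T \<otimes>\<^bsub>EndE\<^esub> D) x = mat_of T x**mat_of D x"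
  by (rule mat_of_eq[OF alg.K_mult[OF T D] x]) (simp add: End_apply x m cl mv_assoc)
 show "mat_of (commutator EndE T D) x = lie (mat_of T x) (mat_of D x)"
  by (rule mat_of_eq[OF alg.K_cmt[OF T D] x])
   (simp add: cr_commutator[OF c] x m cl lie_def matrix_vector_mult_diff_rdistrib mv_assoc)
qed

lemma mat_of_gam: "u\<in>Cinf M ==> x\<in>points M ==> mat_of (gam u) x = scal (u x)"
 by (rule mat_of_eq[OF alg.U_K]) (simp_all add: End_simps scaleR_matrix_vector_assoc[symmetric])

text \<open>The pointwise scalar is a diagonal entry in any frame and hence smooth. This identifies
  congruence modulo functions with pointwise congruence modulo scalars.\<close>

lemma U_iff:
 assumes T: "T\<in>alg.Dn 0" shows "T\<in>UE \<longleftrightarrow> (\<forall>x\<in>points M. mat_of T x\<asymp>0)"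
proof
 assume "T\<in>UE"
 then obtain u where "u\<in>Cinf M" "T = gam u" by blast
 thus "\<forall>x\<in>points M. mat_of T x\<asymp>0" by (simp add: mat_of_gam scal_eq_0)
next
 assume "\<forall>x\<in>points M. mat_of T x\<asymp>0"
 hence "\<forall>x\<in>points M. \<exists>c. mat_of T x = scal c" by (simp add: eq_scal_def)
 then obtain u where u: "!!x. x\<in>points M ==> mat_of T x = scal (u x)" by metis
 have us: "u\<in>Cinf M" by (rule fr.field_scalar_part[OF mat_of(1)[OF T] u])
 have "T = gam u" by (rule K_ext[OF T alg.U_K]) (use us u in "simp_all add: mat_of_gam")
 thus "T\<in>UE" using us by blast
qed

lemma U_diff:
 assumes "T\<in>alg.Dn 0" "D\<in>alg.Dn 0" "T \<ominus>\<^bsub>EndE\<^esub> D\<in>UE" "x\<in>points M" shows "mat_of T x\<asymp>mat_of D x"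
proof -
 have "mat_of (T \<ominus>\<^bsub>EndE\<^esub> D) x\<asymp>0" using U_iff[OF alg.U_K[OF assms(3)]] assms(3,4) by blast
 thus ?thesis by (simp only: mat_of_ops(2)[OF assms(1,2,4)] eq_scal_diff)
qed

lemma mat_of_finsum:
 assumes "finite I" "!!i. i\<in>I ==> g i\<in>alg.Dn 0" "x\<in>points M"
 shows "mat_of (finsum EndE g I) x = (\<Sum>i\<in>I. mat_of (g i) x)"
 using assms(1,2)
proof (induction I rule: finite_induct)
 case empty
 have "\<zero>\<^bsub>EndE\<^esub> = gam (%x. 0)" by (rule gam_arith(5))
 thus ?case using mat_of_gam[OF const_smooth assms(3), of 0] by simp
next
 case (insert i I)
 have "finsum EndE g (insert i I) = g i \<oplus>\<^bsub>EndE\<^esub> finsum EndE g I"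
  by (rule alg.finsum_insert) (use insert in auto)
 moreover have "finsum EndE g I\<in>alg.Dn 0"
  by (rule alg.subspace_finsum[OF alg.subspace_Dn]) (use insert.prems in blast)
 moreover have gi: "g i\<in>alg.Dn 0" using insert.prems by blast
 ultimately show ?case using mat_of_ops(1)[OF gi _ assms(3)] insert by simp
qed

lemma K_closed:
 "T\<in>alg.Dn 0 ==> D\<in>alg.Dn 0 ==> T \<oplus>\<^bsub>EndE\<^esub> D\<in>alg.Dn 0" "T\<in>alg.Dn 0 ==> D\<in>alg.Dn 0 ==> T \<ominus>\<^bsub>EndE\<^esub> D\<in>alg.Dn 0"
 "T\<in>alg.Dn 0 ==> D\<in>alg.Dn 0 ==> T \<otimes>\<^bsub>EndE\<^esub> D\<in>alg.Dn 0"
 "T\<in>alg.Dn 0 ==> D\<in>alg.Dn 0 ==> commutator EndE T D\<in>alg.Dn 0"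
 "u\<in>UE ==> u\<in>alg.Dn 0" "fr.field m ==> op_of m\<in>alg.Dn 0"
 by (rule alg.subspaceD(3,6)[OF alg.subspace_Dn] alg.K_mult alg.K_cmt alg.U_K op_of(1); assumption)+

lemmas K_simps = K_closed mat_of_ops mat_of_gam op_of(3) mat_of(1) scal_mult

lemma casimir_iff:
 assumes e: "!!i. e i\<in>alg.Dn 0" "!!i. f i\<in>alg.Dn 0" and b: "b\<in>Cinf M" and T: "T\<in>alg.Dn 0" and I: "finite I"
 shows "alg.casimir I e f T \<ominus>\<^bsub>EndE\<^esub> gam b \<otimes>\<^bsub>EndE\<^esub> T\<in>UE \<longleftrightarrow>
  (\<forall>x\<in>points M. (\<Sum>i\<in>I. lie (mat_of (e i) x) (lie (mat_of (f i) x) (mat_of T x)))\<asymp>b x *R mat_of T x)"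
proof -
 have c: "alg.casimir I e f T\<in>alg.Dn 0" unfolding alg.casimir_def
  by (rule alg.subspace_finsum[OF alg.subspace_Dn]) (intro K_closed(4) e T)
 have m: "mat_of (alg.casimir I e f T) x = (\<Sum>i\<in>I. lie (mat_of (e i) x) (lie (mat_of (f i) x) (mat_of T x)))" if "x\<in>points M" for x
  unfolding alg.casimir_def by (simp add: mat_of_finsum[OF I _ that] K_simps e T that del: alg.Dn.simps)
 have g: "gam b\<in>alg.Dn 0" using alg.U_K b by blast
 note bT = K_closed(3)[OF g T]
 have "mat_of (alg.casimir I e f T \<ominus>\<^bsub>EndE\<^esub> gam b \<otimes>\<^bsub>EndE\<^esub> T) x =
   (\<Sum>i\<in>I. lie (mat_of (e i) x) (lie (mat_of (f i) x) (mat_of T x))) - b x *R mat_of T x" if "x\<in>points M" for x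
  by (simp only: mat_of_ops(2)[OF c bT that] m[OF that] mat_of_ops(3)[OF g T that] mat_of_gam[OF b that] scal_mult)
 thus ?thesis unfolding U_iff[OF K_closed(2)[OF c bT]] by (simp add: eq_scal_diff)
qed

end

section \<open>Diffeomorphisms and pullback of frames\<close>

lemma smooth_functions_separate:
 assumes M: "smooth_manifold M" and pq: "p\<in>points M" "q\<in>points M" and eq: "!!u. u\<in>Cinf M ==> u p = u q"
 shows "p = q"
proof (rule ccontr)
 assume ne: "p ~= q"
 have "closedin (mtop M) {q}" using M pq(2) by (simp add: smooth_manifold_def closedin_Hausdorff_singleton)
 hence o: "opn M (points M - {q})" by (simp add: closedin_def)
 obtain b V where b: "cutoff M (points M - {q}) b" "p\<in>V" "!!z. z\<in>V ==> b z = 1"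
  using cutoff_exists[OF M o, of p] pq ne by (metis DiffI singletonD)
 have "b q = 0" using b(1) unfolding cutoff_def by blast
 moreover have "b p = 1" using b by blast
 moreover have "b\<in>Cinf M" using b(1) by (simp add: cutoff_def)
 ultimately show False using eq[of b] by simp
qed

definition pullback_frames :: "('a, 'm) manifold => ('a => 'b) => ('b set\<times>('b => real^'p^'p)) set => ('a set\<times>('a => real^'p^'p)) set" where
 "pullback_frames M kappa FF = {({x\<in>points M. kappa x\<in>V}, %x. B (kappa x)) | V B. (V, B)\<in>FF}"

locale manifold_iso =
 fixes M :: "('a, 'm::real_normed_vector) manifold" and N :: "('b, 'k::real_normed_vector) manifold" and kappa eta
 assumes M: "smooth_manifold M" and N: "smooth_manifold N"
  and kappa: "x\<in>points M ==> smooth_at M N kappa x" and eta: "y\<in>points N ==> smooth_at N M eta y"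
  and etakappa: "x\<in>points M ==> eta (kappa x) = x" and kappaeta: "y\<in>points N ==> kappa (eta y) = y"
begin

lemma aM: "atlas M" and aN: "atlas N" using M N by (auto intro: manifold_atlas)

lemma maps: "x\<in>points M ==> kappa x\<in>points N" "y\<in>points N ==> eta y\<in>points M"
 using smooth_at_points(2)[OF kappa aM aN] smooth_at_points(2)[OF eta aN aM] by blast+

lemma inverse: "manifold_iso N M eta kappa"
 by (unfold_locales) (use M N kappa eta etakappa kappaeta in auto)

lemma diffeomorphism: "diffeomorphism M N kappa"
proof -
 have b: "bij_betw kappa (points M) (points N)"
  by (rule bij_betw_byWitness[where f' = eta]) (use maps etakappa kappaeta in auto)
 have "inv_into (points M) kappa y = eta y" if "y\<in>points N" for y
  using that maps(2) kappaeta by (intro inv_into_f_eq[OF bij_betw_imp_inj_on[OF b]]) auto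
 hence i: "smooth_at N M (inv_into (points M) kappa) y" if "y\<in>points N" for y
  using that by (intro smooth_at_cong[OF eta[OF that] aN openin_topspace that]) simp
 show ?thesis unfolding diffeomorphism_def smooth_map_iff[OF aM aN] smooth_map_iff[OF aN aM]
  using b kappa i maps(1) smooth_at_points(2)[OF i aN aM] by blast
qed

lemma preimage_open: assumes "opn N V" shows "opn M {x\<in>points M. kappa x\<in>V}"
 using diffeomorphism assms by (simp add: diffeomorphism_def smooth_map_def continuous_map_def)

lemma smooth_fun_pull: "smooth_fun N (f :: 'b => 'v::euclidean_space) (kappa x) ==> x\<in>points M ==> smooth_fun M (%z. f (kappa z)) x"
 by (rule smooth_at_compose[OF aM aN atlas_model_euclidean kappa])

lemma frames_pullback: assumes F: "frames N FF" shows "frames M (pullback_frames M kappa FF)"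
proof -
 interpret F: frames N FF by (rule F)
 show ?thesis
 proof
  show "smooth_manifold M" by (rule M)
  show "opn M U" if "(U, A)\<in>pullback_frames M kappa FF" for U A
   using that preimage_open[OF F.frame_open] by (auto simp: pullback_frames_def)
  show "invertible (A x)" if "(U, A)\<in>pullback_frames M kappa FF" "x\<in>U" for U A x
   using that F.frame_invertible by (auto simp: pullback_frames_def)
  show "\<exists>U A. (U, A)\<in>pullback_frames M kappa FF \<and> x\<in>U" if x: "x\<in>points M" for x
  proof -
   obtain V B where "(V, B)\<in>FF" "kappa x\<in>V" using F.frame_cover[OF maps(1)[OF x]] by blast
   thus ?thesis using x unfolding pullback_frames_def by blast
  qed
  show "smooth_fun M (%z. B z**minv (A z)) x"
   if UV: "(U, A)\<in>pullback_frames M kappa FF" "(V, B)\<in>pullback_frames M kappa FF" "x\<in>U" "x\<in>V" for U A V B x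
  proof -
   obtain U' A' V' B' where *: "(U', A')\<in>FF" "(V', B')\<in>FF" "kappa x\<in>U'" "kappa x\<in>V'" "x\<in>points M" "A = (%x. A' (kappa x))" "B = (%x. B' (kappa x))"
    using UV by (auto simp: pullback_frames_def)
   show ?thesis using smooth_fun_pull[OF F.transition[OF *(1-4)] *(5)] by (simp add: *(6,7))
  qed
 qed
qed

text \<open>Stated as a relation between families of frames, so that it covers both pulling back
  along \<open>kappa\<close> and undoing a pullback along the inverse.\<close>

definition pulls :: "('b set\<times>('b => real^'p^'p)) set => ('a set\<times>('a => real^'p^'p)) set => bool" where
 "pulls FF FE \<longleftrightarrow> (\<forall>V B. (V, B)\<in>FF --> (\<exists>U A. (U, A)\<in>FE \<and> (\<forall>x\<in>points M. (kappa x\<in>V --> x\<in>U) \<and> A x = B (kappa x))))"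

lemma pulls_pullback: "pulls FF (pullback_frames M kappa FF)"
 unfolding pulls_def
proof (intro allI impI)
 fix V B assume "(V, B)\<in>FF"
 hence "({x\<in>points M. kappa x\<in>V}, %x. B (kappa x))\<in>pullback_frames M kappa FF" by (auto simp: pullback_frames_def)
 thus "\<exists>U A. (U, A)\<in>pullback_frames M kappa FF \<and> (\<forall>x\<in>points M. (kappa x\<in>V --> x\<in>U) \<and> A x = B (kappa x))" by blast
qed

lemma pulls_inverse: "pulls (pullback_frames N eta FE) FE"
 unfolding pulls_def
proof (intro allI impI)
 fix V B assume "(V, B)\<in>pullback_frames N eta FE"
 then obtain U A where "(U, A)\<in>FE" "V = {y\<in>points N. eta y\<in>U}" "B = (%y. A (eta y))" by (auto simp: pullback_frames_def)
 thus "\<exists>U A. (U, A)\<in>FE \<and> (\<forall>x\<in>points M. (kappa x\<in>V --> x\<in>U) \<and> A x = B (kappa x))"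
  by (intro exI[of _ U] exI[of _ A]) (simp add: etakappa)
qed

lemma smooth_hom_pull:
 assumes m: "smooth_hom N FF HH m (kappa x)" and x: "x\<in>points M" and FE: "pulls FF FE" and HE: "pulls HH HE"
 shows "smooth_hom M FE HE (%z. m (kappa z)) x"
proof -
 obtain U A V B where *: "(U, A)\<in>FF" "(V, B)\<in>HH" "kappa x\<in>U" "kappa x\<in>V" "smooth_fun N (%z. B z**m z**minv (A z)) (kappa x)"
  using m by (auto simp: smooth_hom_def)
 obtain U' A' where U: "(U', A')\<in>FE" "\<forall>z\<in>points M. (kappa z\<in>U --> z\<in>U') \<and> A' z = A (kappa z)"
  using FE *(1) unfolding pulls_def by metis
 obtain V' B' where V: "(V', B')\<in>HE" "\<forall>z\<in>points M. (kappa z\<in>V --> z\<in>V') \<and> B' z = B (kappa z)"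
  using HE *(2) unfolding pulls_def by metis
 have "smooth_fun M (%z. B' z**m (kappa z)**minv (A' z)) x"
  by (rule smooth_at_cong[OF smooth_fun_pull[OF *(5) x] aM openin_topspace x]) (use U V in simp)
 thus ?thesis unfolding smooth_hom_def using U V *(3,4) x by blast
qed

end

section \<open>Bundle isomorphisms\<close>

locale bundle_pair = manifold_iso M N kappa eta + B1: vbundle E M + B2: vbundle F N
 for E :: "('a, 'm::real_normed_vector, 'e, 'n::finite) vector_bundle" and M :: "('a, 'm) manifold"
  and F :: "('b, 'k::real_normed_vector, 'f, 'p::finite) vector_bundle" and N :: "('b, 'k) manifold" and kappa eta
begin

lemma inverse_pair: "bundle_pair F N E M eta kappa"
 using inverse B1.vbundle_axioms B2.vbundle_axioms by (simp add: bundle_pair_def)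

definition bundle_map :: "('a => real^'n^'p) => 'e => 'f" where
 "bundle_map G e = B2.pt (kappa (proj E e)) (G (proj E e) *v B1.crd (proj E e) e)"

lemma bundle_map_fibre: "e\<in>points (total E) ==> bundle_map G e\<in>fibre F (kappa (proj E e))"
 unfolding bundle_map_def by (rule B2.pt(1)[OF maps(1)[OF B1.proj_points]])

lemma bundle_map_crd: "x\<in>points M ==> e\<in>fibre E x ==> B2.crd (kappa x) (bundle_map G e) = G x *v B1.crd x e"
 unfolding bundle_map_def using B2.pt(2)[OF maps(1)] by (simp add: B1.fibreD)

text \<open>In trivializations the map is a smooth matrix applied to the fibre vector; the arbitrary
  fibre coordinates cancel.\<close>

lemma bundle_map_smooth:
 assumes e: "e\<in>points (total E)" and G: "smooth_hom M B1.Fr (pullback_frames M kappa B2.Fr) G (proj E e)"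
 shows "smooth_at (total E) (total F) (bundle_map G) e"
proof -
 let ?x = "proj E e"
 obtain U A V B where A: "(U, A)\<in>B1.Fr" "?x\<in>U" and B: "(V, B)\<in>B2.Fr" "kappa ?x\<in>V"
  and s: "smooth_fun M (%z. B (kappa z)**G z**minv (A z)) ?x"
  using G by (auto simp: smooth_hom_def pullback_frames_def)
 obtain tau where t: "A = B1.frm tau" "B1.triv U tau" using A(1) by (auto simp: B1.Fr_def)
 obtain tau' where t': "B = B2.frm tau'" "B2.triv V tau'" using B(1) by (auto simp: B2.Fr_def)
 have xM: "?x\<in>points M" by (rule B1.proj_points[OF e])
 have aE: "atlas (total E)" by (rule B1.total_atlas)
 let ?W = "{x\<in>points M. kappa x\<in>V}\<inter>U"
 have oW: "opn M ?W" using preimage_open[OF B2.triv_open[OF t'(2)]] B1.triv_open[OF t(2)] by (rule openin_Int)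
 have g: "smooth_at (total E) N (%e. kappa (proj E e)) e"
  by (rule smooth_at_compose[OF aE aM aN B1.proj_smooth_at[OF e] kappa[OF xM]])
 have "smooth_fun (total E) (%e. B (kappa (proj E e))**G (proj E e)**minv (A (proj E e))) e"
  by (rule smooth_at_compose[OF aE aM atlas_model_euclidean B1.proj_smooth_at[OF e] s])
 moreover have "smooth_fun (total E) tau e" by (rule B1.triv_smooth[OF t(2)]) (use e A in simp)
 ultimately have "smooth_fun (total E) (%e. (B (kappa (proj E e))**G (proj E e)**minv (A (proj E e))) *v tau e) e"
  by (rule smooth_fun_matrix_vector[OF aE])
 hence "smooth_at (total E) (total F) (%e. B2.lift_triv V tau' (kappa (proj E e), (B (kappa (proj E e))**G (proj E e)**minv (A (proj E e))) *v tau e)) e"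
  by (rule B2.lift_triv_smooth[OF t'(2) aE g _ B(2)])
 thus ?thesis
 proof (rule smooth_at_cong[OF _ aE B1.part_over_open[OF oW]])
  show "e\<in>{e\<in>points (total E). proj E e\<in>?W}" using e A B xM by simp
  fix d assume d: "d\<in>{e\<in>points (total E). proj E e\<in>?W}"
  let ?z = "proj E d"
  have z: "?z\<in>U" "kappa ?z\<in>V" "?z\<in>points M" and df: "d\<in>fibre E ?z" using d by (auto simp: fibre_def)
  have "tau d = A ?z *v B1.crd ?z d" using B1.frm(1)[OF t(2) z(1) df] t(1) by simp
  hence "(B (kappa ?z)**G ?z**minv (A ?z)) *v tau d = (B (kappa ?z)**(G ?z**(minv (A ?z)**A ?z))) *v B1.crd ?z d"
   by (simp only: mv_assoc matrix_mul_assoc)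
  also have "\<dots> = B (kappa ?z) *v (G ?z *v B1.crd ?z d)"
   by (simp add: B1.fr.frame_inv[OF A(1) z(1)] mv_assoc)
  also have "\<dots> = B (kappa ?z) *v B2.crd (kappa ?z) (bundle_map G d)" by (simp add: bundle_map_crd[OF z(3) df])
  also have "\<dots> = tau' (bundle_map G d)"
   using B2.frm(1)[OF t'(2) z(2) bundle_map_fibre] d t'(1) by simp
  finally have "(B (kappa ?z)**G ?z**minv (A ?z)) *v tau d = tau' (bundle_map G d)" .
  thus "B2.lift_triv V tau' (kappa ?z, (B (kappa ?z)**G ?z**minv (A ?z)) *v tau d) = bundle_map G d"
   using B2.lift_triv(3)[OF t'(2) z(2) bundle_map_fibre] d by simp
 qed
qed

lemma bundle_map_inverse:
 assumes H: "!!x. x\<in>points M ==> H (kappa x)**G x = mat 1" and e: "e\<in>points (total E)"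
 shows "bundle_pair.bundle_map F N E M eta H (bundle_map G e) = e"
proof (rule B1.crd_eqI[where x = "proj E e"])
 interpret I: bundle_pair F N E M eta kappa by (rule inverse_pair)
 let ?x = "proj E e"
 have x: "?x\<in>points M" and ef: "e\<in>fibre E ?x" using B1.proj_points[OF e] e by (auto simp: fibre_def)
 show "?x\<in>points M" "e\<in>fibre E ?x" by (fact x ef)+
 have b: "bundle_map G e\<in>points (total F)" "proj F (bundle_map G e) = kappa ?x"
  using bundle_map_fibre[OF e, of G] by (auto simp: fibre_def)
 show "I.bundle_map H (bundle_map G e)\<in>fibre E ?x" using I.bundle_map_fibre[OF b(1)] b(2) etakappa[OF x] by simp
 show "B1.crd ?x (I.bundle_map H (bundle_map G e)) = B1.crd ?x e"
  using I.bundle_map_crd[OF maps(1)[OF x] bundle_map_fibre[OF e], of H G]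
  by (simp add: etakappa[OF x] bundle_map_crd[OF x ef] mv_assoc H[OF x])
qed

lemma vector_bundle_iso_bundle_map:
 assumes card: "CARD('n) = CARD('p)"
  and G: "!!x. x\<in>points M ==> invertible (G x)" "!!x. x\<in>points M ==> smooth_hom M B1.Fr (pullback_frames M kappa B2.Fr) G x"
 shows "vector_bundle_iso E M F N (bundle_map G) kappa"
proof -
 interpret I: bundle_pair F N E M eta kappa by (rule inverse_pair)
 let ?H = "%y. minv (G (eta y))"
 have G': "smooth_hom N B2.Fr (pullback_frames N eta B1.Fr) ?H y" if y: "y\<in>points N" for y
  by (rule I.smooth_hom_pull[OF smooth_hom_inverse[OF B1.fr.frames_self frames_pullback[OF B2.fr.frames_self] G(2,1)] y I.pulls_inverse I.pulls_pullback])
   (rule maps(2)[OF y])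
 note iG = invertible_matrix_inv[OF G(1)]
 interpret T: manifold_iso "total E" "total F" "bundle_map G" "I.bundle_map ?H"
 proof
  show "smooth_manifold (total E)" "smooth_manifold (total F)" by (fact B1.total_manifold B2.total_manifold)+
  show "smooth_at (total E) (total F) (bundle_map G) e" if "e\<in>points (total E)" for e
   by (rule bundle_map_smooth[OF that G(2)[OF B1.proj_points[OF that]]])
  show "smooth_at (total F) (total E) (I.bundle_map ?H) f" if "f\<in>points (total F)" for f
   by (rule I.bundle_map_smooth[OF that G'[OF B2.proj_points[OF that]]])
  show "I.bundle_map ?H (bundle_map G e) = e" if "e\<in>points (total E)" for e
   by (rule bundle_map_inverse[OF _ that]) (simp add: etakappa iG)
  show "bundle_map G (I.bundle_map ?H f) = f" if "f\<in>points (total F)" for f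
   by (rule I.bundle_map_inverse[OF _ that]) (simp add: iG maps(2))
 qed
 show ?thesis unfolding vector_bundle_iso_def
 proof (intro conjI ballI allI)
  show "diffeomorphism (total E) (total F) (bundle_map G)" by (rule T.diffeomorphism)
  show "diffeomorphism M N kappa" by (rule diffeomorphism)
  show "proj F (bundle_map G e) = kappa (proj E e)" if "e\<in>points (total E)" for e
   using bundle_map_fibre[OF that] by (simp add: fibre_def)
  fix x e e' c assume x: "x\<in>points M" and e: "e\<in>fibre E x" "e'\<in>fibre E x"
  have bf: "bundle_map G d\<in>fibre F (kappa x)" if "d\<in>fibre E x" for d using bundle_map_fibre[of d G] that by (simp add: fibre_def)
  note fc = B1.fibre_closed[OF x e] and fd = B2.fibre_closed[OF maps(1)[OF x] bf[OF e(1)] bf[OF e(2)]]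
  show "bundle_map G (fadd E e e') = fadd F (bundle_map G e) (bundle_map G e')"
   by (rule B2.crd_eqI[OF maps(1)[OF x] bf[OF fc(1)] fd(1)])
    (simp add: bundle_map_crd[OF x fc(1)] bundle_map_crd[OF x e(1)] bundle_map_crd[OF x e(2)] B1.crd_linear[OF x e]
     B2.crd_linear[OF maps(1)[OF x] bf[OF e(1)] bf[OF e(2)]] matrix_vector_right_distrib)
  show "bundle_map G (fscale E c e) = fscale F c (bundle_map G e)"
   by (rule B2.crd_eqI[OF maps(1)[OF x] bf[OF fc(2)] fd(2)])
    (simp add: bundle_map_crd[OF x fc(2)] bundle_map_crd[OF x e(1)] B1.crd_linear[OF x e]
     B2.crd_linear[OF maps(1)[OF x] bf[OF e(1)] bf[OF e(2)]] matrix_vector_mult_scaleR)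
 qed
qed

end

section \<open>From an isomorphism of Poisson algebras to a bundle isomorphism\<close>

locale bundle_poisson = B1: vbundle E M + B2: vbundle F N +
 iso: diff_algebra_iso "End_sections E M" "multiplication_op E M ` Cinf M" "points M" "vbundle.gval E M"
  "End_sections F N" "multiplication_op F N ` Cinf N" "points N" "vbundle.gval F N" h k
 for E :: "('a, 'm::real_normed_vector, 'e, 'n::finite) vector_bundle" and M :: "('a, 'm) manifold"
  and F :: "('b, 'k::real_normed_vector, 'f, 'p::finite) vector_bundle" and N :: "('b, 'k) manifold" and h k
begin

lemma swapped: "bundle_poisson F N E M k h"
 using iso.inverse B1.vbundle_axioms B2.vbundle_axioms by (simp add: bundle_poisson_def)

lemma psi_function:
 assumes "u\<in>Cinf M" obtains w where "w\<in>Cinf N" "iso.psi (B1.gam u) = B2.gam w"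
 using iso.psi_U[of "B1.gam u"] assms by blast

text \<open>\<open>psi\<close> followed by evaluation at \<open>y\<close> is a character of the
  functions on \<open>M\<close>.\<close>

lemma point_map_exists:
 assumes y: "y\<in>points N"
 shows "\<exists>x\<in>points M. \<forall>u\<in>Cinf M. B2.gval y (iso.psi (B1.gam u)) = u x"
proof (rule character_is_evaluation[OF B1.base_manifold])
 note g = B1.gam_arith[symmetric]
 fix u v assume uv: "u\<in>Cinf M" "v\<in>Cinf M"
 have U: "B1.gam u\<in>B1.UE" "B1.gam v\<in>B1.UE" using uv by simp_all
 show "B2.gval y (iso.psi (B1.gam (%x. u x + v x))) = B2.gval y (iso.psi (B1.gam u)) + B2.gval y (iso.psi (B1.gam v))"
  unfolding g(1)[OF uv] iso.psi_add[OF U] by (rule B2.alg.ev_add[OF y iso.psi_U[OF U(1)] iso.psi_U[OF U(2)]])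
 show "B2.gval y (iso.psi (B1.gam (%x. u x * v x))) = B2.gval y (iso.psi (B1.gam u)) * B2.gval y (iso.psi (B1.gam v))"
  unfolding g(2)[OF uv] iso.psi_mult[OF U] by (rule B2.alg.ev_mult[OF y iso.psi_U[OF U(1)] iso.psi_U[OF U(2)]])
 show "B2.gval y (iso.psi (B1.gam u)) = B2.gval y (iso.psi (B1.gam v))" if "\<forall>x\<in>points M. u x = v x"
  using B1.gam_eqI[OF uv] that by simp
next
 fix c
 have "B1.gam (%x. c) = c \<odot>\<^bsub>B1.EndE\<^esub> \<one>\<^bsub>B1.EndE\<^esub>"
  unfolding B1.gam_arith(4) B1.gam_arith(3)[OF B1.const_smooth] by simp
 hence "iso.psi (B1.gam (%x. c)) = c \<odot>\<^bsub>B2.EndE\<^esub> \<one>\<^bsub>B2.EndE\<^esub>"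
  by (simp add: iso.psi_smult[OF B1.alg.U_one] iso.psi_one)
 thus "B2.gval y (iso.psi (B1.gam (%x. c))) = c"
  by (simp add: B2.alg.ev_smult[OF y B2.alg.U_one] B2.alg.ev_one[OF y])
qed

definition eta :: "'b => 'a" where
 "eta y = (SOME x. x\<in>points M \<and> (\<forall>u\<in>Cinf M. B2.gval y (iso.psi (B1.gam u)) = u x))"

lemma eta:
 assumes y: "y\<in>points N"
 shows "eta y\<in>points M" "u\<in>Cinf M ==> B2.gval y (iso.psi (B1.gam u)) = u (eta y)"
 using someI_ex[of "%x. x\<in>points M \<and> (\<forall>u\<in>Cinf M. B2.gval y (iso.psi (B1.gam u)) = u x)"] point_map_exists[OF y]
 unfolding eta_def by blast+

lemma eta_function:
 assumes u: "u\<in>Cinf M" shows "(%y. u (eta y))\<in>Cinf N"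
proof -
 obtain w where w: "w\<in>Cinf N" "iso.psi (B1.gam u) = B2.gam w" using psi_function[OF u] by metis
 have e: "w y = u (eta y)" if "y\<in>points N" for y using eta(2)[OF that u] w B2.gval_gam[OF w(1) that] by simp
 show ?thesis unfolding smooth_functions_iff[OF B2.base_atlas]
 proof
  fix y assume y: "y\<in>points N"
  have "smooth_fun N w y" using w(1) y smooth_functions_iff[OF B2.base_atlas] by blast
  thus "smooth_fun N (%y. u (eta y)) y"
   by (rule smooth_at_cong[OF _ B2.base_atlas openin_topspace y]) (simp add: e)
 qed
qed

lemma eta_smooth: "y\<in>points N ==> smooth_at N M eta y"
 by (rule smooth_at_from_functions[OF B2.base_manifold B1.base_manifold]) (use eta(1) eta_function in auto)

lemma psi_gam:
 assumes u: "u\<in>Cinf M" shows "iso.psi (B1.gam u) = B2.gam (%y. u (eta y))"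
proof -
 obtain w where w: "w\<in>Cinf N" "iso.psi (B1.gam u) = B2.gam w" using psi_function[OF u] by metis
 have e: "w y = u (eta y)" if "y\<in>points N" for y using eta(2)[OF that u] w B2.gval_gam[OF w(1) that] by simp
 show ?thesis unfolding w(2) by (rule B2.gam_eqI[OF w(1) eta_function[OF u] e])
qed

text \<open>Not formal, since components of degree 0 are cut out on both sides; it rests on
  \<open>psi_inverse\<close>, that is, on purity of functions.\<close>

lemma psi_psi:
 assumes v: "v\<in>B1.UE" shows "diff_algebra_iso.psi B2.EndE B2.UE B1.EndE B1.UE k (iso.psi v) = v"
proof -
 interpret inv: bundle_poisson F N E M k h by (rule swapped)
 have f: "B2.alg.emb 0 (iso.psi v)\<in>B2.alg.fam" by (rule B2.alg.emb_fam_U[OF iso.psi_U[OF v]])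
 show ?thesis unfolding inv.iso.psi_def
  by (rule iso.psi_inverse[OF v inv.iso.lift(1)[OF f] inv.iso.lift(2)[OF f, symmetric]])
qed

lemma eta_eta:
 assumes x: "x\<in>points M" shows "eta (bundle_poisson.eta F N E M k x) = x"
proof -
 interpret inv: bundle_poisson F N E M k h by (rule swapped)
 note y = inv.eta(1)[OF x]
 show ?thesis
 proof (rule smooth_functions_separate[OF B1.base_manifold eta(1)[OF y] x])
  fix u assume u: "u\<in>Cinf M"
  have "u (eta (inv.eta x)) = B1.gval x (inv.iso.psi (B2.gam (%y. u (eta y))))"
   using inv.eta(2)[OF x eta_function[OF u]] by simp
  also have "\<dots> = B1.gval x (B1.gam u)" using psi_psi[of "B1.gam u"] u by (simp add: psi_gam[OF u])
  finally show "u (eta (inv.eta x)) = u x" using B1.gval_gam[OF u x] by simp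
 qed
qed

text \<open>The point map of the inverse isomorphism; it inverts \<open>eta\<close> because smooth
  functions separate points.\<close>

definition kappa :: "'a => 'b" where "kappa = bundle_poisson.eta F N E M k"

lemma pair: "bundle_pair E M F N kappa eta"
proof -
 interpret inv: bundle_poisson F N E M k h by (rule swapped)
 show ?thesis
 proof
  show "smooth_at M N kappa x" if "x\<in>points M" for x unfolding kappa_def by (rule inv.eta_smooth[OF that])
  show "eta (kappa x) = x" if "x\<in>points M" for x unfolding kappa_def by (rule eta_eta[OF that])
  show "kappa (eta y) = y" if "y\<in>points N" for y unfolding kappa_def by (rule inv.eta_eta[OF that, folded eta_def])
 qed (auto intro: B1.base_manifold B2.base_manifold eta_smooth)
qed

sublocale pr: bundle_pair E M F N kappa eta by (rule pair)

abbreviation FP :: "('a set\<times>('a => real^'p^'p)) set" where "FP \<equiv> pullback_frames M kappa B2.Fr"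

text \<open>\<open>theta\<close> relates fields over different bases; reading its values at
  \<open>kappa x\<close> brings both to \<open>M\<close>.\<close>

definition transfer :: "('a => real^'n^'n) => 'a => real^'p^'p" where
 "transfer m = (%x. B2.mat_of (iso.theta (B1.op_of m)) (kappa x))"

lemma transfer_field_map: "field_map M B1.Fr FP transfer"
proof -
 have FP: "frames M FP" by (rule pr.frames_pullback[OF B2.fr.frames_self])
 interpret FP: frames M FP by (rule FP)
 note [simp del] = B1.alg.Dn.simps B2.alg.Dn.simps
 note [simp] = B1.K_simps B2.K_simps B1.fr.field_scaleR B1.fr.field_add B1.fr.field_lie B1.fr.field_scal
  iso.theta_lift(2) iso.psi_U pr.maps(1)
 have op: "B1.fr.field S ==> B1.fr.field T ==> B1.op_of (%z. S z + T z) = B1.op_of S \<oplus>\<^bsub>B1.EndE\<^esub> B1.op_of T"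
  "B1.fr.field S ==> B1.fr.field T ==> B1.op_of (%z. lie (S z) (T z)) = commutator B1.EndE (B1.op_of S) (B1.op_of T)"
  "u\<in>Cinf M ==> B1.fr.field T ==> B1.op_of (%z. u z *R T z) = B1.gam u \<otimes>\<^bsub>B1.EndE\<^esub> B1.op_of T"
  "u\<in>Cinf M ==> B1.op_of (%z. scal (u z)) = B1.gam u" for S T u
  by (rule B1.K_ext; simp)+
 have psi_mat: "B2.mat_of (B2.gam (%y. u (eta y)) \<otimes>\<^bsub>B2.EndE\<^esub> T) (kappa x) = u x *R B2.mat_of T (kappa x)"
  if "u\<in>Cinf M" "T\<in>B2.alg.Dn 0" "x\<in>points M" for u T x
  using that eta_function[OF that(1)] by (simp add: pr.etakappa)
 show ?thesis
 proof
  fix T assume T: "B1.fr.field T"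
  show "FP.field (transfer T)" unfolding transfer_def
   using pr.smooth_hom_pull[OF _ _ pr.pulls_pullback pr.pulls_pullback] B2.mat_of(1)[OF iso.theta_lift(2)[OF B1.op_of(1)[OF T]]] pr.maps(1) by blast
  fix x assume x: "x\<in>points M"
  {
   fix u assume u: "u\<in>Cinf M"
   show "transfer (%z. u z *R T z) x\<asymp>u x *R transfer T x"
    using B2.U_diff[OF _ _ iso.theta_mult[of "B1.gam u" "B1.op_of T"], of "kappa x"] u T x eta_function[OF u]
    by (simp add: transfer_def op psi_gam psi_mat del: B2.mat_of_ops)
  }
  fix S assume S: "B1.fr.field S"
  show "transfer (%z. S z + T z) x\<asymp>transfer S x + transfer T x"
   using B2.U_diff[OF _ _ iso.theta_add[of "B1.op_of S" "B1.op_of T"], of "kappa x"] S T x by (simp add: transfer_def op)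
  show "transfer (%z. lie (S z) (T z)) x\<asymp>lie (transfer S x) (transfer T x)"
   using B2.U_diff[OF _ _ iso.theta_cmt[of "B1.op_of S" "B1.op_of T"], of "kappa x"] S T x by (simp add: transfer_def op)
 next
  fix u x assume u: "u\<in>Cinf M" and x: "x\<in>points M"
  thus "transfer (%z. scal (u z)) x\<asymp>0"
   using B2.U_iff[OF B2.alg.U_K[OF iso.theta_U[of "B1.gam u"]]] iso.theta_U[of "B1.gam u"] by (simp add: transfer_def op)
 next
  fix e :: "'n => 'n => 'a => real^'n^'n" and b and a' :: "'a => real^'p^'p" and x
  assume e: "!!i j. B1.fr.field (e i j)" and b: "b\<in>Cinf M"
   and cas: "!!a x. B1.fr.field a ==> x\<in>points M ==>
    (\<Sum>i\<in>UNIV. \<Sum>j\<in>UNIV. lie (e i j x) (lie (e j i x) (a x)))\<asymp>b x *R a x"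
   and a': "FP.field a'" and x: "x\<in>points M"
  \<comment> \<open>Pairs of indices form a single index set; the second family carries the
    transposed pair, as in the Casimir sum.\<close>
  let ?e = "%p. B1.op_of (e (fst p) (snd p))" and ?f = "%p. B1.op_of (e (snd p) (fst p))" and ?a = "%y. a' (eta y)"
  have eK: "?e p\<in>B1.alg.Dn 0" "?f p\<in>B1.alg.Dn 0" for p by (rule B1.op_of(1)[OF e])+
  have bN: "(%y. b (eta y))\<in>Cinf N" and gb: "B1.gam b\<in>B1.UE" using eta_function[OF b] b by simp_all
  have KE: "B1.alg.casimir UNIV ?e ?f T \<ominus>\<^bsub>B1.EndE\<^esub> B1.gam b \<otimes>\<^bsub>B1.EndE\<^esub> T\<in>B1.UE" if T: "T\<in>B1.alg.Dn 0" for T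
   unfolding B1.casimir_iff[OF eK b T finite] using cas[OF B1.mat_of(1)[OF T]] by (simp add: e sum.cartesian_product case_prod_beta)
  interpret I: manifold_iso N M eta kappa by (rule pr.inverse)
  have a: "B2.fr.field ?a"
   using I.smooth_hom_pull[OF _ _ I.pulls_inverse I.pulls_inverse] a' eta(1) by blast
  note T = B2.op_of(1)[OF a]
  have "\<forall>y\<in>points N. (\<Sum>p\<in>UNIV. lie (B2.mat_of (iso.theta (?e p)) y) (lie (B2.mat_of (iso.theta (?f p)) y) (B2.mat_of (B2.op_of ?a) y)))
  \<asymp>b (eta y) *R B2.mat_of (B2.op_of ?a) y"
   using iso.theta_casimir[OF finite eK gb KE T]
   unfolding psi_gam[OF b] B2.casimir_iff[OF iso.theta_lift(2)[OF eK(1)] iso.theta_lift(2)[OF eK(2)] bN T finite] by blast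
  from this[rule_format, OF pr.maps(1)[OF x]]
  show "(\<Sum>i\<in>UNIV. \<Sum>j\<in>UNIV. lie (transfer (e i j) x) (lie (transfer (e j i) x) (a' x)))\<asymp>b x *R a' x"
   using x by (simp add: sum.cartesian_product case_prod_beta transfer_def a pr.etakappa)
 qed
qed

lemma card_le:
 assumes "points M ~= {}" "CARD('p)\<ge>2" shows "CARD('n)\<le>CARD('p)"
 using field_map.card_le[OF transfer_field_map] assms by blast

theorem bundles_isomorphic:
 assumes n: "CARD('n)\<ge>2" and p: "CARD('p)\<ge>2" and H1: "trivial_group (cohomology_group 1 (mtop M))"
 shows "vector_bundles_isomorphic E M F N"
proof (cases "points M = {}")
 \<comment> \<open>Over an empty base the total spaces are empty too and any function is a bundle
   isomorphism. No point is available at which to compare the ranks.\<close>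
 case True
 have N: "points N = {}" using eta(1) True by blast
 have T: "points (total E) = {}" "points (total F) = {}" using B1.proj_points B2.proj_points True N by blast+
 have "diffeomorphism (total E) (total F) (%_. undefined)"
  unfolding diffeomorphism_def smooth_map_iff[OF B1.total_atlas B2.total_atlas] smooth_map_iff[OF B2.total_atlas B1.total_atlas]
  by (simp add: T bij_betw_def)
 hence "vector_bundle_iso E M F N (%_. undefined) kappa"
  using pr.diffeomorphism by (simp add: vector_bundle_iso_def T True)
 thus ?thesis unfolding vector_bundles_isomorphic_def by blast
next
 case False
 interpret inv: bundle_poisson F N E M k h by (rule swapped)
 have "points N ~= {}" using pr.maps(1) False by blast
 \<comment> \<open>\<open>theta\<close> bounds one rank by the other, and the inverse isomorphism
   yields the opposite bound.\<close>
 hence card: "CARD('n) = CARD('p)" using card_le[OF False p] inv.card_le[OF _ n] by simp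
 obtain G where G: "!!x. x\<in>points M ==> invertible (G x)" "!!x. x\<in>points M ==> smooth_hom M B1.Fr FP G x"
  using field_map.smooth_intertwiner_exists[OF transfer_field_map card p H1] by blast
 have "vector_bundle_iso E M F N (pr.bundle_map G) kappa" by (rule pr.vector_bundle_iso_bundle_map[OF card G])
 thus ?thesis unfolding vector_bundles_isomorphic_def by blast
qed

end

section \<open>From a bundle isomorphism to an isomorphism of Poisson algebras\<close>

locale diff_algebra_hom = A: diff_algebra R U Omega ev + B: diff_algebra R' U' Omega' ev'
 for R :: "(real, 't) module" (structure) and U :: "'t set" and Omega :: "'x set" and ev
  and R' :: "(real, 's) module" and U' :: "'s set" and Omega' :: "'y set" and ev' +
 fixes H :: "'t => 's"
 assumes bij: "bij_betw H (carrier R) (carrier R')"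
  and H_add: "T\<in>carrier R ==> D\<in>carrier R ==> H (T\<oplus>D) = H T \<oplus>\<^bsub>R'\<^esub> H D"
  and H_mult: "T\<in>carrier R ==> D\<in>carrier R ==> H (T\<otimes>D) = H T \<otimes>\<^bsub>R'\<^esub> H D"
  and H_smult: "T\<in>carrier R ==> H (c\<odot>T) = c \<odot>\<^bsub>R'\<^esub> H T"
  and H_U: "H ` U = U'"
begin

lemma H_carrier: "T\<in>carrier R ==> H T\<in>carrier R'" using bij bij_betwE by blast

lemma H_inj: "T\<in>carrier R ==> D\<in>carrier R ==> H T = H D \<longleftrightarrow> T = D"
 using bij by (auto simp: bij_betw_def inj_on_def)

lemma H_surj: "T'\<in>carrier R' ==> \<exists>T\<in>carrier R. T' = H T" using bij by (auto simp: bij_betw_def)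

lemma H_zero: "H \<zero> = \<zero>\<^bsub>R'\<^esub>"
 using H_smult[of "\<zero>" 0] H_carrier[of "\<zero>"] by simp

lemma H_minus: assumes "T\<in>carrier R" "D\<in>carrier R" shows "H (T\<ominus>D) = H T \<ominus>\<^bsub>R'\<^esub> H D"
proof -
 have "T\<ominus>D = T\<oplus>(-1)\<odot>D" using assms by (simp add: A.minus_eq A.smult_minus_one)
 thus ?thesis using assms H_carrier by (simp add: H_add H_smult B.minus_eq B.smult_minus_one)
qed

lemma H_cmt: "T\<in>carrier R ==> D\<in>carrier R ==> H (A.cmt T D) = B.cmt (H T) (H D)"
 by (simp add: commutator_def H_minus H_mult)

lemma H_finsum: "finite I ==> (!!i. i\<in>I ==> g i\<in>carrier R) ==> H (finsum R g I) = finsum R' (%i. H (g i)) I"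
proof (induction I rule: finite_induct)
 case empty thus ?case by (simp add: H_zero)
next
 case (insert i I)
 have c: "g\<in>I \<rightarrow> carrier R" "g i\<in>carrier R" "(%i. H (g i))\<in>I \<rightarrow> carrier R'" "H (g i)\<in>carrier R'"
  using insert.prems H_carrier by auto
 have "H (finsum R g (insert i I)) = H (g i\<oplus>finsum R g I)" using insert.hyps c by simp
 also have "\<dots> = H (g i) \<oplus>\<^bsub>R'\<^esub> H (finsum R g I)" by (rule H_add[OF c(2)]) (rule A.finsum_closed[OF c(1)])
 also have "\<dots> = finsum R' (%i. H (g i)) (insert i I)" using insert c by simp
 finally show ?case .
qed

text \<open>The filtration is built from \<open>U\<close> and commutators with it, so an algebra
  isomorphism that takes \<open>U\<close> to \<open>U'\<close> preserves it.\<close>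

lemma H_Pn: "T\<in>carrier R ==> H T\<in>B.Pn i \<longleftrightarrow> T\<in>A.Pn i"
proof (induction i arbitrary: T)
 case 0
 have "T\<in>U" if hu: "H T\<in>U'"
 proof -
  obtain u where u: "u\<in>U" "H T = H u" using hu H_U by blast
  thus ?thesis using H_inj[OF 0, of u] by simp
 qed
 thus ?case using H_U by auto
next
 case (Suc i)
 have "(\<forall>u'\<in>U'. B.cmt (H T) u'\<in>B.Pn i) \<longleftrightarrow> (\<forall>u\<in>U. B.cmt (H T) (H u)\<in>B.Pn i)" using H_U by blast
 also have "\<dots> \<longleftrightarrow> (\<forall>u\<in>U. A.cmt T u\<in>A.Pn i)"
  using Suc.IH[of "A.cmt T _"] Suc.prems H_cmt by (metis A.cmt_closed A.in_carrier)
 finally show ?case using Suc.prems H_carrier by simp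
qed

lemma H_P: "T\<in>carrier R ==> H T\<in>B.P i \<longleftrightarrow> T\<in>A.P i"
 using H_Pn H_inj[of T "\<zero>"] by (simp add: A.P_def B.P_def H_zero)

lemma H_symbol: assumes T: "T\<in>carrier R" shows "H ` A.symb i T = B.symb i (H T)"
proof (rule Set.set_eqI)
 fix Z
 show "Z\<in>H ` A.symb i T \<longleftrightarrow> Z\<in>B.symb i (H T)"
 proof
  assume "Z\<in>H ` A.symb i T"
  then obtain D where D: "Z = H D" "D\<in>carrier R" "D\<ominus>T\<in>A.P (i - 1)" using A.symbol_iff[OF T] by auto
  thus "Z\<in>B.symb i (H T)"
   using B.symbol_iff[OF H_carrier[OF T]] H_carrier H_minus[OF D(2) T] H_P[of "D\<ominus>T"] T by simp
 next
  assume "Z\<in>B.symb i (H T)"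
  hence Z: "Z\<in>carrier R'" "Z \<ominus>\<^bsub>R'\<^esub> H T\<in>B.P (i - 1)" using B.symbol_iff[OF H_carrier[OF T]] by auto
  obtain D where D: "D\<in>carrier R" "Z = H D" using H_surj[OF Z(1)] by blast
  hence "D\<ominus>T\<in>A.P (i - 1)" using Z(2) H_minus[OF D(1) T] H_P[of "D\<ominus>T"] T by simp
  thus "Z\<in>H ` A.symb i T" using A.symbol_iff[OF T] D by blast
 qed
qed

definition gr_map :: "(int => 't set) => int => 's set" where "gr_map x = (%i. H ` x i)"

lemma H_fam: assumes T: "T\<in>A.fam" shows "(%i. H (T i))\<in>B.fam"
proof -
 have "{i. H (T i) ~= \<zero>\<^bsub>R'\<^esub>}\<subseteq>{i. T i ~= \<zero>}" using H_zero by auto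
 hence "finite {i. H (T i) ~= \<zero>\<^bsub>R'\<^esub>}" using A.famD(3)[OF T] by (rule finite_subset)
 thus ?thesis using A.famD(1,2)[OF T] H_P by (simp add: B.fam_def)
qed

lemma gr_map_cls: "T\<in>A.fam ==> gr_map (A.cls T) = B.cls (%i. H (T i))"
 unfolding gr_map_def A.cls_def B.cls_def using H_symbol A.famD(2) by blast

lemma fam_surj: assumes T': "T'\<in>B.fam" obtains T where "T\<in>A.fam" "T' = (%i. H (T i))"
proof -
 obtain T where T: "!!i. T i\<in>carrier R" "!!i. T' i = H (T i)" using H_surj[OF B.famD(2)[OF T']] by metis
 have "{i. T i ~= \<zero>}\<subseteq>{i. T' i ~= \<zero>\<^bsub>R'\<^esub>}"
  using H_inj[OF T(1) A.zero_closed] by (auto simp: T(2) H_zero)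
 hence "finite {i. T i ~= \<zero>}" using B.famD(3)[OF T'] by (rule finite_subset)
 moreover have "T i\<in>A.P i" for i using H_P[OF T(1)] B.famD(1)[OF T', of i] by (simp add: T(2))
 ultimately have "T\<in>A.fam" by (simp add: A.fam_def)
 thus thesis using that T(2) by blast
qed

lemma prd_H:
 assumes T: "T\<in>A.fam" and D: "D\<in>A.fam" and p: "A.graded_op p c"
  and H: "!!T D. T\<in>carrier R ==> D\<in>carrier R ==> H (p T D) = q (H T) (H D)"
 shows "(%k. H (A.prd p c T D k)) = B.prd q c (%i. H (T i)) (%i. H (D i))"
 using A.P_carrier[OF A.prd_closed[OF p T D]] unfolding A.prd_def B.prd_def
 by (simp add: fun_eq_iff H_finsum H A.famD(2)[OF T] A.famD(2)[OF D])

lemma poisson_iso: "poisson_algebra_iso A.S B.S gr_map"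
 unfolding poisson_algebra_iso_def
proof (intro conjI ballI allI)
 show "bij_betw gr_map (carrier A.S) (carrier B.S)"
 proof (rule bij_betw_imageI)
  show "inj_on gr_map (carrier A.S)"
  proof (rule inj_onI)
   fix x y assume xy: "x\<in>carrier A.S" "y\<in>carrier A.S" and e: "gr_map x = gr_map y"
   have sub: "x i\<subseteq>carrier R" "y i\<subseteq>carrier R" for i
    using xy A.symbol_iff A.famD(2) by (auto simp: A.carrier_S A.cls_def)
   have "H ` x i = H ` y i" for i using fun_cong[OF e] by (simp add: gr_map_def)
   thus "x = y" using inj_on_image_eq_iff[OF bij_betw_imp_inj_on[OF bij] sub] by blast
  qed
  show "gr_map ` carrier A.S = carrier B.S"
   unfolding A.carrier_S B.carrier_S
  proof (intro equalityI subsetI)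
   show "y\<in>B.cls ` B.fam" if "y\<in>gr_map ` A.cls ` A.fam" for y using that gr_map_cls H_fam by auto
   fix y assume "y\<in>B.cls ` B.fam"
   then obtain T where "T\<in>A.fam" "y = B.cls (%i. H (T i))" using fam_surj by (metis imageE)
   thus "y\<in>gr_map ` A.cls ` A.fam" using gr_map_cls by (metis imageI)
  qed
 qed
next
 fix x assume "x\<in>carrier A.S"
 then obtain T where T: "T\<in>A.fam" "x = A.cls T" by (auto simp: A.carrier_S)
 note c = A.famD(2)[OF T(1)]
 show "gr_map (c \<odot>\<^bsub>A.S\<^esub> x) = c \<odot>\<^bsub>B.S\<^esub> gr_map x" for c
  by (simp add: T A.smult_S gr_map_cls A.smult_fam B.smult_S H_fam H_smult c)
 fix y assume "y\<in>carrier A.S"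
 then obtain D where D: "D\<in>A.fam" "y = A.cls D" by (auto simp: A.carrier_S)
 note d = A.famD(2)[OF D(1)]
 show "gr_map (x \<oplus>\<^bsub>A.S\<^esub> y) = gr_map x \<oplus>\<^bsub>B.S\<^esub> gr_map y"
  by (simp add: T D A.add_S gr_map_cls A.add_fam B.add_S H_fam H_add c d)
 show "gr_map (x \<otimes>\<^bsub>A.S\<^esub> y) = gr_map x \<otimes>\<^bsub>B.S\<^esub> gr_map y"
  by (simp add: T D A.mult_S gr_map_cls A.conv_fam B.mult_S H_fam)
   (simp add: A.conv_prd B.conv_prd prd_H[OF T(1) D(1) A.graded_mult H_mult])
 show "gr_map (bracket A.S x y) = bracket B.S (gr_map x) (gr_map y)"
  by (simp add: T D A.bracket_S gr_map_cls A.brk_fam B.bracket_S H_fam)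
   (simp add: A.brk_prd B.brk_prd prd_H[OF T(1) D(1) A.graded_cmt H_cmt])
qed

end

lemma manifold_iso_of_diffeomorphism:
 assumes M: "smooth_manifold M" and N: "smooth_manifold N" and f: "diffeomorphism M N f"
 shows "manifold_iso M N f (inv_into (points M) f)"
 using f unfolding diffeomorphism_def smooth_map_iff[OF manifold_atlas[OF M] manifold_atlas[OF N]]
  smooth_map_iff[OF manifold_atlas[OF N] manifold_atlas[OF M]]
 by unfold_locales (auto simp: bij_betw_def f_inv_into_f M N)

locale bundle_iso = bundle_pair E M F N kappa eta + T: manifold_iso "total E" "total F" Phi Psi
 for E :: "('a, 'm::real_normed_vector, 'e, 'n::finite) vector_bundle" and M :: "('a, 'm) manifold"
  and F :: "('b, 'k::real_normed_vector, 'f, 'p::finite) vector_bundle" and N :: "('b, 'k) manifold" and kappa eta Phi Psi +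
 assumes fibres: "e\<in>points (total E) ==> proj F (Phi e) = kappa (proj E e)"
  and linear: "x\<in>points M ==> e\<in>fibre E x ==> e'\<in>fibre E x ==> Phi (fadd E e e') = fadd F (Phi e) (Phi e')"
   "x\<in>points M ==> e\<in>fibre E x ==> Phi (fscale E c e) = fscale F c (Phi e)"
begin

lemma map_fibre: "e\<in>fibre E x ==> Phi e\<in>fibre F (kappa x)"
 using T.maps(1) fibres by (auto simp: fibre_def)

text \<open>Symmetry of the situation: linearity of \<open>Psi\<close> on fibres follows from that
  of \<open>Phi\<close> because the two are inverse to each other.\<close>

lemma swapped: "bundle_iso F N E M eta kappa Psi Phi"
proof -
 interpret I: bundle_pair F N E M eta kappa by (rule inverse_pair)
 interpret J: manifold_iso "total F" "total E" Psi Phi by (rule T.inverse)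
 have pe: "proj E (Psi f) = eta (proj F f)" if f: "f\<in>points (total F)" for f
  using fibres[OF T.maps(2)[OF f]] T.kappaeta[OF f] etakappa[OF B1.proj_points[OF T.maps(2)[OF f]]] by simp
 have psi: "Psi f\<in>fibre E (eta y)" "Phi (Psi f) = f" if "f\<in>fibre F y" for f y
  using that T.maps(2) T.kappaeta pe by (auto simp: fibre_def)
 show ?thesis
 proof
  fix y f f' c assume y: "y\<in>points N" and f: "f\<in>fibre F y"
  note x = maps(2)[OF y] and pf = psi[OF f]
  show "Psi (fscale F c f) = fscale E c (Psi f)"
   using T.etakappa[OF B1.fibreD(1)[OF B1.fibre_closed(2)[OF x pf(1) pf(1)]], of c] linear(2)[OF x pf(1)] pf(2) by simp
  assume "f'\<in>fibre F y"
  note pf' = psi[OF this]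
  show "Psi (fadd F f f') = fadd E (Psi f) (Psi f')"
   using T.etakappa[OF B1.fibreD(1)[OF B1.fibre_closed(1)[OF x pf(1) pf'(1)]]] linear(1)[OF x pf(1) pf'(1)] pf(2) pf'(2) by simp
 qed (rule pe)
qed

definition push :: "('a => 'e) => 'b => 'f" where "push s = (\<lambda>y\<in>points N. Phi (s (eta y)))"

lemma push_sec: assumes s: "s\<in>B1.sec" shows "push s\<in>B2.sec"
proof -
 have f: "Phi (s (eta y))\<in>fibre F y" if y: "y\<in>points N" for y
  using map_fibre[OF B1.sec_fibre[OF s maps(2)[OF y]]] kappaeta[OF y] by simp
 have "smooth_at N (total F) (push s) y" if y: "y\<in>points N" for y
 proof -
  have x: "eta y\<in>points M" by (rule maps(2)[OF y])
  have "smooth_at M (total E) s (eta y)" using s x unfolding smooth_sections_def smooth_map_iff[OF B1.base_atlas B1.total_atlas] by blast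
  hence "smooth_at N (total E) (%y. s (eta y)) y"
   by (rule smooth_at_compose[OF B2.base_atlas B1.base_atlas B1.total_atlas eta[OF y]])
  hence "smooth_at N (total F) (%y. Phi (s (eta y))) y"
   by (rule smooth_at_compose[OF B2.base_atlas B1.total_atlas B2.total_atlas]) (rule T.kappa, rule B1.fibreD[OF B1.sec_fibre[OF s x]])
  thus ?thesis by (rule smooth_at_cong[OF _ B2.base_atlas openin_topspace y]) (simp add: push_def)
 qed
 thus ?thesis unfolding smooth_sections_def smooth_map_iff[OF B2.base_atlas B2.total_atlas]
  using f by (auto simp: push_def fibre_def)
qed

lemma push_scale:
 assumes s: "s\<in>B1.sec"
 shows "push (section_mult E M u s) = section_mult F N (%y. u (eta y)) (push s)"
  "push (section_scale E M c s) = section_scale F N c (push s)"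
proof -
 have m: "push (section_mult E M u s) = section_mult F N (%y. u (eta y)) (push s)" for u
  using maps(2) linear(2)[OF maps(2) B1.sec_fibre[OF s maps(2)]]
  by (auto simp: push_def section_mult_def fun_eq_iff)
 show "push (section_mult E M u s) = section_mult F N (%y. u (eta y)) (push s)" by (rule m)
 show "push (section_scale E M c s) = section_scale F N c (push s)" unfolding section_scale_def by (rule m)
qed

lemma push_add:
 assumes s: "s\<in>B1.sec" and t: "t\<in>B1.sec"
 shows "push (section_add E M s t) = section_add F N (push s) (push t)"
 using maps(2) linear(1)[OF maps(2) B1.sec_fibre[OF s maps(2)] B1.sec_fibre[OF t maps(2)]]
 by (auto simp: push_def section_add_def fun_eq_iff)

lemma functions_push: assumes u: "u\<in>Cinf M" shows "(%y. u (eta y))\<in>Cinf N"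
 using u manifold_iso.smooth_fun_pull[OF inverse] maps(2)
 unfolding smooth_functions_iff[OF B2.base_atlas] smooth_functions_iff[OF B1.base_atlas] by blast

lemma push_push:
 assumes s: "s\<in>B1.sec" shows "bundle_iso.push M kappa Psi (push s) = s"
proof -
 interpret inv: bundle_iso F N E M eta kappa Psi Phi by (rule swapped)
 show ?thesis
 proof (rule extensionalityI)
  show "inv.push (push s)\<in>extensional (points M)" by (simp add: inv.push_def)
  show "s\<in>extensional (points M)" using s by (simp add: B1.sec_iff)
  show "inv.push (push s) x = s x" if x: "x\<in>points M" for x
   using x maps(1)[OF x] etakappa[OF x] T.etakappa[OF B1.fibreD(1)[OF B1.sec_fibre[OF s x]]] by (simp add: inv.push_def push_def)
 qed
qed

text \<open>\<open>bundle_iso.push M kappa Psi\<close> pushes sections forward along the inverse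
  bundle map, so this is conjugation by an isomorphism of the spaces of sections.\<close>

definition conj_op :: "('a, 'e) section_operator => ('b, 'f) section_operator" where
 "conj_op T = (\<lambda>t\<in>B2.sec. push (T (bundle_iso.push M kappa Psi t)))"

lemma conj_carrier:
 assumes T: "T\<in>carrier B1.EndE" shows "conj_op T\<in>carrier B2.EndE"
proof -
 interpret inv: bundle_iso F N E M eta kappa Psi Phi by (rule swapped)
 note D = B1.carrier_EndD[OF T]
 show ?thesis unfolding End_sections_def
  by (auto simp: conj_op_def push_sec D inv.push_sec inv.push_add inv.push_scale push_add push_scale B2.section_closed)
qed

lemma conj_conj:
 assumes T: "T\<in>carrier B1.EndE" shows "bundle_iso.conj_op N E M eta kappa Psi Phi (conj_op T) = T"
proof -
 interpret inv: bundle_iso F N E M eta kappa Psi Phi by (rule swapped)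
 have "inv.conj_op (conj_op T) s = T s" if s: "s\<in>B1.sec" for s
  using s push_sec[OF s] push_push[OF s] push_push[OF B1.carrier_EndD(2)[OF T s]] by (simp add: inv.conj_op_def conj_op_def)
 thus ?thesis
  by (intro extensionalityI[of _ B1.sec]) (auto simp: inv.conj_op_def B1.carrier_EndD(1)[OF T])
qed

lemma conj_hom: "diff_algebra_hom B1.EndE B1.UE (points M) B1.gval B2.EndE B2.UE (points N) B2.gval conj_op"
proof -
 interpret inv: bundle_iso F N E M eta kappa Psi Phi by (rule swapped)
 have gam: "conj_op (B1.gam u) = B2.gam (%y. u (eta y))" if u: "u\<in>Cinf M" for u
 proof
  fix t
  show "conj_op (B1.gam u) t = B2.gam (%y. u (eta y)) t"
   by (simp add: conj_op_def multiplication_op_def inv.push_sec push_add push_scale inv.push_push)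
 qed
 show ?thesis
 proof
  show "bij_betw conj_op (carrier B1.EndE) (carrier B2.EndE)"
   by (rule bij_betw_byWitness[where f' = inv.conj_op]) (use conj_conj inv.conj_conj conj_carrier inv.conj_carrier in auto)
  fix T assume T: "T\<in>carrier B1.EndE"
  show "conj_op (c \<odot>\<^bsub>B1.EndE\<^esub> T) = c \<odot>\<^bsub>B2.EndE\<^esub> conj_op T" for c
   by (rule ext) (simp add: conj_op_def End_sections_def inv.push_sec push_add push_scale B1.carrier_EndD(2)[OF T])
  fix D assume D: "D\<in>carrier B1.EndE"
  show "conj_op (T \<oplus>\<^bsub>B1.EndE\<^esub> D) = conj_op T \<oplus>\<^bsub>B2.EndE\<^esub> conj_op D"
   by (rule ext) (simp add: conj_op_def End_sections_def inv.push_sec push_add push_scale B1.carrier_EndD(2)[OF T] B1.carrier_EndD(2)[OF D])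
  show "conj_op (T \<otimes>\<^bsub>B1.EndE\<^esub> D) = conj_op T \<otimes>\<^bsub>B2.EndE\<^esub> conj_op D"
   by (rule ext) (simp add: conj_op_def End_sections_def compose_def inv.push_sec push_push push_sec B1.carrier_EndD(2)[OF D])
 next
  show "conj_op ` B1.UE = B2.UE"
  proof
   show "conj_op ` B1.UE\<subseteq>B2.UE" using gam functions_push by auto
   show "B2.UE\<subseteq>conj_op ` B1.UE"
   proof
    fix w assume "w\<in>B2.UE"
    then obtain v where v: "v\<in>Cinf N" "w = B2.gam v" by blast
    note u = inv.functions_push[OF v(1)]
    have "w = conj_op (B1.gam (%x. v (kappa x)))" unfolding v(2) gam[OF u]
     by (rule B2.gam_eqI[OF v(1) functions_push[OF u]]) (simp add: kappaeta)
    thus "w\<in>conj_op ` B1.UE" using u by blast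
   qed
  qed
 qed
qed

end

lemma bundle_iso_intro:
 assumes E: "smooth_vector_bundle E M" and F: "smooth_vector_bundle F N" and iso: "vector_bundle_iso E M F N Phi kappa"
 shows "bundle_iso E M F N kappa (inv_into (points M) kappa) Phi (inv_into (points (total E)) Phi)"
proof -
 interpret B1: vbundle E M by (unfold_locales) (rule E)
 interpret B2: vbundle F N by (unfold_locales) (rule F)
 interpret manifold_iso M N kappa "inv_into (points M) kappa"
  by (rule manifold_iso_of_diffeomorphism[OF B1.base_manifold B2.base_manifold]) (use iso in "simp add: vector_bundle_iso_def")
 interpret T: manifold_iso "total E" "total F" Phi "inv_into (points (total E)) Phi"
  by (rule manifold_iso_of_diffeomorphism[OF B1.total_manifold B2.total_manifold]) (use iso in "simp add: vector_bundle_iso_def")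
 show ?thesis by unfold_locales (use iso in "auto simp: vector_bundle_iso_def")
qed

lemma poisson_algebras_isomorphic_of_bundles:
 assumes E: "smooth_vector_bundle E M" and F: "smooth_vector_bundle F N" and iso: "vector_bundles_isomorphic E M F N"
 shows "poisson_algebras_isomorphic (symbol_poisson_algebra E M) (symbol_poisson_algebra F N)"
proof -
 obtain Phi kappa where i: "vector_bundle_iso E M F N Phi kappa" using iso by (auto simp: vector_bundles_isomorphic_def)
 interpret bundle_iso E M F N kappa "inv_into (points M) kappa" Phi "inv_into (points (total E)) Phi"
  by (rule bundle_iso_intro[OF E F i])
 show ?thesis
  unfolding poisson_algebras_isomorphic_def B1.symbol_poisson_algebra_S B2.symbol_poisson_algebra_S
  using diff_algebra_hom.poisson_iso[OF conj_hom] by blast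
qed

lemma (in diff_algebra) S_closed:
 assumes "x\<in>carrier S" "y\<in>carrier S"
 shows "x \<oplus>\<^bsub>S\<^esub> y\<in>carrier S" "c \<odot>\<^bsub>S\<^esub> x\<in>carrier S" "x \<otimes>\<^bsub>S\<^esub> y\<in>carrier S" "bracket S x y\<in>carrier S"
 using assms by (auto simp: carrier_S add_S smult_S mult_S bracket_S add_fam smult_fam conv_fam brk_fam)

text \<open>\<open>Q\<close> is an arbitrary record; closure under the operations is taken from the
  graded algebra on the source side and pulled across by \<open>h\<close>.\<close>

lemma poisson_algebra_iso_inverse:
 assumes A: "diff_algebra R U Omega ev" and h: "poisson_algebra_iso (gr_poisson R (diff_algebra.P R U)) Q h"
 shows "poisson_algebra_iso Q (gr_poisson R (diff_algebra.P R U)) (inv_into (carrier (gr_poisson R (diff_algebra.P R U))) h)"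
proof -
 interpret A: diff_algebra R U Omega ev by (rule A)
 let ?k = "inv_into (carrier A.S) h"
 have b: "bij_betw h (carrier A.S) (carrier Q)" using h by (simp add: poisson_algebra_iso_def)
 have k: "?k y\<in>carrier A.S" "h (?k y) = y" if "y\<in>carrier Q" for y
  using b that by (auto simp: bij_betw_def inv_into_into f_inv_into_f)
 have kh: "?k (h x) = x" if "x\<in>carrier A.S" for x using inv_into_f_f[OF bij_betw_imp_inj_on[OF b] that] .
 show ?thesis
  unfolding poisson_algebra_iso_def
 proof (intro conjI ballI allI)
  show "bij_betw ?k (carrier Q) (carrier A.S)" by (rule bij_betw_inv_into[OF b])
  fix x assume x: "x\<in>carrier Q"
  have "h (c \<odot>\<^bsub>A.S\<^esub> ?k x) = c \<odot>\<^bsub>Q\<^esub> x" for c using h k[OF x] by (simp add: poisson_algebra_iso_def)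
  thus "?k (c \<odot>\<^bsub>Q\<^esub> x) = c \<odot>\<^bsub>A.S\<^esub> ?k x" for c
   using kh[OF A.S_closed(2)[OF k(1)[OF x] k(1)[OF x]]] by metis
  fix y assume y: "y\<in>carrier Q"
  note c = A.S_closed[OF k(1)[OF x] k(1)[OF y]]
  have "h (?k x \<oplus>\<^bsub>A.S\<^esub> ?k y) = x \<oplus>\<^bsub>Q\<^esub> y" "h (?k x \<otimes>\<^bsub>A.S\<^esub> ?k y) = x \<otimes>\<^bsub>Q\<^esub> y"
   "h (bracket A.S (?k x) (?k y)) = bracket Q x y"
   using h k[OF x] k[OF y] by (simp_all add: poisson_algebra_iso_def)
  thus "?k (x \<oplus>\<^bsub>Q\<^esub> y) = ?k x \<oplus>\<^bsub>A.S\<^esub> ?k y" "?k (x \<otimes>\<^bsub>Q\<^esub> y) = ?k x \<otimes>\<^bsub>A.S\<^esub> ?k y"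
   "?k (bracket Q x y) = bracket A.S (?k x) (?k y)"
   using kh[OF c(1)] kh[OF c(3)] kh[OF c(4)] by metis+
 qed
qed

lemma bundles_isomorphic_of_poisson_algebras:
 fixes E :: "('a, 'm::real_normed_vector, 'e, 'n::finite) vector_bundle" and M :: "('a, 'm) manifold"
  and F :: "('b, 'k::real_normed_vector, 'f, 'p::finite) vector_bundle" and N :: "('b, 'k) manifold"
 assumes E: "smooth_vector_bundle E M" and F: "smooth_vector_bundle F N"
  and n: "CARD('n) > 1" and p: "CARD('p) > 1" and H1: "trivial_group (cohomology_group 1 (mtop M))"
  and iso: "poisson_algebras_isomorphic (symbol_poisson_algebra E M) (symbol_poisson_algebra F N)"
 shows "vector_bundles_isomorphic E M F N"
proof -
 interpret B1: vbundle E M by (unfold_locales) (rule E)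
 interpret B2: vbundle F N by (unfold_locales) (rule F)
 obtain h where h: "poisson_algebra_iso B1.alg.S B2.alg.S h"
  using iso unfolding poisson_algebras_isomorphic_def B1.symbol_poisson_algebra_S B2.symbol_poisson_algebra_S by blast
 let ?k = "inv_into (carrier B1.alg.S) h"
 note k = poisson_algebra_iso_inverse[OF B1.alg.diff_algebra_axioms h]
 have b: "bij_betw h (carrier B1.alg.S) (carrier B2.alg.S)" using h by (simp add: poisson_algebra_iso_def)
 interpret bundle_poisson E M F N h ?k
 proof
  show "poisson_algebra_iso B1.alg.S B2.alg.S h" by (rule h)
  show "poisson_algebra_iso B2.alg.S B1.alg.S ?k" by (rule k)
  show "?k (h x) = x" if "x\<in>carrier B1.alg.S" for x using inv_into_f_f[OF bij_betw_imp_inj_on[OF b] that] .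
  show "h (?k y) = y" if "y\<in>carrier B2.alg.S" for y using f_inv_into_f[of y h] b that by (simp add: bij_betw_def)
 qed
 show ?thesis by (rule bundles_isomorphic[OF _ _ H1]) (use n p in simp_all)
qed

theorem theorem5p4:
  fixes M :: "('a, 'm::real_normed_vector) manifold"
    and N :: "('b, 'k::real_normed_vector) manifold"
    and E :: "('a, 'm, 'e, 'n::finite) vector_bundle"
    and F :: "('b, 'k, 'f, 'p::finite) vector_bundle"
  assumes "smooth_vector_bundle E M"
    and "smooth_vector_bundle F N"
    and "CARD('n) > 1"
    and "CARD('p) > 1"
    and "trivial_group (cohomology_group 1 (mtop M))"
  shows "poisson_algebras_isomorphic (symbol_poisson_algebra E M) (symbol_poisson_algebra F N)
     \<longleftrightarrow> vector_bundles_isomorphic E M F N"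
  using bundles_isomorphic_of_poisson_algebras[OF assms] poisson_algebras_isomorphic_of_bundles[OF assms(1,2)] by blast

end
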